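(* Let $(X_t)_{t\in\Delta_{[\gamma]}}$ be the family of essential deformations of the Iwasawa manifold $X=X_0$ and $B_t$ the Albanese torus of $X_t$. The vector space isomorphisms $$H^{3,0}(X_t,\mathbb C)\simeq[\gamma_t\wedge\pi_t^\star H^{2,0}(B_t,\mathbb C)]_{\bar\partial}\quad\text{and}\quad H^{2,1}_{[\gamma]}(X_t,\mathbb C)\simeq[\gamma_t\wedge\pi_t^\star H^{1,1}(B_t,\mathbb C)]_{\bar\partial},\qquad t\in\Delta_{[\gamma]},$$ induce $C^\infty$ isomorphisms of vector bundles over $\Delta_{[\gamma]}$ $$F^3\mathcal H^3\simeq F^2\mathcal H^2(B)\quad\text{and}\quad F^2\mathcal H^3_{[\gamma]}\simeq F^1\mathcal H^2(B),$$ where $F^2\mathcal H^2(B)$ is the bundle $\Delta_{[\gamma]}\ni t\mapsto H^{2,0}(B_t,\mathbb C)$ and $F^1\mathcal H^2(B)$ is the bundle $\Delta_{[\gamma]}\ni t\mapsto H^{2,0}(B_t,\mathbb C)\oplus H^{1,1}(B_t,\mathbb C)$.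
   Context: Iwasawa manifold: $X=X_0=G/\Gamma$, $G$ the Heisenberg group of upper unitriangular complex $3\times3$ matrices $\begin{pmatrix}1&z_1&z_3\\0&1&z_2\\0&0&1\end{pmatrix}$, $\Gamma\subset G$ the subgroup with entries in $\mathbb Z[i]$. $\alpha,\beta,\gamma$ are the holomorphic $1$-forms on $X$ induced by $dz_1,dz_2,dz_3-z_1dz_2$; $d\alpha=d\beta=0$, $d\gamma=-\alpha\wedge\beta$. $\xi_\alpha,\xi_\beta,\xi_\gamma$ is the dual frame of holomorphic vector fields. Deformations: $H^{0,1}(X,T^{1,0}X)$ has basis $\bar\alpha_\lambda\otimes\xi_i$ ($\alpha_1=\alpha,\alpha_2=\beta$, $\xi_1=\xi_\alpha,\xi_2=\xi_\beta,\xi_3=\xi_\gamma$; $\lambda=1,2$, $i=1,2,3$), with coordinates $t_{i\lambda}$. The Kuranishi family $(X_t)_{t\in\Delta}$ of $X$ is unobstructed and $\Delta$ is a small open ball about $0$ in this space (which may be shrunk). All $X_t$ have the same underlying $C^\infty$ manifold $X$; with $D(t)=t_{11}t_{22}-t_{12}t_{21}$, the complex structure of $X_t$ has the $(1,0)$-coframe $\alpha_t=\alpha+t_{11}\bar\alpha+t_{12}\bar\beta$, $\beta_t=\beta+t_{21}\bar\alpha+t_{22}\bar\beta$, $\gamma_t=\gamma+t_{31}\bar\alpha+t_{32}\bar\beta-D(t)\bar\gamma$. $\Delta_{[\gamma]}:=\{t\in\Delta: t_{31}=t_{32}=0\}$. $H^{2,1}_{[\gamma]}(X_t,\mathbb C)$,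 $t\in\Delta_{[\gamma]}$: write $\bar\partial_t\gamma_t=\sigma_{1\bar1}\alpha_t\wedge\bar\alpha_t+\sigma_{1\bar2}\alpha_t\wedge\bar\beta_t+\sigma_{2\bar1}\beta_t\wedge\bar\alpha_t+\sigma_{2\bar2}\beta_t\wedge\bar\beta_t$ and $\partial_t\gamma_t=\sigma_{12}\alpha_t\wedge\beta_t$, the $\sigma$'s being constants depending smoothly on $t$, $\sigma_{12}(0)=-1$, $\sigma_{i\bar j}(0)=0$. Put $\Gamma_1(t)=\alpha_t\wedge\gamma_t\wedge\bar\alpha_t-\frac{\sigma_{2\bar2}}{\bar\sigma_{12}}\alpha_t\wedge\beta_t\wedge\bar\gamma_t$, $\Gamma_2(t)=\alpha_t\wedge\gamma_t\wedge\bar\beta_t+\frac{\sigma_{2\bar1}}{\bar\sigma_{12}}\alpha_t\wedge\beta_t\wedge\bar\gamma_t$, $\Gamma_3(t)=\beta_t\wedge\gamma_t\wedge\bar\alpha_t+\frac{\sigma_{1\bar2}}{\bar\sigma_{12}}\alpha_t\wedge\beta_t\wedge\bar\gamma_t$, $\Gamma_4(t)=\beta_t\wedge\gamma_t\wedge\bar\beta_t-\frac{\sigma_{1\bar1}}{\bar\sigma_{12}}\alpha_t\wedge\beta_t\wedge\bar\gamma_t$. Then $H^{2,1}_{[\gamma]}(X_t,\mathbb C):=\langle[\Gamma_1(t)]_{\bar\partial},\dots,[\Gamma_4(t)]_{\bar\partial}\rangle\subset H^{2,1}_{\bar\partial}(X_t,\mathbb C)$. Albanese tori: the forms $\alpha_t,\beta_t$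 descend to a $(1,0)$-coframe of a $2$-dimensional complex torus $B_t$, with holomorphic fibration $\pi_t:X_t\to B_t$; $H^{2,0}(B_t,\mathbb C)=\mathbb C[\alpha_t\wedge\beta_t]_{\bar\partial}$ and $H^{1,1}(B_t,\mathbb C)=\langle[\alpha_t\wedge\bar\alpha_t],[\alpha_t\wedge\bar\beta_t],[\beta_t\wedge\bar\alpha_t],[\beta_t\wedge\bar\beta_t]\rangle$. The notation $[\gamma_t\wedge\pi_t^\star u]_{\bar\partial}$ means: wedge the pullback of the constant-coefficient representative with $\gamma_t$ and, for $(1,1)$-classes, add the multiple of $\alpha_t\wedge\beta_t\wedge\bar\gamma_t$ occurring in the definition of the $\Gamma_j(t)$; thus $[\alpha_t\wedge\beta_t]\mapsto[\alpha_t\wedge\beta_t\wedge\gamma_t]$ and $[\alpha_t\wedge\bar\alpha_t],[\alpha_t\wedge\bar\beta_t],[\beta_t\wedge\bar\alpha_t],[\beta_t\wedge\bar\beta_t]\mapsto-[\Gamma_1(t)],-[\Gamma_2(t)],-[\Gamma_3(t)],-[\Gamma_4(t)]$. $F^3\mathcal H^3$ is the bundle $t\mapsto H^{3,0}(X_t,\mathbb C)$ and $F^2\mathcal H^3_{[\gamma]}$ the bundle $t\mapsto H^{3,0}(X_t,\mathbb C)\oplus H^{2,1}_{[\gamma]}(X_t,\mathbb C)$ over $\Delta_{[\gamma]}$, subbundles of the constant bundle of fibre $H^3_{DR}(X,\mathbb C)$ via $[\alpha_t\wedge\beta_t\wedge\gamma_t]_{\bar\partial}\mapsto\{\alpha_t\wedge\beta_t\wedge\gamma_t\}_{DR}$,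 $[\Gamma_j(t)]_{\bar\partial}\mapsto\{\Gamma_j(t)\}_{DR}$. *)

theory Defs
  imports "HOL-Analysis.Analysis" "HOL-Library.Function_Algebras"
begin

section \<open>Complex vector spaces and quotients\<close>

record 'a vsp =
  vcarr :: "'a set"
  vzero :: 'a
  vadd :: "'a \<Rightarrow> 'a \<Rightarrow> 'a"
  vsmul :: "complex \<Rightarrow> 'a \<Rightarrow> 'a"

definition lincomb :: "'a vsp \<Rightarrow> complex list \<Rightarrow> 'a list \<Rightarrow> 'a" where
  "lincomb V cs vs = foldr (\<lambda>(c, v) w. vadd V (vsmul V c v) w) (zip cs vs) (vzero V)"

definition vprod :: "'a vsp \<Rightarrow> 'b vsp \<Rightarrow> ('a \<times> 'b) vsp" where
  "vprod V W =
    \<lparr>vcarr = vcarr V \<times> vcarr W,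
     vzero = (vzero V, vzero W),
     vadd = (\<lambda>(v, w) (v', w'). (vadd V v v', vadd W w w')),
     vsmul = (\<lambda>c (v, w). (vsmul V c v, vsmul W c w))\<rparr>"

definition lin_map :: "'a vsp \<Rightarrow> 'b vsp \<Rightarrow> ('a \<Rightarrow> 'b) \<Rightarrow> bool" where
  "lin_map V W \<phi> \<longleftrightarrow>
     \<phi> ` vcarr V \<subseteq> vcarr W \<and>
     (\<forall>u\<in>vcarr V. \<forall>v\<in>vcarr V. \<phi> (vadd V u v) = vadd W (\<phi> u) (\<phi> v)) \<and>
     (\<forall>c. \<forall>v\<in>vcarr V. \<phi> (vsmul V c v) = vsmul W c (\<phi> v))"

definition lin_inj :: "'a vsp \<Rightarrow> 'b vsp \<Rightarrow> ('a \<Rightarrow> 'b) \<Rightarrow> bool" where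
  "lin_inj V W \<phi> \<longleftrightarrow> lin_map V W \<phi> \<and> inj_on \<phi> (vcarr V)"

definition lin_iso :: "'a vsp \<Rightarrow> 'b vsp \<Rightarrow> ('a \<Rightarrow> 'b) \<Rightarrow> bool" where
  "lin_iso V W \<phi> \<longleftrightarrow> lin_map V W \<phi> \<and> bij_betw \<phi> (vcarr V) (vcarr W)"


section \<open>Smooth functions\<close>

text \<open>Meant for open sets \<open>S\<close> in a finite-dimensional real vector space.\<close>

primrec Ck_on :: "nat \<Rightarrow> 'a::real_normed_vector set \<Rightarrow> ('a \<Rightarrow> 'b::real_normed_vector) \<Rightarrow> bool" where
  "Ck_on 0 S f \<longleftrightarrow> continuous_on S f"
| "Ck_on (Suc k) S f \<longleftrightarrow>
     (\<forall>x\<in>S. f differentiable (at x)) \<and> (\<forall>v. Ck_on k S (\<lambda>x. frechet_derivative f (at x) v))"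

definition smooth_on :: "'a::real_normed_vector set \<Rightarrow> ('a \<Rightarrow> 'b::real_normed_vector) \<Rightarrow> bool" where
  "smooth_on S f \<longleftrightarrow> (\<forall>k. Ck_on k S f)"


section \<open>Smooth vector bundles inside a constant bundle\<close>

text \<open>
  A map from a subset \<open>U\<close> of a Euclidean space to a complex vector space \<open>V\<close> is smooth if locally
  it is a combination of finitely many fixed vectors of \<open>V\<close>, the coefficients being restrictions of
  smooth functions on an open subset of the ambient space. For \<open>V\<close> of finite dimension this is
  the usual notion, and it does not require a choice of basis or of topology on \<open>V\<close>.
\<close>

definition smooth_into :: "'b vsp \<Rightarrow> 'p::real_normed_vector set \<Rightarrow> ('p \<Rightarrow> 'b) \<Rightarrow> bool" where
  "smooth_into V U s \<longleftrightarrow>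
     (\<forall>t0\<in>U. \<exists>N fs vs. open N \<and> t0 \<in> N \<and> length fs = length vs \<and> set vs \<subseteq> vcarr V \<and>
        (\<forall>f\<in>set fs. smooth_on N f) \<and>
        (\<forall>t\<in>N \<inter> U. s t = lincomb V (map (\<lambda>f. f t) fs) vs))"

text \<open>
  A family of vector spaces \<open>fibre t\<close> together with linear embeddings \<open>incl t\<close> into one
  fixed space. The smooth structure is the one of a subbundle of the constant bundle
  with fibre \<open>ambient\<close>.
\<close>

record ('p, 'a, 'b) embbundle =
  fibre :: "'p \<Rightarrow> 'a vsp"
  ambient :: "'b vsp"
  incl :: "'p \<Rightarrow> 'a \<Rightarrow> 'b"

definition section_on :: "('p, 'a, 'b) embbundle \<Rightarrow> 'p set \<Rightarrow> ('p \<Rightarrow> 'a) \<Rightarrow> bool" where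
  "section_on E U s \<longleftrightarrow> (\<forall>t\<in>U. s t \<in> vcarr (fibre E t))"

definition smooth_section ::
    "('p::real_normed_vector, 'a, 'b) embbundle \<Rightarrow> 'p set \<Rightarrow> ('p \<Rightarrow> 'a) \<Rightarrow> bool" where
  "smooth_section E U s \<longleftrightarrow>
     section_on E U s \<and> smooth_into (ambient E) U (\<lambda>t. incl E t (s t))"

definition smooth_vbundle :: "'p::real_normed_vector set \<Rightarrow> ('p, 'a, 'b) embbundle \<Rightarrow> bool" where
  "smooth_vbundle \<Delta> E \<longleftrightarrow>
     (\<forall>t\<in>\<Delta>. lin_inj (fibre E t) (ambient E) (incl E t)) \<and>
     (\<forall>t0\<in>\<Delta>. \<exists>U fr. openin (top_of_set \<Delta>) U \<and> t0 \<in> U \<and>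
        (\<forall>s\<in>set fr. smooth_section E U s) \<and>
        (\<forall>t\<in>U. \<forall>e\<in>vcarr (fibre E t).
           \<exists>!cs. length cs = length fr \<and> e = lincomb (fibre E t) cs (map (\<lambda>s. s t) fr)))"

definition smooth_vbundle_iso ::
    "'p::real_normed_vector set \<Rightarrow> ('p, 'a, 'b) embbundle \<Rightarrow> ('p, 'c, 'd) embbundle
      \<Rightarrow> ('p \<Rightarrow> 'a \<Rightarrow> 'c) \<Rightarrow> bool" where
  "smooth_vbundle_iso \<Delta> E F \<phi> \<longleftrightarrow>
     smooth_vbundle \<Delta> E \<and> smooth_vbundle \<Delta> F \<and>
     (\<forall>t\<in>\<Delta>. lin_iso (fibre E t) (fibre F t) (\<phi> t)) \<and>
     (\<forall>U s. openin (top_of_set \<Delta>) U \<and> section_on E U s \<longrightarrow>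
        (smooth_section E U s \<longleftrightarrow> smooth_section F U (\<lambda>t. \<phi> t (s t))))"


section \<open>Complex-valued differential forms\<close>

text \<open>
  A \<open>k\<close>-form takes a point and a list of \<open>k\<close> tangent vectors; it is \<open>0\<close> on lists
  of any other length.
\<close>

type_synonym 'v cform = "'v \<Rightarrow> 'v list \<Rightarrow> complex"

definition is_kform :: "nat \<Rightarrow> 'v::real_normed_vector cform \<Rightarrow> bool" where
  "is_kform k \<omega> \<longleftrightarrow>
     (\<forall>p vs. length vs \<noteq> k \<longrightarrow> \<omega> p vs = 0) \<and>
     (\<forall>p vs i. length vs = k \<and> i < k \<longrightarrow> linear (\<lambda>v. \<omega> p (vs[i := v]))) \<and>
     (\<forall>p vs i j. length vs = k \<and> i < j \<and> j < k \<and> vs ! i = vs ! j \<longrightarrow> \<omega> p vs = 0) \<and>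
     (\<forall>vs. smooth_on UNIV (\<lambda>p. \<omega> p vs))"

definition fscale :: "complex \<Rightarrow> 'v cform \<Rightarrow> 'v cform" (infixr "\<cdot>\<^sub>f" 75) where
  "c \<cdot>\<^sub>f \<omega> = (\<lambda>p vs. c * \<omega> p vs)"

definition fcomb :: "complex list \<Rightarrow> 'v cform list \<Rightarrow> 'v cform" where
  "fcomb cs \<omega>s = sum_list (map2 fscale cs \<omega>s)"

definition cnjf :: "'v cform \<Rightarrow> 'v cform" where
  "cnjf \<omega> = (\<lambda>p vs. cnj (\<omega> p vs))"

definition one_form :: "('v \<Rightarrow> 'v \<Rightarrow> complex) \<Rightarrow> 'v cform" where
  "one_form a = (\<lambda>p vs. case vs of [v] \<Rightarrow> a p v | _ \<Rightarrow> 0)"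

text \<open>
  The shuffle formula: \<open>A\<close> is the set of positions fed to \<open>\<omega>\<close>. Subsets of the wrong size contribute
  nothing, so the degrees need not be mentioned.
\<close>

definition wedge :: "'v cform \<Rightarrow> 'v cform \<Rightarrow> 'v cform" (infixr "\<and>\<^sub>w" 70) where
  "\<omega> \<and>\<^sub>w \<eta> = (\<lambda>p vs. \<Sum>A\<in>Pow {..<length vs}.
      (-1) ^ card {(i, j). j < i \<and> i < length vs \<and> i \<in> A \<and> j \<notin> A} *
      \<omega> p (nths vs A) * \<eta> p (nths vs (- A)))"

definition wedges :: "'v cform list \<Rightarrow> 'v cform" where
  "wedges \<omega>s = foldr wedge \<omega>s (\<lambda>p vs. if vs = [] then 1 else 0)"

definition extd :: "'v::real_normed_vector cform \<Rightarrow> 'v cform" where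
  "extd \<omega> = (\<lambda>p vs. \<Sum>i<length vs.
      (-1) ^ i * frechet_derivative (\<lambda>q. \<omega> q (take i vs @ drop (Suc i) vs)) (at p) (vs ! i))"

definition pullback ::
    "('v::real_normed_vector \<Rightarrow> 'w::real_normed_vector) \<Rightarrow> 'w cform \<Rightarrow> 'v cform" where
  "pullback \<phi> \<omega> = (\<lambda>p vs. \<omega> (\<phi> p) (map (frechet_derivative \<phi> (at p)) vs))"


section \<open>Forms and cohomology on a quotient manifold\<close>

text \<open>
  \<open>L\<close> is a group of diffeomorphisms of the vector space acting freely and properly discontinuously;
  forms on the quotient manifold are the \<open>L\<close>-invariant forms.
\<close>

definition forms :: "('v::real_normed_vector \<Rightarrow> 'v) set \<Rightarrow> nat \<Rightarrow> 'v cform set" where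
  "forms L k = {\<omega>. is_kform k \<omega> \<and> (\<forall>\<phi>\<in>L. pullback \<phi> \<omega> = \<omega>)}"

definition coset :: "'v cform set \<Rightarrow> 'v cform \<Rightarrow> 'v cform set" where
  "coset E \<omega> = {\<omega> + \<eta> | \<eta>. \<eta> \<in> E}"

definition quot :: "'v cform set \<Rightarrow> 'v cform set \<Rightarrow> ('v cform set) vsp" where
  "quot Z E =
    \<lparr>vcarr = coset E ` Z,
     vzero = E,
     vadd = (\<lambda>A B. {a + b | a b. a \<in> A \<and> b \<in> B}),
     vsmul = (\<lambda>c A. {c \<cdot>\<^sub>f a + e | a e. a \<in> A \<and> e \<in> E})\<rparr>"

definition dR_closed :: "('v::real_normed_vector \<Rightarrow> 'v) set \<Rightarrow> nat \<Rightarrow> 'v cform set" where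
  "dR_closed L k = {\<omega> \<in> forms L k. extd \<omega> = 0}"

definition dR_exact :: "('v::real_normed_vector \<Rightarrow> 'v) set \<Rightarrow> nat \<Rightarrow> 'v cform set" where
  "dR_exact L k = (case k of 0 \<Rightarrow> {0} | Suc j \<Rightarrow> extd ` forms L j)"

definition H_dR :: "('v::real_normed_vector \<Rightarrow> 'v) set \<Rightarrow> nat \<Rightarrow> ('v cform set) vsp" where
  "H_dR L k = quot (dR_closed L k) (dR_exact L k)"

text \<open>
  A complex structure is given by a global \<open>(1,0)\<close>-coframe \<open>\<theta>\<close>. Every form has a unique expansion in
  the monomials \<open>\<theta>\<^sub>I \<and> cnj \<theta>\<^sub>J\<close> with coefficients that are functions of the point.
\<close>

definition monomial :: "'v cform list \<Rightarrow> nat set \<Rightarrow> nat set \<Rightarrow> 'v cform" where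
  "monomial \<theta> I J = wedges (nths \<theta> I @ map cnjf (nths \<theta> J))"

definition expansion ::
    "'v cform list \<Rightarrow> (nat set \<times> nat set) set \<Rightarrow> (nat set \<times> nat set \<Rightarrow> 'v \<Rightarrow> complex) \<Rightarrow> 'v cform"
  where
  "expansion \<theta> S c = (\<lambda>p vs. \<Sum>(I, J)\<in>S. c (I, J) p * monomial \<theta> I J p vs)"

definition all_idx :: "'v cform list \<Rightarrow> (nat set \<times> nat set) set" where
  "all_idx \<theta> = Pow {..<length \<theta>} \<times> Pow {..<length \<theta>}"

definition pq_idx :: "'v cform list \<Rightarrow> nat \<Rightarrow> nat \<Rightarrow> (nat set \<times> nat set) set" where
  "pq_idx \<theta> p q = {(I, J) \<in> all_idx \<theta>. card I = p \<and> card J = q}"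

definition pq_part :: "'v cform list \<Rightarrow> nat \<Rightarrow> nat \<Rightarrow> 'v cform \<Rightarrow> 'v cform" where
  "pq_part \<theta> p q \<omega> =
     (THE \<eta>. \<exists>c. \<omega> = expansion \<theta> (all_idx \<theta>) c \<and> \<eta> = expansion \<theta> (pq_idx \<theta> p q) c)"

definition pq_forms ::
    "('v::real_normed_vector \<Rightarrow> 'v) set \<Rightarrow> 'v cform list \<Rightarrow> nat \<Rightarrow> nat \<Rightarrow> 'v cform set" where
  "pq_forms L \<theta> p q = {\<omega> \<in> forms L (p + q). \<exists>c. \<omega> = expansion \<theta> (pq_idx \<theta> p q) c}"

text \<open>The operators \<open>\<partial>\<close> and \<open>\<partial>\<close>-bar on forms of type \<open>(p,q)\<close>.\<close>

definition del :: "'v::real_normed_vector cform list \<Rightarrow> nat \<Rightarrow> nat \<Rightarrow> 'v cform \<Rightarrow> 'v cform" where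
  "del \<theta> p q \<omega> = pq_part \<theta> (Suc p) q (extd \<omega>)"

definition delbar :: "'v::real_normed_vector cform list \<Rightarrow> nat \<Rightarrow> nat \<Rightarrow> 'v cform \<Rightarrow> 'v cform" where
  "delbar \<theta> p q \<omega> = pq_part \<theta> p (Suc q) (extd \<omega>)"

definition Dol_closed ::
    "('v::real_normed_vector \<Rightarrow> 'v) set \<Rightarrow> 'v cform list \<Rightarrow> nat \<Rightarrow> nat \<Rightarrow> 'v cform set" where
  "Dol_closed L \<theta> p q = {\<omega> \<in> pq_forms L \<theta> p q. delbar \<theta> p q \<omega> = 0}"

definition Dol_exact ::
    "('v::real_normed_vector \<Rightarrow> 'v) set \<Rightarrow> 'v cform list \<Rightarrow> nat \<Rightarrow> nat \<Rightarrow> 'v cform set" where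
  "Dol_exact L \<theta> p q = (case q of 0 \<Rightarrow> {0} | Suc r \<Rightarrow> delbar \<theta> p r ` pq_forms L \<theta> p r)"

definition H_Dol ::
    "('v::real_normed_vector \<Rightarrow> 'v) set \<Rightarrow> 'v cform list \<Rightarrow> nat \<Rightarrow> nat \<Rightarrow> ('v cform set) vsp" where
  "H_Dol L \<theta> p q = quot (Dol_closed L \<theta> p q) (Dol_exact L \<theta> p q)"

text \<open>
  The linear map \<open>\<Sum> c\<^sub>i [\<omega>\<^sub>i] \<mapsto> \<Sum> c\<^sub>i [\<eta>\<^sub>i]\<close> on classes modulo \<open>E\<close>, with values in classes
  modulo \<open>E'\<close>. It is meaningful when the classes of the \<open>\<omega>\<^sub>i\<close> form a basis of the source.
\<close>

definition lin_ext ::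
    "'v cform set \<Rightarrow> 'v cform list \<Rightarrow> 'w cform set \<Rightarrow> 'w cform list \<Rightarrow> 'v cform set \<Rightarrow> 'w cform set"
  where
  "lin_ext E \<omega>s E' \<eta>s u =
     (THE y. \<exists>cs. length cs = length \<omega>s \<and>
        u = coset E (fcomb cs \<omega>s) \<and> y = coset E' (fcomb cs \<eta>s))"


section \<open>The Iwasawa manifold and its base torus\<close>

text \<open>
  Elements of the Heisenberg group \<open>G\<close> are written in the coordinates \<open>(z\<^sub>1, z\<^sub>2, z\<^sub>3)\<close>. The form
  \<open>dz\<^sub>3 - z\<^sub>1 dz\<^sub>2\<close> is invariant under left translations, so \<open>G/\<Gamma>\<close> is the quotient by
  the left action of \<open>\<Gamma>\<close>.
\<close>

definition heis_matrix :: "complex^3 \<Rightarrow> complex^3^3" where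
  "heis_matrix z = vector [vector [1, z$1, z$3], vector [0, 1, z$2], vector [0, 0, 1]]"

definition heis_mult :: "complex^3 \<Rightarrow> complex^3 \<Rightarrow> complex^3" where
  "heis_mult g z = vector [g$1 + z$1, g$2 + z$2, g$3 + z$3 + g$1 * z$2]"

lemma heis_matrix_mult: "heis_matrix (heis_mult g z) = heis_matrix g ** heis_matrix z"
  by (simp add: heis_matrix_def heis_mult_def matrix_matrix_mult_def vec_eq_iff forall_3 sum_3
      algebra_simps)

definition gauss_ints :: "complex set" where
  "gauss_ints = {z. Re z \<in> \<int> \<and> Im z \<in> \<int>}"

definition lattice_X :: "(complex^3 \<Rightarrow> complex^3) set" where
  "lattice_X = {heis_mult g | g. \<forall>i j. heis_matrix g $ i $ j \<in> gauss_ints}"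

definition lattice_B :: "(complex^2 \<Rightarrow> complex^2) set" where
  "lattice_B = {\<lambda>z. g + z | g. \<forall>i. g $ i \<in> gauss_ints}"

definition proj :: "complex^3 \<Rightarrow> complex^2" where
  "proj z = vector [z$1, z$2]"

definition \<alpha> :: "(complex^3) cform" where "\<alpha> = one_form (\<lambda>z v. v$1)"
definition \<beta> :: "(complex^3) cform" where "\<beta> = one_form (\<lambda>z v. v$2)"
definition \<gamma> :: "(complex^3) cform" where "\<gamma> = one_form (\<lambda>z v. v$3 - z$1 * v$2)"

definition \<alpha>B :: "(complex^2) cform" where "\<alpha>B = one_form (\<lambda>z v. v$1)"
definition \<beta>B :: "(complex^2) cform" where "\<beta>B = one_form (\<lambda>z v. v$2)"


section \<open>Deformations\<close>

text \<open>The parameter \<open>t\<^sub>i\<^sub>\<lambda>\<close> is \<open>t $ i $ \<lambda>\<close>.\<close>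

type_synonym param = "complex^2^3"

definition Delta_gamma :: "real \<Rightarrow> param set" where
  "Delta_gamma \<epsilon> = {t \<in> ball 0 \<epsilon>. t$3$1 = 0 \<and> t$3$2 = 0}"

definition D :: "param \<Rightarrow> complex" where
  "D t = t$1$1 * t$2$2 - t$1$2 * t$2$1"

definition \<alpha>t :: "param \<Rightarrow> (complex^3) cform" where
  "\<alpha>t t = \<alpha> + t$1$1 \<cdot>\<^sub>f cnjf \<alpha> + t$1$2 \<cdot>\<^sub>f cnjf \<beta>"
definition \<beta>t :: "param \<Rightarrow> (complex^3) cform" where
  "\<beta>t t = \<beta> + t$2$1 \<cdot>\<^sub>f cnjf \<alpha> + t$2$2 \<cdot>\<^sub>f cnjf \<beta>"
definition \<gamma>t :: "param \<Rightarrow> (complex^3) cform" where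
  "\<gamma>t t = \<gamma> + t$3$1 \<cdot>\<^sub>f cnjf \<alpha> + t$3$2 \<cdot>\<^sub>f cnjf \<beta> - D t \<cdot>\<^sub>f cnjf \<gamma>"

definition \<alpha>Bt :: "param \<Rightarrow> (complex^2) cform" where
  "\<alpha>Bt t = \<alpha>B + t$1$1 \<cdot>\<^sub>f cnjf \<alpha>B + t$1$2 \<cdot>\<^sub>f cnjf \<beta>B"
definition \<beta>Bt :: "param \<Rightarrow> (complex^2) cform" where
  "\<beta>Bt t = \<beta>B + t$2$1 \<cdot>\<^sub>f cnjf \<alpha>B + t$2$2 \<cdot>\<^sub>f cnjf \<beta>B"

definition coframe_X :: "param \<Rightarrow> (complex^3) cform list" where
  "coframe_X t = [\<alpha>t t, \<beta>t t, \<gamma>t t]"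

definition coframe_B :: "param \<Rightarrow> (complex^2) cform list" where
  "coframe_B t = [\<alpha>Bt t, \<beta>Bt t]"

text \<open>\<open>sigma_bar t $ i $ j\<close> is the coefficient of index \<open>i\<close>, \<open>j\<close>-bar, and
  \<open>sigma12 t\<close> that of index \<open>12\<close>.\<close>

definition sigma_bar :: "param \<Rightarrow> complex^2^2" where
  "sigma_bar t = (THE s. delbar (coframe_X t) 1 0 (\<gamma>t t) =
      s$1$1 \<cdot>\<^sub>f (\<alpha>t t \<and>\<^sub>w cnjf (\<alpha>t t)) + s$1$2 \<cdot>\<^sub>f (\<alpha>t t \<and>\<^sub>w cnjf (\<beta>t t)) +
      s$2$1 \<cdot>\<^sub>f (\<beta>t t \<and>\<^sub>w cnjf (\<alpha>t t)) + s$2$2 \<cdot>\<^sub>f (\<beta>t t \<and>\<^sub>w cnjf (\<beta>t t)))"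

definition sigma12 :: "param \<Rightarrow> complex" where
  "sigma12 t = (THE s. del (coframe_X t) 1 0 (\<gamma>t t) = s \<cdot>\<^sub>f (\<alpha>t t \<and>\<^sub>w \<beta>t t))"

definition \<Omega>t :: "param \<Rightarrow> (complex^3) cform" where
  "\<Omega>t t = \<alpha>t t \<and>\<^sub>w \<beta>t t \<and>\<^sub>w \<gamma>t t"

definition \<Gamma>1 :: "param \<Rightarrow> (complex^3) cform" where
  "\<Gamma>1 t = \<alpha>t t \<and>\<^sub>w \<gamma>t t \<and>\<^sub>w cnjf (\<alpha>t t)
     - (sigma_bar t $ 2 $ 2 / cnj (sigma12 t)) \<cdot>\<^sub>f (\<alpha>t t \<and>\<^sub>w \<beta>t t \<and>\<^sub>w cnjf (\<gamma>t t))"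
definition \<Gamma>2 :: "param \<Rightarrow> (complex^3) cform" where
  "\<Gamma>2 t = \<alpha>t t \<and>\<^sub>w \<gamma>t t \<and>\<^sub>w cnjf (\<beta>t t)
     + (sigma_bar t $ 2 $ 1 / cnj (sigma12 t)) \<cdot>\<^sub>f (\<alpha>t t \<and>\<^sub>w \<beta>t t \<and>\<^sub>w cnjf (\<gamma>t t))"
definition \<Gamma>3 :: "param \<Rightarrow> (complex^3) cform" where
  "\<Gamma>3 t = \<beta>t t \<and>\<^sub>w \<gamma>t t \<and>\<^sub>w cnjf (\<alpha>t t)
     + (sigma_bar t $ 1 $ 2 / cnj (sigma12 t)) \<cdot>\<^sub>f (\<alpha>t t \<and>\<^sub>w \<beta>t t \<and>\<^sub>w cnjf (\<gamma>t t))"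
definition \<Gamma>4 :: "param \<Rightarrow> (complex^3) cform" where
  "\<Gamma>4 t = \<beta>t t \<and>\<^sub>w \<gamma>t t \<and>\<^sub>w cnjf (\<beta>t t)
     - (sigma_bar t $ 1 $ 1 / cnj (sigma12 t)) \<cdot>\<^sub>f (\<alpha>t t \<and>\<^sub>w \<beta>t t \<and>\<^sub>w cnjf (\<gamma>t t))"

definition Gammas :: "param \<Rightarrow> (complex^3) cform list" where
  "Gammas t = [\<Gamma>1 t, \<Gamma>2 t, \<Gamma>3 t, \<Gamma>4 t]"

definition basis20_B :: "param \<Rightarrow> (complex^2) cform list" where
  "basis20_B t = [\<alpha>Bt t \<and>\<^sub>w \<beta>Bt t]"

definition basis11_B :: "param \<Rightarrow> (complex^2) cform list" where
  "basis11_B t = [\<alpha>Bt t \<and>\<^sub>w cnjf (\<alpha>Bt t), \<alpha>Bt t \<and>\<^sub>w cnjf (\<beta>Bt t),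
                  \<beta>Bt t \<and>\<^sub>w cnjf (\<alpha>Bt t), \<beta>Bt t \<and>\<^sub>w cnjf (\<beta>Bt t)]"


section \<open>Cohomology of \<open>X\<^sub>t\<close> and \<open>B\<^sub>t\<close>\<close>

definition H30 :: "param \<Rightarrow> ((complex^3) cform set) vsp" where
  "H30 t = H_Dol lattice_X (coframe_X t) 3 0"

definition H21_gamma :: "param \<Rightarrow> ((complex^3) cform set) vsp" where
  "H21_gamma t = (H_Dol lattice_X (coframe_X t) 2 1)
     \<lparr>vcarr := {coset (Dol_exact lattice_X (coframe_X t) 2 1) (fcomb cs (Gammas t)) | cs. length cs = 4}\<rparr>"

definition H20_B :: "param \<Rightarrow> ((complex^2) cform set) vsp" where
  "H20_B t = H_Dol lattice_B (coframe_B t) 2 0"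

definition H11_B :: "param \<Rightarrow> ((complex^2) cform set) vsp" where
  "H11_B t = H_Dol lattice_B (coframe_B t) 1 1"

text \<open>
  The maps \<open>u \<mapsto> [\<gamma>\<^sub>t \<and> \<pi>\<^sub>t\<^sup>* u]\<close>. In type \<open>(1,1)\<close> the wedge product is
  corrected by the same multiple of \<open>\<alpha>\<^sub>t \<and> \<beta>\<^sub>t \<and> cnj \<gamma>\<^sub>t\<close> as in the \<open>\<Gamma>\<^sub>j\<close>.
\<close>

definition lifts20 :: "param \<Rightarrow> (complex^3) cform list" where
  "lifts20 t = map (\<lambda>u. \<gamma>t t \<and>\<^sub>w pullback proj u) (basis20_B t)"

definition lifts11 :: "param \<Rightarrow> (complex^3) cform list" where
  "lifts11 t = map2 (\<lambda>u c. \<gamma>t t \<and>\<^sub>w pullback proj u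
        + (c / cnj (sigma12 t)) \<cdot>\<^sub>f (\<alpha>t t \<and>\<^sub>w \<beta>t t \<and>\<^sub>w cnjf (\<gamma>t t)))
     (basis11_B t)
     [sigma_bar t $ 2 $ 2, - sigma_bar t $ 2 $ 1, - sigma_bar t $ 1 $ 2, sigma_bar t $ 1 $ 1]"

definition gamma_wedge20 :: "param \<Rightarrow> (complex^2) cform set \<Rightarrow> (complex^3) cform set" where
  "gamma_wedge20 t = lin_ext (Dol_exact lattice_B (coframe_B t) 2 0) (basis20_B t)
     (Dol_exact lattice_X (coframe_X t) 3 0) (lifts20 t)"

definition gamma_wedge11 :: "param \<Rightarrow> (complex^2) cform set \<Rightarrow> (complex^3) cform set" where
  "gamma_wedge11 t = lin_ext (Dol_exact lattice_B (coframe_B t) 1 1) (basis11_B t)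
     (Dol_exact lattice_X (coframe_X t) 2 1) (lifts11 t)"


section \<open>The Hodge bundles\<close>

definition to_dR_30 :: "param \<Rightarrow> (complex^3) cform set \<Rightarrow> (complex^3) cform set" where
  "to_dR_30 t = lin_ext (Dol_exact lattice_X (coframe_X t) 3 0) [\<Omega>t t]
     (dR_exact lattice_X 3) [\<Omega>t t]"

definition to_dR_21 :: "param \<Rightarrow> (complex^3) cform set \<Rightarrow> (complex^3) cform set" where
  "to_dR_21 t = lin_ext (Dol_exact lattice_X (coframe_X t) 2 1) (Gammas t)
     (dR_exact lattice_X 3) (Gammas t)"

definition to_dR_20_B :: "param \<Rightarrow> (complex^2) cform set \<Rightarrow> (complex^2) cform set" where
  "to_dR_20_B t = lin_ext (Dol_exact lattice_B (coframe_B t) 2 0) (basis20_B t)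
     (dR_exact lattice_B 2) (basis20_B t)"

definition to_dR_11_B :: "param \<Rightarrow> (complex^2) cform set \<Rightarrow> (complex^2) cform set" where
  "to_dR_11_B t = lin_ext (Dol_exact lattice_B (coframe_B t) 1 1) (basis11_B t)
     (dR_exact lattice_B 2) (basis11_B t)"

definition F3H3 :: "(param, (complex^3) cform set, (complex^3) cform set) embbundle" where
  "F3H3 = \<lparr>fibre = H30, ambient = H_dR lattice_X 3, incl = to_dR_30\<rparr>"

definition F2H3_gamma ::
    "(param, (complex^3) cform set \<times> (complex^3) cform set, (complex^3) cform set) embbundle" where
  "F2H3_gamma =
    \<lparr>fibre = (\<lambda>t. vprod (H30 t) (H21_gamma t)),
     ambient = H_dR lattice_X 3,
     incl = (\<lambda>t (u, v). vadd (H_dR lattice_X 3) (to_dR_30 t u) (to_dR_21 t v))\<rparr>"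

text \<open>All \<open>B\<^sub>t\<close> share the same underlying smooth torus, so the Hodge bundles of \<open>(B\<^sub>t)\<close> are
  likewise subbundles of the constant bundle with fibre its second de Rham cohomology.\<close>

definition F2H2_B :: "(param, (complex^2) cform set, (complex^2) cform set) embbundle" where
  "F2H2_B = \<lparr>fibre = H20_B, ambient = H_dR lattice_B 2, incl = to_dR_20_B\<rparr>"

definition F1H2_B ::
    "(param, (complex^2) cform set \<times> (complex^2) cform set, (complex^2) cform set) embbundle" where
  "F1H2_B =
    \<lparr>fibre = (\<lambda>t. vprod (H20_B t) (H11_B t)),
     ambient = H_dR lattice_B 2,
     incl = (\<lambda>t (u, v). vadd (H_dR lattice_B 2) (to_dR_20_B t u) (to_dR_11_B t v))\<rparr>"


section \<open>Consistency of the conventions\<close>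

text \<open>Vanishing on lists of length other than one.\<close>

definition deg1 :: "'v cform \<Rightarrow> bool" where
  "deg1 \<omega> \<longleftrightarrow> (\<forall>p vs. length vs \<noteq> 1 \<longrightarrow> \<omega> p vs = 0)"

lemma nths_single: "i < length vs \<Longrightarrow> nths vs {i} = [vs ! i]"
proof (induction vs arbitrary: i)
  case (Cons a vs)
  show ?case
  proof (cases i)
    case 0 then show ?thesis by (simp add: nths_Cons)
  next
    case (Suc j)
    have "{j'. Suc j' \<in> {i}} = {j}" using Suc by auto
    then show ?thesis using Cons Suc by (simp add: nths_Cons)
  qed
qed simp

lemma nths_compl_single: "i < length vs \<Longrightarrow> nths vs (- {i}) = take i vs @ drop (Suc i) vs"
proof (induction vs arbitrary: i)
  case (Cons a vs)
  show ?case
  proof (cases i)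
    case 0
    have "{j'. Suc j' \<in> - {0}} = UNIV" by auto
    then show ?thesis using 0 by (simp add: nths_Cons nths_all)
  next
    case (Suc j)
    have "{j'. Suc j' \<in> - {i}} = - {j}" using Suc by auto
    then show ?thesis using Cons Suc by (simp add: nths_Cons)
  qed
qed simp

lemma wedge_deg1:
  assumes "deg1 \<omega>"
  shows "(\<omega> \<and>\<^sub>w \<eta>) p vs =
    (\<Sum>i<length vs. (-1) ^ i * \<omega> p [vs ! i] * \<eta> p (take i vs @ drop (Suc i) vs))"
proof -
  let ?f = "\<lambda>A. (-1) ^ card {(i, j). j < i \<and> i < length vs \<and> i \<in> A \<and> j \<notin> A} *
      \<omega> p (nths vs A) * \<eta> p (nths vs (- A))"
  have z: "?f A = 0" if "A \<in> Pow {..<length vs} - (\<lambda>i. {i}) ` {..<length vs}" for A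
  proof -
    have A: "A \<subseteq> {..<length vs}" using that by auto
    then have "finite A" using finite_subset by blast
    have "card A \<noteq> 1" using that A by (auto simp: card_1_singleton_iff)
    moreover have "{i. i < length vs \<and> i \<in> A} = A" using A by auto
    ultimately have "length (nths vs A) \<noteq> 1" by (simp add: length_nths)
    then show ?thesis using assms by (simp add: deg1_def)
  qed
  have c: "card {(i', j). j < i' \<and> i' < length vs \<and> i' \<in> {i} \<and> j \<notin> {i}} = i" if "i < length vs" for i
  proof -
    have "{(i', j). j < i' \<and> i' < length vs \<and> i' \<in> {i} \<and> j \<notin> {i}} = Pair i ` {..<i}" using that by auto
    then show ?thesis by (simp add: card_image inj_on_def)
  qed
  have "(\<omega> \<and>\<^sub>w \<eta>) p vs = sum ?f (Pow {..<length vs})" by (simp add: wedge_def)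
  also have "\<dots> = sum ?f ((\<lambda>i. {i}) ` {..<length vs})"
    by (rule sum.mono_neutral_right) (use z in auto)
  also have "\<dots> = (\<Sum>i<length vs. ?f {i})" by (subst sum.reindex) (auto simp: inj_on_def)
  also have "\<dots> = (\<Sum>i<length vs. (-1) ^ i * \<omega> p [vs ! i] * \<eta> p (take i vs @ drop (Suc i) vs))"
    by (rule sum.cong) (simp_all only: lessThan_iff c nths_single nths_compl_single)
  finally show ?thesis .
qed

lemma wedge3:
  assumes "deg1 a" "deg1 b" "deg1 c"
  shows "(a \<and>\<^sub>w b \<and>\<^sub>w c) p vs = (case vs of [x, y, z] \<Rightarrow>
     a p [x] * (b p [y] * c p [z] - b p [z] * c p [y])
   - a p [y] * (b p [x] * c p [z] - b p [z] * c p [x])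
   + a p [z] * (b p [x] * c p [y] - b p [y] * c p [x]) | _ \<Rightarrow> 0)"
proof (cases "length vs = 3")
  case True
  then obtain x y z where "vs = [x, y, z]" by (auto simp: length_Suc_conv numeral_eq_Suc)
  then show ?thesis using assms
    by (simp add: wedge_deg1 numeral_eq_Suc lessThan_Suc algebra_simps)
next
  case False
  have "c p (take j us @ drop (Suc j) us) = 0" if "i < length vs" "us = take i vs @ drop (Suc i) vs" "j < length us" for i j us
    using that False assms(3) by (auto simp: deg1_def)
  then have "(a \<and>\<^sub>w b \<and>\<^sub>w c) p vs = 0"
    using assms by (simp add: wedge_deg1 )
  then show ?thesis using False by (auto split: list.splits)
qed

lemma wedge2:
  assumes "deg1 a" "deg1 b"
  shows "(a \<and>\<^sub>w b) p vs = (case vs of [x, y] \<Rightarrow> a p [x] * b p [y] - a p [y] * b p [x] | _ \<Rightarrow> 0)"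
proof (cases "length vs = 2")
  case True
  then obtain x y where "vs = [x, y]" by (auto simp: length_Suc_conv numeral_eq_Suc)
  then show ?thesis using assms
    by (simp add: wedge_deg1 numeral_eq_Suc lessThan_Suc algebra_simps)
next
  case False
  have "b p (take j vs @ drop (Suc j) vs) = 0" if "j < length vs" for j
    using that False assms(2) by (auto simp: deg1_def)
  then have "(a \<and>\<^sub>w b) p vs = 0"
    using assms by (simp add: wedge_deg1 )
  then show ?thesis using False by (auto split: list.splits)
qed

lemma deg1_simps [simp]: "deg1 (one_form a)" "deg1 \<omega> \<Longrightarrow> deg1 (cnjf \<omega>)" "deg1 \<omega> \<Longrightarrow> deg1 (c \<cdot>\<^sub>f \<omega>)"
  "deg1 \<omega> \<Longrightarrow> deg1 \<eta> \<Longrightarrow> deg1 (\<omega> + \<eta>)"  "deg1 \<omega> \<Longrightarrow> deg1 \<eta> \<Longrightarrow> deg1 (\<omega> - \<eta>)"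
  by (auto simp: deg1_def one_form_def cnjf_def fscale_def split: list.splits)

lemma deg1_frames [simp]: "deg1 (\<alpha>t t)" "deg1 (\<beta>t t)" "deg1 (\<gamma>t t)" "deg1 (\<alpha>Bt t)" "deg1 (\<beta>Bt t)"
  "deg1 \<alpha>" "deg1 \<beta>" "deg1 \<gamma>"
  by (auto simp: \<alpha>t_def \<beta>t_def \<gamma>t_def \<alpha>Bt_def \<beta>Bt_def \<alpha>_def \<beta>_def \<gamma>_def \<alpha>B_def \<beta>B_def)

lemma bl_proj: "bounded_linear proj"
  unfolding proj_def
  apply (rule linear_conv_bounded_linear[THEN iffD1])
  by (auto intro!: linearI simp: vec_eq_iff forall_2)

lemma fd_proj: "frechet_derivative proj (at p) = proj"
  using bl_proj by (rule bounded_linear_imp_has_derivative[THEN frechet_derivative_at[symmetric], of proj])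

lemma pullback_wedge_proj: "pullback proj (a \<and>\<^sub>w b) = pullback proj a \<and>\<^sub>w pullback proj b"
  by (simp add: pullback_def wedge_def fd_proj nths_map)

lemma pullback_proj_coframe: "pullback proj (\<alpha>Bt t) = \<alpha>t t" "pullback proj (\<beta>Bt t) = \<beta>t t"
  "pullback proj (cnjf (\<alpha>Bt t)) = cnjf (\<alpha>t t)" "pullback proj (cnjf (\<beta>Bt t)) = cnjf (\<beta>t t)"
  by (auto simp: fun_eq_iff pullback_def \<alpha>Bt_def \<beta>Bt_def \<alpha>t_def \<beta>t_def \<alpha>_def \<beta>_def \<alpha>B_def \<beta>B_def
      one_form_def cnjf_def fscale_def fd_proj proj_def split: list.splits)

text \<open>Hence the lifted classes are \<open>[\<alpha>\<^sub>t \<and> \<beta>\<^sub>t \<and> \<gamma>\<^sub>t]\<close> and \<open>-[\<Gamma>\<^sub>j(t)]\<close>.\<close>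

lemma lifts20_eq: "lifts20 t = [\<Omega>t t]"
  by (auto simp: lifts20_def basis20_B_def pullback_wedge_proj pullback_proj_coframe \<Omega>t_def
      fun_eq_iff wedge3 algebra_simps split: list.splits)

lemma lifts11_eq: "lifts11 t = [- \<Gamma>1 t, - \<Gamma>2 t, - \<Gamma>3 t, - \<Gamma>4 t]"
  by (auto simp: lifts11_def basis11_B_def pullback_wedge_proj pullback_proj_coframe
      \<Gamma>1_def \<Gamma>2_def \<Gamma>3_def \<Gamma>4_def fscale_def
      fun_eq_iff wedge3 algebra_simps split: list.splits)

lemma extd_gamma: "extd \<gamma> = - (\<alpha> \<and>\<^sub>w \<beta>)"
proof (rule ext, rule ext)
  fix p :: "complex^3" and vs
  show "extd \<gamma> p vs = (- (\<alpha> \<and>\<^sub>w \<beta>)) p vs"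
  proof (cases "length vs = 2")
    case True
    then obtain x y where vs: "vs = [x, y]" by (auto simp: length_Suc_conv numeral_eq_Suc)
    have fd: "frechet_derivative (\<lambda>q::complex^3. w $ 3 - q $ 1 * w $ 2) (at p) v = - (v $ 1 * w $ 2)" for w v :: "complex^3"
    proof -
      have "((\<lambda>q::complex^3. w $ 3 - q $ 1 * w $ 2) has_derivative (\<lambda>v. - (v $ 1 * w $ 2))) (at p)"
        by (auto intro!: derivative_eq_intros bounded_linear_imp_has_derivative bounded_linear_vec_nth)
      from frechet_derivative_at[OF this] show ?thesis by metis
    qed
    show ?thesis unfolding vs
      by (simp add: extd_def wedge2 \<gamma>_def one_form_def lessThan_Suc numeral_eq_Suc fd[unfolded numeral_eq_Suc] ; simp add: \<alpha>_def \<beta>_def one_form_def fd)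
  next
    case False
    have "\<gamma> q (take i vs @ drop (Suc i) vs) = 0" if "i < length vs" for i q
      using that False deg1_frames(8) unfolding deg1_def by force
    then show ?thesis using False by (auto simp: extd_def wedge2 split: list.splits)
  qed
qed

lemma coframe_invariant:
  assumes "\<phi> \<in> lattice_X"
  shows "pullback \<phi> \<alpha> = \<alpha>" "pullback \<phi> \<beta> = \<beta>" "pullback \<phi> \<gamma> = \<gamma>"
proof -
  obtain g where \<phi>: "\<phi> = heis_mult g" using assms by (auto simp: lattice_X_def)
  let ?L = "\<lambda>v::complex^3. vector [v$1, v$2, v$3 + g$1 * v$2] :: complex^3"
  have "linear ?L"
    by (auto intro!: linearI simp: vec_eq_iff forall_3 algebra_simps)
  then have "bounded_linear ?L" by (simp add: linear_conv_bounded_linear)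
  then have "(?L has_derivative ?L) (at p)" for p
    by (rule bounded_linear_imp_has_derivative)
  then have "((\<lambda>z. g + ?L z) has_derivative ?L) (at p)" for p
    by (auto intro!: derivative_eq_intros)
  moreover have "heis_mult g = (\<lambda>z. g + ?L z)"
    by (auto simp: fun_eq_iff heis_mult_def vec_eq_iff forall_3)
  ultimately have "(heis_mult g has_derivative ?L) (at p)" for p by simp
  then have fd: "frechet_derivative (heis_mult g) (at p) = ?L" for p
    by (rule frechet_derivative_at[symmetric])
  show "pullback \<phi> \<alpha> = \<alpha>" "pullback \<phi> \<beta> = \<beta>" "pullback \<phi> \<gamma> = \<gamma>"
    by (auto simp: fun_eq_iff pullback_def \<phi> fd \<alpha>_def \<beta>_def \<gamma>_def one_form_def heis_mult_def
        algebra_simps split: list.splits)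
qed

end

theory Submission
  imports Defs
begin

text \<open>
  On the torus \<open>B\<^sub>t\<close> the statement is Fourier analysis: a holomorphic function has no nonzero frequency, and
  the symbol of the \<open>\<partial>\<close>-bar operator is bounded below on the nonzero frequencies, so a closed form of type
  \<open>(1,1)\<close> is cohomologous to its mean. On \<open>X\<^sub>t\<close> the left-invariant forms \<open>\<Omega>\<^sub>t\<close> and \<open>-\<Gamma>\<^sub>j(t)\<close> are closed. Their
  classes are told apart by averaging: since \<open>d\<gamma> = - \<alpha> \<and> \<beta>\<close> and derivatives along invariant fields have mean
  zero, the coefficient of \<open>\<gamma>\<close> in the mean of an exact \<open>3\<close>-form is a multiple of \<open>cnj \<alpha> \<and> cnj \<beta>\<close>. Its other five
  coordinates are therefore functionals on de Rham cohomology, and by an explicit matrix inversion they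
  recover the coefficients in the frame \<open>\<Omega>\<^sub>t, -\<Gamma>\<^sub>1(t), ..., -\<Gamma>\<^sub>4(t)\<close> smoothly in \<open>t\<close>; the same works on the torus
  with the frame of \<open>F\<^sup>1 H\<^sup>2(B\<^sub>t)\<close>. So on both sides a section is smooth if and only if its coefficients are, and
  the maps in question carry the one frame to the other.
\<close>

section \<open>Smooth functions\<close>

text \<open>The two sides pose different problems. \<open>H11_B t\<close> is the whole Dolbeault
  group, so each of its classes must be reduced to a constant form by a smooth solution of the d-bar
  equation. \<open>H21_gamma t\<close> is a span by definition, so on X_t only independence modulo
  d-bar-exact forms is at stake. A d-bar-exact (2,1)-form is d of a (2,0)-form minus its (3,0)-part,
  which is a function times \<open>\<Omega>t t\<close>; in the mean it counts as a constant multiple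
  of \<open>\<Omega>t t\<close>. Independence of all five forms in de Rham cohomology therefore
  yields independence in Dolbeault cohomology, without solving d-bar on X_t. Averaging on X meets
  the obstacle that invariant functions are not periodic in the base coordinates; integrating over
  the fibres first restores periodicity. Functionals on closed forms and a fixed finite list of
  closed forms let smoothness into \<open>H_dR\<close> be tested without a basis or the dimension of
  that space. The radius 1/4 makes z + T cnj z injective on the base and keeps the denominators
  \<open>NN t\<close> and \<open>1 - D t * cnj (D t)\<close> nonzero.\<close>

lemma Ck_on_cong:
  assumes "open S" "\<And>x. x \<in> S \<Longrightarrow> f x = g x"
  shows "Ck_on k S f \<longleftrightarrow> Ck_on k S g"
  using assms(2)
proof (induction k arbitrary: f g)
  case 0
  then show ?case by (auto cong: continuous_on_cong)
next
  case (Suc k)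
  have hd: "(f has_derivative f') (at x) \<longleftrightarrow> (g has_derivative f') (at x)" if "x \<in> S" for x f'
    using that Suc.prems assms(1) by (metis has_derivative_transform_within_open)
  then have "frechet_derivative f (at x) = frechet_derivative g (at x)" if "x \<in> S" for x
    using that by (simp add: frechet_derivative_def)
  then have "Ck_on k S (\<lambda>x. frechet_derivative f (at x) v) \<longleftrightarrow> Ck_on k S (\<lambda>x. frechet_derivative g (at x) v)" for v
    by (intro Suc.IH) simp
  moreover have "f differentiable (at x) \<longleftrightarrow> g differentiable (at x)" if "x \<in> S" for x
    using that hd by (simp add: differentiable_def)
  ultimately show ?case
    by simp
qed

text \<open>By uniqueness of derivatives an explicit \<open>f'\<close> may replace
  \<open>frechet_derivative\<close> in the recursion of \<open>Ck_on\<close>; this is the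
  introduction rule behind all closure properties below.\<close>

lemma Ck_on_Suc_I:
  assumes "open S" "\<And>x. x \<in> S \<Longrightarrow> (f has_derivative f' x) (at x)"
    and "\<And>v. Ck_on k S (\<lambda>x. f' x v)"
  shows "Ck_on (Suc k) S f"
proof -
  have "frechet_derivative f (at x) = f' x" if "x \<in> S" for x
    using assms(2)[OF that] frechet_derivative_at by metis
  then have "Ck_on k S (\<lambda>x. frechet_derivative f (at x) v)" for v
    using Ck_on_cong[OF assms(1), of "\<lambda>x. frechet_derivative f (at x) v" "\<lambda>x. f' x v"] assms(3) by simp
  then show ?thesis
    using assms(2) by (auto simp: differentiable_def)
qed

lemma Ck_on_mono: "Ck_on (Suc k) S f \<Longrightarrow> Ck_on k S f"
proof (induction k arbitrary: f)
  case 0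
  then show ?case
    by (auto intro!: differentiable_imp_continuous_on simp: differentiable_on_def differentiable_at_withinI)
next
  case (Suc k)
  then show ?case by auto
qed

lemma Ck_on_has_derivative:
  "Ck_on (Suc k) S f \<Longrightarrow> x \<in> S \<Longrightarrow> (f has_derivative frechet_derivative f (at x)) (at x)"
  by (simp add: frechet_derivative_works)

lemma Ck_on_const [simp]: "open S \<Longrightarrow> Ck_on k S (\<lambda>_. c)"
proof (induction k arbitrary: c)
  case (Suc k)
  then show ?case by (intro Ck_on_Suc_I[where f' = "\<lambda>_ _. 0"]) auto
qed simp

lemma Ck_on_subset: "Ck_on k S f \<Longrightarrow> T \<subseteq> S \<Longrightarrow> Ck_on k T f"
  by (induction k arbitrary: f) (auto intro: continuous_on_subset)

lemma Ck_on_bounded_linear: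
  "open S \<Longrightarrow> bounded_linear h \<Longrightarrow> Ck_on k S f \<Longrightarrow> Ck_on k S (\<lambda>x. h (f x))"
proof (induction k arbitrary: f)
  case 0
  then show ?case by (auto intro: bounded_linear.continuous_on)
next
  case (Suc k)
  then show ?case
    by (intro Ck_on_Suc_I[where f' = "\<lambda>x v. h (frechet_derivative f (at x) v)"])
       (auto intro: bounded_linear.has_derivative simp: frechet_derivative_works)
qed

lemma Ck_on_add: "open S \<Longrightarrow> Ck_on k S f \<Longrightarrow> Ck_on k S g \<Longrightarrow> Ck_on k S (\<lambda>x. f x + g x)"
proof (induction k arbitrary: f g)
  case 0
  then show ?case by (auto intro: continuous_intros)
next
  case (Suc k)
  then show ?case
    by (intro Ck_on_Suc_I[where f' = "\<lambda>x v. frechet_derivative f (at x) v + frechet_derivative g (at x) v"])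
       (auto intro: has_derivative_add simp: frechet_derivative_works)
qed

lemma Ck_on_mult:
  fixes f g :: "'a::real_normed_vector \<Rightarrow> 'b::real_normed_algebra"
  shows "open S \<Longrightarrow> Ck_on k S f \<Longrightarrow> Ck_on k S g \<Longrightarrow> Ck_on k S (\<lambda>x. f x * g x)"
proof (induction k arbitrary: f g)
  case 0
  then show ?case by (auto intro: continuous_intros)
next
  case (Suc k)
  note mono = Suc.prems(2,3)[THEN Ck_on_mono]
  show ?case
  proof (intro Ck_on_Suc_I)
    show "((\<lambda>x. f x * g x) has_derivative
        (\<lambda>v. f x * frechet_derivative g (at x) v + frechet_derivative f (at x) v * g x)) (at x)"
      if "x \<in> S" for x
      using that Suc.prems by (intro has_derivative_mult Ck_on_has_derivative)
    show "Ck_on k S (\<lambda>x. f x * frechet_derivative g (at x) v + frechet_derivative f (at x) v * g x)" for v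
      using Suc.prems mono by (intro Ck_on_add Suc.IH) auto
  qed (use Suc.prems in auto)
qed

text \<open>The derivative of the reciprocal is a product of the reciprocal itself with the
  derivative of \<open>f\<close>, so order k for the reciprocal bootstraps to order k + 1.\<close>

lemma Ck_on_inverse:
  fixes f :: "'a::real_normed_vector \<Rightarrow> 'b::real_normed_field"
  assumes "open S" and nz: "\<And>x. x \<in> S \<Longrightarrow> f x \<noteq> 0"
  shows "Ck_on k S f \<Longrightarrow> Ck_on k S (\<lambda>x. inverse (f x))"
proof (induction k)
  case 0
  then show ?case using nz by (auto intro: continuous_intros)
next
  case (Suc k)
  have inv: "Ck_on k S (\<lambda>x. inverse (f x))"
    using Suc Ck_on_mono by blast
  show ?case
  proof (intro Ck_on_Suc_I)
    show "((\<lambda>x. inverse (f x)) has_derivative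
        (\<lambda>v. - 1 * (inverse (f x) * frechet_derivative f (at x) v * inverse (f x)))) (at x)"
      if "x \<in> S" for x
      using Deriv.has_derivative_inverse[OF nz[OF that] Ck_on_has_derivative[OF Suc.prems that]] by simp
    show "Ck_on k S (\<lambda>x. - 1 * (inverse (f x) * frechet_derivative f (at x) v * inverse (f x)))" for v
      using Suc.prems inv assms(1) by (intro Ck_on_mult Ck_on_const) auto
  qed (fact assms(1))
qed

lemma smooth_on_const: "open S \<Longrightarrow> smooth_on S (\<lambda>_. c)"
  by (simp add: smooth_on_def)

lemma smooth_on_subset: "smooth_on S f \<Longrightarrow> T \<subseteq> S \<Longrightarrow> smooth_on T f"
  by (auto simp: smooth_on_def intro: Ck_on_subset)

lemma smooth_on_add: "open S \<Longrightarrow> smooth_on S f \<Longrightarrow> smooth_on S g \<Longrightarrow> smooth_on S (\<lambda>x. f x + g x)"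
  by (simp add: smooth_on_def Ck_on_add)

lemma smooth_on_mult:
  fixes f g :: "'a::real_normed_vector \<Rightarrow> 'b::real_normed_algebra"
  shows "open S \<Longrightarrow> smooth_on S f \<Longrightarrow> smooth_on S g \<Longrightarrow> smooth_on S (\<lambda>x. f x * g x)"
  by (simp add: smooth_on_def Ck_on_mult)

lemma smooth_on_compose_bounded_linear:
  "open S \<Longrightarrow> bounded_linear h \<Longrightarrow> smooth_on S f \<Longrightarrow> smooth_on S (\<lambda>x. h (f x))"
  by (simp add: smooth_on_def Ck_on_bounded_linear)

lemma smooth_on_minus: "open S \<Longrightarrow> smooth_on S f \<Longrightarrow> smooth_on S (\<lambda>x. - f x)"
  by (rule smooth_on_compose_bounded_linear[OF _ bounded_linear_minus[OF bounded_linear_ident]])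

lemma smooth_on_diff: "open S \<Longrightarrow> smooth_on S f \<Longrightarrow> smooth_on S g \<Longrightarrow> smooth_on S (\<lambda>x. f x - g x)"
  using smooth_on_add[OF _ _ smooth_on_minus, of S f g] by simp

lemma smooth_on_cnj: "open S \<Longrightarrow> smooth_on S f \<Longrightarrow> smooth_on S (\<lambda>x. cnj (f x))"
  by (rule smooth_on_compose_bounded_linear[OF _ bounded_linear_cnj])

lemma smooth_on_divide:
  fixes f g :: "'a::real_normed_vector \<Rightarrow> 'b::real_normed_field"
  shows "open S \<Longrightarrow> smooth_on S f \<Longrightarrow> smooth_on S g \<Longrightarrow> (\<And>x. x \<in> S \<Longrightarrow> g x \<noteq> 0) \<Longrightarrow>
    smooth_on S (\<lambda>x. f x / g x)"
  by (simp add: smooth_on_def Ck_on_mult Ck_on_inverse divide_inverse)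

lemma smooth_on_bounded_linear:
  assumes "open S" "bounded_linear h"
  shows "smooth_on S h"
proof -
  have "Ck_on k S h" for k
  proof (cases k)
    case 0
    then show ?thesis using assms by (auto intro: linear_continuous_on)
  next
    case (Suc j)
    then show ?thesis
      using Ck_on_Suc_I[of S h "\<lambda>_. h"] assms by (auto intro: bounded_linear_imp_has_derivative)
  qed
  then show ?thesis by (simp add: smooth_on_def)
qed

lemma smooth_on_sum:
  "open S \<Longrightarrow> (\<And>i. i \<in> I \<Longrightarrow> smooth_on S (f i)) \<Longrightarrow> smooth_on S (\<lambda>x. \<Sum>i\<in>I. f i x)"
  by (induction I rule: infinite_finite_induct) (auto intro: smooth_on_const smooth_on_add)

lemma smooth_on_differentiable: "smooth_on S f \<Longrightarrow> x \<in> S \<Longrightarrow> f differentiable (at x)"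
  unfolding smooth_on_def by (drule spec[of _ 1]) simp

lemma smooth_on_has_derivative:
  "smooth_on S f \<Longrightarrow> x \<in> S \<Longrightarrow> (f has_derivative frechet_derivative f (at x)) (at x)"
  using smooth_on_differentiable frechet_derivative_works by blast

lemma smooth_on_continuous: "smooth_on S f \<Longrightarrow> continuous_on S f"
  unfolding smooth_on_def by (drule spec[of _ 0]) simp

lemma smooth_on_frechet_derivative: "smooth_on S f \<Longrightarrow> smooth_on S (\<lambda>x. frechet_derivative f (at x) v)"
  unfolding smooth_on_def using Ck_on.simps(2) by blast

lemma continuous_on_frechet_derivative:
  "smooth_on S f \<Longrightarrow> continuous_on S (\<lambda>x. frechet_derivative f (at x) v)"
  by (intro smooth_on_continuous smooth_on_frechet_derivative)

section \<open>Fourier series of periodic functions\<close>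

definition periodic :: "('a::euclidean_space \<Rightarrow> 'b) \<Rightarrow> bool" where
  "periodic f \<longleftrightarrow> (\<forall>x. \<forall>b\<in>Basis. f (x + b) = f x)"

text \<open>The standard integer lattice is self-dual, so one set serves both as the group of
  periods and as the group of frequencies.\<close>

definition lattice :: "'a::euclidean_space set" where
  "lattice = {k. \<forall>b\<in>Basis. k \<bullet> b \<in> \<int>}"

definition tmean :: "('a::euclidean_space \<Rightarrow> complex) \<Rightarrow> complex" where
  "tmean f = integral (cbox 0 One) f"

lemma periodic_int: "periodic f \<Longrightarrow> b \<in> Basis \<Longrightarrow> f (x + of_int n *\<^sub>R b) = f x"
proof (induction n rule: int_induct[where k = 0])
  case (step1 i)
  have "f (x + of_int (i + 1) *\<^sub>R b) = f ((x + of_int i *\<^sub>R b) + b)"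
    by (simp add: algebra_simps)
  then show ?case using step1 by (simp add: periodic_def)
next
  case (step2 i)
  have "f (x + of_int (i - 1) *\<^sub>R b) = f ((x + of_int (i - 1) *\<^sub>R b) + b)"
    using step2.prems by (simp add: periodic_def)
  also have "\<dots> = f (x + of_int i *\<^sub>R b)"
    by (simp add: algebra_simps)
  finally show ?case using step2 by simp
qed simp

lemma periodic_shift: "periodic f \<Longrightarrow> periodic (\<lambda>x. f (x + c))"
  unfolding periodic_def by (metis add.assoc add.commute)

lemma integrable_continuous_UNIV:
  "continuous_on UNIV (f :: 'a::euclidean_space \<Rightarrow> complex) \<Longrightarrow> f integrable_on cbox a b"
  by (rule integrable_continuous) (rule continuous_on_subset, auto)

lemma tmean_add:
  "continuous_on UNIV f \<Longrightarrow> continuous_on UNIV g \<Longrightarrow> tmean (\<lambda>x. f x + g x) = tmean f + tmean g"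
  unfolding tmean_def by (intro integral_add integrable_continuous_UNIV)

lemma tmean_diff:
  "continuous_on UNIV f \<Longrightarrow> continuous_on UNIV g \<Longrightarrow> tmean (\<lambda>x. f x - g x) = tmean f - tmean g"
  unfolding tmean_def by (intro integral_diff integrable_continuous_UNIV)

lemma tmean_cmult: "tmean (\<lambda>x. c * f x) = c * tmean f"
  unfolding tmean_def by simp

lemma tmean_minus: "tmean (\<lambda>x. - f x) = - tmean f"
  unfolding tmean_def by simp

lemma tmean_const [simp]: "tmean (\<lambda>_::'a::euclidean_space. c) = c"
  unfolding tmean_def by (simp add: content_unit)

lemma tmean_sum:
  "(\<And>i. i \<in> I \<Longrightarrow> continuous_on UNIV (f i)) \<Longrightarrow> tmean (\<lambda>x. \<Sum>i\<in>I. f i x) = (\<Sum>i\<in>I. tmean (f i))"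
proof (induction I rule: infinite_finite_induct)
  case (insert i I)
  then show ?case by (simp add: tmean_add continuous_on_sum)
qed simp_all

text \<open>The part of the shifted box that sticks out is the translate by \<open>b\<close> of the
  part that is missing, and periodicity makes the two integrals equal.\<close>

lemma tmean_shift_Basis_le1:
  fixes f :: "'a::euclidean_space \<Rightarrow> complex"
  assumes f: "continuous_on UNIV f" "periodic f" and b: "b \<in> Basis" and s: "0 \<le> s" "s \<le> 1"
  shows "tmean (\<lambda>x. f (x + s *\<^sub>R b)) = tmean f"
proof -
  have box: "x \<in> cbox u v \<longleftrightarrow> (u \<bullet> b \<le> x \<bullet> b \<and> x \<bullet> b \<le> v \<bullet> b) \<and>
      (\<forall>i\<in>Basis - {b}. u \<bullet> i \<le> x \<bullet> i \<and> x \<bullet> i \<le> v \<bullet> i)" for x u v :: 'a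
    using b by (auto simp: mem_box)
  have bb: "i \<in> Basis - {b} \<Longrightarrow> b \<bullet> i = 0" "b \<bullet> b = 1" for i
    using b by (auto simp: inner_Basis)
  have split: "integral (cbox u v) f = integral (cbox u v \<inter> {x. x \<bullet> b \<le> c}) f + integral (cbox u v \<inter> {x. x \<bullet> b \<ge> c}) f" for u v c
    by (rule integral_split) (use f b in \<open>auto intro: integrable_continuous_UNIV\<close>)
  \<comment> \<open>The corner \<open>One + (s - 1) *\<^sub>R b\<close> has coordinate s along
    \<open>b\<close>: this is the slab from 0 to s, and \<open>B2\<close> is that slab moved by
    \<open>b\<close>.\<close>
  have A1: "cbox 0 One \<inter> {x. x \<bullet> b \<le> s} = cbox 0 (One + (s - 1) *\<^sub>R b)"
    using s b by (intro set_eqI) (auto simp: box bb inner_add_left)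
  have A2: "cbox 0 One \<inter> {x. x \<bullet> b \<ge> s} = cbox (s *\<^sub>R b) One"
    using s b by (intro set_eqI) (auto simp: box bb inner_add_left)
  have B1: "cbox (s *\<^sub>R b) (One + s *\<^sub>R b) \<inter> {x. x \<bullet> b \<le> 1} = cbox (s *\<^sub>R b) One"
    using s b by (intro set_eqI) (auto simp: box bb inner_add_left)
  have B2: "cbox (s *\<^sub>R b) (One + s *\<^sub>R b) \<inter> {x. x \<bullet> b \<ge> 1} = cbox (0 + b) ((One + (s - 1) *\<^sub>R b) + b)"
    using s b by (intro set_eqI) (auto simp: box bb inner_add_left)
  have "tmean (\<lambda>x. f (x + s *\<^sub>R b)) = integral (cbox (0 + s *\<^sub>R b) (One + s *\<^sub>R b)) f"
    using integral_shift_cbox_plus[of 0 One f "s *\<^sub>R b"] by (simp add: tmean_def o_def add.commute)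
  also have "\<dots> = integral (cbox (s *\<^sub>R b) One) f + integral (cbox (0 + b) ((One + (s - 1) *\<^sub>R b) + b)) f"
    using split[of "s *\<^sub>R b" "One + s *\<^sub>R b" 1] unfolding B1 B2 by simp
  also have "integral (cbox (0 + b) ((One + (s - 1) *\<^sub>R b) + b)) f = integral (cbox 0 (One + (s - 1) *\<^sub>R b)) f"
    using f(2) b integral_shift_cbox_plus[of 0 "One + (s - 1) *\<^sub>R b" f b]
    by (simp add: periodic_def add.commute[of b] o_def)
  finally show ?thesis
    using split[of 0 One s] unfolding A1 A2 tmean_def by simp
qed

lemma tmean_shift_Basis:
  fixes f :: "'a::euclidean_space \<Rightarrow> complex"
  assumes f: "continuous_on UNIV f" "periodic f" and b: "b \<in> Basis"
  shows "tmean (\<lambda>x. f (x + s *\<^sub>R b)) = tmean f"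
proof -
  have "f (x + s *\<^sub>R b) = f (x + frac s *\<^sub>R b)" for x
    using periodic_int[OF f(2) b, of "x + frac s *\<^sub>R b" "\<lfloor>s\<rfloor>"]
    by (simp add: frac_def algebra_simps)
  then show ?thesis
    using tmean_shift_Basis_le1[OF f b, of "frac s"] frac_lt_1[of s] by simp
qed

lemma tmean_shift:
  fixes f :: "'a::euclidean_space \<Rightarrow> complex"
  assumes f: "continuous_on UNIV f" "periodic f"
  shows "tmean (\<lambda>x. f (x + c)) = tmean f"
proof -
  have "tmean (\<lambda>x. f (x + (\<Sum>b\<in>B. (c \<bullet> b) *\<^sub>R b))) = tmean f" if "finite B" "B \<subseteq> Basis" for B
    using that
  proof (induction B)
    case (insert b B)
    have "continuous_on UNIV (\<lambda>x. f (x + (\<Sum>b\<in>B. (c \<bullet> b) *\<^sub>R b)))"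
      by (rule continuous_on_compose2[OF f(1)]) (auto intro: continuous_intros)
    from tmean_shift_Basis[OF this periodic_shift[OF f(2)], of b "c \<bullet> b"]
    show ?case using insert by (simp add: add.assoc)
  qed simp
  from this[of Basis] show ?thesis by (simp add: euclidean_representation)
qed

text \<open>The mean of the translates along \<open>v\<close> is constant; differentiating it under
  the integral gives the mean of \<open>f'\<close>. This serves as integration by parts
  throughout.\<close>

lemma tmean_directional_derivative:
  fixes f f' :: "'a::euclidean_space \<Rightarrow> complex"
  assumes f: "continuous_on UNIV f" "periodic f" and f': "continuous_on UNIV f'"
    and D: "\<And>x. ((\<lambda>s. f (x + s *\<^sub>R v)) has_vector_derivative f' x) (at 0)"
  shows "tmean f' = 0"
proof -
  \<comment> \<open>The Leibniz rule asks for the derivative at every s, while \<open>D\<close>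
    gives it at 0 only; the base point is moved instead.\<close>
  have "((\<lambda>s. f (x + s *\<^sub>R v)) has_vector_derivative f' (x + s *\<^sub>R v)) (at s within UNIV)" for x s
  proof -
    have "((\<lambda>r. f ((x + s *\<^sub>R v) + r *\<^sub>R v)) has_vector_derivative f' (x + s *\<^sub>R v)) (at (s - s))"
      using D[of "x + s *\<^sub>R v"] by simp
    then have "((\<lambda>r. f ((x + s *\<^sub>R v) + r *\<^sub>R v)) \<circ> (\<lambda>r. r - s) has_vector_derivative 1 *\<^sub>R f' (x + s *\<^sub>R v)) (at s)"
      by (intro vector_diff_chain_at) (auto intro!: derivative_eq_intros simp: has_vector_derivative_def)
    then show ?thesis by (simp add: o_def algebra_simps)
  qed
  then have "((\<lambda>s. integral (cbox 0 One) (\<lambda>x. f (x + s *\<^sub>R v))) has_vector_derivative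
      integral (cbox 0 One) (\<lambda>x. f' (x + 0 *\<^sub>R v))) (at 0 within UNIV)"
  proof (rule leibniz_rule_vector_derivative)
    show "(\<lambda>x. f (x + s *\<^sub>R v)) integrable_on cbox 0 One" for s
      by (intro integrable_continuous_UNIV continuous_on_compose2[OF f(1)] continuous_intros) auto
    show "continuous_on (UNIV \<times> cbox 0 One) (\<lambda>(s, x). f' (x + s *\<^sub>R v))"
      unfolding split_beta by (intro continuous_on_compose2[OF f'] continuous_intros) auto
  qed auto
  moreover have "(\<lambda>s. integral (cbox 0 One) (\<lambda>x. f (x + s *\<^sub>R v))) = (\<lambda>s. tmean f)"
    using tmean_shift[OF f] by (simp add: tmean_def)
  ultimately have "((\<lambda>s. tmean f) has_vector_derivative tmean f') (at (0::real))"
    by (simp add: tmean_def)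
  then show ?thesis
    using has_vector_derivative_const vector_derivative_unique_at by metis
qed

section \<open>Characters and uniqueness of Fourier coefficients\<close>

definition chr :: "'a::euclidean_space \<Rightarrow> 'a \<Rightarrow> complex" where
  "chr k x = exp (2 * pi * \<i> * of_real (k \<bullet> x))"

definition fourier :: "('a::euclidean_space \<Rightarrow> complex) \<Rightarrow> 'a \<Rightarrow> complex" where
  "fourier f k = tmean (\<lambda>x. f x * chr (- k) x)"

lemma chr_add: "chr (k + l) x = chr k x * chr l x" "chr k (x + y) = chr k x * chr k y"
  by (simp_all add: chr_def exp_add [symmetric] inner_add_left inner_add_right algebra_simps)

lemma chr_0 [simp]: "chr 0 x = 1" "chr k 0 = 1"
  by (simp_all add: chr_def)

lemma norm_chr [simp]: "norm (chr k x) = 1"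
  by (simp add: chr_def norm_exp_eq_Re)

lemma chr_scaleR: "chr k (s *\<^sub>R v) = exp (s *\<^sub>R (2 * pi * \<i> * of_real (k \<bullet> v)))"
  by (simp add: chr_def scaleR_conv_of_real algebra_simps)

lemma continuous_on_chr [continuous_intros]: "continuous_on S (chr k)"
  unfolding chr_def by (intro continuous_intros)

lemma lattice_add: "k \<in> lattice \<Longrightarrow> l \<in> lattice \<Longrightarrow> k + l \<in> lattice"
  and lattice_minus: "k \<in> lattice \<Longrightarrow> - k \<in> lattice"
  and lattice_0 [simp]: "0 \<in> lattice"
  by (auto simp: lattice_def inner_add_left)

lemma lattice_Basis: "b \<in> Basis \<Longrightarrow> b \<in> lattice"
  by (auto simp: lattice_def inner_Basis)

lemma periodic_chr: "k \<in> lattice \<Longrightarrow> periodic (chr k)"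
proof -
  assume k: "k \<in> lattice"
  have "chr k b = 1" if "b \<in> Basis" for b
  proof -
    have "k \<bullet> b \<in> \<int>" using k that by (simp add: lattice_def)
    then obtain n where "k \<bullet> b = of_int n" by (rule Ints_cases)
    then show ?thesis
      using exp_integer_2pi[of "of_int n"] by (simp add: chr_def mult_ac)
  qed
  then show ?thesis by (simp add: periodic_def chr_add)
qed

lemma periodic_mult: "periodic f \<Longrightarrow> periodic g \<Longrightarrow> periodic (\<lambda>x. f x * g x)"
  and periodic_add: "periodic f \<Longrightarrow> periodic g \<Longrightarrow> periodic (\<lambda>x. f x + g x)"
  and periodic_diff: "periodic f \<Longrightarrow> periodic g \<Longrightarrow> periodic (\<lambda>x. f x - g x)"
  and periodic_const: "periodic (\<lambda>x. c)"
  by (simp_all add: periodic_def)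

lemma chr_vector_derivative:
  "((\<lambda>s. chr k (x + s *\<^sub>R v)) has_vector_derivative 2 * pi * \<i> * of_real (k \<bullet> v) * chr k x) (at 0)"
proof -
  have "((\<lambda>s. chr k x * exp (s *\<^sub>R (2 * pi * \<i> * of_real (k \<bullet> v)))) has_vector_derivative
      chr k x * (exp (0 *\<^sub>R (2 * pi * \<i> * of_real (k \<bullet> v))) * (2 * pi * \<i> * of_real (k \<bullet> v)))) (at 0)"
    by (intro has_vector_derivative_mult_right exp_scaleR_has_vector_derivative_right)
  then show ?thesis
    by (simp add: chr_add chr_scaleR mult_ac)
qed

text \<open>The function \<open>f x * chr (- k) x\<close> is periodic, so its derivative along
  \<open>v\<close> has mean zero; the product rule splits it into the two sides.\<close>

lemma fourier_derivative:
  fixes f f' :: "'a::euclidean_space \<Rightarrow> complex"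
  assumes f: "continuous_on UNIV f" "periodic f" and f': "continuous_on UNIV f'"
    and d: "\<And>x. ((\<lambda>s. f (x + s *\<^sub>R v)) has_vector_derivative f' x) (at 0)"
    and k: "k \<in> lattice"
  shows "fourier f' k = 2 * pi * \<i> * of_real (k \<bullet> v) * fourier f k"
proof -
  let ?w = "2 * pi * \<i> * of_real (k \<bullet> v)"
  have "tmean (\<lambda>x. f' x * chr (- k) x - ?w * (f x * chr (- k) x)) = 0"
  proof (rule tmean_directional_derivative)
    show "periodic (\<lambda>x. f x * chr (- k) x)"
      using f(2) k by (intro periodic_mult periodic_chr lattice_minus)
    show "((\<lambda>s. f (x + s *\<^sub>R v) * chr (- k) (x + s *\<^sub>R v)) has_vector_derivative
        f' x * chr (- k) x - ?w * (f x * chr (- k) x)) (at 0)" for x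
      using has_vector_derivative_mult[OF d[of x] chr_vector_derivative[of "-k" x v]]
      by (simp add: algebra_simps)
  qed (intro continuous_intros f f')+
  moreover have "tmean (\<lambda>x. f' x * chr (- k) x - ?w * (f x * chr (- k) x))
      = tmean (\<lambda>x. f' x * chr (- k) x) - tmean (\<lambda>x. ?w * (f x * chr (- k) x))"
    by (intro tmean_diff continuous_intros f f')
  ultimately show ?thesis
    by (simp add: fourier_def tmean_cmult)
qed

lemma tmean_chr: "k \<in> lattice \<Longrightarrow> k \<noteq> 0 \<Longrightarrow> tmean (chr k) = 0"
proof -
  assume k: "k \<in> lattice" "k \<noteq> 0"
  \<comment> \<open>Differentiating along k itself produces the factor \<open>k \<bullet> k\<close>,
    which is nonzero.\<close>
  have "tmean (\<lambda>x. 2 * pi * \<i> * of_real (k \<bullet> k) * chr k x) = 0"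
    by (rule tmean_directional_derivative[OF _ _ _ chr_vector_derivative])
       (intro continuous_intros periodic_chr k)+
  then show ?thesis using k by (simp add: tmean_cmult)
qed

text \<open>The trigonometric polynomial \<open>T\<close> exceeds 1 only near the centre of the period box, so a
  continuous function orthogonal to all its powers must vanish there.\<close>

lemma fourier_unique_centre:
  fixes g :: "'a::euclidean_space \<Rightarrow> complex"
  assumes g: "continuous_on UNIV g" and orth: "\<And>k. k \<in> lattice \<Longrightarrow> tmean (\<lambda>x. g x * chr k x) = 0"
  shows "g ((1/2) *\<^sub>R One) = 0"
proof (rule ccontr)
  define c :: 'a where "c = (1/2) *\<^sub>R One"
  assume "g ((1/2) *\<^sub>R One) \<noteq> 0"
  then have gc: "g c \<noteq> 0" by (simp add: c_def)
  define n where "n = real DIM('a)"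
  have n: "n \<ge> 1" using DIM_positive[where 'a='a] by (simp add: n_def Suc_le_eq)
  define u where "u x = Re (g x / g c)" for x
  have contu: "continuous_on UNIV u" unfolding u_def by (intro continuous_intros g) (use gc in auto)
  have cb: "c \<bullet> b = 1/2" if "b \<in> Basis" for b using that by (simp add: c_def)
  obtain \<eta> where \<eta>: "\<eta> > 0" "\<And>x. dist x c < \<eta> \<Longrightarrow> dist (u x) (u c) < 1/2"
    using contu unfolding continuous_on_iff by (metis UNIV_I zero_less_divide_1_iff zero_less_numeral)
  \<comment> \<open>The bound 1/8 keeps the shifted cosines nonnegative on the cube
    \<open>K \<delta>\<close>; the other bound puts that cube into the ball where the normalised
    real part u is at least 1/2.\<close>
  define \<delta> where "\<delta> = min (1/8) (\<eta> / (2 * n))"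
  have \<delta>: "\<delta> > 0" "\<delta> \<le> 1/8" "n * \<delta> < \<eta>"
    using \<eta> n by (auto simp: \<delta>_def min_def field_simps)
  have uge: "u x \<ge> 1/2" if "\<And>b. b \<in> Basis \<Longrightarrow> \<bar>x \<bullet> b - 1/2\<bar> \<le> \<delta>" for x
  proof -
    have "norm (x - c) \<le> (\<Sum>b\<in>Basis. \<bar>(x - c) \<bullet> b\<bar>)" by (rule norm_le_l1)
    also have "\<dots> \<le> (\<Sum>b\<in>(Basis::'a set). \<delta>)" using that by (intro sum_mono) (simp add: inner_diff_left cb)
    also have "\<dots> < \<eta>" using \<delta> by (simp add: n_def)
    finally have "dist (u x) (u c) < 1/2" by (intro \<eta>) (simp add: dist_norm)
    moreover have "u c = 1" using gc by (simp add: u_def)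
    ultimately show ?thesis unfolding dist_real_def by linarith
  qed
  \<comment> \<open>Outside \<open>K \<delta>\<close> some coordinate contributes at most cos(2 pi
    \<delta>) = 1 - 2 n \<epsilon>, so the average of the cosines is at most 1 - 2 \<epsilon> there.
    Adding \<epsilon> keeps the absolute value of \<open>T\<close> below 1 outside the cube, yet
    lifts \<open>T\<close> above 1 near the centre.\<close>
  define \<epsilon> where "\<epsilon> = (1 - cos (2 * pi * \<delta>)) / (2 * n)"
  have "cos (2 * pi * \<delta>) < cos 0"
    using \<delta> by (intro cos_monotone_0_pi) auto
  then have \<epsilon>: "\<epsilon> > 0" using n by (simp add: \<epsilon>_def)
  have "2 * n * \<epsilon> = 1 - cos (2 * pi * \<delta>)" using n by (simp add: \<epsilon>_def)
  then have \<epsilon>n: "cos (2 * pi * \<delta>) = 1 - 2 * n * \<epsilon>" by simp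
  define T where "T x = \<epsilon> - (\<Sum>b\<in>Basis. cos (2 * pi * (x \<bullet> b))) / n" for x :: 'a
  have cosh: "- cos (2 * pi * r) = cos (2 * pi * \<bar>r - 1/2\<bar>)" for r
  proof -
    have "cos (2 * pi * \<bar>r - 1/2\<bar>) = cos (2 * pi * (r - 1/2))"
      by (cases "r \<ge> 1/2") (auto simp: abs_if simp flip: cos_minus[of "2 * pi * (r - 1/2)"] intro!: arg_cong[of _ _ cos] simp: algebra_simps)
    also have "\<dots> = cos (2 * pi * r - pi)" by (simp add: algebra_simps)
    finally show ?thesis by (simp add: cos_diff)
  qed
  have T: "T x = \<epsilon> + (\<Sum>b\<in>Basis. cos (2 * pi * \<bar>x \<bullet> b - 1/2\<bar>)) / n" for x
    by (simp add: T_def cosh[symmetric] sum_negf)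
  obtain \<rho> where \<rho>: "\<rho> > 0" "\<rho> \<le> \<delta>" "cos (2 * pi * \<rho>) \<ge> 1 - \<epsilon> / 2"
  proof -
    have "isCont (\<lambda>r. cos (2 * pi * r)) 0" by (intro continuous_intros)
    then have "\<exists>d>0. \<forall>r. dist r 0 < d \<longrightarrow> dist (cos (2 * pi * r)) (cos (2 * pi * 0)) < \<epsilon> / 2"
      using \<epsilon> unfolding continuous_at_eps_delta by (meson half_gt_zero)
    then obtain d where d: "d > 0" "\<And>r. \<bar>r\<bar> < d \<Longrightarrow> \<bar>cos (2 * pi * r) - 1\<bar> < \<epsilon> / 2"
      by (auto simp: dist_real_def simp del: less_divide_eq_numeral1)
    define r where "r = min \<delta> (d / 2)"
    have r: "r > 0" "r \<le> \<delta>" "\<bar>r\<bar> < d" using \<delta> d(1) by (auto simp: r_def)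
    have "cos (2 * pi * r) \<ge> 1 - \<epsilon> / 2" using d(2)[OF r(3)] by linarith
    then show ?thesis using r that by blast
  qed
  define K where "K r = {x::'a. \<forall>b\<in>Basis. \<bar>x \<bullet> b - 1/2\<bar> \<le> r}" for r
  have sum_le: "(\<Sum>b\<in>Basis. f b) / n \<le> B" if "\<And>b. b \<in> Basis \<Longrightarrow> f b \<le> B" for f :: "'a \<Rightarrow> real" and B
    using sum_bounded_above[of "Basis::'a set" f B] that n by (simp add: n_def divide_le_eq mult.commute)
  have sum_ge: "(\<Sum>b\<in>Basis. f b) / n \<ge> B" if "\<And>b. b \<in> Basis \<Longrightarrow> f b \<ge> B" for f :: "'a \<Rightarrow> real" and B
    using sum_bounded_below[of "Basis::'a set" B f] that n by (simp add: n_def le_divide_eq mult.commute)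
  have T\<rho>: "T x \<ge> 1 + \<epsilon> / 2" if "x \<in> K \<rho>" for x
  proof -
    have "cos (2 * pi * \<bar>x \<bullet> b - 1/2\<bar>) \<ge> 1 - \<epsilon> / 2" if "b \<in> Basis" for b
    proof -
      have "cos (2 * pi * \<rho>) \<le> cos (2 * pi * \<bar>x \<bullet> b - 1/2\<bar>)"
        using \<open>x \<in> K \<rho>\<close> that \<rho> \<delta> by (intro cos_monotone_0_pi_le) (auto simp: K_def)
      then show ?thesis using \<rho> by simp
    qed
    then have "1 - \<epsilon> / 2 \<le> (\<Sum>b\<in>Basis. cos (2 * pi * \<bar>x \<bullet> b - 1/2\<bar>)) / n" by (rule sum_ge)
    then show ?thesis unfolding T by linarith
  qed
  have T\<delta>: "T x \<ge> 0" if "x \<in> K \<delta>" for x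
  proof -
    have "cos (2 * pi * \<bar>x \<bullet> b - 1/2\<bar>) \<ge> 0" if "b \<in> Basis" for b
    proof -
      have "\<bar>x \<bullet> b - 1/2\<bar> \<le> 1/8" using \<open>x \<in> K \<delta>\<close> that \<delta> by (fastforce simp: K_def)
      then have "2 * pi * \<bar>x \<bullet> b - 1/2\<bar> \<le> 2 * pi * (1/8)" by (intro mult_left_mono) auto
      then show ?thesis by (intro cos_ge_zero) (auto intro: order_trans[of _ 0])
    qed
    then have "0 \<le> (\<Sum>b\<in>Basis. cos (2 * pi * \<bar>x \<bullet> b - 1/2\<bar>)) / n" by (rule sum_ge)
    then show ?thesis unfolding T using \<epsilon> by linarith
  qed
  have Tout: "\<bar>T x\<bar> \<le> 1" if x: "x \<in> cbox 0 One" "x \<notin> K \<delta>" for x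
  proof -
    obtain b where b: "b \<in> Basis" "\<bar>x \<bullet> b - 1/2\<bar> > \<delta>" using x by (auto simp: K_def not_le)
    have "0 \<le> x \<bullet> b" "x \<bullet> b \<le> 1" using x(1) b(1) by (simp_all add: mem_box)
    then have "\<bar>x \<bullet> b - 1/2\<bar> \<le> 1/2" by linarith
    then have "2 * pi * \<bar>x \<bullet> b - 1/2\<bar> \<le> 2 * pi * (1/2)" by (intro mult_left_mono) auto
    then have "cos (2 * pi * \<bar>x \<bullet> b - 1/2\<bar>) \<le> cos (2 * pi * \<delta>)"
      using b \<delta> by (intro cos_monotone_0_pi_le) auto
    then have cb: "cos (2 * pi * \<bar>x \<bullet> b - 1/2\<bar>) \<le> 1 - 2 * n * \<epsilon>" using \<epsilon>n by simp
    have "(\<Sum>b\<in>Basis. cos (2 * pi * \<bar>x \<bullet> b - 1/2\<bar>)) =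
        cos (2 * pi * \<bar>x \<bullet> b - 1/2\<bar>) + (\<Sum>b\<in>Basis - {b}. cos (2 * pi * \<bar>x \<bullet> b - 1/2\<bar>))"
      using b by (simp add: sum.remove)
    also have "(\<Sum>b\<in>Basis - {b}. cos (2 * pi * \<bar>x \<bullet> b - 1/2\<bar>)) \<le> (\<Sum>b\<in>Basis - {b}. 1)"
      by (intro sum_mono) auto
    also have "(\<Sum>b\<in>Basis - {b}. 1) = n - 1" using b n by (simp add: n_def of_nat_diff)
    finally have "(\<Sum>b\<in>Basis. cos (2 * pi * \<bar>x \<bullet> b - 1/2\<bar>)) \<le> n - 2 * n * \<epsilon>" using cb by simp
    then have "(\<Sum>b\<in>Basis. cos (2 * pi * \<bar>x \<bullet> b - 1/2\<bar>)) / n \<le> (n - 2 * n * \<epsilon>) / n"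
      using n by (intro divide_right_mono) auto
    also have "\<dots> = 1 - 2 * \<epsilon>" using n by (simp add: field_simps)
    finally have "(\<Sum>b\<in>Basis. cos (2 * pi * \<bar>x \<bullet> b - 1/2\<bar>)) / n \<le> 1 - 2 * \<epsilon>" .
    moreover have "-1 \<le> (\<Sum>b\<in>Basis. cos (2 * pi * \<bar>x \<bullet> b - 1/2\<bar>)) / n" by (intro sum_ge) auto
    ultimately show ?thesis unfolding T using \<epsilon> by linarith
  qed
  have contT: "continuous_on S T" for S unfolding T_def using n by (intro continuous_intros) auto
  obtain C where C: "C \<ge> 0" "\<And>x. x \<in> cbox 0 One \<Longrightarrow> \<bar>u x\<bar> \<le> C"
  proof -
    have "bounded (u ` cbox 0 One)"
      by (intro compact_imp_bounded compact_continuous_image continuous_on_subset[OF contu]) auto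
    then obtain C where "\<forall>y\<in>u ` cbox 0 One. norm y \<le> C" unfolding bounded_iff by blast
    then show ?thesis by (intro that[of "max 0 C"]) (auto simp: max.coboundedI2)
  qed
  \<comment> \<open>Inside \<open>K \<delta>\<close> both factors are nonnegative. Outside,
    \<open>T x ^ N\<close> may have either sign but is bounded by 1, which costs at most the
    constant \<open>C\<close> for every N.\<close>
  have low: "u x * T x ^ N \<ge> (if x \<in> K \<rho> then (1 + \<epsilon> / 2) ^ N / 2 else 0) - C" if x: "x \<in> cbox 0 One" for x N
  proof (cases "x \<in> K \<delta>")
    case True
    then have u: "u x \<ge> 1/2" by (intro uge) (auto simp: K_def)
    have "u x * T x ^ N \<ge> 0" using u T\<delta>[OF True] by simp
    moreover have "u x * T x ^ N \<ge> (1 + \<epsilon> / 2) ^ N / 2" if "x \<in> K \<rho>"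
    proof -
      have "(1/2) * (1 + \<epsilon> / 2) ^ N \<le> u x * T x ^ N"
        using u T\<rho>[OF that] \<epsilon> by (intro mult_mono power_mono) auto
      then show ?thesis by simp
    qed
    ultimately show ?thesis using C by auto
  next
    case False
    moreover have "K \<rho> \<subseteq> K \<delta>" using \<rho>(2) unfolding K_def by (auto intro: order_trans)
    ultimately have "x \<notin> K \<rho>" by blast
    have "\<bar>T x\<bar> ^ N \<le> 1" using Tout[OF x False] by (intro power_le_one) auto
    then have "\<bar>u x * T x ^ N\<bar> \<le> C * 1"
      unfolding abs_mult power_abs using C x by (intro mult_mono) auto
    then show ?thesis using \<open>x \<notin> K \<rho>\<close> by auto
  qed
  have Kbox: "K \<rho> = cbox ((1/2 - \<rho>) *\<^sub>R One) ((1/2 + \<rho>) *\<^sub>R One)"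
    unfolding K_def mem_box set_eq_iff mem_Collect_eq by (intro allI ball_cong refl) (auto simp: abs_le_iff)
  have Ksub: "K \<rho> \<subseteq> cbox 0 One"
  proof
    fix x assume x: "x \<in> K \<rho>"
    have "0 \<le> x \<bullet> b \<and> x \<bullet> b \<le> 1" if "b \<in> Basis" for b
    proof -
      have "\<bar>x \<bullet> b - 1/2\<bar> \<le> \<rho>" using x that by (simp add: K_def)
      then show ?thesis using \<rho> \<delta> by linarith
    qed
    then show "x \<in> cbox 0 One" by (simp add: mem_box)
  qed
  define V where "V = measure lborel (K \<rho>)"
  have V: "V > 0" unfolding V_def Kbox content_pos_lt_eq using \<rho> by auto
  \<comment> \<open>All frequencies are treated at once: multiplication by \<open>T\<close> moves a
    frequency by plus or minus a basis vector, so the induction on N needs every k.\<close>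
  have int0: "tmean (\<lambda>x. g x * of_real (T x) ^ N * chr k x) = 0" if "k \<in> lattice" for N k
    using that
  proof (induction N arbitrary: k)
    case 0
    then show ?case using orth by simp
  next
    case (Suc N)
    let ?h = "\<lambda>x. g x * of_real (T x) ^ N"
    have h: "continuous_on UNIV ?h" by (intro continuous_intros g contT)
    have cosb: "complex_of_real (cos (2 * pi * (x \<bullet> b))) = (chr b x + chr (- b) x) / 2" for b x :: 'a
      unfolding cos_of_real[symmetric] cos_exp_eq by (simp add: chr_def mult_ac inner_commute)
    have "g x * of_real (T x) ^ Suc N * chr k x =
       of_real \<epsilon> * (?h x * chr k x) - (\<Sum>b\<in>Basis. (1 / (2 * of_real n)) * (?h x * chr (k + b) x + ?h x * chr (k - b) x))" for x
    proof -
      have "of_real (T x) = of_real \<epsilon> - (\<Sum>b\<in>Basis. (chr b x + chr (- b) x) / (2 * of_real n))"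
        by (simp add: T_def cosb[symmetric] sum_divide_distrib divide_divide_eq_left[symmetric])
      moreover have "g x * of_real (T x) ^ Suc N * chr k x = ?h x * chr k x * of_real (T x)"
        by (simp add: mult_ac)
      ultimately have "g x * of_real (T x) ^ Suc N * chr k x = ?h x * chr k x * of_real \<epsilon>
           - ?h x * chr k x * (\<Sum>b\<in>Basis. (chr b x + chr (- b) x) / (2 * of_real n))"
        by (simp only: right_diff_distrib)
      also have "?h x * chr k x * (\<Sum>b\<in>Basis. (chr b x + chr (- b) x) / (2 * of_real n)) =
         (\<Sum>b\<in>Basis. (1 / (2 * of_real n)) * (?h x * chr (k + b) x + ?h x * chr (k - b) x))"
        unfolding sum_distrib_left by (intro sum.cong refl) (simp add: chr_add field_simps diff_conv_add_uminus del: add_uminus_conv_diff)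
      finally show ?thesis by (simp add: mult_ac)
    qed
    then have "tmean (\<lambda>x. g x * of_real (T x) ^ Suc N * chr k x) =
       tmean (\<lambda>x. of_real \<epsilon> * (?h x * chr k x) - (\<Sum>b\<in>Basis. (1 / (2 * of_real n)) * (?h x * chr (k + b) x + ?h x * chr (k - b) x)))"
      by simp
    also have "\<dots> = of_real \<epsilon> * tmean (\<lambda>x. ?h x * chr k x) - (\<Sum>b\<in>Basis. (1 / (2 * of_real n)) *
        (tmean (\<lambda>x. ?h x * chr (k + b) x) + tmean (\<lambda>x. ?h x * chr (k - b) x)))"
    proof -
      have c: "continuous_on UNIV (\<lambda>x. ?h x * chr l x)" for l
        by (rule continuous_on_mult[OF h]) (rule continuous_on_chr)
      have "tmean (\<lambda>x. of_real \<epsilon> * (?h x * chr k x) - (\<Sum>b\<in>Basis. (1 / (2 * of_real n)) * (?h x * chr (k + b) x + ?h x * chr (k - b) x)))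
        = tmean (\<lambda>x. of_real \<epsilon> * (?h x * chr k x)) - tmean (\<lambda>x. \<Sum>b\<in>Basis. (1 / (2 * of_real n)) * (?h x * chr (k + b) x + ?h x * chr (k - b) x))"
        by (intro tmean_diff continuous_on_mult_left continuous_on_sum continuous_on_add c)
      also have "tmean (\<lambda>x. \<Sum>b\<in>Basis. (1 / (2 * of_real n)) * (?h x * chr (k + b) x + ?h x * chr (k - b) x))
        = (\<Sum>b\<in>Basis. tmean (\<lambda>x. (1 / (2 * of_real n)) * (?h x * chr (k + b) x + ?h x * chr (k - b) x)))"
        by (intro tmean_sum continuous_on_mult_left continuous_on_add c)
      finally show ?thesis
        unfolding tmean_cmult by (simp only: tmean_add[OF c c])
    qed
    also have "\<dots> = 0"
      using Suc by (simp add: lattice_add lattice_minus lattice_Basis diff_conv_add_uminus del: add_uminus_conv_diff)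
    finally show ?case .
  qed
  have int1: "integral (cbox 0 One) (\<lambda>x. u x * T x ^ N) = 0" for N
  proof -
    have "tmean (\<lambda>x. (1 / g c) * (g x * of_real (T x) ^ N * chr 0 x)) = 0"
      unfolding tmean_cmult using int0[of 0 N] by simp
    then have i0: "integral (cbox 0 One) (\<lambda>x. g x / g c * of_real (T x) ^ N) = 0"
      by (simp add: tmean_def)
    have "(\<lambda>x. g x / g c * of_real (T x) ^ N) integrable_on cbox 0 One"
      by (intro integrable_continuous_UNIV continuous_intros g contT) (use gc in auto)
    from integral_linear[OF this bounded_linear_Re] i0
    have "integral (cbox 0 One) (\<lambda>x. Re (g x / g c * of_real (T x) ^ N)) = 0"
      by (auto simp: o_def)
    moreover have "Re (g x / g c * of_real (T x) ^ N) = u x * T x ^ N" for x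
      by (simp only: u_def of_real_power[symmetric] times_complex.sel Re_complex_of_real
          Im_complex_of_real mult_zero_right diff_0_right)
    ultimately show ?thesis by simp
  qed
  \<comment> \<open>Integrating \<open>low\<close> against the vanishing integral
    \<open>int1\<close> bounds an exponentially growing quantity by \<open>C\<close>; letting N grow
    gives the contradiction.\<close>
  have ineq: "(1 + \<epsilon> / 2) ^ N / 2 * V \<le> C" for N
  proof -
    let ?s = "\<lambda>x. (if x \<in> K \<rho> then (1 + \<epsilon> / 2) ^ N / 2 else 0)"
    have "((\<lambda>x. (1 + \<epsilon> / 2) ^ N / 2) has_integral measure lborel (K \<rho>) *\<^sub>R ((1 + \<epsilon> / 2) ^ N / 2)) (K \<rho>)"
      unfolding Kbox by (rule has_integral_const)
    then have s: "(?s has_integral V * ((1 + \<epsilon> / 2) ^ N / 2)) (cbox 0 One)"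
      unfolding has_integral_restrict[OF Ksub] by (simp add: V_def)
    have "((\<lambda>x. ?s x - C) has_integral V * ((1 + \<epsilon> / 2) ^ N / 2) - measure lborel (cbox 0 (One::'a)) *\<^sub>R C) (cbox 0 One)"
      by (intro has_integral_diff s has_integral_const)
    moreover have "((\<lambda>x. u x * T x ^ N) has_integral 0) (cbox 0 One)"
    proof -
      have "(\<lambda>x. u x * T x ^ N) integrable_on cbox 0 One"
        by (intro integrable_continuous continuous_on_mult continuous_on_power contT continuous_on_subset[OF contu]) auto
      from integrable_integral[OF this] show ?thesis by (simp only: int1)
    qed
    ultimately have "V * ((1 + \<epsilon> / 2) ^ N / 2) - measure lborel (cbox 0 (One::'a)) *\<^sub>R C \<le> 0"
      by (rule has_integral_le) (use low in auto)
    then show ?thesis by (simp add: content_unit mult.commute)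
  qed
  obtain N where "2 * C / V < (1 + \<epsilon> / 2) ^ N"
    using real_arch_pow[of "1 + \<epsilon> / 2" "2 * C / V"] \<epsilon> by auto
  then have "C < (1 + \<epsilon> / 2) ^ N / 2 * V" using V by (simp add: field_simps)
  then show False using ineq[of N] by simp
qed

text \<open>A translation moves x to the centre of the box. It multiplies each Fourier coefficient
  by a value of a character, so vanishing is preserved.\<close>

lemma fourier_unique:
  fixes f :: "'a::euclidean_space \<Rightarrow> complex"
  assumes f: "continuous_on UNIV f" "periodic f" and 0: "\<And>k. k \<in> lattice \<Longrightarrow> fourier f k = 0"
  shows "f x = 0"
proof -
  define a where "a = x - (1/2) *\<^sub>R One"
  have "f ((1/2) *\<^sub>R One + a) = 0"
  proof (rule fourier_unique_centre)
    show "continuous_on UNIV (\<lambda>y. f (y + a))"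
      by (intro continuous_on_compose2[OF f(1)] continuous_intros) auto
    fix k :: 'a assume k: "k \<in> lattice"
    let ?h = "\<lambda>y. f y * chr k y"
    have "tmean (\<lambda>y. ?h (y + a)) = tmean ?h"
      using k by (intro tmean_shift continuous_intros periodic_mult periodic_chr f)
    also have "\<dots> = 0" using 0[OF lattice_minus[OF k]] by (simp add: fourier_def)
    finally have "tmean (\<lambda>y. chr k a * (f (y + a) * chr k y)) = 0"
      by (simp add: chr_add mult_ac)
    then have "chr k a = 0 \<or> tmean (\<lambda>y. f (y + a) * chr k y) = 0"
      unfolding tmean_cmult by simp
    then show "tmean (\<lambda>y. f (y + a) * chr k y) = 0"
      using norm_chr[of k a] by (metis norm_zero zero_neq_one)
  qed
  then show ?thesis by (simp add: a_def)
qed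

section \<open>Summability over the lattice and rapidly decreasing coefficients\<close>

lemma sum_inverse_squares_bounded: "\<exists>C. \<forall>R. finite R \<and> R \<subseteq> \<int> \<longrightarrow> (\<Sum>r\<in>R. 1 / (1 + r\<^sup>2)) \<le> (C::real)"
proof -
  let ?\<phi> = "\<lambda>r::real. 1 / (1 + r\<^sup>2)"
  have s: "summable (\<lambda>n. ?\<phi> (real n))"
  proof (rule summable_comparison_test')
    show "summable (\<lambda>n. inverse (real n ^ 2))" by (rule inverse_power_summable) simp
    show "norm (?\<phi> (real n)) \<le> inverse (real n ^ 2)" if "n \<ge> 1" for n
      using that by (simp add: field_simps add_pos_nonneg)
  qed
  have *: "sum ?\<phi> R \<le> (\<Sum>n. ?\<phi> (real n))" if R: "finite R" "R \<subseteq> \<int>" "inj_on abs R" for R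
  proof -
    have "inj_on (\<lambda>r. nat \<lfloor>\<bar>r\<bar>\<rfloor>) R"
    proof (rule inj_onI)
      fix x y assume xy: "x \<in> R" "y \<in> R" "nat \<lfloor>\<bar>x\<bar>\<rfloor> = nat \<lfloor>\<bar>y\<bar>\<rfloor>"
      obtain m n where "x = of_int m" "y = of_int n" using xy R by (meson Ints_cases subsetD)
      then have "nat \<bar>m\<bar> = nat \<bar>n\<bar>" using xy(3) by simp (simp flip: of_int_abs)
      then have "\<bar>x\<bar> = \<bar>y\<bar>" using \<open>x = of_int m\<close> \<open>y = of_int n\<close> by (simp flip: of_int_abs)
      then show "x = y" using R(3) xy by (auto dest: inj_onD)
    qed
    moreover have "?\<phi> r = ?\<phi> (real (nat \<lfloor>\<bar>r\<bar>\<rfloor>))" if "r \<in> R" for r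
    proof -
      obtain m where "r = of_int m" using \<open>r \<in> R\<close> R by (meson Ints_cases subsetD)
      then show ?thesis by simp
    qed
    ultimately have "sum ?\<phi> R = (\<Sum>n\<in>(\<lambda>r. nat \<lfloor>\<bar>r\<bar>\<rfloor>) ` R. ?\<phi> (real n))"
      by (subst sum.reindex) (auto intro: sum.cong)
    also have "\<dots> \<le> (\<Sum>n. ?\<phi> (real n))"
      using R s by (intro sum_le_suminf) auto
    finally show ?thesis .
  qed
  have "sum ?\<phi> R \<le> 2 * (\<Sum>n. ?\<phi> (real n))" if R: "finite R" "R \<subseteq> \<int>" for R
  proof -
    have "sum ?\<phi> R = sum ?\<phi> (R \<inter> {r. r \<ge> 0}) + sum ?\<phi> (R \<inter> - {r. r \<ge> 0})"
      using R(1) by (subst sum.union_disjoint[symmetric]) (auto intro: sum.cong)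
    also have "\<dots> \<le> (\<Sum>n. ?\<phi> (real n)) + (\<Sum>n. ?\<phi> (real n))"
      using R by (intro add_mono *) (auto simp: inj_on_def abs_if)
    finally show ?thesis by simp
  qed
  then show ?thesis by blast
qed

text \<open>A finite set of lattice points lies in a finite grid, over which the sum of the products
  factors into one-dimensional sums with a common bound.\<close>

lemma lattice_summable:
  "(\<lambda>k::'a::euclidean_space. \<Prod>b\<in>Basis. 1 / (1 + (k \<bullet> b)\<^sup>2)) summable_on lattice"
proof -
  let ?\<phi> = "\<lambda>r::real. 1 / (1 + r\<^sup>2)"
  obtain C where C: "\<And>R. finite R \<Longrightarrow> R \<subseteq> \<int> \<Longrightarrow> sum ?\<phi> R \<le> C"
    using sum_inverse_squares_bounded by blast
  have pos: "?\<phi> r \<ge> 0" for r by (simp add: add_nonneg_nonneg)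
  show ?thesis
  proof (rule nonneg_bdd_above_summable_on)
    show "0 \<le> (\<Prod>b\<in>Basis. ?\<phi> (k \<bullet> b))" for k :: 'a using pos by (intro prod_nonneg) auto
    show "bdd_above (sum (\<lambda>k::'a. \<Prod>b\<in>Basis. ?\<phi> (k \<bullet> b)) ` {F. F \<subseteq> lattice \<and> finite F})"
    proof (rule bdd_aboveI2)
      fix F :: "'a set" assume "F \<in> {F. F \<subseteq> lattice \<and> finite F}"
      then have F: "F \<subseteq> lattice" "finite F" by auto
      define R where "R = (\<Union>b\<in>Basis. (\<lambda>k. k \<bullet> b) ` F)"
      have R: "finite R" "R \<subseteq> \<int>" using F by (auto simp: R_def lattice_def)
      let ?r = "\<lambda>k::'a. restrict (\<lambda>b. k \<bullet> b) Basis"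
      have inj: "inj_on ?r F"
      proof (rule inj_onI)
        fix k l :: 'a assume kl: "?r k = ?r l"
        have "k \<bullet> b = l \<bullet> b" if b: "b \<in> Basis" for b
          using fun_cong[OF kl, of b] unfolding restrict_apply'[OF b] .
        then show "k = l" by (rule euclidean_eqI)
      qed
      have "(\<Sum>k\<in>F. \<Prod>b\<in>Basis. ?\<phi> (k \<bullet> b)) = (\<Sum>k\<in>F. \<Prod>b\<in>Basis. ?\<phi> (?r k b))"
        by (intro sum.cong prod.cong) auto
      also have "\<dots> = (\<Sum>g\<in>?r ` F. \<Prod>b\<in>Basis. ?\<phi> (g b))"
        using inj by (simp add: sum.reindex)
      also have "\<dots> \<le> (\<Sum>g\<in>PiE (Basis :: 'a set) (\<lambda>_. R). \<Prod>b\<in>Basis. ?\<phi> (g b))"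
      proof (rule sum_mono2)
        show "finite (PiE (Basis::'a set) (\<lambda>_. R))" using R(1) by (intro finite_PiE) auto
        show "?r ` F \<subseteq> PiE Basis (\<lambda>_. R)" by (auto simp: R_def)
        show "0 \<le> (\<Prod>b\<in>Basis. ?\<phi> (g b))" for g :: "'a \<Rightarrow> real" by (intro prod_nonneg pos)
      qed
      also have "\<dots> = (\<Prod>b\<in>(Basis::'a set). sum ?\<phi> R)"
        using R(1) by (intro prod_sum_PiE[symmetric]) auto
      also have "\<dots> \<le> (\<Prod>b\<in>(Basis::'a set). C)"
        by (intro prod_mono conjI sum_nonneg pos C R)
      finally show "(\<Sum>k\<in>F. \<Prod>b\<in>Basis. ?\<phi> (k \<bullet> b)) \<le> (\<Prod>b\<in>(Basis::'a set). C)" .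
    qed
  qed
qed

text \<open>These turn out to be the coefficient families of smooth periodic functions:
  \<open>rapid_fourier\<close> gives one direction, \<open>fseries_smooth\<close> with
  \<open>fourier_fseries\<close> the other.\<close>

definition rapid :: "('a::euclidean_space \<Rightarrow> complex) \<Rightarrow> bool" where
  "rapid a \<longleftrightarrow> (\<forall>m. \<exists>C. \<forall>k\<in>lattice. norm (a k) * (1 + norm k) ^ m \<le> C)"

lemma rapid_mult:
  assumes "rapid a" "\<And>k. k \<in> lattice \<Longrightarrow> norm (c k) \<le> B * (1 + norm k) ^ p"
  shows "rapid (\<lambda>k. c k * a k)"
  unfolding rapid_def
proof
  fix m
  obtain C where C: "\<And>k. k \<in> lattice \<Longrightarrow> norm (a k) * (1 + norm k) ^ (p + m) \<le> C"
    using assms(1) unfolding rapid_def by blast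
  have "0 \<le> norm (c 0)" by simp
  also have "\<dots> \<le> B" using assms(2)[of 0] by simp
  finally have B: "B \<ge> 0" .
  have "norm (c k * a k) * (1 + norm k) ^ m \<le> B * C" if k: "k \<in> lattice" for k
  proof -
    have "norm (c k * a k) * (1 + norm k) ^ m \<le> (B * (1 + norm k) ^ p) * norm (a k) * (1 + norm k) ^ m"
      unfolding norm_mult using assms(2)[OF k] by (intro mult_right_mono) auto
    also have "\<dots> = B * (norm (a k) * (1 + norm k) ^ (p + m))" by (simp add: power_add mult_ac)
    also have "\<dots> \<le> B * C" using B C[OF k] by (intro mult_left_mono)
    finally show ?thesis .
  qed
  then show "\<exists>C. \<forall>k\<in>lattice. norm (c k * a k) * (1 + norm k) ^ m \<le> C" by blast
qed

lemma rapid_add: "rapid a \<Longrightarrow> rapid b \<Longrightarrow> rapid (\<lambda>k. a k + b k)"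
  unfolding rapid_def
proof
  fix m assume "\<forall>m. \<exists>C. \<forall>k\<in>lattice. norm (a k) * (1 + norm k) ^ m \<le> C"
    "\<forall>m. \<exists>C. \<forall>k\<in>lattice. norm (b k) * (1 + norm k) ^ m \<le> C"
  then obtain C C' where C: "\<And>k. k \<in> lattice \<Longrightarrow> norm (a k) * (1 + norm k) ^ m \<le> C"
    "\<And>k. k \<in> lattice \<Longrightarrow> norm (b k) * (1 + norm k) ^ m \<le> C'" by meson
  have "norm (a k + b k) * (1 + norm k) ^ m \<le> C + C'" if "k \<in> lattice" for k
  proof -
    have "norm (a k + b k) * (1 + norm k) ^ m \<le> (norm (a k) + norm (b k)) * (1 + norm k) ^ m"
      by (intro mult_right_mono norm_triangle_ineq) auto
    then show ?thesis using C[OF that] by (simp add: algebra_simps)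
  qed
  then show "\<exists>C. \<forall>k\<in>lattice. norm (a k + b k) * (1 + norm k) ^ m \<le> C" by blast
qed

text \<open>Each factor 1 + (k \<bullet> b)^2 is at most (1 + norm k)^2, so decay of order twice the
  dimension is dominated by the summable product family.\<close>

lemma rapid_summable_on: "rapid a \<Longrightarrow> (\<lambda>k. norm (a k)) summable_on (lattice :: 'a::euclidean_space set)"
proof -
  assume "rapid a"
  then obtain C where C: "\<And>k::'a. k \<in> lattice \<Longrightarrow> norm (a k) * (1 + norm k) ^ (2 * DIM('a)) \<le> C"
    unfolding rapid_def by blast
  show ?thesis
  proof (rule summable_on_comparison_test)
    show "(\<lambda>k::'a. C * (\<Prod>b\<in>Basis. 1 / (1 + (k \<bullet> b)\<^sup>2))) summable_on lattice"
      by (intro summable_on_cmult_right lattice_summable)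
    fix k :: 'a assume k: "k \<in> lattice"
    have "(\<Prod>b\<in>Basis. 1 + (k \<bullet> b)\<^sup>2) \<le> (\<Prod>b\<in>(Basis::'a set). (1 + norm k)\<^sup>2)"
    proof (intro prod_mono conjI)
      fix b :: 'a assume "b \<in> Basis"
      then have "\<bar>k \<bullet> b\<bar>\<^sup>2 \<le> (norm k)\<^sup>2" by (intro power_mono Basis_le_norm) auto
      then show "1 + (k \<bullet> b)\<^sup>2 \<le> (1 + norm k)\<^sup>2"
        using norm_ge_zero[of k] by (simp add: power2_eq_square algebra_simps del: norm_ge_zero)
    qed (simp add: add_nonneg_nonneg)
    also have "\<dots> = (1 + norm k) ^ (2 * DIM('a))" by (simp add: power_mult)
    finally have "norm (a k) * (\<Prod>b\<in>Basis. 1 + (k \<bullet> b)\<^sup>2) \<le> norm (a k) * (1 + norm k) ^ (2 * DIM('a))"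
      by (intro mult_left_mono) auto
    also have "\<dots> \<le> C" by (rule C[OF k])
    finally have *: "norm (a k) * (\<Prod>b\<in>Basis. 1 + (k \<bullet> b)\<^sup>2) \<le> C" .
    moreover have "(\<Prod>b\<in>Basis. 1 + (k \<bullet> b)\<^sup>2) > 0" by (intro prod_pos) (simp add: add_pos_nonneg)
    ultimately have "norm (a k) \<le> C / (\<Prod>b\<in>Basis. 1 + (k \<bullet> b)\<^sup>2)" by (simp add: le_divide_eq)
    then show "norm (a k) \<le> C * (\<Prod>b\<in>Basis. 1 / (1 + (k \<bullet> b)\<^sup>2))"
      by (simp add: prod_dividef)
  qed simp
qed

text \<open>A summable family has countable support, and this one never vanishes on the
  lattice.\<close>

lemma countable_lattice: "countable (lattice :: 'a::euclidean_space set)"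
proof -
  have "countable {k\<in>(lattice :: 'a set). (\<Prod>b\<in>Basis. 1 / (1 + (k \<bullet> b)\<^sup>2)) \<noteq> (0::real)}"
    using lattice_summable summable_countable_real by blast
  moreover have "{k\<in>lattice. (\<Prod>b\<in>Basis. 1 / (1 + (k \<bullet> b)\<^sup>2)) \<noteq> (0::real)} = (lattice :: 'a set)"
    by (auto simp: add_nonneg_eq_0_iff)
  ultimately show ?thesis by simp
qed

lemma infinite_lattice: "infinite (lattice :: 'a::euclidean_space set)"
proof -
  obtain b :: 'a where b: "b \<in> Basis" using nonempty_Basis by blast
  have "inj (\<lambda>n. real n *\<^sub>R b)" using b by (auto intro!: injI simp: nonzero_Basis)
  then have "infinite (range (\<lambda>n. real n *\<^sub>R b))" using finite_imageD by blast
  moreover have "range (\<lambda>n. real n *\<^sub>R b) \<subseteq> lattice" using b by (auto simp: lattice_def inner_Basis)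
  ultimately show ?thesis using finite_subset by blast
qed

text \<open>An enumeration turns sums over frequencies into ordinary series, to which the theorems
  on uniform limits and termwise differentiation apply.\<close>

definition lat :: "nat \<Rightarrow> 'a::euclidean_space" where
  "lat = from_nat_into lattice"

lemma bij_lat: "bij_betw lat UNIV lattice"
  unfolding lat_def by (intro bij_betw_from_nat_into countable_lattice infinite_lattice)

lemma lat_in: "lat n \<in> lattice"
  using bij_lat by (metis UNIV_I bij_betwE)

lemma rapid_summable: "rapid a \<Longrightarrow> summable (\<lambda>n. norm (a (lat n)))"
  using rapid_summable_on[of a] summable_on_reindex_bij_betw[OF bij_lat, of "\<lambda>k. norm (a k)"]
  by (intro summable_on_imp_summable) simp

definition fseries :: "('a::euclidean_space \<Rightarrow> complex) \<Rightarrow> 'a \<Rightarrow> complex" where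
  "fseries a x = (\<Sum>n. a (lat n) * chr (lat n) x)"

lemma fseries_uniform:
  "rapid a \<Longrightarrow> uniform_limit S (\<lambda>n x. \<Sum>i<n. a (lat i) * chr (lat i) x) (fseries a) sequentially"
  unfolding fseries_def[abs_def]
  by (rule Weierstrass_m_test[OF _ rapid_summable]) (auto simp: norm_mult)

lemma rapid_linear: "rapid a \<Longrightarrow> rapid (\<lambda>k. 2 * pi * \<i> * of_real (k \<bullet> v) * a k)"
proof (rule rapid_mult)
  show "norm (2 * pi * \<i> * of_real (k \<bullet> v)) \<le> (2 * pi * norm v) * (1 + norm k) ^ 1" for k
    using Cauchy_Schwarz_ineq2[of k v] pi_gt_zero
    by (simp add: norm_mult) (smt (verit, ccfv_SIG) mult_left_mono mult.assoc mult.commute norm_ge_zero mult_right_mono)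
qed

lemma chr_has_derivative: "(chr k has_derivative (\<lambda>v. 2 * pi * \<i> * of_real (k \<bullet> v) * chr k x)) (at x within S)"
proof -
  have "((\<lambda>x. 2 * pi * \<i> * of_real (k \<bullet> x)) has_derivative (\<lambda>v. 2 * pi * \<i> * of_real (k \<bullet> v))) (at x within S)"
    by (auto intro!: derivative_eq_intros)
  from has_derivative_compose[OF this DERIV_exp[unfolded has_field_derivative_def]]
  show ?thesis unfolding chr_def by (simp add: mult_ac)
qed

lemma fseries_has_derivative:
  fixes a :: "'a::euclidean_space \<Rightarrow> complex"
  assumes a: "rapid a"
  shows "(fseries a has_derivative (\<lambda>v. fseries (\<lambda>k. 2 * pi * \<i> * of_real (k \<bullet> v) * a k) x)) (at x)"
proof -
  let ?f = "\<lambda>n (x::'a). a (lat n) * chr (lat n) x"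
  let ?f' = "\<lambda>n (x::'a) v. 2 * pi * \<i> * of_real ((lat n :: 'a) \<bullet> v) * a (lat n) * chr (lat n) x"
  let ?g' = "\<lambda>x v. fseries (\<lambda>k. 2 * pi * \<i> * of_real (k \<bullet> v) * a k) x"
  \<comment> \<open>\<open>M n\<close> bounds the operator norm of the derivative of the n-th term
    uniformly in x; its summability gives the uniform convergence that termwise differentiation
    requires.\<close>
  define M where "M n = norm ((2 * pi * of_real (norm (lat n :: 'a))) * a (lat n))" for n
  have "rapid (\<lambda>k. (2 * pi * of_real (norm k)) * a k)"
    by (rule rapid_mult[OF a, where B = "2 * pi" and p = 1]) (simp add: norm_mult)
  then have M: "summable M" unfolding M_def by (rule rapid_summable)
  have bound: "norm (?f' n x v) \<le> M n * norm v" for n x v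
  proof -
    have "norm (?f' n x v) = 2 * pi * norm (a (lat n)) * \<bar>lat n \<bullet> v\<bar>" by (simp add: norm_mult)
    also have "\<dots> \<le> 2 * pi * norm (a (lat n)) * (norm (lat n :: 'a) * norm v)"
      by (intro mult_left_mono Cauchy_Schwarz_ineq2) simp
    finally show ?thesis by (simp add: M_def norm_mult mult_ac)
  qed
  have "\<exists>g. \<forall>x\<in>UNIV. (\<lambda>n. ?f n x) sums g x \<and> (g has_derivative ?g' x) (at x within UNIV)"
  proof (rule has_derivative_series)
    show "(?f n has_derivative ?f' n x) (at x within UNIV)" for n x
      by (rule has_derivative_eq_rhs[OF has_derivative_mult_right[OF chr_has_derivative]]) (simp add: mult_ac)
    show "(\<lambda>n. ?f n 0) sums fseries a 0"
      unfolding fseries_def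
      by (rule summable_sums, rule summable_norm_cancel) (simp add: norm_mult rapid_summable[OF a])
    fix e :: real assume "e > 0"
    then obtain N where N: "\<And>n. n \<ge> N \<Longrightarrow> norm (\<Sum>i. M (i + n)) < e"
      using suminf_exist_split[OF _ M] by blast
    have "norm ((\<Sum>i<n. ?f' i x h) - ?g' x h) \<le> e * norm h" if n: "n \<ge> N" for n x h
    proof -
      have s: "summable (\<lambda>i. norm (?f' i x h))"
        by (rule summable_comparison_test'[of "\<lambda>n. M n * norm h"]) (use M bound in \<open>auto intro: summable_mult2\<close>)
      then have s': "summable (\<lambda>i. ?f' i x h)" by (rule summable_norm_cancel)
      have "?g' x h = (\<Sum>i. ?f' (i + n) x h) + (\<Sum>i<n. ?f' i x h)"
        unfolding fseries_def by (rule suminf_split_initial_segment[OF s'])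
      then have "norm ((\<Sum>i<n. ?f' i x h) - ?g' x h) = norm (\<Sum>i. ?f' (i + n) x h)" by simp
      also have "\<dots> \<le> (\<Sum>i. norm (?f' (i + n) x h))"
        by (intro summable_norm summable_ignore_initial_segment s)
      also have "\<dots> \<le> (\<Sum>i. M (i + n) * norm h)"
        by (intro suminf_le bound summable_ignore_initial_segment s summable_mult2 M)
      also have "\<dots> = (\<Sum>i. M (i + n)) * norm h"
        by (intro suminf_mult2[symmetric] summable_ignore_initial_segment M)
      also have "\<dots> \<le> e * norm h" using N[OF n] by (intro mult_right_mono) auto
      finally show ?thesis .
    qed
    then show "\<forall>\<^sub>F n in sequentially. \<forall>x\<in>UNIV. \<forall>h. norm ((\<Sum>i<n. ?f' i x h) - ?g' x h) \<le> e * norm h"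
      unfolding eventually_sequentially by blast
  qed auto
  then obtain g where g: "\<And>x. (\<lambda>n. ?f n x) sums g x" "\<And>x. (g has_derivative ?g' x) (at x)" by auto
  have "g = fseries a" unfolding fseries_def fun_eq_iff using g(1) sums_unique by blast
  then show ?thesis using g(2) by simp
qed

text \<open>Each directional derivative is again such a series with rapidly decreasing coefficients,
  so the induction on the order runs over all coefficient families simultaneously.\<close>

lemma fseries_smooth: "rapid a \<Longrightarrow> smooth_on UNIV (fseries a)"
proof -
  have "Ck_on k UNIV (fseries a)" if "rapid a" for k and a :: "'a \<Rightarrow> complex"
    using that
  proof (induction k arbitrary: a)
    case 0
    have "isCont (fseries a) x" for x
      using fseries_has_derivative[OF 0] by (rule has_derivative_continuous)
    then show ?case by (simp add: continuous_at_imp_continuous_on)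
  next
    case (Suc k)
    show ?case by (intro Ck_on_Suc_I[OF _ fseries_has_derivative] open_UNIV Suc.IH rapid_linear Suc.prems)
  qed
  then show "rapid a \<Longrightarrow> ?thesis" by (simp add: smooth_on_def)
qed

lemma fseries_periodic: "periodic (fseries (a :: 'a::euclidean_space \<Rightarrow> complex))"
  using periodic_chr[OF lat_in[where 'a='a]] unfolding periodic_def fseries_def by auto

text \<open>Uniform convergence allows integration term by term, and by orthogonality of the
  characters the integrals of the partial sums are constant once the index of k has been
  passed.\<close>

lemma fourier_fseries:
  fixes a :: "'a::euclidean_space \<Rightarrow> complex"
  assumes a: "rapid a" and k: "k \<in> lattice"
  shows "fourier (fseries a) k = a k"
proof -
  let ?p = "\<lambda>n x. (\<Sum>i<n. a (lat i) * chr (lat i) x) * chr (- k) x"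
  have "uniform_limit (cbox 0 One) ?p (\<lambda>x. fseries a x * chr (- k) x) sequentially"
  proof (rule uniform_lim_mult[OF fseries_uniform[OF a] uniform_limit_const])
    show "bounded (fseries a ` cbox 0 One)"
      by (intro compact_imp_bounded compact_continuous_image continuous_on_subset[OF smooth_on_continuous[OF fseries_smooth[OF a]]]) auto
    show "bounded (chr (- k) ` cbox 0 One)"
      by (intro compact_imp_bounded compact_continuous_image continuous_intros) auto
  qed
  moreover have "continuous_on (cbox 0 One) (?p n)" for n by (intro continuous_intros)
  ultimately obtain I J where IJ: "\<And>n. (?p n has_integral I n) (cbox 0 One)"
    "((\<lambda>x. fseries a x * chr (- k) x) has_integral J) (cbox 0 One)" "I \<longlonglongrightarrow> J"
    by (rule uniform_limit_integral_cbox) auto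
  obtain j where j: "lat j = k" using k bij_lat by (metis bij_betw_iff_bijections)
  have inj: "lat i = k \<longleftrightarrow> i = j" for i using bij_lat j unfolding bij_betw_def by (metis UNIV_I inj_onD)
  have "I n = (\<Sum>i<n. if i = j then a k else 0)" for n
  proof -
    have "I n = tmean (?p n)" using integral_unique[OF IJ(1)[of n]] by (simp add: tmean_def)
    also have "?p n = (\<lambda>x. \<Sum>i<n. a (lat i) * chr (lat i - k) x)"
      by (simp add: fun_eq_iff sum_distrib_right chr_add mult.assoc diff_conv_add_uminus del: add_uminus_conv_diff)
    also have "tmean \<dots> = (\<Sum>i<n. a (lat i) * tmean (chr (lat i - k)))"
      by (subst tmean_sum) (auto intro!: continuous_intros simp: tmean_cmult)
    also have "\<dots> = (\<Sum>i<n. if i = j then a k else 0)"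
    proof (intro sum.cong refl)
      fix i
      show "a (lat i) * tmean (chr (lat i - k)) = (if i = j then a k else 0)"
      proof (cases "i = j")
        case True
        moreover have "tmean (chr (0::'a)) = tmean (\<lambda>_::'a. 1)"
          by (rule arg_cong[where f = tmean]) (simp add: fun_eq_iff)
        ultimately show ?thesis using j by simp
      next
        case False
        then have "lat i - k \<noteq> 0" using inj by auto
        moreover have "lat i - k \<in> lattice"
          using lattice_add[OF lat_in lattice_minus[OF k]] by simp
        ultimately show ?thesis using False by (simp add: tmean_chr)
      qed
    qed
    finally show ?thesis .
  qed
  then have "I n = a k" if "n > j" for n using that by simp
  then have "I \<longlonglongrightarrow> a k"
    by (intro tendsto_eventually) (auto simp: eventually_sequentially intro!: exI[of _ "Suc j"])
  then have "J = a k" using IJ(3) LIMSEQ_unique by blast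
  then show ?thesis using IJ(2) by (simp add: fourier_def tmean_def integral_unique)
qed

lemma line_has_vector_derivative:
  assumes "(f has_derivative f') (at x)"
  shows "((\<lambda>s. f (x + s *\<^sub>R v)) has_vector_derivative f' v) (at 0)"
proof -
  have "((\<lambda>s. x + s *\<^sub>R v) has_derivative (\<lambda>s. s *\<^sub>R v)) (at 0)"
    by (auto intro!: derivative_eq_intros)
  moreover have "(f has_derivative f') (at (x + 0 *\<^sub>R v))" using assms by simp
  ultimately have "((\<lambda>s. f (x + s *\<^sub>R v)) has_derivative (\<lambda>s. f' (s *\<^sub>R v))) (at 0)"
    by (rule has_derivative_compose)
  then show ?thesis
    using has_derivative_linear[OF assms] by (simp add: has_vector_derivative_def linear_cmul)
qed

lemmas smooth_line_derivative = line_has_vector_derivative[OF smooth_on_has_derivative[OF _ UNIV_I]]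

lemma periodic_frechet_derivative:
  assumes "smooth_on UNIV f" "periodic f"
  shows "periodic (\<lambda>x. frechet_derivative f (at x) v)"
  unfolding periodic_def
proof (intro allI ballI)
  fix x b :: 'a assume b: "b \<in> Basis"
  have "((\<lambda>y. y + b) has_derivative (\<lambda>y. y)) (at x)" by (auto intro!: derivative_eq_intros)
  from has_derivative_compose[OF this smooth_on_has_derivative[OF assms(1) UNIV_I]]
  have "((\<lambda>y. f (y + b)) has_derivative frechet_derivative f (at (x + b))) (at x)" by simp
  moreover have "(\<lambda>y. f (y + b)) = f" using assms(2) b by (simp add: periodic_def fun_eq_iff)
  ultimately have "(f has_derivative frechet_derivative f (at (x + b))) (at x)" by simp
  then show "frechet_derivative f (at (x + b)) v = frechet_derivative f (at x) v"
    using frechet_derivative_at by metis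
qed

lemma tmean_bounded:
  assumes "continuous_on UNIV (f :: 'a::euclidean_space \<Rightarrow> complex)"
  shows "\<exists>B. \<forall>k. norm (fourier f k) \<le> B"
proof -
  have "bounded (f ` cbox 0 One)"
    by (intro compact_imp_bounded compact_continuous_image continuous_on_subset[OF assms]) auto
  then obtain B where B: "\<And>x. x \<in> cbox 0 One \<Longrightarrow> norm (f x) \<le> B" by (auto simp: bounded_iff)
  have "norm (fourier f k) \<le> B" for k
  proof -
    have "norm (integral (cbox 0 One) (\<lambda>x. f x * chr (- k) x)) \<le> integral (cbox 0 (One::'a)) (\<lambda>_. B)"
    proof (rule integral_norm_bound_integral)
      show "(\<lambda>x. f x * chr (- k) x) integrable_on cbox 0 One"
        by (intro integrable_continuous_UNIV continuous_on_mult assms continuous_on_chr)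
    qed (use B in \<open>auto simp: norm_mult\<close>)
    then show ?thesis by (simp add: fourier_def tmean_def content_unit)
  qed
  then show ?thesis by blast
qed

lemma fourier_frechet_derivative:
  assumes "smooth_on UNIV f" "periodic f" "k \<in> lattice"
  shows "fourier (\<lambda>x. frechet_derivative f (at x) v) k = 2 * pi * \<i> * of_real (k \<bullet> v) * fourier f k"
  by (intro fourier_derivative[where f = f] smooth_on_continuous continuous_on_frechet_derivative
      smooth_line_derivative assms)

text \<open>Differentiating m times along a basis vector \<open>b\<close> multiplies the coefficient
  by the m-th power of 2 pi i k \<bullet> b, and Fourier coefficients of continuous functions are
  bounded. The largest coordinate then controls the norm of k.\<close>

lemma rapid_fourier:
  assumes "smooth_on UNIV f" "periodic (f :: 'a::euclidean_space \<Rightarrow> complex)"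
  shows "rapid (fourier f)"
proof -
  have *: "\<exists>C. \<forall>k\<in>lattice. norm (fourier f k) * \<bar>k \<bullet> b\<bar> ^ m \<le> C"
    if "b \<in> Basis" "smooth_on UNIV f" "periodic f" for b m and f :: "'a \<Rightarrow> complex"
    using that
  proof (induction m arbitrary: f)
    case 0
    then show ?case using tmean_bounded[OF smooth_on_continuous[OF 0(2)]] by auto
  next
    case (Suc m)
    obtain C where C: "\<And>k. k \<in> lattice \<Longrightarrow>
        norm (fourier (\<lambda>x. frechet_derivative f (at x) b) k) * \<bar>k \<bullet> b\<bar> ^ m \<le> C"
      using Suc.IH[OF Suc.prems(1) smooth_on_frechet_derivative[OF Suc.prems(2)]
        periodic_frechet_derivative[OF Suc.prems(2,3)]] by blast
    have "norm (fourier f k) * \<bar>k \<bullet> b\<bar> ^ Suc m \<le> C / (2 * pi)" if "k \<in> lattice" for k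
      using C[OF that] unfolding fourier_frechet_derivative[OF Suc.prems(2,3) that]
      by (simp add: norm_mult field_simps)
    then show ?case by blast
  qed
  show ?thesis
    unfolding rapid_def
  proof
    fix m
    have "\<forall>b\<in>Basis. \<exists>C. \<forall>k\<in>lattice. norm (fourier f k) * \<bar>k \<bullet> b\<bar> ^ m \<le> C"
      using * assms by blast
    then obtain C where C: "\<And>b k. b \<in> Basis \<Longrightarrow> k \<in> lattice \<Longrightarrow> norm (fourier f k) * \<bar>k \<bullet> b\<bar> ^ m \<le> C b"
      by metis
    obtain B where B: "\<And>k. norm (fourier f k) \<le> B"
      using tmean_bounded[OF smooth_on_continuous[OF assms(1)]] by blast
    have "norm (fourier f k) * (1 + norm k) ^ m \<le> (1 + real DIM('a)) ^ m * (B + (\<Sum>b\<in>Basis. C b))"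
      if k: "k \<in> lattice" for k
    proof -
      \<comment> \<open>Inserting 1 gives both M >= 1 and 1 + norm k <= (1 + dimension) M, without a
        separate treatment of k = 0.\<close>
      define M where "M = Max (insert 1 ((\<lambda>b. \<bar>k \<bullet> b\<bar>) ` Basis))"
      have M: "1 \<le> M" "\<And>b. b \<in> Basis \<Longrightarrow> \<bar>k \<bullet> b\<bar> \<le> M"
        unfolding M_def by (intro Max_ge; simp)+
      have "M \<in> insert 1 ((\<lambda>b. \<bar>k \<bullet> b\<bar>) ` Basis)" unfolding M_def by (intro Max_in) auto
      then have Mm: "M ^ m \<le> 1 + (\<Sum>b\<in>Basis. \<bar>k \<bullet> b\<bar> ^ m)"
      proof
        assume "M = 1"
        then show ?thesis by (simp add: sum_nonneg)
      next
        assume "M \<in> (\<lambda>b. \<bar>k \<bullet> b\<bar>) ` Basis"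
        then obtain b where b: "b \<in> Basis" "M = \<bar>k \<bullet> b\<bar>" by blast
        have "\<bar>k \<bullet> b\<bar> ^ m \<le> (\<Sum>b\<in>Basis. \<bar>k \<bullet> b\<bar> ^ m)" using b by (intro member_le_sum) auto
        then show ?thesis using b by simp
      qed
      have "norm k \<le> (\<Sum>b\<in>Basis. \<bar>k \<bullet> b\<bar>)" by (rule norm_le_l1)
      also have "\<dots> \<le> (\<Sum>b\<in>(Basis::'a set). M)" by (intro sum_mono M)
      finally have "1 + norm k \<le> (1 + real DIM('a)) * M" using M(1) by (simp add: algebra_simps)
      then have "(1 + norm k) ^ m \<le> ((1 + real DIM('a)) * M) ^ m" by (intro power_mono) auto
      also have "\<dots> \<le> (1 + real DIM('a)) ^ m * (1 + (\<Sum>b\<in>Basis. \<bar>k \<bullet> b\<bar> ^ m))"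
        unfolding power_mult_distrib using Mm by (intro mult_left_mono) auto
      finally have "norm (fourier f k) * (1 + norm k) ^ m
          \<le> norm (fourier f k) * ((1 + real DIM('a)) ^ m * (1 + (\<Sum>b\<in>Basis. \<bar>k \<bullet> b\<bar> ^ m)))"
        by (intro mult_left_mono) auto
      also have "\<dots> = (1 + real DIM('a)) ^ m * (norm (fourier f k) + (\<Sum>b\<in>Basis. norm (fourier f k) * \<bar>k \<bullet> b\<bar> ^ m))"
        by (simp add: algebra_simps sum_distrib_left)
      also have "\<dots> \<le> (1 + real DIM('a)) ^ m * (B + (\<Sum>b\<in>Basis. C b))"
        using k by (intro mult_left_mono add_mono B sum_mono C) auto
      finally show ?thesis .
    qed
    then show "\<exists>C. \<forall>k\<in>lattice. norm (fourier f k) * (1 + norm k) ^ m \<le> C" by blast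
  qed
qed

section \<open>Holomorphic functions and the d-bar equation on a torus\<close>

lemma fourier_add: "continuous_on UNIV f \<Longrightarrow> continuous_on UNIV g \<Longrightarrow>
    fourier (\<lambda>x. f x + g x) k = fourier f k + fourier g k"
  unfolding fourier_def distrib_right by (intro tmean_add continuous_on_mult continuous_on_chr)

lemma fourier_diff: "continuous_on UNIV f \<Longrightarrow> continuous_on UNIV g \<Longrightarrow>
    fourier (\<lambda>x. f x - g x) k = fourier f k - fourier g k"
  unfolding fourier_def left_diff_distrib by (intro tmean_diff continuous_on_mult continuous_on_chr)

lemma fourier_cmult: "fourier (\<lambda>x. c * f x) k = c * fourier f k"
  unfolding fourier_def mult.assoc by (rule tmean_cmult)

lemma fourier_const: "k \<in> lattice \<Longrightarrow> fourier (\<lambda>x. c) k = (if k = 0 then c else 0)"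
  by (auto simp: fourier_def tmean_cmult tmean_chr lattice_minus)

lemma fourier_0: "fourier f 0 = tmean f"
  by (simp add: fourier_def)

text \<open>A pair \<open>(u, v)\<close> of real vectors stands for the complex vector field \<open>\<partial>\<^sub>u + \<i> \<partial>\<^sub>v\<close>.\<close>

lemma periodic_kernel_constant:
  fixes f :: "'a::euclidean_space \<Rightarrow> complex"
  assumes f: "continuous_on UNIV f" "periodic f"
    and f': "\<And>v. continuous_on UNIV (\<lambda>x. f' x v)"
    and d: "\<And>x v. ((\<lambda>s. f (x + s *\<^sub>R v)) has_vector_derivative f' x v) (at 0)"
    and J: "\<And>u v x. (u, v) \<in> J \<Longrightarrow> f' x u + \<i> * f' x v = 0"
    and sym: "\<And>k. k \<in> lattice \<Longrightarrow> k \<noteq> 0 \<Longrightarrow> \<exists>(u, v)\<in>J. k \<bullet> u \<noteq> 0 \<or> k \<bullet> v \<noteq> 0"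
  shows "f x = f y"
proof -
  \<comment> \<open>Subtracting the mean removes frequency 0; at every other frequency some symbol k
    \<bullet> u + i k \<bullet> v is nonzero, its real and imaginary parts being the two
    pairings.\<close>
  have "f x - tmean f = 0" for x
  proof (rule fourier_unique[where f = "\<lambda>x. f x - tmean f"])
    fix k :: 'a assume k: "k \<in> lattice"
    have fk: "fourier f k = 0" if "k \<noteq> 0"
    proof -
      obtain u v where uv: "(u, v) \<in> J" "k \<bullet> u \<noteq> 0 \<or> k \<bullet> v \<noteq> 0" using sym[OF k \<open>k \<noteq> 0\<close>] by blast
      have "0 = fourier (\<lambda>x. f' x u + \<i> * f' x v) k" using J[OF uv(1)] by (simp add: fourier_def)
      also have "\<dots> = fourier (\<lambda>x. f' x u) k + \<i> * fourier (\<lambda>x. f' x v) k"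
        by (subst fourier_add) (auto intro!: continuous_intros f' simp: fourier_cmult)
      also have "\<dots> = 2 * pi * \<i> * (of_real (k \<bullet> u) + \<i> * of_real (k \<bullet> v)) * fourier f k"
        using fourier_derivative[OF f f' d k] by (simp add: algebra_simps)
      finally have "of_real (k \<bullet> u) + \<i> * of_real (k \<bullet> v) = 0 \<or> fourier f k = 0" by simp
      then show ?thesis using uv(2) by (auto simp: complex_eq_iff)
    qed
    then show "fourier (\<lambda>x. f x - tmean f) k = 0"
      using f(1) k by (subst fourier_diff) (auto simp: fourier_const fourier_0)
  qed (intro continuous_intros f periodic_diff periodic_const)+
  then show ?thesis by simp
qed

definition cdir :: "'a::real_normed_vector \<times> 'a \<Rightarrow> ('a \<Rightarrow> complex) \<Rightarrow> 'a \<Rightarrow> complex" where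
  "cdir w f x = frechet_derivative f (at x) (fst w) + \<i> * frechet_derivative f (at x) (snd w)"

lemma cdir_smooth: "smooth_on UNIV f \<Longrightarrow> smooth_on UNIV (cdir w f)"
  unfolding cdir_def[abs_def]
  by (intro smooth_on_add smooth_on_mult smooth_on_const smooth_on_frechet_derivative) auto

lemma cdir_periodic: "smooth_on UNIV f \<Longrightarrow> periodic f \<Longrightarrow> periodic (cdir w f)"
  unfolding cdir_def[abs_def] by (intro periodic_add periodic_mult periodic_const periodic_frechet_derivative)

lemma fourier_cdir:
  assumes "smooth_on UNIV f" "periodic f" "k \<in> lattice"
  shows "fourier (cdir w f) k = 2 * pi * \<i> * (of_real (k \<bullet> fst w) + \<i> * of_real (k \<bullet> snd w)) * fourier f k"
proof -
  have "fourier (cdir w f) k = fourier (\<lambda>x. frechet_derivative f (at x) (fst w)) k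
      + \<i> * fourier (\<lambda>x. frechet_derivative f (at x) (snd w)) k"
    unfolding cdir_def[abs_def] fourier_cmult[symmetric]
    by (intro fourier_add continuous_intros continuous_on_frechet_derivative assms)
  then show ?thesis using assms by (simp add: fourier_frechet_derivative algebra_simps)
qed

lemma tmean_cdir: "smooth_on UNIV f \<Longrightarrow> periodic f \<Longrightarrow> tmean (cdir w f) = 0"
  using fourier_cdir[of f 0 w] by (simp add: fourier_0)

text \<open>The two equations are solved frequency by frequency with the multiplier of the adjoint
  divided by the Laplacian. Compatibility makes this one function solve both equations, and the
  lower bound \<open>c\<close> limits the growth of the multiplier, so the coefficients stay rapidly
  decreasing.\<close>

lemma dbar_solve:
  fixes f1 f2 :: "'a::euclidean_space \<Rightarrow> complex"
  assumes f1: "smooth_on UNIV f1" "periodic f1" and f2: "smooth_on UNIV f2" "periodic f2"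
    and comp: "\<And>x. cdir w1 f2 x = cdir w2 f1 x"
    and c: "c > 0" "\<And>k. k \<in> lattice \<Longrightarrow> k \<noteq> 0 \<Longrightarrow>
      c \<le> (k \<bullet> fst w1)\<^sup>2 + (k \<bullet> snd w1)\<^sup>2 + (k \<bullet> fst w2)\<^sup>2 + (k \<bullet> snd w2)\<^sup>2"
  obtains g where "smooth_on UNIV g" "periodic g"
    "\<And>x. cdir w1 g x = f1 x - tmean f1" "\<And>x. cdir w2 g x = f2 x - tmean f2"
proof -
  define sy where "sy w k = of_real (k \<bullet> fst w) + \<i> * of_real (k \<bullet> snd w)" for w and k :: 'a
  define N where "N k = cmod (sy w1 k) ^ 2 + cmod (sy w2 k) ^ 2" for k
  have N: "N k = (k \<bullet> fst w1)\<^sup>2 + (k \<bullet> snd w1)\<^sup>2 + (k \<bullet> fst w2)\<^sup>2 + (k \<bullet> snd w2)\<^sup>2" for k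
    by (simp add: N_def sy_def cmod_power2)
  \<comment> \<open>Frequency 0 is set to 0 because derivatives have mean zero; this is why the
    means of f1 and f2 are subtracted in the result.\<close>
  define q where "q w k = (if k = 0 then 0 else cnj (sy w k) / (2 * pi * \<i> * N k))" for w k
  define a where "a k = q w1 k * fourier f1 k + q w2 k * fourier f2 k" for k
  have cp: "sy w1 k * fourier f2 k = sy w2 k * fourier f1 k" if k: "k \<in> lattice" for k
  proof -
    have "fourier (cdir w1 f2) k = fourier (cdir w2 f1) k"
      using comp by (simp add: fourier_def)
    then show ?thesis
      unfolding fourier_cdir[OF f1 k] fourier_cdir[OF f2 k] sy_def by simp
  qed
  have qb: "norm (q w k) \<le> (norm (fst w) + norm (snd w)) / (2 * pi * c) * (1 + norm k) ^ 1"
    if k: "k \<in> lattice" for w k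
  proof (cases "k = 0")
    case True
    then show ?thesis using c(1) by (simp add: q_def)
  next
    case False
    have Nc: "N k \<ge> c" using c(2)[OF k False] N by simp
    have "norm (sy w k) \<le> \<bar>k \<bullet> fst w\<bar> + \<bar>k \<bullet> snd w\<bar>"
      unfolding sy_def by (rule order_trans[OF norm_triangle_ineq]) (simp add: norm_mult)
    also have "\<dots> \<le> norm k * norm (fst w) + norm k * norm (snd w)"
      by (intro add_mono Cauchy_Schwarz_ineq2)
    also have "\<dots> = (norm (fst w) + norm (snd w)) * norm k" by (simp add: algebra_simps)
    also have "\<dots> \<le> (norm (fst w) + norm (snd w)) * (1 + norm k)" by (intro mult_left_mono) auto
    finally have l: "norm (sy w k) \<le> (norm (fst w) + norm (snd w)) * (1 + norm k)" .
    have "norm (q w k) = norm (sy w k) / (2 * pi * N k)"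
      using False Nc c(1) by (simp add: q_def norm_divide norm_mult)
    also have "\<dots> \<le> (norm (fst w) + norm (snd w)) * (1 + norm k) / (2 * pi * c)"
      using l Nc c(1) by (intro frac_le mult_left_mono) auto
    finally show ?thesis by simp
  qed
  have a: "rapid a"
    unfolding a_def[abs_def] by (intro rapid_add rapid_mult[OF rapid_fourier[OF f1] qb] rapid_mult[OF rapid_fourier[OF f2] qb])
  have key: "2 * pi * \<i> * sy w1 k * a k = (if k = 0 then 0 else fourier f1 k)"
            "2 * pi * \<i> * sy w2 k * a k = (if k = 0 then 0 else fourier f2 k)" if k: "k \<in> lattice" for k
  proof -
    have Nk: "of_real (N k) = sy w1 k * cnj (sy w1 k) + sy w2 k * cnj (sy w2 k)"
      unfolding N_def of_real_add complex_norm_square ..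
    have nz: "complex_of_real (N k) \<noteq> 0" if "k \<noteq> 0"
    proof -
      have "N k > 0" using c(1) c(2)[OF k that] N[of k] by linarith
      then show ?thesis by simp
    qed
    have "2 * pi * \<i> * z * a k = z * (cnj (sy w1 k) * fourier f1 k + cnj (sy w2 k) * fourier f2 k) / N k"
      if "k \<noteq> 0" for z
      using that nz by (simp add: a_def q_def field_simps)
    \<comment> \<open>By \<open>cp\<close> the mixed term with cnj (sy w2 k) turns into the square
      modulus of \<open>sy w2 k\<close> times the coefficient of f1, and the sum of the square
      moduli is \<open>N k\<close>.\<close>
    moreover have "sy w1 k * (cnj (sy w1 k) * fourier f1 k + cnj (sy w2 k) * fourier f2 k) = N k * fourier f1 k"
      using cp[OF k] unfolding Nk by (simp add: algebra_simps)
    moreover have "sy w2 k * (cnj (sy w1 k) * fourier f1 k + cnj (sy w2 k) * fourier f2 k) = N k * fourier f2 k"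
      using cp[OF k] unfolding Nk by (simp add: algebra_simps)
    ultimately show "2 * pi * \<i> * sy w1 k * a k = (if k = 0 then 0 else fourier f1 k)"
            "2 * pi * \<i> * sy w2 k * a k = (if k = 0 then 0 else fourier f2 k)"
      using nz by (auto simp: sy_def)
  qed
  have *: "cdir w (fseries a) x = f x - tmean f"
    if f: "smooth_on UNIV f" "periodic f"
      and k: "\<And>k. k \<in> lattice \<Longrightarrow> 2 * pi * \<i> * sy w k * a k = (if k = 0 then 0 else fourier f k)" for w f x
  proof -
    have c1: "continuous_on UNIV (cdir w (fseries a))" "continuous_on UNIV (\<lambda>x. f x - tmean f)"
      by (intro continuous_intros smooth_on_continuous cdir_smooth fseries_smooth a f)+
    have "cdir w (fseries a) x - (f x - tmean f) = 0"
    proof (rule fourier_unique[where f = "\<lambda>x. cdir w (fseries a) x - (f x - tmean f)"])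
      fix k :: 'a assume kl: "k \<in> lattice"
      have "fourier (\<lambda>x. cdir w (fseries a) x - (f x - tmean f)) k
          = 2 * pi * \<i> * sy w k * a k - (fourier f k - (if k = 0 then tmean f else 0))"
        using kl c1 f(1) by (simp add: fourier_diff fourier_cdir fourier_const fourier_fseries a fseries_smooth
          fseries_periodic smooth_on_continuous sy_def del: of_real_mult)
      then show "fourier (\<lambda>x. cdir w (fseries a) x - (f x - tmean f)) k = 0"
        using k[OF kl] by (simp add: fourier_0)
    qed (intro continuous_on_diff c1 periodic_diff periodic_const cdir_periodic fseries_smooth fseries_periodic a f)+
    then show ?thesis by simp
  qed
  show thesis
    by (rule that[of "fseries a"]) (intro fseries_smooth a fseries_periodic *[OF f1] *[OF f2] key | assumption)+
qed

section \<open>Quotients and framed bundles\<close>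

definition fsub :: "'v cform set \<Rightarrow> bool" where
  "fsub E \<longleftrightarrow> 0 \<in> E \<and> (\<forall>a\<in>E. \<forall>b\<in>E. a + b \<in> E) \<and> (\<forall>c. \<forall>a\<in>E. c \<cdot>\<^sub>f a \<in> E)"

lemma fscale_simps [simp]:
  "c \<cdot>\<^sub>f (0 :: 'v cform) = 0" "0 \<cdot>\<^sub>f \<omega> = 0" "1 \<cdot>\<^sub>f \<omega> = \<omega>" "c \<cdot>\<^sub>f d \<cdot>\<^sub>f \<omega> = (c * d) \<cdot>\<^sub>f \<omega>" "(- 1) \<cdot>\<^sub>f \<omega> = - \<omega>"
  by (auto simp: fscale_def fun_eq_iff)

lemma fscale_add: "c \<cdot>\<^sub>f (a + b) = c \<cdot>\<^sub>f a + c \<cdot>\<^sub>f b" "(c + d) \<cdot>\<^sub>f a = c \<cdot>\<^sub>f a + d \<cdot>\<^sub>f a"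
  by (auto simp: fscale_def fun_eq_iff algebra_simps)

lemma fsub_0: "fsub E \<Longrightarrow> 0 \<in> E"
  and fsub_add: "fsub E \<Longrightarrow> a \<in> E \<Longrightarrow> b \<in> E \<Longrightarrow> a + b \<in> E"
  and fsub_scale: "fsub E \<Longrightarrow> a \<in> E \<Longrightarrow> c \<cdot>\<^sub>f a \<in> E"
  by (auto simp: fsub_def)

lemma fsub_diff: "fsub E \<Longrightarrow> a \<in> E \<Longrightarrow> b \<in> E \<Longrightarrow> a - b \<in> E"
  using fsub_add[of E a "(- 1) \<cdot>\<^sub>f b"] fsub_scale[of E b "- 1"] by simp

lemma coset_eq_iff: "fsub E \<Longrightarrow> coset E a = coset E b \<longleftrightarrow> a - b \<in> E"
proof
  assume E: "fsub E" and eq: "coset E a = coset E b"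
  have "a \<in> coset E a" using fsub_0[OF E] by (force simp: coset_def)
  then obtain \<eta> where "\<eta> \<in> E" "a = b + \<eta>" unfolding eq by (auto simp: coset_def)
  then show "a - b \<in> E" by simp
next
  assume E: "fsub E" and d: "a - b \<in> E"
  have "a + \<eta> = b + ((a - b) + \<eta>)" "b + \<eta> = a + (\<eta> - (a - b))" for \<eta> by simp_all
  then show "coset E a = coset E b"
    unfolding coset_def using fsub_add[OF E d] fsub_diff[OF E _ d] by blast
qed

lemma coset_plus: "fsub E \<Longrightarrow> {a' + b' | a' b'. a' \<in> coset E a \<and> b' \<in> coset E b} = coset E (a + b)"
proof (intro set_eqI iffI)
  fix x assume E: "fsub E" and "x \<in> {a' + b' | a' b'. a' \<in> coset E a \<and> b' \<in> coset E b}"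
  then obtain \<eta> \<zeta> where "\<eta> \<in> E" "\<zeta> \<in> E" "x = (a + \<eta>) + (b + \<zeta>)" by (auto simp: coset_def)
  moreover have "(a + \<eta>) + (b + \<zeta>) = (a + b) + (\<eta> + \<zeta>)" by (simp add: algebra_simps)
  ultimately show "x \<in> coset E (a + b)" using fsub_add[OF E] by (auto simp: coset_def)
next
  fix x assume E: "fsub E" and "x \<in> coset E (a + b)"
  then obtain \<eta> where \<eta>: "\<eta> \<in> E" "x = (a + \<eta>) + (b + 0)" by (auto simp: coset_def algebra_simps)
  have "a + \<eta> \<in> coset E a" "b + 0 \<in> coset E b" using \<eta>(1) fsub_0[OF E] by (force simp: coset_def)+
  then show "x \<in> {a' + b' | a' b'. a' \<in> coset E a \<and> b' \<in> coset E b}" using \<eta>(2) by blast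
qed

text \<open>The extra summand \<open>e\<close> is what makes the case c = 0 right: the multiples
  alone would form the set {0} instead of the zero class \<open>E\<close>.\<close>

lemma coset_scale: "fsub E \<Longrightarrow> {c \<cdot>\<^sub>f a' + e | a' e. a' \<in> coset E a \<and> e \<in> E} = coset E (c \<cdot>\<^sub>f a)"
proof (intro set_eqI iffI)
  fix x assume E: "fsub E" and "x \<in> {c \<cdot>\<^sub>f a' + e | a' e. a' \<in> coset E a \<and> e \<in> E}"
  then obtain \<eta> e where "\<eta> \<in> E" "e \<in> E" "x = c \<cdot>\<^sub>f (a + \<eta>) + e" by (auto simp: coset_def)
  then have "c \<cdot>\<^sub>f \<eta> + e \<in> E" "x = c \<cdot>\<^sub>f a + (c \<cdot>\<^sub>f \<eta> + e)"
    using fsub_add[OF E fsub_scale[OF E]] by (auto simp: fscale_add add.assoc)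
  then show "x \<in> coset E (c \<cdot>\<^sub>f a)" by (auto simp: coset_def)
next
  fix x assume E: "fsub E" and "x \<in> coset E (c \<cdot>\<^sub>f a)"
  then obtain e where e: "e \<in> E" "x = c \<cdot>\<^sub>f (a + 0) + e" by (auto simp: coset_def)
  have "a + 0 \<in> coset E a" using fsub_0[OF E] by (force simp: coset_def)
  then show "x \<in> {c \<cdot>\<^sub>f a' + e | a' e. a' \<in> coset E a \<and> e \<in> E}" using e by blast
qed

lemma coset_0: "coset E 0 = E"
  by (auto simp: coset_def)

lemma quot_simps:
  "vcarr (quot Z E) = coset E ` Z" "vzero (quot Z E) = coset E 0"
  "fsub E \<Longrightarrow> vadd (quot Z E) (coset E a) (coset E b) = coset E (a + b)"
  "fsub E \<Longrightarrow> vsmul (quot Z E) c (coset E a) = coset E (c \<cdot>\<^sub>f a)"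
  by (simp_all add: quot_def coset_0 coset_plus coset_scale)

lemma fcomb_simps [simp]: "fcomb [] \<omega>s = 0" "fcomb cs [] = 0" "fcomb (c # cs) (\<omega> # \<omega>s) = c \<cdot>\<^sub>f \<omega> + fcomb cs \<omega>s"
  by (simp_all add: fcomb_def)

lemma fcomb_apply:
  "length cs = length \<omega>s \<Longrightarrow> fcomb cs \<omega>s p vs = (\<Sum>i<length \<omega>s. cs ! i * (\<omega>s ! i) p vs)"
  by (induction cs \<omega>s rule: list_induct2) (simp_all add: fscale_def sum.lessThan_Suc_shift del: sum.lessThan_Suc)

lemma fcomb_add:
  "length cs = length \<omega>s \<Longrightarrow> length ds = length \<omega>s \<Longrightarrow> fcomb (map2 (+) cs ds) \<omega>s = fcomb cs \<omega>s + fcomb ds \<omega>s"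
  by (auto simp: fun_eq_iff fcomb_apply sum.distrib algebra_simps)

lemma fcomb_scale: "length cs = length \<omega>s \<Longrightarrow> fcomb (map ((*) c) cs) \<omega>s = c \<cdot>\<^sub>f fcomb cs \<omega>s"
  by (auto simp: fun_eq_iff fcomb_apply fscale_def sum_distrib_left algebra_simps)

lemma fcomb_in: "fsub E \<Longrightarrow> length cs = length \<omega>s \<Longrightarrow> set \<omega>s \<subseteq> E \<Longrightarrow> fcomb cs \<omega>s \<in> E"
proof -
  assume E: "fsub E" and "length cs = length \<omega>s" "set \<omega>s \<subseteq> E"
  from this(2,3) show ?thesis
    by (induction cs \<omega>s rule: list_induct2) (auto intro: fsub_add[OF E] fsub_scale[OF E] fsub_0[OF E])
qed

lemma lincomb_quot:
  "fsub E \<Longrightarrow> length cs = length \<omega>s \<Longrightarrow> lincomb (quot Z E) cs (map (coset E) \<omega>s) = coset E (fcomb cs \<omega>s)"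
proof -
  assume E: "fsub E" and "length cs = length \<omega>s"
  from this(2) show ?thesis
  proof (induction cs \<omega>s rule: list_induct2)
    case Nil
    show ?case by (simp only: lincomb_def fcomb_simps zip.simps list.map foldr.simps id_apply quot_simps)
  next
    case (Cons c cs \<omega> \<omega>s)
    have "lincomb (quot Z E) (c # cs) (map (coset E) (\<omega> # \<omega>s)) =
        vadd (quot Z E) (vsmul (quot Z E) c (coset E \<omega>)) (lincomb (quot Z E) cs (map (coset E) \<omega>s))"
      by (simp add: lincomb_def)
    then show ?case by (simp only: Cons.IH quot_simps(3,4)[OF E] fcomb_simps)
  qed
qed

text \<open>Linear independence of the classes modulo \<open>E\<close>; the inclusion in {0} says
  that every entry of the coefficient list vanishes.\<close>

definition findep :: "'v cform set \<Rightarrow> 'v cform list \<Rightarrow> bool" where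
  "findep E \<omega>s \<longleftrightarrow> (\<forall>cs. length cs = length \<omega>s \<longrightarrow> fcomb cs \<omega>s \<in> E \<longrightarrow> set cs \<subseteq> {0})"

lemma findep_eq:
  assumes "fsub E" "findep E \<omega>s" "length cs = length \<omega>s" "length ds = length \<omega>s"
    "coset E (fcomb cs \<omega>s) = coset E (fcomb ds \<omega>s)"
  shows "cs = ds"
proof -
  have "fcomb (map2 (+) cs (map ((*) (- 1)) ds)) \<omega>s = fcomb cs \<omega>s - fcomb ds \<omega>s"
    using assms by (subst fcomb_add) (simp_all only: fcomb_scale length_map fscale_simps diff_conv_add_uminus)
  then have "fcomb (map2 (+) cs (map ((*) (- 1)) ds)) \<omega>s \<in> E"
    using assms coset_eq_iff by metis
  moreover have "length (map2 (+) cs (map ((*) (- 1)) ds)) = length \<omega>s" using assms by simp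
  ultimately have z: "set (map2 (+) cs (map ((*) (- 1)) ds)) \<subseteq> {0}" using assms(2) unfolding findep_def by blast
  show ?thesis
  proof (rule nth_equalityI)
    fix i assume "i < length cs"
    then have "map2 (+) cs (map ((*) (- 1)) ds) ! i \<in> {0}"
      using z assms(3,4) by (intro subsetD[OF z] nth_mem) simp
    then show "cs ! i = ds ! i" using \<open>i < length cs\<close> assms(3,4) by simp
  qed (use assms in simp)
qed

text \<open>Independence of the source classes makes the coefficient list unique, so the description
  in \<open>lin_ext\<close> denotes.\<close>

lemma lin_ext_eq:
  assumes "fsub E" "findep E \<omega>s" "length cs = length \<omega>s"
  shows "lin_ext E \<omega>s E' \<eta>s (coset E (fcomb cs \<omega>s)) = coset E' (fcomb cs \<eta>s)"
  unfolding lin_ext_def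
  by (rule the_equality) (use assms findep_eq in \<open>blast+\<close>)

section \<open>Smooth frames detected by linear functionals\<close>

definition lsmooth :: "'p::real_normed_vector set \<Rightarrow> ('p \<Rightarrow> complex) \<Rightarrow> bool" where
  "lsmooth U f \<longleftrightarrow> (\<forall>t0\<in>U. \<exists>N h. open N \<and> t0 \<in> N \<and> smooth_on N h \<and> (\<forall>t\<in>N \<inter> U. f t = h t))"

text \<open>Linearity is assumed on the subspace \<open>Z\<close> only, because the functionals to
  come are integrals and additive only on forms with integrable values.\<close>

lemma additive_fcomb:
  assumes Z: "fsub Z" and f: "\<And>a b. a \<in> Z \<Longrightarrow> b \<in> Z \<Longrightarrow> f (a + b) = f a + f b"
    "\<And>c a. a \<in> Z \<Longrightarrow> f (c \<cdot>\<^sub>f a) = c * (f a :: complex)"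
  shows "length cs = length \<omega>s \<Longrightarrow> set \<omega>s \<subseteq> Z \<Longrightarrow> f (fcomb cs \<omega>s) = (\<Sum>i<length \<omega>s. cs ! i * f (\<omega>s ! i))"
proof (induction cs \<omega>s rule: list_induct2)
  case Nil
  have "f 0 = 0" using f(2)[OF fsub_0[OF Z], of 0] by (simp only: fscale_simps mult_zero_left)
  then show ?case by (simp only: fcomb_simps list.size lessThan_0 sum.empty)
next
  case (Cons c cs \<omega> \<omega>s)
  then have "fcomb cs \<omega>s \<in> Z" "c \<cdot>\<^sub>f \<omega> \<in> Z"
    using fcomb_in[OF Z, of cs \<omega>s] fsub_scale[OF Z] by auto
  moreover have "\<omega> \<in> Z" using Cons.prems by simp
  ultimately have "f (fcomb (c # cs) (\<omega> # \<omega>s)) = c * f \<omega> + f (fcomb cs \<omega>s)"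
    by (simp only: fcomb_simps f)
  then show ?case
    using Cons by (simp add: sum.lessThan_Suc_shift del: sum.lessThan_Suc fcomb_simps)
qed

text \<open>The frame \<open>\<nu> t\<close> depends smoothly on \<open>t\<close> because it is a smooth combination of the fixed forms \<open>\<kappa>\<close>. The
  functionals \<open>ell k\<close> vanish on \<open>X\<close> and recover the coefficients in the frame, smoothly in \<open>t\<close>, from a class
  modulo \<open>X\<close>.\<close>

locale frame_data =
  fixes \<Delta> W :: "'p::real_normed_vector set"
    and n :: nat and \<nu> :: "'p \<Rightarrow> 'v cform list"
    and Z X :: "'v cform set" and \<kappa> :: "'v cform list" and M :: "nat \<Rightarrow> nat \<Rightarrow> 'p \<Rightarrow> complex"
    and m :: nat and ell :: "nat \<Rightarrow> 'v cform \<Rightarrow> complex" and r :: "nat \<Rightarrow> nat \<Rightarrow> 'p \<Rightarrow> complex"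
  assumes W: "open W" "\<Delta> \<subseteq> W"
    and subspaces: "fsub X" "fsub Z"
    and \<nu>: "t \<in> \<Delta> \<Longrightarrow> length (\<nu> t) = n"
      "t \<in> \<Delta> \<Longrightarrow> i < n \<Longrightarrow> \<nu> t ! i = fcomb (map (\<lambda>k. M i k t) [0..<length \<kappa>]) \<kappa>"
      "set \<kappa> \<subseteq> Z" "i < n \<Longrightarrow> k < length \<kappa> \<Longrightarrow> smooth_on W (M i k)"
    and ell: "k < m \<Longrightarrow> a \<in> Z \<Longrightarrow> b \<in> Z \<Longrightarrow> ell k (a + b) = ell k a + ell k b"
      "k < m \<Longrightarrow> a \<in> Z \<Longrightarrow> ell k (c \<cdot>\<^sub>f a) = c * ell k a" "k < m \<Longrightarrow> a \<in> X \<Longrightarrow> ell k a = 0"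
    and coeff: "t \<in> \<Delta> \<Longrightarrow> length cs = n \<Longrightarrow> i < n \<Longrightarrow>
      cs ! i = (\<Sum>k<m. r i k t * ell k (fcomb cs (\<nu> t)))"
      "i < n \<Longrightarrow> k < m \<Longrightarrow> smooth_on W (r i k)"

text \<open>\<open>e t\<close> is the coordinate map from coefficient lists of length n onto the
  fibre. Describing the fibre through it treats single quotients and products of two quotients
  alike.\<close>

locale framed_bundle = frame_data \<Delta> W n \<nu> Z X \<kappa> M m ell r
  for \<Delta> W :: "'p::real_normed_vector set" and E :: "('p, 'a, 'v cform set) embbundle"
    and n :: nat and e :: "'p \<Rightarrow> complex list \<Rightarrow> 'a" and \<nu> :: "'p \<Rightarrow> 'v cform list"
    and Z X :: "'v cform set" and \<kappa> :: "'v cform list" and M :: "nat \<Rightarrow> nat \<Rightarrow> 'p \<Rightarrow> complex"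
    and m :: nat and ell :: "nat \<Rightarrow> 'v cform \<Rightarrow> complex" and r :: "nat \<Rightarrow> nat \<Rightarrow> 'p \<Rightarrow> complex" +
  assumes ambient: "ambient E = quot Z X"
    and carrier: "t \<in> \<Delta> \<Longrightarrow> vcarr (fibre E t) = e t ` {cs. length cs = n}"
    and add: "t \<in> \<Delta> \<Longrightarrow> length cs = n \<Longrightarrow> length ds = n \<Longrightarrow>
      vadd (fibre E t) (e t cs) (e t ds) = e t (map2 (+) cs ds)"
    and smul: "t \<in> \<Delta> \<Longrightarrow> length cs = n \<Longrightarrow> vsmul (fibre E t) c (e t cs) = e t (map ((*) c) cs)"
    and zero: "t \<in> \<Delta> \<Longrightarrow> vzero (fibre E t) = e t (replicate n 0)"
    and incl: "t \<in> \<Delta> \<Longrightarrow> length cs = n \<Longrightarrow> incl E t (e t cs) = coset X (fcomb cs (\<nu> t))"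
begin

lemma ell_fcomb: "k < m \<Longrightarrow> length cs = length \<omega>s \<Longrightarrow> set \<omega>s \<subseteq> Z \<Longrightarrow>
    ell k (fcomb cs \<omega>s) = (\<Sum>i<length \<omega>s. cs ! i * ell k (\<omega>s ! i))"
  by (rule additive_fcomb[OF subspaces(2)]) (simp_all only: ell)

lemma \<nu>_in: "t \<in> \<Delta> \<Longrightarrow> set (\<nu> t) \<subseteq> Z"
  unfolding set_conv_nth using \<nu> fcomb_in[OF subspaces(2)] by auto

lemma ell_coset: "k < m \<Longrightarrow> a \<in> Z \<Longrightarrow> b \<in> Z \<Longrightarrow> coset X a = coset X b \<Longrightarrow> ell k a = ell k b"
proof -
  assume k: "k < m" and ab: "a \<in> Z" "b \<in> Z" "coset X a = coset X b"
  then have d: "a - b \<in> X" "a - b \<in> Z"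
    using coset_eq_iff[OF subspaces(1)] fsub_diff[OF subspaces(2)] by auto
  have "ell k a = ell k ((a - b) + b)" by simp
  then show ?thesis using ell(1)[OF k d(2) ab(2)] ell(3)[OF k d(1)] by simp
qed

text \<open>The functionals are well defined modulo \<open>X\<close>, and \<open>r\<close> computes
  the coefficients from their values; hence the frame is independent already in the ambient
  quotient.\<close>

lemma coeff_unique:
  assumes "t \<in> \<Delta>" "length cs = n" "length ds = n" "coset X (fcomb cs (\<nu> t)) = coset X (fcomb ds (\<nu> t))"
  shows "cs = ds"
proof (rule nth_equalityI)
  fix i assume i: "i < length cs"
  have "ell k (fcomb cs (\<nu> t)) = ell k (fcomb ds (\<nu> t))" if "k < m" for k
    using assms \<nu>(1) \<nu>_in fcomb_in[OF subspaces(2)] by (intro ell_coset[OF that]) auto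
  then show "cs ! i = ds ! i"
    using coeff(1)[OF assms(1,2), of i] coeff(1)[OF assms(1,3), of i] i assms(2) by simp
qed (use assms in simp)

lemma e_inj: "t \<in> \<Delta> \<Longrightarrow> inj_on (e t) {cs. length cs = n}"
  using coeff_unique incl by (auto simp: inj_on_def) metis

lemma lin_inj_incl: "t \<in> \<Delta> \<Longrightarrow> lin_inj (fibre E t) (ambient E) (incl E t)"
proof -
  assume t: "t \<in> \<Delta>"
  have in_Z: "fcomb cs (\<nu> t) \<in> Z" if "length cs = n" for cs
    using that t \<nu>(1) \<nu>_in fcomb_in[OF subspaces(2)] by auto
  have "inj_on (incl E t) (vcarr (fibre E t))"
    unfolding carrier[OF t] using coeff_unique[OF t] incl[OF t] by (auto simp: inj_on_def)
  moreover have "lin_map (fibre E t) (ambient E) (incl E t)"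
    unfolding lin_map_def ambient carrier[OF t]
    using in_Z by (auto simp: t add smul incl \<nu>(1) quot_simps subspaces(1) fcomb_add fcomb_scale)
  ultimately show ?thesis by (simp add: lin_inj_def)
qed

text \<open>Smoothness in the ambient space is expressed by coefficients on both sides: the
  functionals and \<open>r\<close> lead from a smooth family of classes to its coefficients, while
  the expansion of the frame in the fixed forms \<kappa> leads back.\<close>

lemma smooth_section_iff:
  assumes U: "U \<subseteq> \<Delta>" and c: "\<And>t. t \<in> U \<Longrightarrow> length (c t) = n \<and> s t = e t (c t)"
  shows "smooth_section E U s \<longleftrightarrow> (\<forall>i<n. lsmooth U (\<lambda>t. c t ! i))"
proof
  assume "smooth_section E U s"
  then have s: "smooth_into (quot Z X) U (\<lambda>t. incl E t (s t))"
    by (simp add: smooth_section_def ambient)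
  show "\<forall>i<n. lsmooth U (\<lambda>t. c t ! i)"
    unfolding lsmooth_def
  proof (intro allI impI ballI)
    fix i t0 assume i: "i < n" and t0: "t0 \<in> U"
    obtain N fs vs where N: "open N" "t0 \<in> N" "length fs = length vs" "set vs \<subseteq> coset X ` Z"
        "\<And>f. f \<in> set fs \<Longrightarrow> smooth_on N f"
        "\<And>t. t \<in> N \<inter> U \<Longrightarrow> incl E t (s t) = lincomb (quot Z X) (map (\<lambda>f. f t) fs) vs"
      using bspec[OF s[unfolded smooth_into_def] t0] by (auto simp: quot_simps)
    \<comment> \<open>The functionals act on forms, so representatives in \<open>Z\<close> are
      chosen for the finitely many fixed classes.\<close>
    have "\<exists>\<omega>s. vs = map (coset X) \<omega>s \<and> set \<omega>s \<subseteq> Z"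
      using N(4)
    proof (induction vs)
      case (Cons v vs)
      then obtain \<omega> \<omega>s where "v = coset X \<omega>" "\<omega> \<in> Z" "vs = map (coset X) \<omega>s" "set \<omega>s \<subseteq> Z" by auto
      then show ?case by (intro exI[of _ "\<omega> # \<omega>s"]) simp
    qed simp
    then obtain \<omega>s where \<omega>s: "vs = map (coset X) \<omega>s" "set \<omega>s \<subseteq> Z" by blast
    \<comment> \<open>The inner sum is \<open>ell k\<close> of the combination of the fixed
      representatives; it depends on t only through the smooth coefficients
      \<open>fs\<close>.\<close>
    let ?h = "\<lambda>t. \<Sum>k<m. r i k t * (\<Sum>j<length \<omega>s. (fs ! j) t * ell k (\<omega>s ! j))"
    have "c t ! i = ?h t" if t: "t \<in> N \<inter> U" for t
    proof -
      have tD: "t \<in> \<Delta>" and ct: "length (c t) = n" "s t = e t (c t)" using t U c by auto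
      have "coset X (fcomb (c t) (\<nu> t)) = coset X (fcomb (map (\<lambda>f. f t) fs) \<omega>s)"
        using N(6)[OF t] ct incl[OF tD] lincomb_quot[OF subspaces(1)] \<omega>s(1) N(3) by simp
      then have "ell k (fcomb (c t) (\<nu> t)) = ell k (fcomb (map (\<lambda>f. f t) fs) \<omega>s)" if "k < m" for k
        using ct \<nu>(1)[OF tD] \<nu>_in[OF tD] \<omega>s N(3) by (intro ell_coset that fcomb_in subspaces) auto
      also have "ell k (fcomb (map (\<lambda>f. f t) fs) \<omega>s) = (\<Sum>j<length \<omega>s. (fs ! j) t * ell k (\<omega>s ! j))" if "k < m" for k
        using \<omega>s N(3) by (simp add: ell_fcomb[OF that])
      finally show ?thesis using coeff(1)[OF tD ct(1) i] by simp
    qed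
    moreover have "smooth_on (N \<inter> W) ?h"
      using N W coeff(2)[OF i] \<omega>s(1)
      by (intro smooth_on_sum smooth_on_mult smooth_on_const)
         (auto intro: smooth_on_subset[of W] smooth_on_subset[of N])
    ultimately show "\<exists>N h. open N \<and> t0 \<in> N \<and> smooth_on N h \<and> (\<forall>t\<in>N \<inter> U. c t ! i = h t)"
      using N(1,2) W U t0 by (intro exI[of _ "N \<inter> W"] exI[of _ ?h]) auto
  qed
next
  assume ls: "\<forall>i<n. lsmooth U (\<lambda>t. c t ! i)"
  have "section_on E U s" using U c carrier by (auto simp: section_on_def)
  moreover have "smooth_into (quot Z X) U (\<lambda>t. incl E t (s t))"
    unfolding smooth_into_def
  proof
    fix t0 assume t0: "t0 \<in> U"
    have "\<forall>i. \<exists>N h. i < n \<longrightarrow> open N \<and> t0 \<in> N \<and> smooth_on N h \<and> (\<forall>t\<in>N \<inter> U. c t ! i = h t)"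
      using ls t0 unfolding lsmooth_def by blast
    then obtain N h where N: "\<And>i. i < n \<Longrightarrow> open (N i)" "\<And>i. i < n \<Longrightarrow> t0 \<in> N i"
       "\<And>i. i < n \<Longrightarrow> smooth_on (N i) (h i)" "\<And>i t. i < n \<Longrightarrow> t \<in> N i \<inter> U \<Longrightarrow> c t ! i = h i t"
      by metis
    let ?N = "W \<inter> (\<Inter>i\<in>{..<n}. N i)"
    \<comment> \<open>These are the coefficients of the section with respect to the fixed forms
      \<kappa>, obtained by inserting the expansion of each frame element and exchanging
      sums.\<close>
    let ?fs = "map (\<lambda>k t. \<Sum>i<n. h i t * M i k t) [0..<length \<kappa>]"
    have N': "open ?N" "t0 \<in> ?N" using N W t0 U by auto
    have "incl E t (s t) = lincomb (quot Z X) (map (\<lambda>f. f t) ?fs) (map (coset X) \<kappa>)" if t: "t \<in> ?N \<inter> U" for t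
    proof -
      have tD: "t \<in> \<Delta>" and ct: "length (c t) = n" "s t = e t (c t)" using t U c by auto
      have "fcomb (c t) (\<nu> t) p vs = fcomb (map (\<lambda>f. f t) ?fs) \<kappa> p vs" for p vs
      proof -
        have "fcomb (c t) (\<nu> t) p vs = (\<Sum>i<n. h i t * (\<Sum>k<length \<kappa>. M i k t * (\<kappa> ! k) p vs))"
          using ct(1) \<nu>(1,2)[OF tD] N(4) t by (simp add: fcomb_apply)
        also have "\<dots> = (\<Sum>k<length \<kappa>. (\<Sum>i<n. h i t * M i k t) * (\<kappa> ! k) p vs)"
          unfolding sum_distrib_left sum_distrib_right mult.assoc by (rule sum.swap)
        finally show ?thesis by (simp add: fcomb_apply)
      qed
      then have "fcomb (c t) (\<nu> t) = fcomb (map (\<lambda>f. f t) ?fs) \<kappa>" by blast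
      then show ?thesis
        using ct incl[OF tD] by (subst lincomb_quot[OF subspaces(1)]) auto
    qed
    moreover have "smooth_on ?N f" if "f \<in> set ?fs" for f
    proof -
      have "\<exists>k. k < length \<kappa> \<and> f = (\<lambda>t. \<Sum>i<n. h i t * M i k t)" using that by auto
      then obtain k where k: "k < length \<kappa>" "f = (\<lambda>t. \<Sum>i<n. h i t * M i k t)" by blast
      show ?thesis unfolding k(2)
        by (intro smooth_on_sum smooth_on_mult N')
           (use N \<nu>(4) k(1) in \<open>auto intro: smooth_on_subset[OF N(3)] smooth_on_subset[OF \<nu>(4)]\<close>)
    qed
    moreover have "set (map (coset X) \<kappa>) \<subseteq> vcarr (quot Z X)" using \<nu>(3) by (auto simp: quot_simps)
    ultimately show "\<exists>N fs vs. open N \<and> t0 \<in> N \<and> length fs = length vs \<and> set vs \<subseteq> vcarr (quot Z X) \<and>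
        (\<forall>f\<in>set fs. smooth_on N f) \<and>
        (\<forall>t\<in>N \<inter> U. incl E t (s t) = lincomb (quot Z X) (map (\<lambda>f. f t) fs) vs)"
      using N' by (intro exI[of _ ?N] exI[of _ ?fs] exI[of _ "map (coset X) \<kappa>"]) auto
  qed
  ultimately show "smooth_section E U s" by (simp add: smooth_section_def ambient)
qed

lemma lincomb_frame:
  assumes t: "t \<in> \<Delta>" and cs: "length cs = n"
  shows "lincomb (fibre E t) cs (map (\<lambda>i. e t (map (\<lambda>j. if j = i then 1 else 0) [0..<n])) [0..<n]) = e t cs"
proof -
  let ?u = "\<lambda>i. map (\<lambda>j. if j = i then 1 else 0) [0..<n] :: complex list"
  \<comment> \<open>\<open>lincomb\<close> folds from the right, so the induction runs downwards
    over tails, starting from the empty tail and the zero list.\<close>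
  have *: "lincomb (fibre E t) (drop k cs) (map (\<lambda>i. e t (?u i)) [k..<n]) = e t (map (\<lambda>j. if k \<le> j then cs ! j else 0) [0..<n])"
    if "k \<le> n" for k
    using that
  proof (induction k rule: inc_induct)
    case base
    then show ?case using cs by (simp add: lincomb_def zero[OF t] map_replicate_trivial flip: map_replicate_const)
        (rule arg_cong[where f = "e t"], auto simp: list_eq_iff_nth_eq)
  next
    case (step k)
    have "drop k cs = cs ! k # drop (Suc k) cs" "[k..<n] = k # [Suc k..<n]"
      using step cs by (auto simp: Cons_nth_drop_Suc upt_conv_Cons)
    then have "lincomb (fibre E t) (drop k cs) (map (\<lambda>i. e t (?u i)) [k..<n]) =
       vadd (fibre E t) (vsmul (fibre E t) (cs ! k) (e t (?u k))) (e t (map (\<lambda>j. if Suc k \<le> j then cs ! j else 0) [0..<n]))"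
      using step by (simp add: lincomb_def)
    also have "\<dots> = e t (map (\<lambda>j. if k \<le> j then cs ! j else 0) [0..<n])"
      by (simp add: smul[OF t] add[OF t]) (rule arg_cong[where f = "e t"], auto simp: list_eq_iff_nth_eq not_less_eq_eq)
    finally show ?case .
  qed
  have "map (\<lambda>j. if 0 \<le> j then cs ! j else 0) [0..<n] = cs"
    using cs by (auto simp: list_eq_iff_nth_eq)
  with *[of 0] show ?thesis by (simp only: drop_0 le0)
qed

text \<open>The unit coefficient lists give a global frame, so the whole of \<Delta> serves as
  trivialising neighbourhood of each point.\<close>

lemma smooth_vbundle: "smooth_vbundle \<Delta> E"
proof -
  let ?u = "\<lambda>i. map (\<lambda>j. if j = i then 1 else 0) [0..<n] :: complex list"
  let ?fr = "map (\<lambda>i t. e t (?u i)) [0..<n]"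
  have sec: "smooth_section E \<Delta> s" if "s \<in> set ?fr" for s
  proof -
    have "\<exists>i. s = (\<lambda>t. e t (?u i))" using that by auto
    then obtain i where i: "s = (\<lambda>t. e t (?u i))" by blast
    have "lsmooth \<Delta> (\<lambda>t. ?u i ! j)" for j
      unfolding lsmooth_def using W by (intro ballI exI[of _ W] exI[of _ "\<lambda>_. ?u i ! j"]) (auto intro: smooth_on_const)
    then show ?thesis
      using smooth_section_iff[OF order_refl, of "\<lambda>t. ?u i" s] i by (simp del: nth_map)
  qed
  have uniq: "\<exists>!cs. length cs = length ?fr \<and> x = lincomb (fibre E t) cs (map (\<lambda>s. s t) ?fr)"
    if t: "t \<in> \<Delta>" and x: "x \<in> vcarr (fibre E t)" for t x
  proof -
    obtain cs where cs: "length cs = n" "x = e t cs" using x carrier[OF t] by auto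
    have l: "lincomb (fibre E t) ds (map (\<lambda>s. s t) ?fr) = e t ds" if "length ds = n" for ds
      using lincomb_frame[OF t that] by (simp add: comp_def)
    show ?thesis
    proof (rule ex1I[of _ cs])
      show "length cs = length ?fr \<and> x = lincomb (fibre E t) cs (map (\<lambda>s. s t) ?fr)" using l cs by simp
      fix ds assume "length ds = length ?fr \<and> x = lincomb (fibre E t) ds (map (\<lambda>s. s t) ?fr)"
      then have "length ds = n" "e t ds = e t cs" using l cs by auto
      then show "ds = cs" using e_inj[OF t] cs by (auto dest: inj_onD)
    qed
  qed
  show ?thesis
    unfolding smooth_vbundle_def
    using lin_inj_incl sec uniq by (intro conjI ballI exI[of _ \<Delta>] exI[of _ ?fr]) auto
qed

end

text \<open>In the two frames \<phi> is the identity on coefficient lists, and on both sides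
  smoothness of a section is the same condition on its coefficients.\<close>

lemma framed_bundle_iso:
  assumes "framed_bundle \<Delta> W E n e \<nu> Z X \<kappa> M m ell r"
    and "framed_bundle \<Delta> W' F n e' \<nu>' Z' X' \<kappa>' M' m' ell' r'"
    and \<phi>: "\<And>t cs. t \<in> \<Delta> \<Longrightarrow> length cs = n \<Longrightarrow> \<phi> t (e t cs) = e' t cs"
  shows "smooth_vbundle_iso \<Delta> E F \<phi>"
proof -
  interpret E: framed_bundle \<Delta> W E n e \<nu> Z X \<kappa> M m ell r by fact
  interpret F: framed_bundle \<Delta> W' F n e' \<nu>' Z' X' \<kappa>' M' m' ell' r' by fact
  have iso: "lin_iso (fibre E t) (fibre F t) (\<phi> t)" if t: "t \<in> \<Delta>" for t
  proof -
    have "bij_betw (\<phi> t) (vcarr (fibre E t)) (vcarr (fibre F t))"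
      unfolding bij_betw_def E.carrier[OF t] F.carrier[OF t]
      using \<phi>[OF t] F.e_inj[OF t] by (auto simp: inj_on_def image_image intro!: image_cong)
    moreover have "lin_map (fibre E t) (fibre F t) (\<phi> t)"
      unfolding lin_map_def E.carrier[OF t] F.carrier[OF t]
      by (auto simp: t \<phi> E.add E.smul F.add F.smul)
    ultimately show ?thesis by (simp add: lin_iso_def)
  qed
  have "smooth_section E U s \<longleftrightarrow> smooth_section F U (\<lambda>t. \<phi> t (s t))"
    if U: "openin (top_of_set \<Delta>) U" and s: "section_on E U s" for U s
  proof -
    have UD: "U \<subseteq> \<Delta>" using openin_imp_subset[OF U] .
    have "\<forall>t. \<exists>cs. t \<in> U \<longrightarrow> length cs = n \<and> s t = e t cs"
      using s UD E.carrier by (fastforce simp: section_on_def)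
    then obtain c where c: "\<And>t. t \<in> U \<Longrightarrow> length (c t) = n \<and> s t = e t (c t)" by metis
    have c': "length (c t) = n \<and> \<phi> t (s t) = e' t (c t)" if "t \<in> U" for t
      using c[OF that] \<phi>[of t "c t"] that UD by auto
    show ?thesis
      using E.smooth_section_iff[OF UD, of c s] F.smooth_section_iff[OF UD, of c "\<lambda>t. \<phi> t (s t)"] c c' by simp
  qed
  then show ?thesis
    unfolding smooth_vbundle_iso_def using E.smooth_vbundle F.smooth_vbundle iso by blast
qed

section \<open>Coframes, types and the exterior derivative\<close>

definition unitf :: "'v cform" where "unitf = (\<lambda>p vs. if vs = [] then 1 else 0)"

lemma wedges_eq: "wedges \<omega>s = foldr wedge \<omega>s unitf"
  by (simp add: wedges_def unitf_def)

lemma wedge_Nil: "deg1 a \<Longrightarrow> (a \<and>\<^sub>w \<omega>) p [] = 0"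
  by (simp add: wedge_deg1)

text \<open>Contraction with the first argument is an antiderivation. This recursion replaces the
  shuffle sum in inductions over argument lists.\<close>

lemma wedge_Cons: "deg1 a \<Longrightarrow>
    (a \<and>\<^sub>w \<omega>) p (v # vs) = a p [v] * \<omega> p vs - (a \<and>\<^sub>w (\<lambda>p vs. \<omega> p (v # vs))) p vs"
  by (simp add: wedge_deg1 sum.lessThan_Suc_shift sum_negf del: sum.lessThan_Suc)

lemma wedge_sum:
  assumes "deg1 a"
  shows "(a \<and>\<^sub>w (\<lambda>p vs. \<Sum>i\<in>I. c i p * \<omega> i p vs)) = (\<lambda>p vs. \<Sum>i\<in>I. c i p * (a \<and>\<^sub>w \<omega> i) p vs)"
  unfolding fun_eq_iff wedge_deg1[OF assms] sum_distrib_left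
  by (intro allI, subst sum.swap) (intro sum.cong refl, simp add: mult_ac)

lemma wedge_add: "deg1 a \<Longrightarrow> a \<and>\<^sub>w (\<omega> + \<eta>) = a \<and>\<^sub>w \<omega> + a \<and>\<^sub>w \<eta>"
  and wedge_minus: "deg1 a \<Longrightarrow> a \<and>\<^sub>w (- \<omega>) = - (a \<and>\<^sub>w \<omega>)"
  and wedge_diff: "deg1 a \<Longrightarrow> a \<and>\<^sub>w (\<omega> - \<eta>) = a \<and>\<^sub>w \<omega> - a \<and>\<^sub>w \<eta>"
  and wedge_scale: "deg1 a \<Longrightarrow> a \<and>\<^sub>w (c \<cdot>\<^sub>f \<omega>) = c \<cdot>\<^sub>f (a \<and>\<^sub>w \<omega>)"
  and wedge_0: "deg1 a \<Longrightarrow> a \<and>\<^sub>w 0 = 0"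
  by (simp_all add: fun_eq_iff wedge_deg1 fscale_def algebra_simps sum.distrib sum_negf sum_distrib_left sum_subtractf)

lemma wedge_fun_scale:
  "deg1 a \<Longrightarrow> a \<and>\<^sub>w (\<lambda>p vs. f p * \<omega> p vs) = (\<lambda>p vs. f p * (a \<and>\<^sub>w \<omega>) p vs)"
  by (simp add: fun_eq_iff wedge_deg1 sum_distrib_left mult_ac)

lemma wedge_unitf: "deg1 a \<Longrightarrow> a \<and>\<^sub>w unitf = a"
proof (rule ext, rule ext)
  fix p vs assume a: "deg1 a"
  show "(a \<and>\<^sub>w unitf) p vs = a p vs"
  proof (cases vs)
    case Nil
    then show ?thesis using a by (simp add: wedge_Nil deg1_def)
  next
    case (Cons v us)
    have "(a \<and>\<^sub>w (\<lambda>p vs. unitf p (v # vs))) p us = 0"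
      using a by (simp add: wedge_deg1 unitf_def)
    then show ?thesis using a Cons by (cases us) (auto simp: wedge_Cons unitf_def deg1_def)
  qed
qed

text \<open>Contracting both sides with the first argument leaves terms symmetric up to sign and a
  shorter instance with \<omega> contracted; therefore the induction generalises over
  \<omega>.\<close>

lemma wedge_swap: "deg1 a \<Longrightarrow> deg1 b \<Longrightarrow> a \<and>\<^sub>w b \<and>\<^sub>w \<omega> = - (b \<and>\<^sub>w a \<and>\<^sub>w \<omega>)"
proof (rule ext, rule ext)
  fix p vs assume a: "deg1 a" and b: "deg1 b"
  show "(a \<and>\<^sub>w b \<and>\<^sub>w \<omega>) p vs = (- (b \<and>\<^sub>w a \<and>\<^sub>w \<omega>)) p vs"
  proof (induction vs arbitrary: \<omega>)
    case Nil
    show ?case using a b by (simp add: wedge_Nil)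
  next
    case (Cons v vs)
    have *: "(a' \<and>\<^sub>w (\<lambda>p vs. (b' \<and>\<^sub>w \<omega>) p (v # vs))) p vs = b' p [v] * (a' \<and>\<^sub>w \<omega>) p vs
        - (a' \<and>\<^sub>w b' \<and>\<^sub>w (\<lambda>p vs. \<omega> p (v # vs))) p vs" if ab: "deg1 a'" "deg1 b'" for a' b'
    proof -
      have "(\<lambda>p vs. (b' \<and>\<^sub>w \<omega>) p (v # vs)) =
          (\<lambda>p vs. b' p [v] * \<omega> p vs) - (b' \<and>\<^sub>w (\<lambda>p vs. \<omega> p (v # vs)))"
        using ab by (simp add: fun_eq_iff wedge_Cons)
      then show ?thesis using ab by (simp add: wedge_diff wedge_fun_scale)
    qed
    have **: "(a' \<and>\<^sub>w b' \<and>\<^sub>w \<omega>) p (v # vs) = a' p [v] * (b' \<and>\<^sub>w \<omega>) p vs - (b' p [v] * (a' \<and>\<^sub>w \<omega>) p vs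
        - (a' \<and>\<^sub>w b' \<and>\<^sub>w (\<lambda>p vs. \<omega> p (v # vs))) p vs)" if ab: "deg1 a'" "deg1 b'" for a' b'
      by (simp only: wedge_Cons[OF ab(1), of "b' \<and>\<^sub>w \<omega>"] *[OF ab])
    show ?case
      using Cons.IH[of "\<lambda>p vs. \<omega> p (v # vs)"] **[OF a b] **[OF b a] by simp
  qed
qed

lemma wedge_same: "deg1 a \<Longrightarrow> a \<and>\<^sub>w a \<and>\<^sub>w \<omega> = 0"
  using wedge_swap[of a a \<omega>] by (simp add: fun_eq_iff)

text \<open>Contraction with the complex field (x - s y) / 2. Forms accept real vectors only, so the
  complex linear extension in the first slot is written out.\<close>

definition contract :: "complex \<Rightarrow> ('v \<Rightarrow> 'v) \<Rightarrow> ('v \<Rightarrow> 'v) \<Rightarrow> 'v cform \<Rightarrow> 'v cform" where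
  "contract s x y \<omega> = (\<lambda>p vs. (\<omega> p (x p # vs) - s * \<omega> p (y p # vs)) / 2)"

lemma contract_sum:
  "contract s x y (\<lambda>p vs. \<Sum>i\<in>I. c i p * \<omega> i p vs) = (\<lambda>p vs. \<Sum>i\<in>I. c i p * contract s x y (\<omega> i) p vs)"
  by (simp add: fun_eq_iff contract_def sum_divide_distrib sum_distrib_left sum_subtractf[symmetric] diff_divide_distrib[symmetric] algebra_simps)

lemma contract_wedge:
  assumes "deg1 a"
  shows "contract s x y (a \<and>\<^sub>w \<omega>) p vs = contract s x y a p [] * \<omega> p vs - (a \<and>\<^sub>w contract s x y \<omega>) p vs"
proof -
  have *: "(a \<and>\<^sub>w (\<lambda>q vs. \<omega> q (u # vs))) p vs = (\<Sum>i<length vs. (-1) ^ i * a p [vs ! i] * \<omega> p (u # take i vs @ drop (Suc i) vs))" for u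
    using assms by (simp add: wedge_deg1)
  have "(a \<and>\<^sub>w contract s x y \<omega>) p vs =
     ((a \<and>\<^sub>w (\<lambda>q vs. \<omega> q (x p # vs))) p vs - s * (a \<and>\<^sub>w (\<lambda>q vs. \<omega> q (y p # vs))) p vs) / 2"
    unfolding * using assms
    by (simp add: wedge_deg1 contract_def sum_divide_distrib sum_distrib_left sum_subtractf[symmetric] diff_divide_distrib[symmetric] algebra_simps)
  then show ?thesis using assms by (simp add: contract_def wedge_Cons algebra_simps diff_divide_distrib add_divide_distrib)
qed

text \<open>The complex vector fields \<open>(x k - \<i> y k) / 2\<close> are dual to the \<open>\<theta> ! k\<close>. Indices \<open>k < n\<close> refer to
  \<open>\<theta> ! k\<close>, indices \<open>n + k\<close> to its conjugate.\<close>

locale coframe =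
  fixes \<theta> :: "'v::real_normed_vector cform list" and n :: nat and x y :: "nat \<Rightarrow> 'v \<Rightarrow> 'v"
  assumes len: "length \<theta> = n"
    and deg: "i < n \<Longrightarrow> deg1 (\<theta> ! i)"
    and dual: "i < n \<Longrightarrow> j < n \<Longrightarrow> (\<theta> ! i) p [x j p] = (if i = j then 1 else 0)"
      "i < n \<Longrightarrow> j < n \<Longrightarrow> (\<theta> ! i) p [y j p] = (if i = j then \<i> else 0)"
    and complete: "v = (\<Sum>j<n. Re ((\<theta> ! j) p [v]) *\<^sub>R x j p + Im ((\<theta> ! j) p [v]) *\<^sub>R y j p)"
begin

definition co :: "nat \<Rightarrow> 'v cform" where
  "co k = (if k < n then \<theta> ! k else cnjf (\<theta> ! (k - n)))"

definition cn :: "nat \<Rightarrow> 'v cform \<Rightarrow> 'v cform" where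
  "cn k = (if k < n then contract \<i> (x k) (y k) else contract (- \<i>) (x (k - n)) (y (k - n)))"

definition mono :: "nat list \<Rightarrow> 'v cform" where
  "mono ks = foldr (\<lambda>k \<omega>. co k \<and>\<^sub>w \<omega>) ks unitf"

text \<open>Successive contraction with the dual fields in the order of the list, followed by
  evaluation on no arguments; on increasing lists it extracts the coefficient of the matching
  monomial.\<close>

primrec cf :: "nat list \<Rightarrow> 'v cform \<Rightarrow> 'v \<Rightarrow> complex" where
  "cf [] \<omega> p = \<omega> p []"
| "cf (k # ks) \<omega> p = cf ks (cn k \<omega>) p"

definition idx :: "nat set \<Rightarrow> nat set \<Rightarrow> nat list" where
  "idx I J = nths [0..<n] I @ map ((+) n) (nths [0..<n] J)"

lemma co_deg1: "k < 2 * n \<Longrightarrow> deg1 (co k)"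
  using deg by (auto simp: co_def)

lemma cn_co: "k < 2 * n \<Longrightarrow> l < 2 * n \<Longrightarrow> cn k (co l) p [] = (if k = l then 1 else 0)"
  using dual by (auto simp: co_def cn_def contract_def cnjf_def)

lemma cn_sum: "cn k (\<lambda>p vs. \<Sum>i\<in>I. c i p * \<omega> i p vs) = (\<lambda>p vs. \<Sum>i\<in>I. c i p * cn k (\<omega> i) p vs)"
  by (simp add: cn_def contract_sum)

lemma cf_sum: "cf ks (\<lambda>p vs. \<Sum>i\<in>I. c i p * \<omega> i p vs) p = (\<Sum>i\<in>I. c i p * cf ks (\<omega> i) p)"
  by (induction ks arbitrary: \<omega>) (simp_all add: cn_sum)

lemma cn_wedge: "k < 2 * n \<Longrightarrow> l < 2 * n \<Longrightarrow>
    cn k (co l \<and>\<^sub>w \<omega>) = (if k = l then \<omega> - co l \<and>\<^sub>w cn k \<omega> else - (co l \<and>\<^sub>w cn k \<omega>))"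
proof (rule ext, rule ext)
  fix p vs assume kl: "k < 2 * n" "l < 2 * n"
  have "cn k (co l \<and>\<^sub>w \<omega>) p vs = cn k (co l) p [] * \<omega> p vs - (co l \<and>\<^sub>w cn k \<omega>) p vs"
    using contract_wedge[OF co_deg1[OF kl(2)]] by (simp add: cn_def)
  then show "cn k (co l \<and>\<^sub>w \<omega>) p vs = (if k = l then \<omega> - co l \<and>\<^sub>w cn k \<omega> else - (co l \<and>\<^sub>w cn k \<omega>)) p vs"
    using cn_co[OF kl] by simp
qed

lemma cn_minus: "cn k (- \<omega>) = - cn k \<omega>" and cn_0: "cn k 0 = 0"
  by (auto simp: cn_def contract_def fun_eq_iff algebra_simps minus_divide_left)

lemma cf_minus: "cf ks (- \<omega>) p = - cf ks \<omega> p" and cf_0: "cf ks 0 p = 0"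
  by (induction ks arbitrary: \<omega>) (simp_all add: cn_minus cn_0)

lemma cn_mono: "set ks \<subseteq> {..<2 * n} \<Longrightarrow> k < 2 * n \<Longrightarrow> k \<notin> set ks \<Longrightarrow> cn k (mono ks) = 0"
proof (induction ks)
  case Nil
  then show ?case by (auto simp: mono_def cn_def contract_def unitf_def fun_eq_iff)
next
  case (Cons l ks)
  then have "cn k (mono (l # ks)) = - (co l \<and>\<^sub>w cn k (mono ks))"
    by (simp add: mono_def cn_wedge)
  moreover have "cn k (mono ks) = 0" using Cons.prems by (intro Cons.IH) auto
  moreover have "co l \<and>\<^sub>w 0 = 0" using Cons.prems co_deg1 by (intro wedge_0) simp
  ultimately show ?case by (simp only: minus_zero)
qed

text \<open>The factor \<open>co l\<close> is never contracted away, so it survives to the end and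
  vanishes on the empty argument list.\<close>

lemma cf_stuck: "set ks \<subseteq> {..<2 * n} \<Longrightarrow> l < 2 * n \<Longrightarrow> l \<notin> set ks \<Longrightarrow> cf ks (co l \<and>\<^sub>w \<omega>) p = 0"
proof (induction ks arbitrary: \<omega>)
  case Nil
  then show ?case by (simp add: wedge_Nil co_deg1)
next
  case (Cons k ks)
  then show ?case by (auto simp: cn_wedge cf_minus)
qed

text \<open>Compare the heads of the two increasing lists: equal heads cancel; a smaller k is absent
  from \<open>ls\<close>, so its contraction gives 0; a smaller l is absent from \<open>ks\<close>,
  so \<open>co l\<close> is stuck.\<close>

lemma cf_mono:
  "sorted_wrt (<) ks \<Longrightarrow> sorted_wrt (<) ls \<Longrightarrow> set ks \<subseteq> {..<2 * n} \<Longrightarrow> set ls \<subseteq> {..<2 * n} \<Longrightarrow>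
    cf ks (mono ls) p = (if ks = ls then 1 else 0)"
proof (induction ks arbitrary: ls)
  case Nil
  then show ?case by (cases ls) (auto simp: mono_def unitf_def wedge_Nil co_deg1)
next
  case (Cons k ks)
  show ?case
  proof (cases ls)
    case Nil
    then show ?thesis using Cons.prems cn_mono[of "[]" k] by (simp add: cf_0)
  next
    case (Cons l ls')
    note pr = Cons.prems[unfolded Cons]
    consider "k = l" | "k < l" | "l < k" by linarith
    then show ?thesis
    proof cases
      case 1
      then have "k \<notin> set ls'" using pr by auto
      then have "cn k (mono ls) = mono ls'"
        using pr 1 cn_mono[of ls' k] co_deg1[of l] Cons by (simp add: mono_def cn_wedge wedge_0)
      then show ?thesis using Cons.IH[of ls'] pr 1 Cons by simp
    next
      case 2
      then have "k \<notin> set ls" using pr Cons by auto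
      then show ?thesis using cn_mono[of ls k] pr 2 Cons by (simp add: cf_0)
    next
      case 3
      then have "l \<notin> set ks" using pr by auto
      then have "cf ks (co l \<and>\<^sub>w cn k (mono ls')) p = 0" using pr by (intro cf_stuck) auto
      then show ?thesis using pr 3 Cons by (simp add: mono_def cn_wedge cf_minus)
    qed
  qed
qed

lemma nths_upt: "nths [0..<m] I = filter (\<lambda>i. i \<in> I) [0..<m]"
  by (induction m) (auto simp: nths_append)

lemma idx_sorted: "sorted_wrt (<) (idx I J)"
  by (auto simp: idx_def nths_upt sorted_wrt_append sorted_wrt_map intro!: sorted_wrt_filter)

lemma idx_set: "set (idx I J) \<subseteq> {..<2 * n}"
  by (auto simp: idx_def set_nths)

lemma idx_inj:
  assumes "I \<subseteq> {..<n}" "J \<subseteq> {..<n}" "I' \<subseteq> {..<n}" "J' \<subseteq> {..<n}" "idx I J = idx I' J'"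
  shows "I = I' \<and> J = J'"
proof -
  have s: "set (idx A B) = A \<union> (+) n ` B" if "A \<subseteq> {..<n}" "B \<subseteq> {..<n}" for A B
    using that by (force simp: idx_def set_nths)
  have A: "A = set (idx A B) \<inter> {..<n}" if "A \<subseteq> {..<n}" "B \<subseteq> {..<n}" for A B
    using that by (auto simp: s[OF that])
  have B: "B = (\<lambda>k. k - n) ` (set (idx A B) \<inter> {n..})" if "A \<subseteq> {..<n}" "B \<subseteq> {..<n}" for A B
    using that by (force simp: s[OF that] image_iff)
  show ?thesis using assms A B by metis
qed

lemma monomial_eq: "monomial \<theta> I J = mono (idx I J)"
proof -
  have \<theta>: "\<theta> = map ((!) \<theta>) [0..<n]" using len by (metis map_nth)
  have 1: "nths \<theta> I = map co (nths [0..<n] I)"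
    by (subst \<theta>) (auto simp: nths_map co_def set_nths)
  have 2: "map cnjf (nths \<theta> J) = map co (map ((+) n) (nths [0..<n] J))"
    by (subst \<theta>) (auto simp: nths_map co_def)
  have "foldr (\<lambda>k \<omega>. co k \<and>\<^sub>w \<omega>) ks unitf = foldr wedge (map co ks) unitf" for ks
    by (simp add: foldr_map comp_def)
  then show ?thesis
    unfolding monomial_def wedges_eq mono_def idx_def 1 2 by simp
qed

lemma finite_idx: "finite (all_idx \<theta>)"
  by (simp add: all_idx_def)

lemma cf_expansion:
  assumes "S \<subseteq> all_idx \<theta>" "(I, J) \<in> all_idx \<theta>"
  shows "cf (idx I J) (expansion \<theta> S c) p = (if (I, J) \<in> S then c (I, J) p else 0)"
proof -
  have fS: "finite S" using finite_idx assms(1) finite_subset by blast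
  have "expansion \<theta> S c = (\<lambda>p vs. \<Sum>s\<in>S. c s p * monomial \<theta> (fst s) (snd s) p vs)"
    by (simp add: expansion_def split_beta)
  then have "cf (idx I J) (expansion \<theta> S c) p = (\<Sum>s\<in>S. c s p * cf (idx I J) (monomial \<theta> (fst s) (snd s)) p)"
    by (simp add: cf_sum)
  also have "\<dots> = (\<Sum>s\<in>S. if s = (I, J) then c s p else 0)"
  proof (intro sum.cong refl)
    fix s assume s: "s \<in> S"
    have "idx I J = idx (fst s) (snd s) \<longleftrightarrow> s = (I, J)"
      using idx_inj[of I J "fst s" "snd s"] s assms len by (auto simp: all_idx_def)
    then show "c s p * cf (idx I J) (monomial \<theta> (fst s) (snd s)) p = (if s = (I, J) then c s p else 0)"
      by (simp add: monomial_eq cf_mono idx_sorted idx_set)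
  qed
  finally show ?thesis using fS by simp
qed

lemma expansion_unique:
  assumes "S \<subseteq> all_idx \<theta>" "expansion \<theta> S c = expansion \<theta> S c'" "s \<in> S"
  shows "c s p = c' s p"
proof -
  have s: "(fst s, snd s) \<in> all_idx \<theta>" "(fst s, snd s) \<in> S" using assms by auto
  show ?thesis
    using cf_expansion[OF assms(1) s(1), of c p] cf_expansion[OF assms(1) s(1), of c' p] s(2) assms(2) by simp
qed

lemma pq_idx_subset: "pq_idx \<theta> p q \<subseteq> all_idx \<theta>"
  by (auto simp: pq_idx_def)

text \<open>Coefficients of expansions are unique, which makes the description in
  \<open>pq_part\<close> denote the partial expansion.\<close>

lemma pq_part_expansion: "pq_part \<theta> p q (expansion \<theta> (all_idx \<theta>) c) = expansion \<theta> (pq_idx \<theta> p q) c"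
  unfolding pq_part_def
proof (rule the_equality)
  fix \<eta> assume "\<exists>c'. expansion \<theta> (all_idx \<theta>) c = expansion \<theta> (all_idx \<theta>) c' \<and> \<eta> = expansion \<theta> (pq_idx \<theta> p q) c'"
  then obtain c' where c': "expansion \<theta> (all_idx \<theta>) c = expansion \<theta> (all_idx \<theta>) c'" "\<eta> = expansion \<theta> (pq_idx \<theta> p q) c'"
    by blast
  have "c s u = c' s u" if "s \<in> pq_idx \<theta> p q" for s u
    using expansion_unique[OF order_refl c'(1)] that pq_idx_subset by blast
  then show "\<eta> = expansion \<theta> (pq_idx \<theta> p q) c"
    unfolding c'(2) expansion_def by (auto intro!: sum.cong simp: fun_eq_iff)
qed blast

definition oftype :: "nat \<Rightarrow> nat \<Rightarrow> 'v cform \<Rightarrow> bool" where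
  "oftype p q \<omega> \<longleftrightarrow> (\<exists>c. \<omega> = expansion \<theta> (pq_idx \<theta> p q) c)"

text \<open>\<open>pq_part\<close> is a definite description, so its linearity has to be restricted
  to forms that possess an expansion at all.\<close>

definition expandable :: "'v cform \<Rightarrow> bool" where
  "expandable \<omega> \<longleftrightarrow> (\<exists>c. \<omega> = expansion \<theta> (all_idx \<theta>) c)"

lemma expansion_add: "expansion \<theta> S c + expansion \<theta> S d = expansion \<theta> S (\<lambda>s p. c s p + d s p)"
  by (auto simp: expansion_def fun_eq_iff sum.distrib[symmetric] algebra_simps intro!: sum.cong)

lemma expansion_mult: "(\<lambda>p vs. f p * expansion \<theta> S c p vs) = expansion \<theta> S (\<lambda>s p. f p * c s p)"
  by (auto simp: expansion_def fun_eq_iff sum_distrib_left mult_ac intro!: sum.cong)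

lemma expansion_extend:
  assumes "S \<subseteq> all_idx \<theta>"
  shows "expansion \<theta> S c = expansion \<theta> (all_idx \<theta>) (\<lambda>s p. if s \<in> S then c s p else 0)"
proof -
  have "(\<Sum>s\<in>S. case s of (I, J) \<Rightarrow> c (I, J) p * monomial \<theta> I J p vs) =
     (\<Sum>s\<in>all_idx \<theta>. case s of (I, J) \<Rightarrow> (if (I, J) \<in> S then c (I, J) p else 0) * monomial \<theta> I J p vs)" for p vs
    using finite_idx assms by (intro sum.mono_neutral_cong_left) auto
  then show ?thesis by (simp add: expansion_def fun_eq_iff)
qed

lemma oftype_add: "oftype p q \<omega> \<Longrightarrow> oftype p q \<eta> \<Longrightarrow> oftype p q (\<omega> + \<eta>)"
  unfolding oftype_def by (elim exE, hypsubst, rule exI, rule expansion_add)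

lemma oftype_mult: "oftype p q \<omega> \<Longrightarrow> oftype p q (\<lambda>u vs. f u * \<omega> u vs)"
  unfolding oftype_def using expansion_mult by metis

lemma oftype_scale: "oftype p q \<omega> \<Longrightarrow> oftype p q (c \<cdot>\<^sub>f \<omega>)"
  unfolding fscale_def by (rule oftype_mult)

lemma oftype_minus: "oftype p q \<omega> \<Longrightarrow> oftype p q (- \<omega>)"
  using oftype_scale[of p q \<omega> "- 1"] by simp

lemma oftype_0: "oftype p q 0"
  unfolding oftype_def by (intro exI[of _ "\<lambda>_ _. 0"]) (simp add: expansion_def fun_eq_iff split_beta)

lemma oftype_sum: "(\<And>i. i \<in> I \<Longrightarrow> oftype p q (\<omega> i)) \<Longrightarrow> oftype p q (\<Sum>i\<in>I. \<omega> i)"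
  by (induction I rule: infinite_finite_induct) (auto intro: oftype_add simp: oftype_0)

lemma oftype_monomial:
  assumes "I \<subseteq> {..<n}" "J \<subseteq> {..<n}"
  shows "oftype (card I) (card J) (monomial \<theta> I J)"
proof -
  have m: "(I, J) \<in> pq_idx \<theta> (card I) (card J)" using assms len by (simp add: pq_idx_def all_idx_def)
  have f: "finite (pq_idx \<theta> (card I) (card J))" using finite_subset[OF pq_idx_subset finite_idx] .
  have "monomial \<theta> I J = expansion \<theta> (pq_idx \<theta> (card I) (card J)) (\<lambda>s _. if s = (I, J) then 1 else 0)"
  proof (intro ext)
    fix p vs
    have "expansion \<theta> (pq_idx \<theta> (card I) (card J)) (\<lambda>s _. if s = (I, J) then 1 else 0) p vs =
       (\<Sum>s\<in>pq_idx \<theta> (card I) (card J). if s = (I, J) then monomial \<theta> I J p vs else 0)"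
      unfolding expansion_def
    proof (intro sum.cong refl)
      fix s
      show "(case s of (A, B) \<Rightarrow> (if (A, B) = (I, J) then 1 else 0) * monomial \<theta> A B p vs) = (if s = (I, J) then monomial \<theta> I J p vs else 0)"
        by (cases s) simp
    qed
    then show "monomial \<theta> I J p vs = expansion \<theta> (pq_idx \<theta> (card I) (card J)) (\<lambda>s _. if s = (I, J) then 1 else 0) p vs"
      using m f by simp
  qed
  then show ?thesis unfolding oftype_def by blast
qed

lemma oftype_expandable: "oftype p q \<omega> \<Longrightarrow> expandable \<omega>"
  unfolding oftype_def expandable_def by (elim exE, drule trans[OF _ expansion_extend[OF pq_idx_subset]]) (rule exI)

lemma expandable_add: "expandable \<omega> \<Longrightarrow> expandable \<eta> \<Longrightarrow> expandable (\<omega> + \<eta>)"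
  unfolding expandable_def by (elim exE, hypsubst, rule exI, rule expansion_add)

lemma pq_part_add: "expandable \<omega> \<Longrightarrow> expandable \<eta> \<Longrightarrow> pq_part \<theta> p q (\<omega> + \<eta>) = pq_part \<theta> p q \<omega> + pq_part \<theta> p q \<eta>"
  unfolding expandable_def by (auto simp: expansion_add pq_part_expansion)

lemma pq_part_scale: "expandable \<omega> \<Longrightarrow> pq_part \<theta> p q (c \<cdot>\<^sub>f \<omega>) = c \<cdot>\<^sub>f pq_part \<theta> p q \<omega>"
  unfolding expandable_def fscale_def by (auto simp: expansion_mult pq_part_expansion)

lemma pq_part_oftype:
  assumes "oftype p q \<omega>"
  shows "pq_part \<theta> p' q' \<omega> = (if p' = p \<and> q' = q then \<omega> else 0)"
proof -
  obtain c where c: "\<omega> = expansion \<theta> (pq_idx \<theta> p q) c" using assms by (auto simp: oftype_def)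
  have "pq_part \<theta> p' q' \<omega> = expansion \<theta> (pq_idx \<theta> p' q') (\<lambda>s u. if s \<in> pq_idx \<theta> p q then c s u else 0)"
    unfolding c expansion_extend[OF pq_idx_subset] pq_part_expansion ..
  moreover have "expansion \<theta> (pq_idx \<theta> p' q') (\<lambda>s u. if s \<in> pq_idx \<theta> p q then c s u else 0)
      = (if p' = p \<and> q' = q then \<omega> else 0)"
  proof (cases "p' = p \<and> q' = q")
    case True
    then show ?thesis unfolding c expansion_def by (auto intro!: sum.cong simp: fun_eq_iff)
  next
    case False
    then have "s \<notin> pq_idx \<theta> p q" if "s \<in> pq_idx \<theta> p' q'" for s using that by (auto simp: pq_idx_def)
    then show ?thesis using False by (auto simp: expansion_def fun_eq_iff intro!: sum.neutral)
  qed
  ultimately show ?thesis by simp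
qed

lemma pq_part_sum2:
  assumes "oftype p1 q1 \<omega>" "oftype p q \<eta>" "(p1, q1) \<noteq> (p, q)"
  shows "pq_part \<theta> p q (\<omega> + \<eta>) = \<eta>"
  using assms by (auto simp: pq_part_add oftype_expandable pq_part_oftype)

text \<open>The derivatives along the dual complex fields, followed from index n on by those along
  their conjugates; the latter are the components of d-bar f.\<close>

definition dZ :: "nat \<Rightarrow> ('v \<Rightarrow> complex) \<Rightarrow> 'v \<Rightarrow> complex" where
  "dZ k f p = (if k < n then (frechet_derivative f (at p) (x k p) - \<i> * frechet_derivative f (at p) (y k p)) / 2
     else (frechet_derivative f (at p) (x (k - n) p) + \<i> * frechet_derivative f (at p) (y (k - n) p)) / 2)"

lemma derivative_expand:
  assumes "f differentiable (at p)"
  shows "frechet_derivative f (at p) v = (\<Sum>k<2*n. dZ k f p * co k p [v])"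
proof -
  interpret linear "frechet_derivative f (at p)"
    using assms frechet_derivative_works has_derivative_linear by blast
  let ?D = "frechet_derivative f (at p)"
  have "?D v = ?D (\<Sum>j<n. Re ((\<theta> ! j) p [v]) *\<^sub>R x j p + Im ((\<theta> ! j) p [v]) *\<^sub>R y j p)"
    using complete[of v p] by simp
  also have "\<dots> = (\<Sum>j<n. Re ((\<theta> ! j) p [v]) *\<^sub>R ?D (x j p) + Im ((\<theta> ! j) p [v]) *\<^sub>R ?D (y j p))"
    by (simp add: sum add scale)
  also have "\<dots> = (\<Sum>j<n. dZ j f p * co j p [v] + dZ (n + j) f p * co (n + j) p [v])"
  proof (intro sum.cong refl)
    fix j assume "j \<in> {..<n}"
    then have j: "j < n" by simp
    define z where "z = (\<theta> ! j) p [v]"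
    \<comment> \<open>The passage from the real frame to the complex one: \<open>a\<close> and
      \<open>b\<close> are the derivatives along the real fields, and z is the value of the coframe
      element.\<close>
    have "Re z *\<^sub>R a + Im z *\<^sub>R b = (a - \<i> * b) / 2 * z + (a + \<i> * b) / 2 * cnj z" for a b :: complex
      by (simp add: complex_eq_iff field_simps)
    then show "Re ((\<theta> ! j) p [v]) *\<^sub>R ?D (x j p) + Im ((\<theta> ! j) p [v]) *\<^sub>R ?D (y j p)
      = dZ j f p * co j p [v] + dZ (n + j) f p * co (n + j) p [v]"
      using j by (simp add: dZ_def co_def cnjf_def z_def)
  qed
  also have "\<dots> = (\<Sum>k<2*n. dZ k f p * co k p [v])"
  proof -
    have "{..<2*n} = {..<n} \<union> (+) n ` {..<n}"
    proof (intro equalityI subsetI)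
      fix k assume "k \<in> {..<2*n}"
      then have "k < n \<or> k = n + (k - n) \<and> k - n < n" by auto
      then show "k \<in> {..<n} \<union> (+) n ` {..<n}" by blast
    qed auto
    moreover have "{..<n} \<inter> (+) n ` {..<n} = {}" by auto
    ultimately show ?thesis
      by (simp add: sum.distrib sum.union_disjoint sum.reindex)
  qed
  finally show ?thesis .
qed

end

section \<open>Calculus of the exterior derivative\<close>

lemma one_form_single [simp]: "one_form a p [v] = a p v"
  by (simp add: one_form_def)

definition fdiff :: "'v::real_normed_vector cform \<Rightarrow> bool" where
  "fdiff \<omega> \<longleftrightarrow> (\<forall>p vs. (\<lambda>q. \<omega> q vs) differentiable (at p))"

definition fconst :: "'v cform \<Rightarrow> bool" where
  "fconst \<omega> \<longleftrightarrow> (\<forall>p q vs. \<omega> p vs = \<omega> q vs)"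

lemma fdiffD: "fdiff \<omega> \<Longrightarrow> ((\<lambda>q. \<omega> q vs) has_derivative frechet_derivative (\<lambda>q. \<omega> q vs) (at p)) (at p)"
  by (simp add: fdiff_def frechet_derivative_works)

lemma fdiff_I: "(\<And>p vs. ((\<lambda>q. \<omega> q vs) has_derivative F p vs) (at p)) \<Longrightarrow> fdiff \<omega>"
  unfolding fdiff_def differentiable_def by blast

lemma is_kform_smooth: "is_kform k \<omega> \<Longrightarrow> smooth_on UNIV (\<lambda>p. \<omega> p vs)"
  by (simp add: is_kform_def)

lemma is_kform_fdiff: "is_kform k \<omega> \<Longrightarrow> fdiff \<omega>"
  unfolding fdiff_def using is_kform_smooth smooth_on_differentiable by blast

lemma extdI:
  assumes "\<And>vs. ((\<lambda>q. \<omega> q vs) has_derivative (\<lambda>v. \<omega>' v vs)) (at p)"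
  shows "extd \<omega> p vs = (\<Sum>i<length vs. (-1) ^ i * \<omega>' (vs ! i) (take i vs @ drop (Suc i) vs))"
proof -
  have "frechet_derivative (\<lambda>q. \<omega> q us) (at p) = (\<lambda>v. \<omega>' v us)" for us
    using frechet_derivative_at[OF assms] by simp
  then show ?thesis by (simp add: extd_def)
qed

lemma extd_add: "fdiff \<omega> \<Longrightarrow> fdiff \<eta> \<Longrightarrow> extd (\<omega> + \<eta>) = extd \<omega> + extd \<eta>"
proof (rule ext, rule ext)
  fix p vs assume "fdiff \<omega>" "fdiff \<eta>"
  then have "extd (\<omega> + \<eta>) p vs = (\<Sum>i<length vs. (-1) ^ i *
      (frechet_derivative (\<lambda>q. \<omega> q (take i vs @ drop (Suc i) vs)) (at p) (vs ! i)
      + frechet_derivative (\<lambda>q. \<eta> q (take i vs @ drop (Suc i) vs)) (at p) (vs ! i)))"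
    by (intro extdI) (auto intro!: has_derivative_add fdiffD)
  then show "extd (\<omega> + \<eta>) p vs = (extd \<omega> + extd \<eta>) p vs"
    by (simp add: extd_def sum.distrib algebra_simps)
qed

lemma extd_fun_scale:
  assumes f: "\<And>p. f differentiable (at p)" and \<omega>: "fdiff \<omega>"
  shows "extd (\<lambda>p vs. f p * \<omega> p vs) =
    one_form (\<lambda>p v. frechet_derivative f (at p) v) \<and>\<^sub>w \<omega> + (\<lambda>p vs. f p * extd \<omega> p vs)"
proof (rule ext, rule ext)
  fix p vs
  have "extd (\<lambda>p vs. f p * \<omega> p vs) p vs = (\<Sum>i<length vs. (-1) ^ i *
      (f p * frechet_derivative (\<lambda>q. \<omega> q (take i vs @ drop (Suc i) vs)) (at p) (vs ! i)
      + frechet_derivative f (at p) (vs ! i) * \<omega> p (take i vs @ drop (Suc i) vs)))"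
    by (rule extdI) (intro has_derivative_mult fdiffD[OF \<omega>] f[unfolded frechet_derivative_works])
  then show "extd (\<lambda>p vs. f p * \<omega> p vs) p vs =
      (one_form (\<lambda>p v. frechet_derivative f (at p) v) \<and>\<^sub>w \<omega> + (\<lambda>p vs. f p * extd \<omega> p vs)) p vs"
    by (simp add: extd_def wedge_deg1 sum.distrib sum_distrib_left algebra_simps)
qed

lemma extd_fconst: "fconst \<omega> \<Longrightarrow> extd \<omega> = 0"
proof (rule ext, rule ext)
  fix p vs assume c: "fconst \<omega>"
  have "(\<lambda>q. \<omega> q us) = (\<lambda>_. \<omega> p us)" for us using c unfolding fconst_def fun_eq_iff by blast
  then have "((\<lambda>q. \<omega> q us) has_derivative (\<lambda>_. 0)) (at p)" for us by simp
  from extdI[of \<omega> "\<lambda>_ _. 0", OF this] show "extd \<omega> p vs = 0 p vs" by simp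
qed

lemma fconst_fdiff: "fconst \<omega> \<Longrightarrow> fdiff \<omega>"
proof (rule fdiff_I)
  fix p vs assume c: "fconst \<omega>"
  have "(\<lambda>q. \<omega> q vs) = (\<lambda>_. \<omega> p vs)" using c unfolding fconst_def fun_eq_iff by blast
  then show "((\<lambda>q. \<omega> q vs) has_derivative (\<lambda>_. 0)) (at p)" by simp
qed

lemma extd_scale: "fdiff \<omega> \<Longrightarrow> extd (c \<cdot>\<^sub>f \<omega>) = c \<cdot>\<^sub>f extd \<omega>"
proof (rule ext, rule ext)
  fix p vs assume "fdiff \<omega>"
  then have "extd (c \<cdot>\<^sub>f \<omega>) p vs = (\<Sum>i<length vs. (-1) ^ i *
      (c * frechet_derivative (\<lambda>q. \<omega> q (take i vs @ drop (Suc i) vs)) (at p) (vs ! i)))"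
    unfolding fscale_def by (intro extdI) (auto intro!: has_derivative_mult_right fdiffD)
  then show "extd (c \<cdot>\<^sub>f \<omega>) p vs = (c \<cdot>\<^sub>f extd \<omega>) p vs"
    by (simp add: extd_def fscale_def sum_distrib_left algebra_simps)
qed

lemma fdiff_add: "fdiff \<omega> \<Longrightarrow> fdiff \<eta> \<Longrightarrow> fdiff (\<omega> + \<eta>)"
  and fdiff_scale: "fdiff \<omega> \<Longrightarrow> fdiff (c \<cdot>\<^sub>f \<omega>)"
  and fdiff_cnjf: "fdiff \<omega> \<Longrightarrow> fdiff (cnjf \<omega>)"
  by (rule fdiff_I, simp add: fscale_def cnjf_def,
      rule has_derivative_add has_derivative_mult_right bounded_linear.has_derivative[OF bounded_linear_cnj], (erule fdiffD)+)+

lemma fdiff_fun_scale: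
  "(\<And>p. f differentiable (at p)) \<Longrightarrow> fdiff \<omega> \<Longrightarrow> fdiff (\<lambda>p vs. f p * \<omega> p vs)"
  unfolding fdiff_def by (intro allI differentiable_mult) auto

lemma fdiff_minus: "fdiff \<omega> \<Longrightarrow> fdiff (- \<omega>)"
  using fdiff_scale[of \<omega> "- 1"] by simp

lemma extd_minus: "fdiff \<omega> \<Longrightarrow> extd (- \<omega>) = - extd \<omega>"
  using extd_scale[of \<omega> "- 1"] by simp

lemma extd_diff: "fdiff \<omega> \<Longrightarrow> fdiff \<eta> \<Longrightarrow> extd (\<omega> - \<eta>) = extd \<omega> - extd \<eta>"
  using extd_add[OF _ fdiff_minus, of \<omega> \<eta>] extd_minus[of \<eta>] by simp

lemma extd_cnjf: "fdiff \<omega> \<Longrightarrow> extd (cnjf \<omega>) = cnjf (extd \<omega>)"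
proof (rule ext, rule ext)
  fix p vs assume "fdiff \<omega>"
  then have "extd (cnjf \<omega>) p vs = (\<Sum>i<length vs. (-1) ^ i *
      (cnj (frechet_derivative (\<lambda>q. \<omega> q (take i vs @ drop (Suc i) vs)) (at p) (vs ! i))))"
    unfolding cnjf_def
    by (intro extdI bounded_linear.has_derivative[OF bounded_linear_cnj]) (rule fdiffD)
  then show "extd (cnjf \<omega>) p vs = cnjf (extd \<omega>) p vs"
    by (simp add: extd_def cnjf_def)
qed

text \<open>Cartan's formula for a constant field, whose Lie derivative is the directional
  derivative.\<close>

lemma extd_Cons:
  "extd \<omega> p (v # vs) = frechet_derivative (\<lambda>q. \<omega> q vs) (at p) v - extd (\<lambda>q us. \<omega> q (v # us)) p vs"
  by (simp add: extd_def sum.lessThan_Suc_shift sum_negf del: sum.lessThan_Suc)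

lemma wedge_fconst_has_derivative:
  assumes a: "deg1 a" "fconst a" and \<omega>: "fdiff \<omega>"
  shows "((\<lambda>q. (a \<and>\<^sub>w \<omega>) q vs) has_derivative
    (\<lambda>v. (a \<and>\<^sub>w (\<lambda>q us. frechet_derivative (\<lambda>r. \<omega> r us) (at q) v)) p vs)) (at p)"
proof -
  have "(\<lambda>q. (a \<and>\<^sub>w \<omega>) q vs) = (\<lambda>q. \<Sum>i<length vs. (-1) ^ i * a p [vs ! i] * \<omega> q (take i vs @ drop (Suc i) vs))"
  proof
    fix q
    have "a q us = a p us" for us using a(2) by (auto simp: fconst_def)
    then show "(a \<and>\<^sub>w \<omega>) q vs = (\<Sum>i<length vs. (-1) ^ i * a p [vs ! i] * \<omega> q (take i vs @ drop (Suc i) vs))"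
      by (simp add: wedge_deg1[OF a(1)])
  qed
  moreover have "((\<lambda>q. \<Sum>i<length vs. (-1) ^ i * a p [vs ! i] * \<omega> q (take i vs @ drop (Suc i) vs)) has_derivative
    (\<lambda>v. \<Sum>i<length vs. (-1) ^ i * a p [vs ! i] * frechet_derivative (\<lambda>r. \<omega> r (take i vs @ drop (Suc i) vs)) (at p) v)) (at p)"
    by (intro has_derivative_sum has_derivative_mult_right fdiffD[OF \<omega>])
  ultimately show ?thesis by (simp add: wedge_deg1[OF a(1)])
qed

lemma fdiff_wedge_fconst: "deg1 a \<Longrightarrow> fconst a \<Longrightarrow> fdiff \<omega> \<Longrightarrow> fdiff (a \<and>\<^sub>w \<omega>)"
  by (rule fdiff_I) (rule wedge_fconst_has_derivative)

text \<open>The Leibniz rule for a factor that is closed because its coefficients are constant. The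
  induction over the arguments combines Cartan's formula with \<open>wedge_Cons\<close>; the
  directional derivative passes through the constant factor.\<close>

lemma extd_wedge_fconst:
  assumes a: "deg1 a" "fconst a"
  shows "fdiff \<omega> \<Longrightarrow> extd (a \<and>\<^sub>w \<omega>) = - (a \<and>\<^sub>w extd \<omega>)"
proof (rule ext, rule ext)
  fix p vs assume "fdiff \<omega>"
  then show "extd (a \<and>\<^sub>w \<omega>) p vs = (- (a \<and>\<^sub>w extd \<omega>)) p vs"
  proof (induction vs arbitrary: \<omega>)
    case Nil
    then show ?case by (simp add: extd_def wedge_Nil a)
  next
    case (Cons v vs)
    let ?i = "\<lambda>q us. \<omega> q (v # us)"
    let ?D = "\<lambda>q us. frechet_derivative (\<lambda>r. \<omega> r us) (at q) v"
    have fi: "fdiff ?i" using Cons.prems by (simp add: fdiff_def)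
    have av: "a q [v] = a p [v]" for q using a(2) by (auto simp: fconst_def)
    have "(\<lambda>q us. (a \<and>\<^sub>w \<omega>) q (v # us)) = a p [v] \<cdot>\<^sub>f \<omega> - (a \<and>\<^sub>w ?i)"
      using av by (simp add: fun_eq_iff wedge_Cons[OF a(1)] fscale_def)
    then have "extd (\<lambda>q us. (a \<and>\<^sub>w \<omega>) q (v # us)) p vs = a p [v] * extd \<omega> p vs - extd (a \<and>\<^sub>w ?i) p vs"
      using Cons.prems fi by (simp add: extd_diff extd_scale fdiff_scale fdiff_wedge_fconst a) (simp add: fscale_def)
    moreover have "frechet_derivative (\<lambda>q. (a \<and>\<^sub>w \<omega>) q vs) (at p) v = (a \<and>\<^sub>w ?D) p vs"
      using frechet_derivative_at[OF wedge_fconst_has_derivative[OF a Cons.prems]] by metis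
    ultimately have L: "extd (a \<and>\<^sub>w \<omega>) p (v # vs) = (a \<and>\<^sub>w ?D) p vs - (a p [v] * extd \<omega> p vs + (a \<and>\<^sub>w extd ?i) p vs)"
      using Cons.IH[OF fi] by (simp add: extd_Cons)
    have "(\<lambda>q us. extd \<omega> q (v # us)) = ?D - extd ?i"
      by (simp add: fun_eq_iff extd_Cons)
    then have "(a \<and>\<^sub>w extd \<omega>) p (v # vs) = a p [v] * extd \<omega> p vs - ((a \<and>\<^sub>w ?D) p vs - (a \<and>\<^sub>w extd ?i) p vs)"
      using wedge_diff[OF a(1)] by (simp only: wedge_Cons[OF a(1)]) simp
    then show ?case using L by simp
  qed
qed

lemma fconst_add: "fconst \<omega> \<Longrightarrow> fconst \<eta> \<Longrightarrow> fconst (\<omega> + \<eta>)"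
  and fconst_scale: "fconst \<omega> \<Longrightarrow> fconst (c \<cdot>\<^sub>f \<omega>)"
  and fconst_cnjf: "fconst \<omega> \<Longrightarrow> fconst (cnjf \<omega>)"
  unfolding fconst_def fscale_def cnjf_def plus_fun_def
  by (intro allI arg_cong2[where f = "(+)"] arg_cong2[where f = "(*)"] arg_cong[where f = cnj] refl; blast)+

lemma fconst_wedge: "fconst \<omega> \<Longrightarrow> fconst \<eta> \<Longrightarrow> fconst (\<omega> \<and>\<^sub>w \<eta>)"
  unfolding fconst_def wedge_def by (intro allI sum.cong refl arg_cong2[where f = times]) auto

section \<open>Smooth one-forms, their products and subspaces of forms\<close>

definition is1 :: "'v::real_normed_vector cform \<Rightarrow> bool" where
  "is1 a \<longleftrightarrow> deg1 a \<and> (\<forall>p. linear (\<lambda>v. a p [v])) \<and> (\<forall>v. smooth_on UNIV (\<lambda>p. a p [v]))"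

lemma is1_deg1: "is1 a \<Longrightarrow> deg1 a"
  by (simp add: is1_def)

lemma is1_smooth: "is1 a \<Longrightarrow> smooth_on UNIV (\<lambda>p. a p vs)"
proof (cases "length vs = 1")
  case True
  then show "is1 a \<Longrightarrow> ?thesis" by (auto simp: is1_def length_Suc_conv)
next
  case False
  then have "is1 a \<Longrightarrow> (\<lambda>p. a p vs) = (\<lambda>p. 0)" by (auto simp: is1_def deg1_def)
  then show "is1 a \<Longrightarrow> ?thesis" by (simp add: smooth_on_const)
qed

lemma is1_fdiff: "is1 a \<Longrightarrow> fdiff a"
  unfolding fdiff_def using is1_smooth smooth_on_differentiable by blast

lemma is1_add: "is1 a \<Longrightarrow> is1 b \<Longrightarrow> is1 (a + b)"
  and is1_scale: "is1 a \<Longrightarrow> is1 (c \<cdot>\<^sub>f a)"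
  and is1_cnjf: "is1 a \<Longrightarrow> is1 (cnjf a)"
proof -
  show "is1 (a + b)" if "is1 a" "is1 b"
    using that by (auto simp: is1_def linear_iff algebra_simps intro!: smooth_on_add)
  show "is1 (c \<cdot>\<^sub>f a)" if "is1 a"
    unfolding is1_def
  proof (intro conjI allI)
    show "deg1 (c \<cdot>\<^sub>f a)" using that by (intro deg1_simps) (simp add: is1_def)
  qed (use that in \<open>auto simp: is1_def fscale_def linear_iff algebra_simps intro!: smooth_on_mult smooth_on_const\<close>)
  show "is1 (cnjf a)" if "is1 a"
    unfolding is1_def
  proof (intro conjI allI)
    show "deg1 (cnjf a)" using that by (intro deg1_simps) (simp add: is1_def)
  qed (use that in \<open>auto simp: is1_def cnjf_def linear_iff intro!: smooth_on_cnj\<close>)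
qed

lemma is1_minus: "is1 a \<Longrightarrow> is1 (- a)"
  using is1_scale[of a "- 1"] by simp

lemma is1_diff: "is1 a \<Longrightarrow> is1 b \<Longrightarrow> is1 (a - b)"
  using is1_add[OF _ is1_minus, of a b] by simp

lemma is_kform_1: "is1 a \<Longrightarrow> is_kform 1 a"
  unfolding is_kform_def
  using is1_smooth[of a] by (auto simp: is1_def deg1_def length_Suc_conv)

lemma linear_mult_left: "linear f \<Longrightarrow> linear (\<lambda>v. c * f v :: complex)"
  and linear_mult_right: "linear f \<Longrightarrow> linear (\<lambda>v. f v * c :: complex)"
  by (simp_all add: linear_iff algebra_simps)

lemma is_kform_2: "is1 a \<Longrightarrow> is1 b \<Longrightarrow> is_kform 2 (a \<and>\<^sub>w b)"
proof -
  assume a: "is1 a" and b: "is1 b"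
  note w = wedge2[OF is1_deg1[OF a] is1_deg1[OF b]]
  have l: "linear (\<lambda>v. a p [v])" "linear (\<lambda>v. b p [v])" for p using a b by (auto simp: is1_def)
  have s: "smooth_on UNIV (\<lambda>p. a p [v])" "smooth_on UNIV (\<lambda>p. b p [v])" for v using a b by (auto simp: is1_def)
  show ?thesis
    unfolding is_kform_def
  proof (intro conjI allI impI)
    fix p and vs :: "'a list" assume "length vs \<noteq> 2"
    then show "(a \<and>\<^sub>w b) p vs = 0" by (auto simp: w split: list.splits)
  next
    fix p and i :: nat and vs :: "'a list" assume *: "length vs = 2 \<and> i < 2"
    then obtain x y where "vs = [x, y]" by (auto simp: length_Suc_conv numeral_eq_Suc)
    moreover have "i = 0 \<or> i = 1" using * by auto
    ultimately show "linear (\<lambda>v. (a \<and>\<^sub>w b) p (vs[i := v]))"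
      by (auto simp: w intro!: linear_compose_sub linear_mult_left linear_mult_right l)
  next
    fix p and i j :: nat and vs :: "'a list" assume "length vs = 2 \<and> i < j \<and> j < 2 \<and> vs ! i = vs ! j"
    then obtain x where "vs = [x, x]" by (auto simp: length_Suc_conv numeral_eq_Suc less_Suc_eq)
    then show "(a \<and>\<^sub>w b) p vs = 0" by (simp add: w)
  next
    fix vs :: "'a list"
    show "smooth_on UNIV (\<lambda>p. (a \<and>\<^sub>w b) p vs)"
      unfolding w by (cases vs rule: remdups_adj.cases; cases "tl (tl vs)") (auto split: list.split intro!: smooth_on_diff smooth_on_mult smooth_on_const s)
  qed
qed

lemma is_kform_3: "is1 a \<Longrightarrow> is1 b \<Longrightarrow> is1 c \<Longrightarrow> is_kform 3 (a \<and>\<^sub>w b \<and>\<^sub>w c)"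
proof -
  assume a: "is1 a" and b: "is1 b" and c: "is1 c"
  note w = wedge3[OF is1_deg1[OF a] is1_deg1[OF b] is1_deg1[OF c]]
  have l: "linear (\<lambda>v. a p [v])" "linear (\<lambda>v. b p [v])" "linear (\<lambda>v. c p [v])" for p
    using a b c by (auto simp: is1_def)
  have s: "smooth_on UNIV (\<lambda>p. a p [v])" "smooth_on UNIV (\<lambda>p. b p [v])" "smooth_on UNIV (\<lambda>p. c p [v])" for v
    using a b c by (auto simp: is1_def)
  show ?thesis
    unfolding is_kform_def
  proof (intro conjI allI impI)
    fix p and vs :: "'a list" assume "length vs \<noteq> 3"
    then show "(a \<and>\<^sub>w b \<and>\<^sub>w c) p vs = 0" by (auto simp: w split: list.splits)
  next
    fix p and i :: nat and vs :: "'a list" assume *: "length vs = 3 \<and> i < 3"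
    then obtain x y z where "vs = [x, y, z]" by (auto simp: length_Suc_conv numeral_eq_Suc)
    moreover have "i = 0 \<or> i = 1 \<or> i = 2" using * by auto
    ultimately show "linear (\<lambda>v. (a \<and>\<^sub>w b \<and>\<^sub>w c) p (vs[i := v]))"
      by (auto simp: w numeral_eq_Suc intro!: linear_compose_sub linear_compose_add linear_mult_left linear_mult_right l)
  next
    fix p and i j :: nat and vs :: "'a list" assume *: "length vs = 3 \<and> i < j \<and> j < 3 \<and> vs ! i = vs ! j"
    then obtain x y z where "vs = [x, y, z]" by (auto simp: length_Suc_conv numeral_eq_Suc)
    moreover have "(i = 0 \<and> j = 1) \<or> (i = 0 \<and> j = 2) \<or> (i = 1 \<and> j = 2)" using * by auto
    ultimately show "(a \<and>\<^sub>w b \<and>\<^sub>w c) p vs = 0" using * by (auto simp: w numeral_eq_Suc algebra_simps)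
  next
    fix vs :: "'a list"
    show "smooth_on UNIV (\<lambda>p. (a \<and>\<^sub>w b \<and>\<^sub>w c) p vs)"
    proof (cases "length vs = 3")
      case True
      then obtain x y z where "vs = [x, y, z]" by (auto simp: length_Suc_conv numeral_eq_Suc)
      then show ?thesis
        by (auto simp: w intro!: smooth_on_diff smooth_on_add smooth_on_mult smooth_on_const s)
    next
      case False
      then have "(\<lambda>p. (a \<and>\<^sub>w b \<and>\<^sub>w c) p vs) = (\<lambda>p. 0)" by (intro ext) (auto simp: w split: list.split)
      then show ?thesis by (simp add: smooth_on_const)
    qed
  qed
qed

lemma is_kform_fun_scale: "is_kform k \<omega> \<Longrightarrow> smooth_on UNIV f \<Longrightarrow> is_kform k (\<lambda>p vs. f p * \<omega> p vs)"
  by (auto simp: is_kform_def intro!: linear_mult_left smooth_on_mult)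

lemma is_kform_add: "is_kform k \<omega> \<Longrightarrow> is_kform k \<eta> \<Longrightarrow> is_kform k (\<omega> + \<eta>)"
  by (auto simp: is_kform_def intro!: linear_compose_add smooth_on_add)

lemma is_kform_scale: "is_kform k \<omega> \<Longrightarrow> is_kform k (c \<cdot>\<^sub>f \<omega>)"
  unfolding fscale_def by (intro is_kform_fun_scale smooth_on_const) auto

lemma is_kform_0: "is_kform k 0"
  by (auto simp: is_kform_def linear_iff smooth_on_const)

lemma pullback_wedge: "pullback \<phi> (a \<and>\<^sub>w b) = pullback \<phi> a \<and>\<^sub>w pullback \<phi> b"
  by (simp add: pullback_def wedge_def nths_map)

lemma pullback_add: "pullback \<phi> (a + b) = pullback \<phi> a + pullback \<phi> b"
  and pullback_scale: "pullback \<phi> (c \<cdot>\<^sub>f a) = c \<cdot>\<^sub>f pullback \<phi> a"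
  and pullback_cnjf: "pullback \<phi> (cnjf a) = cnjf (pullback \<phi> a)"
  and pullback_0: "pullback \<phi> 0 = 0"
  by (simp_all add: pullback_def fscale_def cnjf_def fun_eq_iff)

lemma fsub_forms: "fsub (forms L k)"
  by (auto simp: fsub_def forms_def is_kform_add is_kform_scale is_kform_0 pullback_add pullback_scale pullback_0)

lemma forms_fdiff: "\<omega> \<in> forms L k \<Longrightarrow> fdiff \<omega>"
  by (auto simp: forms_def intro: is_kform_fdiff)

lemma extd_0: "extd 0 = 0"
  by (rule extd_fconst) (simp add: fconst_def)

lemma fsub_dR_closed: "fsub (dR_closed L k)"
  unfolding fsub_def dR_closed_def
  using fsub_forms[of L k] by (auto simp: fsub_def extd_add extd_scale extd_0 forms_fdiff)

lemma fsub_dR_exact: "fsub (dR_exact L k)"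
proof (cases k)
  case 0
  then show ?thesis by (auto simp: fsub_def dR_exact_def)
next
  case (Suc j)
  note f = fsub_forms[of L j]
  have "0 \<in> extd ` forms L j" using fsub_0[OF f] extd_0 by force
  moreover have "a + b \<in> extd ` forms L j" if "a \<in> extd ` forms L j" "b \<in> extd ` forms L j" for a b
    using that fsub_add[OF f] extd_add[OF forms_fdiff forms_fdiff] by (auto simp flip: extd_add[OF forms_fdiff forms_fdiff])
  moreover have "c \<cdot>\<^sub>f a \<in> extd ` forms L j" if "a \<in> extd ` forms L j" for a c
    using that fsub_scale[OF f] by (auto simp flip: extd_scale[OF forms_fdiff])
  ultimately show ?thesis using Suc by (simp add: fsub_def dR_exact_def)
qed

lemma fsub_zero: "fsub {0}"
  by (simp add: fsub_def)

section \<open>Types of derivatives\<close>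

context coframe
begin

lemma fsub_pq_forms: "fsub (pq_forms L \<theta> p q)"
  unfolding fsub_def pq_forms_def oftype_def[symmetric]
  using fsub_forms[of L "p + q"] by (auto simp: fsub_def intro: oftype_add oftype_scale oftype_0)

text \<open>Linearity of \<open>delbar\<close> holds where \<open>pq_part\<close> is linear, hence
  the hypothesis that the derivatives have expansions.\<close>

lemma fsub_Dol_exact:
  assumes "\<And>\<omega>. \<omega> \<in> pq_forms L \<theta> p q \<Longrightarrow> expandable (extd \<omega>)"
  shows "fsub (Dol_exact L \<theta> p (Suc q))"
proof -
  let ?P = "pq_forms L \<theta> p q" let ?d = "delbar \<theta> p q"
  note f = fsub_pq_forms[of L p q]
  have fd: "fdiff \<omega>" if "\<omega> \<in> ?P" for \<omega> using that forms_fdiff by (auto simp: pq_forms_def)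
  have d: "?d (a + b) = ?d a + ?d b" "?d (c \<cdot>\<^sub>f a) = c \<cdot>\<^sub>f ?d a" if "a \<in> ?P" "b \<in> ?P" for a b c
    using that assms fd by (simp_all add: delbar_def extd_add extd_scale pq_part_add pq_part_scale)
  have "?d 0 = 0" using d(2)[OF fsub_0[OF f] fsub_0[OF f], of 0] by simp
  then have "0 \<in> ?d ` ?P" using fsub_0[OF f] by force
  moreover have "a + b \<in> ?d ` ?P" if ab: "a \<in> ?d ` ?P" "b \<in> ?d ` ?P" for a b
  proof -
    obtain a' b' where *: "a' \<in> ?P" "b' \<in> ?P" "a = ?d a'" "b = ?d b'" using ab by blast
    show ?thesis unfolding *(3,4) d(1)[OF *(1,2), symmetric] using fsub_add[OF f *(1,2)] by (rule imageI)
  qed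
  moreover have "c \<cdot>\<^sub>f a \<in> ?d ` ?P" if a: "a \<in> ?d ` ?P" for a c
  proof -
    obtain a' where *: "a' \<in> ?P" "a = ?d a'" using a by blast
    show ?thesis unfolding *(2) d(2)[OF *(1,1), symmetric] using fsub_scale[OF f *(1)] by (rule imageI)
  qed
  ultimately show ?thesis by (simp add: fsub_def Dol_exact_def)
qed

lemma derivative_form:
  assumes "f differentiable (at p)"
  shows "(one_form (\<lambda>p v. frechet_derivative f (at p) v) \<and>\<^sub>w \<omega>) p vs
    = (\<Sum>k<2*n. dZ k f p * (co k \<and>\<^sub>w \<omega>) p vs)"
  using assms
  by (simp add: wedge_deg1 co_deg1 derivative_expand sum_distrib_left sum_distrib_right)
     (subst sum.swap, simp add: mult_ac)

end

lemma sum_form_apply: "(\<Sum>i\<in>I. \<omega> i) p vs = (\<Sum>i\<in>I. (\<omega> i :: 'v cform) p vs)"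
  by (induction I rule: infinite_finite_induct) simp_all

context coframe
begin

lemma mono_Cons: "mono (k # ks) = co k \<and>\<^sub>w mono ks"
  by (simp add: mono_def)

lemma co_wedge_mono_in: "set ks \<subseteq> {..<2 * n} \<Longrightarrow> k \<in> set ks \<Longrightarrow> co k \<and>\<^sub>w mono ks = 0"
proof (induction ks)
  case (Cons l ks)
  show ?case
  proof (cases "k = l")
    case True
    then show ?thesis using Cons.prems by (simp add: mono_Cons wedge_same co_deg1)
  next
    case False
    have "co k \<and>\<^sub>w mono (l # ks) = - (co l \<and>\<^sub>w co k \<and>\<^sub>w mono ks)"
      unfolding mono_Cons using Cons.prems False by (intro wedge_swap co_deg1) auto
    also have "co k \<and>\<^sub>w mono ks = 0" using Cons.prems False by (intro Cons.IH) auto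
    also have "co l \<and>\<^sub>w 0 = 0" using Cons.prems by (intro wedge_0 co_deg1) auto
    finally show ?thesis by (simp only: minus_zero)
  qed
qed simp

text \<open>Each transposition on the way to the sorted position costs a sign. Only the existence of
  the scalar is recorded, since types are invariant under scaling.\<close>

lemma co_wedge_mono_insort:
  "set ks \<subseteq> {..<2 * n} \<Longrightarrow> k < 2 * n \<Longrightarrow> k \<notin> set ks \<Longrightarrow>
    \<exists>s. co k \<and>\<^sub>w mono ks = s \<cdot>\<^sub>f mono (insort k ks)"
proof (induction ks)
  case Nil
  have "co k \<and>\<^sub>w mono [] = 1 \<cdot>\<^sub>f mono (insort k [])" by (simp only: fscale_simps insort_key.simps mono_Cons)
  then show ?case by blast
next
  case (Cons l ks)
  show ?case
  proof (cases "k \<le> l")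
    case True
    then have "co k \<and>\<^sub>w mono (l # ks) = 1 \<cdot>\<^sub>f mono (insort k (l # ks))"
      by (simp only: fscale_simps insort_key.simps mono_Cons[of k] if_True)
    then show ?thesis by blast
  next
    case False
    obtain s where s: "co k \<and>\<^sub>w mono ks = s \<cdot>\<^sub>f mono (insort k ks)" using Cons by auto
    have "co k \<and>\<^sub>w mono (l # ks) = - (co l \<and>\<^sub>w co k \<and>\<^sub>w mono ks)"
      unfolding mono_Cons using Cons.prems by (intro wedge_swap co_deg1) auto
    also have "co l \<and>\<^sub>w co k \<and>\<^sub>w mono ks = s \<cdot>\<^sub>f (co l \<and>\<^sub>w mono (insort k ks))"
      unfolding s using Cons.prems by (intro wedge_scale co_deg1) auto
    also have "- (s \<cdot>\<^sub>f (co l \<and>\<^sub>w mono (insort k ks))) = (- s) \<cdot>\<^sub>f mono (insort k (l # ks))"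
      using False by (simp add: mono_Cons fscale_def fun_eq_iff)
    finally show ?thesis by blast
  qed
qed

lemma set_idx: "I \<subseteq> {..<n} \<Longrightarrow> J \<subseteq> {..<n} \<Longrightarrow> set (idx I J) = I \<union> (+) n ` J"
  by (force simp: idx_def set_nths)

lemma idx_insort:
  assumes "sorted_wrt (<) (insort k (idx I J))" "I' \<subseteq> {..<n}" "J' \<subseteq> {..<n}"
    "set (insort k (idx I J)) = I' \<union> (+) n ` J'"
  shows "insort k (idx I J) = idx I' J'"
  using assms set_idx[OF assms(2,3)] idx_sorted strict_sorted_equal by metis

lemma co_wedge_monomial:
  assumes I: "I \<subseteq> {..<n}" "J \<subseteq> {..<n}" and k: "k < 2 * n"
  shows "oftype (if k < n then Suc (card I) else card I) (if k < n then card J else Suc (card J))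
    (co k \<and>\<^sub>w monomial \<theta> I J)"
proof (cases "k \<in> set (idx I J)")
  case True
  then have "co k \<and>\<^sub>w monomial \<theta> I J = 0"
    unfolding monomial_eq by (intro co_wedge_mono_in idx_set)
  then show ?thesis using oftype_0 by simp
next
  case False
  obtain s where s: "co k \<and>\<^sub>w monomial \<theta> I J = s \<cdot>\<^sub>f mono (insort k (idx I J))"
    unfolding monomial_eq using co_wedge_mono_insort[OF idx_set k False] by blast
  have srt: "sorted_wrt (<) (insort k (idx I J))"
    using idx_sorted[of I J] False by (simp add: strict_sorted_iff sorted_insort distinct_insort)
  have fin: "finite I" "finite J" using I finite_subset by blast+
  show ?thesis
  proof (cases "k < n")
    case True
    have "insort k (idx I J) = idx (insert k I) J"
      using I True by (intro idx_insort srt) (auto simp: set_insort_key set_idx)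
    moreover have "k \<notin> I" using False set_idx[OF I] by auto
    ultimately show ?thesis
      unfolding s using oftype_monomial[of "insert k I" J] I True fin
      by (auto simp: monomial_eq intro!: oftype_scale)
  next
    case kn: False
    then have kk: "k = n + (k - n)" "k - n < n" using k by auto
    have "insort k (idx I J) = idx I (insert (k - n) J)"
      using I kk by (intro idx_insort srt) (auto simp: set_insort_key set_idx)
    moreover have "k - n \<notin> J" using False set_idx[OF I] kk by auto
    ultimately show ?thesis
      unfolding s using oftype_monomial[of I "insert (k - n) J"] I kk fin kn
      by (auto simp: monomial_eq intro!: oftype_scale)
  qed
qed

lemma oftype_wedge:
  assumes "oftype p q \<omega>" and k: "k < 2 * n"
  shows "oftype (if k < n then Suc p else p) (if k < n then q else Suc q) (co k \<and>\<^sub>w \<omega>)"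
proof -
  obtain c where c: "\<omega> = expansion \<theta> (pq_idx \<theta> p q) c" using assms(1) by (auto simp: oftype_def)
  have "\<omega> = (\<lambda>u vs. \<Sum>s\<in>pq_idx \<theta> p q. c s u * monomial \<theta> (fst s) (snd s) u vs)"
    unfolding c by (simp add: expansion_def split_beta)
  then have e: "co k \<and>\<^sub>w \<omega> = (\<lambda>u vs. \<Sum>s\<in>pq_idx \<theta> p q. c s u * (co k \<and>\<^sub>w monomial \<theta> (fst s) (snd s)) u vs)"
    by (simp only: wedge_sum[OF co_deg1[OF k]])
  also have "\<dots> = (\<Sum>s\<in>pq_idx \<theta> p q. (\<lambda>u vs. c s u * (co k \<and>\<^sub>w monomial \<theta> (fst s) (snd s)) u vs))"
    by (simp add: fun_eq_iff sum_form_apply)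
  finally have e: "co k \<and>\<^sub>w \<omega> = (\<Sum>s\<in>pq_idx \<theta> p q. (\<lambda>u vs. c s u * (co k \<and>\<^sub>w monomial \<theta> (fst s) (snd s)) u vs))" .
  show ?thesis
    unfolding e
  proof (rule oftype_sum, rule oftype_mult)
    fix s assume "s \<in> pq_idx \<theta> p q"
    then have "fst s \<subseteq> {..<n}" "snd s \<subseteq> {..<n}" "card (fst s) = p" "card (snd s) = q"
      using len by (auto simp: pq_idx_def all_idx_def)
    then show "oftype (if k < n then Suc p else p) (if k < n then q else Suc q) (co k \<and>\<^sub>w monomial \<theta> (fst s) (snd s))"
      using co_wedge_monomial[OF _ _ k, of "fst s" "snd s"] by metis
  qed
qed

text \<open>With g k = dZ k f this is the wedge product of \<omega> with \<partial>f for the first n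
  indices and with d-bar f for the last n.\<close>

definition dform :: "(nat \<Rightarrow> 'v \<Rightarrow> complex) \<Rightarrow> nat set \<Rightarrow> 'v cform \<Rightarrow> 'v cform" where
  "dform g K \<omega> = (\<Sum>k\<in>K. (\<lambda>u vs. g k u * (co k \<and>\<^sub>w \<omega>) u vs))"

lemma oftype_dform:
  assumes "oftype p q \<omega>"
  shows "oftype (Suc p) q (dform g {..<n} \<omega>)" "oftype p (Suc q) (dform g {n..<2*n} \<omega>)"
proof -
  show "oftype (Suc p) q (dform g {..<n} \<omega>)"
    unfolding dform_def
  proof (rule oftype_sum, rule oftype_mult)
    fix k assume "k \<in> {..<n}"
    then show "oftype (Suc p) q (co k \<and>\<^sub>w \<omega>)" using oftype_wedge[OF assms, of k] by simp
  qed
  show "oftype p (Suc q) (dform g {n..<2*n} \<omega>)"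
    unfolding dform_def
  proof (rule oftype_sum, rule oftype_mult)
    fix k assume "k \<in> {n..<2*n}"
    then show "oftype p (Suc q) (co k \<and>\<^sub>w \<omega>)" using oftype_wedge[OF assms, of k] by simp
  qed
qed

lemma extd_fun_scale_dform:
  assumes f: "\<And>p. f differentiable (at p)" and \<omega>: "fdiff \<omega>"
  shows "extd (\<lambda>p vs. f p * \<omega> p vs) =
    dform (\<lambda>k. dZ k f) {..<n} \<omega> + dform (\<lambda>k. dZ k f) {n..<2*n} \<omega> + (\<lambda>p vs. f p * extd \<omega> p vs)"
proof -
  have "{..<2*n} = {..<n} \<union> {n..<2*n}" "{..<n} \<inter> {n..<2*n} = {}" by auto
  then have "one_form (\<lambda>p v. frechet_derivative f (at p) v) \<and>\<^sub>w \<omega>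
      = dform (\<lambda>k. dZ k f) {..<n} \<omega> + dform (\<lambda>k. dZ k f) {n..<2*n} \<omega>"
    by (intro ext) (simp add: derivative_form f dform_def sum_form_apply sum.union_disjoint)
  then show ?thesis using extd_fun_scale[OF f \<omega>] by simp
qed

text \<open>For closed \<omega> the derivative of f \<omega> is df wedged with \<omega>, and its two
  halves have different types, so the d-bar part is the half with the conjugate coframe.\<close>

lemma pq_part_extd_fun_scale:
  assumes f: "\<And>p. f differentiable (at p)" and \<omega>: "fdiff \<omega>" "oftype p q \<omega>" "extd \<omega> = 0"
  shows "expandable (extd (\<lambda>p vs. f p * \<omega> p vs))"
    and "pq_part \<theta> p (Suc q) (extd (\<lambda>p vs. f p * \<omega> p vs)) = dform (\<lambda>k. dZ k f) {n..<2*n} \<omega>"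
proof -
  have e: "extd (\<lambda>p vs. f p * \<omega> p vs) = dform (\<lambda>k. dZ k f) {..<n} \<omega> + dform (\<lambda>k. dZ k f) {n..<2*n} \<omega>"
    unfolding extd_fun_scale_dform[OF f \<omega>(1)] \<omega>(3) by (simp add: fun_eq_iff)
  note o = oftype_dform[OF \<omega>(2)]
  show "expandable (extd (\<lambda>p vs. f p * \<omega> p vs))"
    unfolding e by (intro expandable_add oftype_expandable[OF o(1)] oftype_expandable[OF o(2)])
  show "pq_part \<theta> p (Suc q) (extd (\<lambda>p vs. f p * \<omega> p vs)) = dform (\<lambda>k. dZ k f) {n..<2*n} \<omega>"
    unfolding e by (rule pq_part_sum2[OF o(1) o(2)]) simp
qed

end

section \<open>The base torus\<close>

definition vec2 :: "complex \<Rightarrow> complex \<Rightarrow> complex^2" where "vec2 a b = vector [a, b]"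

lemma vec2_nth [simp]: "vec2 a b $ 1 = a" "vec2 a b $ 2 = b"
  by (simp_all add: vec2_def)

lemma vec2_eq_iff: "(u :: complex^2) = v \<longleftrightarrow> u $ 1 = v $ 1 \<and> u $ 2 = v $ 2"
  by (simp add: vec_eq_iff forall_2)

text \<open>The map z + T cnj z gives the holomorphic coordinates of B_t as real-linear functions on
  the fixed space; its components are the values of the coframe.\<close>

definition Sm :: "param \<Rightarrow> complex^2 \<Rightarrow> complex^2" where
  "Sm t z = vec2 (z$1 + t$1$1 * cnj (z$1) + t$1$2 * cnj (z$2)) (z$2 + t$2$1 * cnj (z$1) + t$2$2 * cnj (z$2))"

definition Rm :: "param \<Rightarrow> complex^2 \<Rightarrow> complex^2" where
  "Rm t = inv (Sm t)"

text \<open>The determinant of \<open>1 - T cnj T\<close> for the matrix \<open>T\<close> of the first two rows of \<open>t\<close>.\<close>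

definition NN :: "param \<Rightarrow> complex" where
  "NN t = 1 - (t$1$1 * cnj (t$1$1) + t$1$2 * cnj (t$2$1) + t$2$1 * cnj (t$1$2) + t$2$2 * cnj (t$2$2)) + D t * cnj (D t)"

lemma linear_Sm: "linear (Sm t)"
  by (rule linearI) (auto simp: Sm_def vec2_eq_iff algebra_simps scaleR_conv_of_real[where 'a = complex])

lemma small_entries:
  assumes "norm t < 1/4"
  shows "cmod (t$i$j) < 1/4"
  using Finite_Cartesian_Product.norm_nth_le[of "t$i" j] Finite_Cartesian_Product.norm_nth_le[of t i] assms by linarith

lemma small_D:
  assumes "norm t < 1/4"
  shows "cmod (D t) < 1/8"
proof -
  have p: "cmod (t$i$j * t$k$l) < 1/16" for i j k l
  proof -
    have "cmod (t$i$j * t$k$l) < (1/4) * (1/4)"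
      unfolding norm_mult by (intro mult_strict_mono' small_entries assms) auto
    then show ?thesis by simp
  qed
  have "cmod (D t) \<le> cmod (t$1$1 * t$2$2) + cmod (t$1$2 * t$2$1)"
    unfolding D_def by (rule norm_triangle_ineq4)
  then show ?thesis using p[of 1 1 2 2] p[of 1 2 2 1] by linarith
qed

lemma NN_nonzero:
  assumes "norm t < 1/4"
  shows "NN t \<noteq> 0"
proof
  assume "NN t = 0"
  define a b c d where "a = t$1$1 * cnj (t$1$1)" "b = t$1$2 * cnj (t$2$1)" "c = t$2$1 * cnj (t$1$2)" "d = t$2$2 * cnj (t$2$2)"
  have p: "cmod (t$i$j * cnj (t$k$l)) < 1/16" for i j k l
  proof -
    have "cmod (t$i$j * cnj (t$k$l)) < (1/4) * (1/4)"
      unfolding norm_mult complex_mod_cnj by (intro mult_strict_mono' small_entries assms) auto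
    then show ?thesis by simp
  qed
  have "cmod (D t * cnj (D t)) < (1/8) * (1/8)"
    unfolding norm_mult complex_mod_cnj using small_D[OF assms] by (intro mult_strict_mono') auto
  moreover have "1 = a + b + c + d - D t * cnj (D t)"
    using \<open>NN t = 0\<close> by (simp add: NN_def a_b_c_d_def algebra_simps)
  then have "1 = cmod (a + b + c + d - D t * cnj (D t))" by (metis norm_one)
  moreover have "cmod (a + b + c + d - D t * cnj (D t)) \<le> cmod a + cmod b + cmod c + cmod d + cmod (D t * cnj (D t))"
    by (meson add_mono norm_triangle_ineq norm_triangle_ineq4 order_refl order_trans)
  moreover have "cmod a < 1/16" "cmod b < 1/16" "cmod c < 1/16" "cmod d < 1/16"
    unfolding a_b_c_d_def by (rule p)+
  ultimately show False by linarith
qed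

text \<open>On the kernel each coordinate is bounded by a quarter of the sum of both moduli, so this
  sum is at most half of itself.\<close>

lemma Sm_inj:
  assumes "norm t < 1/4"
  shows "inj (Sm t)"
proof -
  have "z = 0" if "Sm t z = 0" for z
  proof -
    have e: "z$1 = - (t$1$1 * cnj (z$1) + t$1$2 * cnj (z$2))" "z$2 = - (t$2$1 * cnj (z$1) + t$2$2 * cnj (z$2))"
      unfolding eq_neg_iff_add_eq_0 using that by (simp_all add: Sm_def vec2_eq_iff add.assoc)
    have b: "cmod (u * cnj a + v * cnj b) \<le> 1/4 * cmod a + 1/4 * cmod b"
      if "cmod u < 1/4" "cmod v < 1/4" for u v a b
    proof -
      have "cmod (u * cnj a + v * cnj b) \<le> cmod u * cmod a + cmod v * cmod b"
        by (rule order_trans[OF norm_triangle_ineq]) (simp add: norm_mult)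
      also have "\<dots> \<le> 1/4 * cmod a + 1/4 * cmod b" using that by (intro add_mono mult_right_mono) auto
      finally show ?thesis .
    qed
    have "cmod (z$1) \<le> 1/4 * cmod (z$1) + 1/4 * cmod (z$2)"
      by (subst e(1)) (simp only: norm_minus_cancel b small_entries assms)
    moreover have "cmod (z$2) \<le> 1/4 * cmod (z$1) + 1/4 * cmod (z$2)"
      by (subst e(2)) (simp only: norm_minus_cancel b small_entries assms)
    ultimately have "cmod (z$1) \<le> 0 \<and> cmod (z$2) \<le> 0"
      using norm_ge_zero[of "z$1"] norm_ge_zero[of "z$2"] by linarith
    then show ?thesis by (simp add: vec2_eq_iff)
  qed
  then show ?thesis using linear_injective_0[OF linear_Sm] by blast
qed

lemma Sm_Rm: "norm t < 1/4 \<Longrightarrow> Sm t (Rm t z) = z"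
  and Rm_Sm: "norm t < 1/4 \<Longrightarrow> Rm t (Sm t z) = z"
  and linear_Rm: "norm t < 1/4 \<Longrightarrow> linear (Rm t)"
  using Sm_inj[of t] linear_injective_imp_surjective[OF linear_Sm Sm_inj, of t]
    inj_linear_imp_inv_linear[OF linear_Sm Sm_inj, of t]
  by (simp_all add: Rm_def surj_f_inv_f)

text \<open>Together with \<open>yB\<close> the real and imaginary coordinate directions of B_t,
  pulled back by the inverse of \<open>Sm t\<close>. The fields are constant; the point
  \<open>p\<close> is there to fit the locale \<open>coframe\<close>.\<close>

definition xB :: "param \<Rightarrow> nat \<Rightarrow> complex^2 \<Rightarrow> complex^2" where
  "xB t j p = Rm t (if j = 0 then vec2 1 0 else vec2 0 1)"
definition yB :: "param \<Rightarrow> nat \<Rightarrow> complex^2 \<Rightarrow> complex^2" where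
  "yB t j p = Rm t (if j = 0 then vec2 \<i> 0 else vec2 0 \<i>)"

lemma coframe_B_eval: "\<alpha>Bt t p [v] = Sm t v $ 1" "\<beta>Bt t p [v] = Sm t v $ 2"
  by (simp_all add: \<alpha>Bt_def \<beta>Bt_def \<alpha>B_def \<beta>B_def fscale_def cnjf_def Sm_def)

lemma vec2_expand: "z = Re (z$1) *\<^sub>R vec2 1 0 + Im (z$1) *\<^sub>R vec2 \<i> 0 + Re (z$2) *\<^sub>R vec2 0 1 + Im (z$2) *\<^sub>R vec2 0 \<i>"
  by (simp add: vec2_eq_iff complex_eq_iff)

lemma less2: "(i::nat) < 2 \<longleftrightarrow> i = 0 \<or> i = 1"
  by auto

lemma coframe_B:
  assumes "norm t < 1/4"
  shows "coframe (coframe_B t) 2 (xB t) (yB t)"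
proof
  show "length (coframe_B t) = 2" by (simp add: coframe_B_def)
  show "deg1 (coframe_B t ! i)" if "i < 2" for i
    using that by (auto simp: coframe_B_def less2)
  show "(coframe_B t ! i) p [xB t j p] = (if i = j then 1 else 0)"
    "(coframe_B t ! i) p [yB t j p] = (if i = j then \<i> else 0)" if "i < 2" "j < 2" for i j p
    using that by (auto simp: coframe_B_def less2 coframe_B_eval xB_def yB_def Sm_Rm[OF assms])
  fix v p
  have "v = Rm t (Sm t v)" using assms by (simp add: Rm_Sm)
  also have "\<dots> = Re (Sm t v $ 1) *\<^sub>R Rm t (vec2 1 0) + Im (Sm t v $ 1) *\<^sub>R Rm t (vec2 \<i> 0)
      + Re (Sm t v $ 2) *\<^sub>R Rm t (vec2 0 1) + Im (Sm t v $ 2) *\<^sub>R Rm t (vec2 0 \<i>)"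
    by (subst vec2_expand[of "Sm t v"]) (simp add: linear_add[OF linear_Rm[OF assms]] linear_cmul[OF linear_Rm[OF assms]])
  finally show "v = (\<Sum>j<2. Re ((coframe_B t ! j) p [v]) *\<^sub>R xB t j p + Im ((coframe_B t ! j) p [v]) *\<^sub>R yB t j p)"
    by (simp add: coframe_B_def coframe_B_eval xB_def yB_def lessThan_Suc numeral_2_eq_2 add_ac)
qed

section \<open>Invariant forms on the torus and their coefficients\<close>

lemma gauss_lattice: "(\<forall>i. (g::complex^2) $ i \<in> gauss_ints) \<longleftrightarrow> g \<in> lattice"
  unfolding lattice_def Basis_vec_def
  by (auto simp: gauss_ints_def Basis_complex_def inner_axis complex_inner_1_right complex_inner_i_right)

lemma periodic_lattice:
  fixes k :: "'a::euclidean_space"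
  assumes "periodic f" "k \<in> lattice"
  shows "f (x + k) = f x"
proof -
  have "f (x + (\<Sum>b\<in>B. (k \<bullet> b) *\<^sub>R b)) = f x" if "finite B" "B \<subseteq> Basis" for B
    using that
  proof (induction B arbitrary: x)
    case (insert b B)
    have "k \<bullet> b \<in> \<int>" using assms(2) insert.prems by (auto simp: lattice_def)
    then obtain m where m: "k \<bullet> b = of_int m" by (rule Ints_cases)
    have "f (x + (\<Sum>b\<in>insert b B. (k \<bullet> b) *\<^sub>R b)) = f ((x + (\<Sum>b\<in>B. (k \<bullet> b) *\<^sub>R b)) + of_int m *\<^sub>R b)"
      using insert.hyps m by (simp add: add_ac)
    then show ?case using insert periodic_int[OF assms(1), of b] by simp
  qed simp
  from this[of Basis] show ?thesis by (simp add: euclidean_representation)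
qed

lemma lattice_B_eq: "lattice_B = {\<lambda>z. g + z | g. g \<in> lattice}"
  unfolding lattice_B_def gauss_lattice by (rule refl)

lemma pullback_translation: "pullback (\<lambda>z. g + z) \<omega> = (\<lambda>p vs. \<omega> (g + p) vs)"
proof -
  have "((\<lambda>z. g + z) has_derivative (\<lambda>v. v)) (at p)" for p by (auto intro!: derivative_eq_intros)
  then have "frechet_derivative (\<lambda>z. g + z) (at p) = (\<lambda>v. v)" for p
    using frechet_derivative_at by metis
  then show ?thesis by (simp add: pullback_def)
qed

text \<open>A translation has identity derivative, so pulling back only moves the base point and
  invariance is periodicity of every value on constant vectors.\<close>

lemma forms_B_iff: "\<omega> \<in> forms lattice_B k \<longleftrightarrow> is_kform k \<omega> \<and> (\<forall>vs. periodic (\<lambda>p. \<omega> p vs))"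
proof -
  have "(\<forall>\<phi>\<in>lattice_B. pullback \<phi> \<omega> = \<omega>) \<longleftrightarrow> (\<forall>vs. periodic (\<lambda>p. \<omega> p vs))"
  proof
    assume L: "\<forall>\<phi>\<in>lattice_B. pullback \<phi> \<omega> = \<omega>"
    show "\<forall>vs. periodic (\<lambda>p. \<omega> p vs)"
      unfolding periodic_def
    proof (intro allI ballI)
      fix vs p and b :: "complex^2" assume "b \<in> Basis"
      then have "(\<lambda>z. b + z) \<in> lattice_B" using lattice_Basis by (auto simp: lattice_B_eq)
      with L have "pullback (\<lambda>z. b + z) \<omega> = \<omega>" by (rule bspec)
      then have "(\<lambda>p vs. \<omega> (b + p) vs) = \<omega>" by (simp only: pullback_translation)
      from fun_cong[OF fun_cong[OF this, of p], of vs] show "\<omega> (p + b) vs = \<omega> p vs"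
        by (simp add: add.commute)
    qed
  next
    assume P: "\<forall>vs. periodic (\<lambda>p. \<omega> p vs)"
    show "\<forall>\<phi>\<in>lattice_B. pullback \<phi> \<omega> = \<omega>"
    proof
      fix \<phi> assume "\<phi> \<in> lattice_B"
      then obtain g where g: "\<phi> = (\<lambda>z. g + z)" "g \<in> lattice" unfolding lattice_B_eq by blast
      show "pullback \<phi> \<omega> = \<omega>"
        unfolding g(1) pullback_translation
        using periodic_lattice[OF P[rule_format] g(2)] by (simp add: fun_eq_iff add.commute)
    qed
  qed
  then show ?thesis by (simp add: forms_def)
qed

lemma is1_coframe_B: "is1 (\<alpha>Bt t)" "is1 (\<beta>Bt t)"
proof -
  have "linear (\<lambda>v. Sm t v $ i)" for i
    using linear_Sm[of t] by (simp add: linear_iff)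
  then show "is1 (\<alpha>Bt t)" "is1 (\<beta>Bt t)" by (auto simp: is1_def coframe_B_eval smooth_on_const)
qed

lemma fconst_deg1I: "deg1 a \<Longrightarrow> (\<And>p q v. a p [v] = a q [v]) \<Longrightarrow> fconst a"
  unfolding fconst_def
proof (intro allI)
  fix p q and vs :: "'a list" assume a: "deg1 a" "\<And>p q v. a p [v] = a q [v]"
  show "a p vs = a q vs"
  proof (cases "length vs = 1")
    case True
    then obtain v where "vs = [v]" by (auto simp: length_Suc_conv)
    then show ?thesis using a(2) by simp
  next
    case False
    then show ?thesis using a(1) by (simp add: deg1_def)
  qed
qed

lemma fconst_coframe_B: "fconst (\<alpha>Bt t)" "fconst (\<beta>Bt t)"
  by (rule fconst_deg1I, simp, simp add: coframe_B_eval)+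

lemma periodic_fconst: "fconst \<omega> \<Longrightarrow> periodic (\<lambda>p. \<omega> p vs)"
  by (auto simp: fconst_def periodic_def)

lemma fconst_forms_B: "is_kform k \<omega> \<Longrightarrow> fconst \<omega> \<Longrightarrow> \<omega> \<in> forms lattice_B k"
  by (simp add: forms_B_iff periodic_fconst)

lemma pq_idx_2:
  "length \<theta> = 2 \<Longrightarrow> pq_idx \<theta> 2 0 = {({0,1}, {})}"
  "length \<theta> = 2 \<Longrightarrow> pq_idx \<theta> 1 0 = {({0}, {}), ({1}, {})}"
  "length \<theta> = 2 \<Longrightarrow> pq_idx \<theta> 1 1 = {({0}, {0}), ({0}, {1}), ({1}, {0}), ({1}, {1})}"
proof -
  have P: "Pow {..<2::nat} = {{}, {0}, {1}, {0,1}}"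
    by (simp add: numeral_2_eq_2 lessThan_Suc Pow_insert insert_commute Un_commute)
  have c: "{I \<in> Pow {..<2::nat}. card I = 0} = {{}}" "{I \<in> Pow {..<2::nat}. card I = 1} = {{0}, {1}}"
    "{I \<in> Pow {..<2::nat}. card I = 2} = {{0,1}}"
    unfolding P by auto
  have *: "pq_idx \<theta> p q = {I \<in> Pow {..<2}. card I = p} \<times> {I \<in> Pow {..<2}. card I = q}" if "length \<theta> = 2" for p q
    using that by (auto simp: pq_idx_def all_idx_def)
  show "length \<theta> = 2 \<Longrightarrow> pq_idx \<theta> 2 0 = {({0,1}, {})}"
    "length \<theta> = 2 \<Longrightarrow> pq_idx \<theta> 1 0 = {({0}, {}), ({1}, {})}"
    "length \<theta> = 2 \<Longrightarrow> pq_idx \<theta> 1 1 = {({0}, {0}), ({0}, {1}), ({1}, {0}), ({1}, {1})}"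
    by (simp_all only: * c) auto
qed

lemma monomials_2:
  assumes "deg1 a" "deg1 b"
  shows "monomial [a, b] {0, 1} {} = a \<and>\<^sub>w b" "monomial [a, b] {0} {} = a" "monomial [a, b] {1} {} = b"
    "monomial [a, b] {0} {0} = a \<and>\<^sub>w cnjf a" "monomial [a, b] {0} {1} = a \<and>\<^sub>w cnjf b"
    "monomial [a, b] {1} {0} = b \<and>\<^sub>w cnjf a" "monomial [a, b] {1} {1} = b \<and>\<^sub>w cnjf b"
    "monomial [a, b] {0, 1} {0} = a \<and>\<^sub>w b \<and>\<^sub>w cnjf a" "monomial [a, b] {0, 1} {1} = a \<and>\<^sub>w b \<and>\<^sub>w cnjf b"
    "monomial [a, b] {0} {0, 1} = a \<and>\<^sub>w cnjf a \<and>\<^sub>w cnjf b" "monomial [a, b] {1} {0, 1} = b \<and>\<^sub>w cnjf a \<and>\<^sub>w cnjf b"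
  using assms by (simp_all add: monomial_def wedges_eq nths_Cons wedge_unitf)

locale small_param =
  fixes t :: param
  assumes small: "norm t < 1/4"
begin

sublocale B: coframe "coframe_B t" 2 "xB t" "yB t"
  by (rule coframe_B[OF small])

abbreviation "a0 \<equiv> \<alpha>Bt t"
abbreviation "a1 \<equiv> \<beta>Bt t"
abbreviation "b0 \<equiv> cnjf (\<alpha>Bt t)"
abbreviation "b1 \<equiv> cnjf (\<beta>Bt t)"

lemma B_co: "B.co 0 = a0" "B.co 1 = a1" "B.co 2 = b0" "B.co 3 = b1"
  unfolding B.co_def by (simp_all add: coframe_B_def)

lemmas is1_B = is1_coframe_B[of t] is1_cnjf[OF is1_coframe_B(1)[of t]] is1_cnjf[OF is1_coframe_B(2)[of t]]
lemmas fconst_B = fconst_coframe_B[of t] fconst_cnjf[OF fconst_coframe_B(1)[of t]] fconst_cnjf[OF fconst_coframe_B(2)[of t]]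
lemmas monomials_B = monomials_2[OF deg1_frames(4)[of t] deg1_frames(5)[of t], folded coframe_B_def, unfolded One_nat_def]

text \<open>The pair for which \<open>cdir\<close> is twice the j-th d-bar derivative; this factor 2
  reappears when solutions of the d-bar equation are converted.\<close>

definition wB :: "nat \<Rightarrow> (complex^2) \<times> (complex^2)" where
  "wB j = (xB t j 0, yB t j 0)"

lemma dZ_bar: "j < 2 \<Longrightarrow> B.dZ (2 + j) f p = cdir (wB j) f p / 2"
  by (simp add: B.dZ_def cdir_def wB_def xB_def yB_def)

text \<open>Expanding k in the four frame vectors has coefficients of size at most 2 norm k. Pairing
  with k gives (norm k)^2 <= 8 norm k sqrt A for the sum of squares A, and a nonzero integer vector
  has norm at least 1.\<close>

lemma lattice_lower_bound:
  fixes k :: "complex^2"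
  assumes k: "k \<in> lattice" "k \<noteq> 0"
  shows "1 / 64 \<le> (k \<bullet> fst (wB 0))\<^sup>2 + (k \<bullet> snd (wB 0))\<^sup>2 + (k \<bullet> fst (wB 1))\<^sup>2 + (k \<bullet> snd (wB 1))\<^sup>2"
proof -
  define s where "s = Sm t k"
  define A where "A = (k \<bullet> fst (wB 0))\<^sup>2 + (k \<bullet> snd (wB 0))\<^sup>2 + (k \<bullet> fst (wB 1))\<^sup>2 + (k \<bullet> snd (wB 1))\<^sup>2"
  have "1 \<le> norm k"
  proof -
    obtain b where b: "b \<in> Basis" "k \<bullet> b \<noteq> 0" using k(2) by (metis euclidean_eq_iff inner_zero_left)
    then have "k \<bullet> b \<in> \<int>" using k(1) by (simp add: lattice_def)
    then have "\<bar>k \<bullet> b\<bar> \<ge> 1" using b(2) by (rule Ints_nonzero_abs_ge1)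
    then show ?thesis using Basis_le_norm[OF b(1), of k] by linarith
  qed
  have sb: "cmod (s $ i) \<le> 2 * norm k" for i
  proof -
    have "cmod (Sm t k $ 1) \<le> cmod (k$1) + cmod (t$1$1) * cmod (k$1) + cmod (t$1$2) * cmod (k$2)"
      unfolding Sm_def vec2_nth by (intro order_trans[OF norm_triangle_ineq] add_mono) (simp_all add: norm_mult)
    moreover have "cmod (Sm t k $ 2) \<le> cmod (k$2) + cmod (t$2$1) * cmod (k$1) + cmod (t$2$2) * cmod (k$2)"
      unfolding Sm_def vec2_nth by (intro order_trans[OF norm_triangle_ineq] add_mono) (simp_all add: norm_mult)
    moreover have p: "cmod (t$i$j) * cmod (k$l) \<le> 1/4 * norm k" for i j l
      using small_entries[OF small, of i j] by (intro mult_mono Finite_Cartesian_Product.norm_nth_le) auto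
    moreover have q: "cmod (k$l) \<le> norm k" for l by (rule Finite_Cartesian_Product.norm_nth_le)
    ultimately have "cmod (Sm t k $ 1) \<le> 2 * norm k" "cmod (Sm t k $ 2) \<le> 2 * norm k"
      using norm_ge_zero[of k] p[of 1 1 1] p[of 1 2 2] p[of 2 1 1] p[of 2 2 2] q[of 1] q[of 2] by linarith+
    then show ?thesis using exhaust_2[of i] by (auto simp: s_def)
  qed
  have ab: "\<bar>k \<bullet> fst (wB 0)\<bar> \<le> sqrt A" "\<bar>k \<bullet> snd (wB 0)\<bar> \<le> sqrt A" "\<bar>k \<bullet> fst (wB 1)\<bar> \<le> sqrt A" "\<bar>k \<bullet> snd (wB 1)\<bar> \<le> sqrt A"
    unfolding A_def by (intro real_le_rsqrt, simp)+
  have kR: "k = Re (s $ 1) *\<^sub>R fst (wB 0) + Im (s $ 1) *\<^sub>R snd (wB 0) + Re (s $ 2) *\<^sub>R fst (wB 1) + Im (s $ 2) *\<^sub>R snd (wB 1)"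
    using B.complete[of k 0] by (simp add: coframe_B_def coframe_B_eval numeral_2_eq_2 lessThan_Suc wB_def s_def add_ac)
  have "norm k * norm k = k \<bullet> k" by (simp add: norm_eq_sqrt_inner)
  also have "\<dots> = k \<bullet> (Re (s $ 1) *\<^sub>R fst (wB 0) + Im (s $ 1) *\<^sub>R snd (wB 0) + Re (s $ 2) *\<^sub>R fst (wB 1) + Im (s $ 2) *\<^sub>R snd (wB 1))"
    using kR by simp
  also have "\<dots> = Re (s $ 1) * (k \<bullet> fst (wB 0)) + Im (s $ 1) * (k \<bullet> snd (wB 0)) + Re (s $ 2) * (k \<bullet> fst (wB 1)) + Im (s $ 2) * (k \<bullet> snd (wB 1))"
    by (simp add: inner_add_right)
  also have "\<dots> \<le> 2 * norm k * sqrt A + 2 * norm k * sqrt A + 2 * norm k * sqrt A + 2 * norm k * sqrt A"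
  proof -
    have "x * y \<le> 2 * norm k * sqrt A" if "\<bar>x\<bar> \<le> 2 * norm k" "\<bar>y\<bar> \<le> sqrt A" for x y
    proof -
      have "x * y \<le> \<bar>x\<bar> * \<bar>y\<bar>" by (metis abs_ge_self abs_mult)
      also have "\<dots> \<le> 2 * norm k * sqrt A" using that by (intro mult_mono) auto
      finally show ?thesis .
    qed
    moreover have "\<bar>Re (s $ i)\<bar> \<le> 2 * norm k" "\<bar>Im (s $ i)\<bar> \<le> 2 * norm k" for i
      using sb[of i] abs_Re_le_cmod[of "s $ i"] abs_Im_le_cmod[of "s $ i"] by linarith+
    ultimately show ?thesis using ab by (intro add_mono) auto
  qed
  finally have "norm k * norm k \<le> norm k * (8 * sqrt A)" by (simp add: algebra_simps)
  then have "norm k \<le> 8 * sqrt A"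
    by (rule mult_left_le_imp_le) (use \<open>1 \<le> norm k\<close> in linarith)
  then have "1 \<le> 8 * sqrt A" using \<open>1 \<le> norm k\<close> by linarith
  then have "(1/8)\<^sup>2 \<le> (sqrt A)\<^sup>2" by (intro power_mono) auto
  moreover have "A \<ge> 0" by (simp add: A_def)
  ultimately show ?thesis by (simp add: A_def power2_eq_square)
qed

lemma B_holomorphic_const:
  assumes f: "smooth_on UNIV f" "periodic f" and 0: "\<And>p j. j < 2 \<Longrightarrow> B.dZ (2 + j) f p = 0"
  shows "f p = f q"
proof (rule periodic_kernel_constant[where f' = "\<lambda>x. frechet_derivative f (at x)" and J = "{wB 0, wB 1}"])
  show "frechet_derivative f (at x) u + \<i> * frechet_derivative f (at x) v = 0" if "(u, v) \<in> {wB 0, wB 1}" for u v x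
  proof -
    have "u = fst (wB 0) \<and> v = snd (wB 0) \<or> u = fst (wB 1) \<and> v = snd (wB 1)"
      using that by (metis empty_iff fst_conv insertE snd_conv)
    moreover have "cdir (wB 0) f x = 0" "cdir (wB 1) f x = 0"
      using 0[of 0 x] 0[of 1 x] dZ_bar[of 0 f x] dZ_bar[of 1 f x] by simp_all
    ultimately show ?thesis by (auto simp: cdir_def)
  qed
  show "\<exists>(u, v)\<in>{wB 0, wB 1}. k \<bullet> u \<noteq> 0 \<or> k \<bullet> v \<noteq> 0" if "k \<in> lattice" "k \<noteq> 0" for k
    using lattice_lower_bound[OF that] by (auto simp: split_beta)
qed (intro smooth_on_continuous continuous_on_frechet_derivative smooth_line_derivative f)+

lemma tmean_dZ_bar: "smooth_on UNIV f \<Longrightarrow> periodic f \<Longrightarrow> j < 2 \<Longrightarrow> tmean (B.dZ (2 + j) f) = 0"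
proof -
  assume f: "smooth_on UNIV f" "periodic f" and j: "j < 2"
  have "B.dZ (2 + j) f = (\<lambda>p. (1/2) * cdir (wB j) f p)" using dZ_bar[OF j] by (simp add: fun_eq_iff)
  then show ?thesis using tmean_cdir[OF f, of "wB j"] tmean_cmult[of "1/2" "cdir (wB j) f"] by simp
qed

text \<open>The coefficients of a form in the coframe are values on constant vector fields.\<close>

lemma cf_smooth_periodic:
  assumes "set ks \<subseteq> {..<4}" "\<And>vs. smooth_on UNIV (\<lambda>p. \<omega> p vs)" "\<And>vs. periodic (\<lambda>p. \<omega> p vs)"
  shows "smooth_on UNIV (B.cf ks \<omega>) \<and> periodic (B.cf ks \<omega>)"
  using assms
proof (induction ks arbitrary: \<omega>)
  case Nil
  have "B.cf [] \<omega> = (\<lambda>p. \<omega> p [])" by (simp add: fun_eq_iff)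
  then show ?case using Nil by simp
next
  case (Cons k ks)
  have e: "(\<lambda>p. B.cn k \<omega> p vs) = (\<lambda>p. (1/2) * \<omega> p (xB t (if k < 2 then k else k - 2) 0 # vs)
      + (if k < 2 then - \<i> / 2 else \<i> / 2) * \<omega> p (yB t (if k < 2 then k else k - 2) 0 # vs))" for vs
    by (auto simp: B.cn_def contract_def xB_def yB_def fun_eq_iff diff_divide_distrib add_divide_distrib)
  have "smooth_on UNIV (B.cf ks (B.cn k \<omega>)) \<and> periodic (B.cf ks (B.cn k \<omega>))"
  proof (rule Cons.IH)
    show "set ks \<subseteq> {..<4}" using Cons.prems by simp
    show "smooth_on UNIV (\<lambda>p. B.cn k \<omega> p vs)" for vs
      unfolding e by (intro smooth_on_add smooth_on_mult smooth_on_const Cons.prems open_UNIV)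
    show "periodic (\<lambda>p. B.cn k \<omega> p vs)" for vs
      unfolding e by (intro periodic_add periodic_mult periodic_const Cons.prems)
  qed
  moreover have "B.cf (k # ks) \<omega> = B.cf ks (B.cn k \<omega>)" by (simp add: fun_eq_iff)
  ultimately show ?case by simp
qed

text \<open>The definition of \<open>pq_forms\<close> provides coefficient functions without
  regularity; being the contractions \<open>B.cf\<close> of the form, they inherit smoothness and
  periodicity from it.\<close>

lemma pq_form_coefficients:
  assumes "\<omega> \<in> pq_forms lattice_B (coframe_B t) p q"
  obtains c where "\<omega> = expansion (coframe_B t) (pq_idx (coframe_B t) p q) c"
    "\<And>s. s \<in> pq_idx (coframe_B t) p q \<Longrightarrow> smooth_on UNIV (c s) \<and> periodic (c s)"
proof -
  obtain c where c: "\<omega> = expansion (coframe_B t) (pq_idx (coframe_B t) p q) c" and \<omega>: "\<omega> \<in> forms lattice_B (p + q)"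
    using assms by (auto simp: pq_forms_def)
  have "smooth_on UNIV (c s) \<and> periodic (c s)" if s: "s \<in> pq_idx (coframe_B t) p q" for s
  proof -
    have m: "(fst s, snd s) \<in> all_idx (coframe_B t)" using s B.pq_idx_subset by auto
    have "c s = B.cf (B.idx (fst s) (snd s)) \<omega>"
      using B.cf_expansion[OF B.pq_idx_subset m, of p q c] s unfolding c by (simp add: fun_eq_iff)
    moreover have "set (B.idx (fst s) (snd s)) \<subseteq> {..<4}" using B.idx_set[of "fst s" "snd s"] by simp
    moreover have "\<And>vs. smooth_on UNIV (\<lambda>p. \<omega> p vs)" "\<And>vs. periodic (\<lambda>p. \<omega> p vs)"
      using \<omega> by (auto simp: forms_B_iff intro: is_kform_smooth)
    ultimately show ?thesis
      using cf_smooth_periodic[of "B.idx (fst s) (snd s)" \<omega>] by simp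
  qed
  then show ?thesis using that c by blast
qed

lemma kform_B: "is_kform 2 (a0 \<and>\<^sub>w a1)" "is_kform 2 (a0 \<and>\<^sub>w b0)" "is_kform 2 (a0 \<and>\<^sub>w b1)"
   "is_kform 2 (a1 \<and>\<^sub>w b0)" "is_kform 2 (a1 \<and>\<^sub>w b1)"
  by (intro is_kform_2 is1_B)+

lemma fconst_B2: "fconst (a0 \<and>\<^sub>w a1)" "fconst (a0 \<and>\<^sub>w b0)" "fconst (a0 \<and>\<^sub>w b1)" "fconst (a1 \<and>\<^sub>w b0)" "fconst (a1 \<and>\<^sub>w b1)"
  by (intro fconst_wedge fconst_B)+

lemma oftype_B: "B.oftype 2 0 (a0 \<and>\<^sub>w a1)" "B.oftype 1 1 (a0 \<and>\<^sub>w b0)" "B.oftype 1 1 (a0 \<and>\<^sub>w b1)"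
   "B.oftype 1 1 (a1 \<and>\<^sub>w b0)" "B.oftype 1 1 (a1 \<and>\<^sub>w b1)" "B.oftype 1 0 a0" "B.oftype 1 0 a1"
  using B.oftype_monomial[of "{0,1}" "{}"] B.oftype_monomial[of "{0}" "{0}"] B.oftype_monomial[of "{0}" "{1}"]
    B.oftype_monomial[of "{1}" "{0}"] B.oftype_monomial[of "{1}" "{1}"] B.oftype_monomial[of "{0}" "{}"] B.oftype_monomial[of "{1}" "{}"]
  by (simp_all add: monomials_B numeral_2_eq_2)

lemma dform_2: "B.dform g {2..<4} \<omega> = (\<lambda>u vs. g 2 u * (b0 \<and>\<^sub>w \<omega>) u vs + g 3 u * (b1 \<and>\<^sub>w \<omega>) u vs)"
proof -
  have "{2..<4::nat} = {2, 3}" by auto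
  then show ?thesis by (simp add: B.dform_def B_co fun_eq_iff)
qed

section \<open>Dolbeault cohomology of the torus in types (2,0) and (1,1)\<close>

lemma pq_forms_20:
  assumes "\<omega> \<in> pq_forms lattice_B (coframe_B t) 2 0"
  obtains f where "\<omega> = (\<lambda>p vs. f p * (a0 \<and>\<^sub>w a1) p vs)" "smooth_on UNIV f" "periodic f"
proof -
  obtain c where c: "\<omega> = expansion (coframe_B t) (pq_idx (coframe_B t) 2 0) c"
    "\<And>s. s \<in> pq_idx (coframe_B t) 2 0 \<Longrightarrow> smooth_on UNIV (c s) \<and> periodic (c s)"
    using pq_form_coefficients[OF assms] by blast
  note i = pq_idx_2(1)[OF B.len]
  have "\<omega> = (\<lambda>p vs. c ({0,1}, {}) p * (a0 \<and>\<^sub>w a1) p vs)"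
    unfolding c(1) i by (simp add: expansion_def monomials_B)
  then show ?thesis using that c(2)[of "({0,1}, {})"] i by simp
qed

lemma Dol_closed_20: "Dol_closed lattice_B (coframe_B t) 2 0 = {c \<cdot>\<^sub>f (a0 \<and>\<^sub>w a1) | c. True}"
proof (intro equalityI subsetI)
  fix \<omega> assume \<omega>: "\<omega> \<in> Dol_closed lattice_B (coframe_B t) 2 0"
  then obtain f where f: "\<omega> = (\<lambda>p vs. f p * (a0 \<and>\<^sub>w a1) p vs)" "smooth_on UNIV f" "periodic f"
    using pq_forms_20 by (auto simp: Dol_closed_def)
  have fd: "\<And>p. f differentiable (at p)" using smooth_on_differentiable[OF f(2)] by simp
  have "0 = delbar (coframe_B t) 2 0 \<omega>" using \<omega> by (simp add: Dol_closed_def)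
  also have "\<dots> = B.dform (\<lambda>k. B.dZ k f) {2..<4} (a0 \<and>\<^sub>w a1)"
    unfolding delbar_def f(1) using B.pq_part_extd_fun_scale(2)[OF fd fconst_fdiff[OF fconst_B2(1)] oftype_B(1) extd_fconst[OF fconst_B2(1)]] by simp
  finally have z: "B.dform (\<lambda>k. B.dZ k f) {2..<4} (a0 \<and>\<^sub>w a1) = 0" ..
  \<comment> \<open>Moving a conjugate coframe element past \<open>a0 \<and>\<^sub>w a1\<close>
    costs no sign, so d-bar of the form is an expansion in two monomials, and uniqueness makes its
    coefficients vanish.\<close>
  have e: "expansion (coframe_B t) {({0,1},{0}), ({0,1},{1})} (\<lambda>s. if snd s = {0} then B.dZ 2 f else B.dZ 3 f) =
      expansion (coframe_B t) {({0,1},{0}), ({0,1},{1})} (\<lambda>_ _. 0)" (is "expansion _ ?S _ = _")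
  proof -
    have "expansion (coframe_B t) ?S (\<lambda>s. if snd s = {0} then B.dZ 2 f else B.dZ 3 f)
       = B.dform (\<lambda>k. B.dZ k f) {2..<4} (a0 \<and>\<^sub>w a1)"
      unfolding dform_2 by (simp add: expansion_def monomials_B fun_eq_iff wedge3 split: list.split) (simp add: algebra_simps)
    then show ?thesis unfolding z by (simp add: expansion_def fun_eq_iff)
  qed
  have S: "?S \<subseteq> all_idx (coframe_B t)" by (auto simp: all_idx_def coframe_B_def)
  have "B.dZ 2 f p = 0" "B.dZ 3 f p = 0" for p
    using B.expansion_unique[OF S e, of "({0,1},{0})" p] B.expansion_unique[OF S e, of "({0,1},{1})" p] by simp_all
  then have "B.dZ (2 + j) f p = 0" if "j < 2" for j p
    using that by (auto simp: less2 simp del: add_2_eq_Suc add_2_eq_Suc')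
  then have "f p = f 0" for p
    by (intro B_holomorphic_const f)
  then have "\<omega> = f 0 \<cdot>\<^sub>f (a0 \<and>\<^sub>w a1)" unfolding f(1) fscale_def by metis
  then show "\<omega> \<in> {c \<cdot>\<^sub>f (a0 \<and>\<^sub>w a1) | c. True}" by blast
next
  fix \<omega> assume "\<omega> \<in> {c \<cdot>\<^sub>f (a0 \<and>\<^sub>w a1) | c. True}"
  then obtain c where c: "\<omega> = c \<cdot>\<^sub>f (a0 \<and>\<^sub>w a1)" by blast
  have "extd \<omega> = 0" unfolding c by (intro extd_fconst fconst_scale fconst_B2)
  then have "delbar (coframe_B t) 2 0 \<omega> = 0"
    using B.pq_part_oftype[OF B.oftype_0, of 2 1] by (simp add: delbar_def)
  moreover have "\<omega> \<in> forms lattice_B 2" unfolding c by (intro fsub_scale fsub_forms fconst_forms_B kform_B fconst_B2)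
  moreover have "B.oftype 2 0 \<omega>" unfolding c by (intro B.oftype_scale oftype_B)
  ultimately show "\<omega> \<in> Dol_closed lattice_B (coframe_B t) 2 0"
    by (simp add: Dol_closed_def pq_forms_def B.oftype_def)
qed

lemma pq_forms_11:
  assumes "\<omega> \<in> pq_forms lattice_B (coframe_B t) 1 1"
  obtains f00 f01 f10 f11 where "\<omega> = (\<lambda>p vs. f00 p * (a0 \<and>\<^sub>w b0) p vs) + (\<lambda>p vs. f01 p * (a0 \<and>\<^sub>w b1) p vs)
      + (\<lambda>p vs. f10 p * (a1 \<and>\<^sub>w b0) p vs) + (\<lambda>p vs. f11 p * (a1 \<and>\<^sub>w b1) p vs)"
    "smooth_on UNIV f00" "periodic f00" "smooth_on UNIV f01" "periodic f01"
    "smooth_on UNIV f10" "periodic f10" "smooth_on UNIV f11" "periodic f11"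
proof -
  obtain c where c: "\<omega> = expansion (coframe_B t) (pq_idx (coframe_B t) 1 1) c"
    "\<And>s. s \<in> pq_idx (coframe_B t) 1 1 \<Longrightarrow> smooth_on UNIV (c s) \<and> periodic (c s)"
    using pq_form_coefficients[OF assms] by blast
  note i = pq_idx_2(3)[OF B.len]
  have "\<omega> = (\<lambda>p vs. c ({0}, {0}) p * (a0 \<and>\<^sub>w b0) p vs) + (\<lambda>p vs. c ({0}, {1}) p * (a0 \<and>\<^sub>w b1) p vs)
      + (\<lambda>p vs. c ({1}, {0}) p * (a1 \<and>\<^sub>w b0) p vs) + (\<lambda>p vs. c ({1}, {1}) p * (a1 \<and>\<^sub>w b1) p vs)"
    unfolding c(1) i by (simp add: expansion_def monomials_B fun_eq_iff)
  then show ?thesis using that c(2) unfolding i by simp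
qed

lemma pq_forms_10:
  assumes "\<omega> \<in> pq_forms lattice_B (coframe_B t) 1 0"
  obtains g0 g1 where "\<omega> = (\<lambda>p vs. g0 p * a0 p vs) + (\<lambda>p vs. g1 p * a1 p vs)"
    "smooth_on UNIV g0" "periodic g0" "smooth_on UNIV g1" "periodic g1"
proof -
  obtain c where c: "\<omega> = expansion (coframe_B t) (pq_idx (coframe_B t) 1 0) c"
    "\<And>s. s \<in> pq_idx (coframe_B t) 1 0 \<Longrightarrow> smooth_on UNIV (c s) \<and> periodic (c s)"
    using pq_form_coefficients[OF assms] by blast
  note i = pq_idx_2(2)[OF B.len]
  have "\<omega> = (\<lambda>p vs. c ({0}, {}) p * a0 p vs) + (\<lambda>p vs. c ({1}, {}) p * a1 p vs)"
    unfolding c(1) i by (simp add: expansion_def monomials_B fun_eq_iff)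
  then show ?thesis using that c(2) unfolding i by simp
qed

lemma delbar_10:
  assumes g: "smooth_on UNIV g0" "smooth_on UNIV g1"
  defines "\<eta> \<equiv> (\<lambda>p vs. g0 p * a0 p vs) + (\<lambda>p vs. g1 p * a1 p vs)"
  shows "B.expandable (extd \<eta>)"
    "delbar (coframe_B t) 1 0 \<eta> = - ((\<lambda>p vs. B.dZ 2 g0 p * (a0 \<and>\<^sub>w b0) p vs) + (\<lambda>p vs. B.dZ 3 g0 p * (a0 \<and>\<^sub>w b1) p vs)
      + (\<lambda>p vs. B.dZ 2 g1 p * (a1 \<and>\<^sub>w b0) p vs) + (\<lambda>p vs. B.dZ 3 g1 p * (a1 \<and>\<^sub>w b1) p vs))"
proof -
  have fd: "\<And>p. g0 differentiable (at p)" "\<And>p. g1 differentiable (at p)"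
    using g smooth_on_differentiable by blast+
  note e0 = B.pq_part_extd_fun_scale[OF fd(1) fconst_fdiff[OF fconst_B(1)] oftype_B(6) extd_fconst[OF fconst_B(1)]]
  note e1 = B.pq_part_extd_fun_scale[OF fd(2) fconst_fdiff[OF fconst_B(2)] oftype_B(7) extd_fconst[OF fconst_B(2)]]
  have x: "extd \<eta> = extd (\<lambda>p vs. g0 p * a0 p vs) + extd (\<lambda>p vs. g1 p * a1 p vs)"
    unfolding \<eta>_def by (intro extd_add fdiff_fun_scale fd fconst_fdiff fconst_B)
  show "B.expandable (extd \<eta>)" unfolding x by (intro B.expandable_add e0 e1)
  have "delbar (coframe_B t) 1 0 \<eta> = B.dform (\<lambda>k. B.dZ k g0) {2..<4} a0 + B.dform (\<lambda>k. B.dZ k g1) {2..<4} a1"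
    unfolding delbar_def x B.pq_part_add[OF e0(1) e1(1)] using e0(2) e1(2) by simp
  also have "\<dots> = - ((\<lambda>p vs. B.dZ 2 g0 p * (a0 \<and>\<^sub>w b0) p vs) + (\<lambda>p vs. B.dZ 3 g0 p * (a0 \<and>\<^sub>w b1) p vs)
      + (\<lambda>p vs. B.dZ 2 g1 p * (a1 \<and>\<^sub>w b0) p vs) + (\<lambda>p vs. B.dZ 3 g1 p * (a1 \<and>\<^sub>w b1) p vs))"
    unfolding dform_2 by (simp add: fun_eq_iff wedge2 split: list.split) (simp add: algebra_simps)
  finally show "delbar (coframe_B t) 1 0 \<eta> = - ((\<lambda>p vs. B.dZ 2 g0 p * (a0 \<and>\<^sub>w b0) p vs) + (\<lambda>p vs. B.dZ 3 g0 p * (a0 \<and>\<^sub>w b1) p vs)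
      + (\<lambda>p vs. B.dZ 2 g1 p * (a1 \<and>\<^sub>w b0) p vs) + (\<lambda>p vs. B.dZ 3 g1 p * (a1 \<and>\<^sub>w b1) p vs))" .
qed

text \<open>A (1,1)-form on the torus amounts to two (0,1)-forms, the cofactors of \<open>a0\<close>
  and \<open>a1\<close>. Closedness decouples into one compatibility condition for each, which is
  the hypothesis of \<open>dbar_solve\<close>.\<close>

lemma closed_11_equations:
  assumes f: "smooth_on UNIV f00" "smooth_on UNIV f01" "smooth_on UNIV f10" "smooth_on UNIV f11"
    and 0: "delbar (coframe_B t) 1 1 ((\<lambda>p vs. f00 p * (a0 \<and>\<^sub>w b0) p vs) + (\<lambda>p vs. f01 p * (a0 \<and>\<^sub>w b1) p vs)
      + (\<lambda>p vs. f10 p * (a1 \<and>\<^sub>w b0) p vs) + (\<lambda>p vs. f11 p * (a1 \<and>\<^sub>w b1) p vs)) = 0" (is "delbar _ _ _ ?\<omega> = 0")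
  shows "B.dZ 2 f01 p = B.dZ 3 f00 p" "B.dZ 2 f11 p = B.dZ 3 f10 p"
proof -
  have fd: "\<And>p. f00 differentiable (at p)" "\<And>p. f01 differentiable (at p)"
    "\<And>p. f10 differentiable (at p)" "\<And>p. f11 differentiable (at p)"
    using f smooth_on_differentiable by blast+
  note e00 = B.pq_part_extd_fun_scale[OF fd(1) fconst_fdiff[OF fconst_B2(2)] oftype_B(2) extd_fconst[OF fconst_B2(2)]]
  note e01 = B.pq_part_extd_fun_scale[OF fd(2) fconst_fdiff[OF fconst_B2(3)] oftype_B(3) extd_fconst[OF fconst_B2(3)]]
  note e10 = B.pq_part_extd_fun_scale[OF fd(3) fconst_fdiff[OF fconst_B2(4)] oftype_B(4) extd_fconst[OF fconst_B2(4)]]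
  note e11 = B.pq_part_extd_fun_scale[OF fd(4) fconst_fdiff[OF fconst_B2(5)] oftype_B(5) extd_fconst[OF fconst_B2(5)]]
  have x: "extd ?\<omega> = extd (\<lambda>p vs. f00 p * (a0 \<and>\<^sub>w b0) p vs) + extd (\<lambda>p vs. f01 p * (a0 \<and>\<^sub>w b1) p vs)
      + extd (\<lambda>p vs. f10 p * (a1 \<and>\<^sub>w b0) p vs) + extd (\<lambda>p vs. f11 p * (a1 \<and>\<^sub>w b1) p vs)"
    by (simp only: extd_add fdiff_add fdiff_fun_scale[OF fd(1)] fdiff_fun_scale[OF fd(2)] fdiff_fun_scale[OF fd(3)]
        fdiff_fun_scale[OF fd(4)] fconst_fdiff fconst_B2)
  have "0 = delbar (coframe_B t) 1 1 ?\<omega>" using 0 by simp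
  also have "\<dots> = B.dform (\<lambda>k. B.dZ k f00) {2..<4} (a0 \<and>\<^sub>w b0) + B.dform (\<lambda>k. B.dZ k f01) {2..<4} (a0 \<and>\<^sub>w b1)
      + B.dform (\<lambda>k. B.dZ k f10) {2..<4} (a1 \<and>\<^sub>w b0) + B.dform (\<lambda>k. B.dZ k f11) {2..<4} (a1 \<and>\<^sub>w b1)"
    unfolding delbar_def x using e00 e01 e10 e11 by (simp add: B.pq_part_add B.expandable_add)
  also have "\<dots> = expansion (coframe_B t) {({0},{0,1}), ({1},{0,1})}
      (\<lambda>s p. if fst s = {0} then B.dZ 3 f00 p - B.dZ 2 f01 p else B.dZ 3 f10 p - B.dZ 2 f11 p)"
    unfolding dform_2
    by (simp add: expansion_def monomials_B fun_eq_iff wedge3 split: list.split) (simp add: algebra_simps)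
  finally have e: "expansion (coframe_B t) {({0},{0,1}), ({1},{0,1})}
      (\<lambda>s p. if fst s = {0} then B.dZ 3 f00 p - B.dZ 2 f01 p else B.dZ 3 f10 p - B.dZ 2 f11 p)
     = expansion (coframe_B t) {({0},{0,1}), ({1},{0,1})} (\<lambda>_ _. 0)" (is "expansion _ ?S _ = _")
    by (simp add: expansion_def fun_eq_iff)
  have S: "?S \<subseteq> all_idx (coframe_B t)" by (auto simp: all_idx_def coframe_B_def)
  show "B.dZ 2 f01 p = B.dZ 3 f00 p" "B.dZ 2 f11 p = B.dZ 3 f10 p"
    using B.expansion_unique[OF S e, of "({0},{0,1})" p] B.expansion_unique[OF S e, of "({1},{0,1})" p] by simp_all
qed

end

context small_param
begin

definition "E20 = Dol_exact lattice_B (coframe_B t) 2 0"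
definition "E11 = Dol_exact lattice_B (coframe_B t) 1 1"

lemma E20: "E20 = {0}"
  by (simp add: E20_def Dol_exact_def)

lemma expandable_extd_10: "\<omega> \<in> pq_forms lattice_B (coframe_B t) 1 0 \<Longrightarrow> B.expandable (extd \<omega>)"
proof -
  assume "\<omega> \<in> pq_forms lattice_B (coframe_B t) 1 0"
  then obtain g0 g1 where "\<omega> = (\<lambda>p vs. g0 p * a0 p vs) + (\<lambda>p vs. g1 p * a1 p vs)"
    "smooth_on UNIV g0" "smooth_on UNIV g1"
    using pq_forms_10 by blast
  then show ?thesis using delbar_10(1) by simp
qed

lemma fsub_E11: "fsub E11"
  unfolding E11_def One_nat_def by (rule B.fsub_Dol_exact) (use expandable_extd_10 in simp)

lemma H20_B_carrier: "vcarr (H20_B t) = (\<lambda>cs. coset E20 (fcomb cs (basis20_B t))) ` {cs. length cs = 1}"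
proof -
  have "{cs::complex list. length cs = 1} = range (\<lambda>c. [c])" by (auto simp: length_Suc_conv)
  then show ?thesis
    unfolding H20_B_def H_Dol_def quot_simps Dol_closed_20 E20_def basis20_B_def
    by (auto simp: image_iff)
qed

lemma form_2_nonzero:
  assumes "a0 \<and>\<^sub>w a1 = 0" shows False
proof -
  have "(a0 \<and>\<^sub>w a1) 0 [xB t 0 0, xB t 1 0] = 1"
    using B.dual(1)[of 0 0 0] B.dual(1)[of 0 1 0] B.dual(1)[of 1 0 0] B.dual(1)[of 1 1 0]
    by (simp add: wedge2 coframe_B_def)
  then show False using assms by simp
qed

lemma findep_20: "findep E20 (basis20_B t)"
  unfolding findep_def
proof (intro allI impI)
  fix cs assume "length cs = length (basis20_B t)" and 0: "fcomb cs (basis20_B t) \<in> E20"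
  then obtain c where c: "cs = [c]" by (auto simp: basis20_B_def length_Suc_conv)
  have "c \<cdot>\<^sub>f (a0 \<and>\<^sub>w a1) = 0" using 0 by (simp add: c E20 basis20_B_def)
  then have "c = 0"
  proof (rule contrapos_pp)
    assume "c \<noteq> 0"
    show "c \<cdot>\<^sub>f (a0 \<and>\<^sub>w a1) \<noteq> 0"
    proof
      assume "c \<cdot>\<^sub>f (a0 \<and>\<^sub>w a1) = 0"
      then have "inverse c \<cdot>\<^sub>f c \<cdot>\<^sub>f (a0 \<and>\<^sub>w a1) = 0" by simp
      then show False using \<open>c \<noteq> 0\<close> form_2_nonzero by simp
    qed
  qed
  then show "set cs \<subseteq> {0}" by (simp add: c)
qed

lemma fcomb_11: "fcomb [c00, c01, c10, c11] (basis11_B t) =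
    c00 \<cdot>\<^sub>f (a0 \<and>\<^sub>w b0) + c01 \<cdot>\<^sub>f (a0 \<and>\<^sub>w b1) + c10 \<cdot>\<^sub>f (a1 \<and>\<^sub>w b0) + c11 \<cdot>\<^sub>f (a1 \<and>\<^sub>w b1)"
  by (simp add: basis11_B_def add.assoc)

lemma coefficients_11_unique:
  assumes "(\<lambda>p vs. f00 p * (a0 \<and>\<^sub>w b0) p vs) + (\<lambda>p vs. f01 p * (a0 \<and>\<^sub>w b1) p vs)
      + (\<lambda>p vs. f10 p * (a1 \<and>\<^sub>w b0) p vs) + (\<lambda>p vs. f11 p * (a1 \<and>\<^sub>w b1) p vs) =
     (\<lambda>p vs. g00 p * (a0 \<and>\<^sub>w b0) p vs) + (\<lambda>p vs. g01 p * (a0 \<and>\<^sub>w b1) p vs)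
      + (\<lambda>p vs. g10 p * (a1 \<and>\<^sub>w b0) p vs) + (\<lambda>p vs. g11 p * (a1 \<and>\<^sub>w b1) p vs)"
  shows "f00 p = g00 p" "f01 p = g01 p" "f10 p = g10 p" "f11 p = g11 p"
proof -
  let ?S = "{({0}, {0}), ({0}, {1}), ({1}, {0}), ({1}, {1})} :: (nat set \<times> nat set) set"
  let ?c = "\<lambda>f00 f01 f10 f11 (s :: nat set \<times> nat set). if fst s = {0} then (if snd s = {0} then f00 else f01) else (if snd s = {0} then f10 else f11)"
  have e: "expansion (coframe_B t) ?S (?c f00 f01 f10 f11) = expansion (coframe_B t) ?S (?c g00 g01 g10 g11)"
    using assms by (simp add: expansion_def monomials_B fun_eq_iff add.assoc)
  have S: "?S \<subseteq> all_idx (coframe_B t)" by (auto simp: all_idx_def coframe_B_def)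
  show "f00 p = g00 p" "f01 p = g01 p" "f10 p = g10 p" "f11 p = g11 p"
    using B.expansion_unique[OF S e, of "({0},{0})" p] B.expansion_unique[OF S e, of "({0},{1})" p]
      B.expansion_unique[OF S e, of "({1},{0})" p] B.expansion_unique[OF S e, of "({1},{1})" p] by simp_all
qed

text \<open>Constants that are d-bar derivatives of periodic functions equal their own means, and
  these are zero.\<close>

lemma findep_11: "findep E11 (basis11_B t)"
  unfolding findep_def
proof (intro allI impI)
  fix cs assume l: "length cs = length (basis11_B t)" and e: "fcomb cs (basis11_B t) \<in> E11"
  then obtain c00 c01 c10 c11 where c: "cs = [c00, c01, c10, c11]"
    by (auto simp: basis11_B_def length_Suc_conv)
  obtain \<eta> where \<eta>: "\<eta> \<in> pq_forms lattice_B (coframe_B t) 1 0" "fcomb cs (basis11_B t) = delbar (coframe_B t) 1 0 \<eta>"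
    using e by (auto simp: E11_def Dol_exact_def)
  obtain g0 g1 where g: "\<eta> = (\<lambda>p vs. g0 p * a0 p vs) + (\<lambda>p vs. g1 p * a1 p vs)"
    "smooth_on UNIV g0" "periodic g0" "smooth_on UNIV g1" "periodic g1"
    using pq_forms_10[OF \<eta>(1)] by blast
  have "(\<lambda>p vs. c00 * (a0 \<and>\<^sub>w b0) p vs) + (\<lambda>p vs. c01 * (a0 \<and>\<^sub>w b1) p vs)
      + (\<lambda>p vs. c10 * (a1 \<and>\<^sub>w b0) p vs) + (\<lambda>p vs. c11 * (a1 \<and>\<^sub>w b1) p vs) =
     (\<lambda>p vs. - B.dZ 2 g0 p * (a0 \<and>\<^sub>w b0) p vs) + (\<lambda>p vs. - B.dZ 3 g0 p * (a0 \<and>\<^sub>w b1) p vs)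
      + (\<lambda>p vs. - B.dZ 2 g1 p * (a1 \<and>\<^sub>w b0) p vs) + (\<lambda>p vs. - B.dZ 3 g1 p * (a1 \<and>\<^sub>w b1) p vs)"
    using \<eta>(2) unfolding c fcomb_11 g(1) delbar_10(2)[OF g(2,4)] by (simp add: fscale_def fun_eq_iff)
  note q = coefficients_11_unique[OF this]
  have "c00 = tmean (\<lambda>p. - B.dZ (2 + 0) g0 p)" "c01 = tmean (\<lambda>p. - B.dZ (2 + 1) g0 p)"
    "c10 = tmean (\<lambda>p. - B.dZ (2 + 0) g1 p)" "c11 = tmean (\<lambda>p. - B.dZ (2 + 1) g1 p)"
    using q tmean_const by (simp_all flip: q)
  moreover have "tmean (B.dZ 2 g) = 0" "tmean (B.dZ 3 g) = 0" if "smooth_on UNIV g" "periodic g" for g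
    using tmean_dZ_bar[OF that, of 0] tmean_dZ_bar[OF that, of 1] by simp_all
  ultimately show "set cs \<subseteq> {0}" using g by (simp add: c tmean_minus)
qed

text \<open>The d-bar equation is solved separately for the cofactors of \<open>a0\<close> and
  \<open>a1\<close>; what cannot be solved away is the list of means, which supplies the
  coefficients of the constant representative.\<close>

lemma H11_B_carrier: "vcarr (H11_B t) = (\<lambda>cs. coset E11 (fcomb cs (basis11_B t))) ` {cs. length cs = 4}"
proof -
  have "coset E11 \<omega> \<in> (\<lambda>cs. coset E11 (fcomb cs (basis11_B t))) ` {cs. length cs = 4}"
    if \<omega>: "\<omega> \<in> Dol_closed lattice_B (coframe_B t) 1 1" for \<omega>
  proof -
    obtain f00 f01 f10 f11 where f: "\<omega> = (\<lambda>p vs. f00 p * (a0 \<and>\<^sub>w b0) p vs) + (\<lambda>p vs. f01 p * (a0 \<and>\<^sub>w b1) p vs)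
      + (\<lambda>p vs. f10 p * (a1 \<and>\<^sub>w b0) p vs) + (\<lambda>p vs. f11 p * (a1 \<and>\<^sub>w b1) p vs)"
      "smooth_on UNIV f00" "periodic f00" "smooth_on UNIV f01" "periodic f01"
      "smooth_on UNIV f10" "periodic f10" "smooth_on UNIV f11" "periodic f11"
      using pq_forms_11[of \<omega>] \<omega> unfolding Dol_closed_def by blast
    have "delbar (coframe_B t) 1 1 \<omega> = 0" using \<omega> by (simp add: Dol_closed_def)
    note eqs = closed_11_equations[OF f(2,4,6,8) this[unfolded f(1)]]
    have c: "cdir (wB 0) f01 x = cdir (wB 1) f00 x" "cdir (wB 0) f11 x = cdir (wB 1) f10 x" for x
      using eqs[of x] dZ_bar[of 0 f01 x] dZ_bar[of 1 f00 x] dZ_bar[of 0 f11 x] dZ_bar[of 1 f10 x] by simp_all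
    obtain g0 where g0: "smooth_on UNIV g0" "periodic g0"
      "\<And>x. cdir (wB 0) g0 x = f00 x - tmean f00" "\<And>x. cdir (wB 1) g0 x = f01 x - tmean f01"
      by (rule dbar_solve[OF f(2-5) c(1), of "1/64"]) (use lattice_lower_bound in auto)
    obtain g1 where g1: "smooth_on UNIV g1" "periodic g1"
      "\<And>x. cdir (wB 0) g1 x = f10 x - tmean f10" "\<And>x. cdir (wB 1) g1 x = f11 x - tmean f11"
      by (rule dbar_solve[OF f(6-9) c(2), of "1/64"]) (use lattice_lower_bound in auto)
    have dg: "B.dZ 2 g0 x = (f00 x - tmean f00) / 2" "B.dZ 3 g0 x = (f01 x - tmean f01) / 2"
      "B.dZ 2 g1 x = (f10 x - tmean f10) / 2" "B.dZ 3 g1 x = (f11 x - tmean f11) / 2" for x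
      using dZ_bar[of 0 g0 x] dZ_bar[of 1 g0 x] dZ_bar[of 0 g1 x] dZ_bar[of 1 g1 x] g0 g1 by simp_all
    define \<eta> where "\<eta> = (\<lambda>p vs. g0 p * a0 p vs) + (\<lambda>p vs. g1 p * a1 p vs)"
    have "\<eta> \<in> forms lattice_B 1"
      unfolding forms_B_iff \<eta>_def
    proof (intro conjI allI)
      show "is_kform 1 ((\<lambda>p vs. g0 p * a0 p vs) + (\<lambda>p vs. g1 p * a1 p vs))"
        by (intro is_kform_add is_kform_fun_scale is_kform_1 is1_B g0 g1)
      show "periodic (\<lambda>p. ((\<lambda>p vs. g0 p * a0 p vs) + (\<lambda>p vs. g1 p * a1 p vs)) p vs)" for vs
        unfolding plus_fun_apply by (intro periodic_add periodic_mult g0 g1 periodic_fconst fconst_B)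
    qed
    moreover have "B.oftype 1 0 \<eta>"
      unfolding \<eta>_def by (intro B.oftype_add B.oftype_mult oftype_B)
    ultimately have "\<eta> \<in> pq_forms lattice_B (coframe_B t) 1 0"
      by (simp add: pq_forms_def B.oftype_def)
    then have "delbar (coframe_B t) 1 0 \<eta> \<in> E11" by (simp add: E11_def Dol_exact_def)
    \<comment> \<open>The factor 2 compensates that \<open>B.dZ\<close> is half of
      \<open>cdir\<close>, and the sign comes from moving the conjugate forms behind
      \<open>a0\<close> and \<open>a1\<close> in \<open>delbar_10\<close>.\<close>
    then have "(- 2) \<cdot>\<^sub>f delbar (coframe_B t) 1 0 \<eta> \<in> E11" by (rule fsub_scale[OF fsub_E11])
    moreover have "(- 2) \<cdot>\<^sub>f delbar (coframe_B t) 1 0 \<eta> = \<omega> - fcomb [tmean f00, tmean f01, tmean f10, tmean f11] (basis11_B t)"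
      unfolding \<eta>_def delbar_10(2)[OF g0(1) g1(1)] dg fcomb_11 f(1)
      by (simp add: fscale_def fun_eq_iff field_simps)
    ultimately have "coset E11 \<omega> = coset E11 (fcomb [tmean f00, tmean f01, tmean f10, tmean f11] (basis11_B t))"
      using coset_eq_iff[OF fsub_E11] by simp
    then show ?thesis by (intro image_eqI[of _ _ "[tmean f00, tmean f01, tmean f10, tmean f11]"]) auto
  qed
  moreover have "fcomb cs (basis11_B t) \<in> Dol_closed lattice_B (coframe_B t) 1 1" if l: "length cs = 4" for cs
  proof -
    obtain a b c d where cs: "cs = [a, b, c, d]" using l by (auto simp: length_Suc_conv numeral_eq_Suc)
    have "fconst (fcomb cs (basis11_B t))"
      unfolding cs fcomb_11 by (intro fconst_add fconst_scale fconst_B2)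
    then have "extd (fcomb cs (basis11_B t)) = 0" by (rule extd_fconst)
    then have "delbar (coframe_B t) 1 1 (fcomb cs (basis11_B t)) = 0"
      using B.pq_part_oftype[OF B.oftype_0, of 1 2] by (simp add: delbar_def numeral_2_eq_2)
    moreover have "fcomb cs (basis11_B t) \<in> forms lattice_B 2"
      unfolding cs fcomb_11 by (intro fsub_add fsub_scale fsub_forms fconst_forms_B kform_B fconst_B2)
    moreover have "B.oftype 1 1 (fcomb cs (basis11_B t))"
      unfolding cs fcomb_11 by (intro B.oftype_add B.oftype_scale oftype_B)
    ultimately show ?thesis by (simp add: Dol_closed_def pq_forms_def B.oftype_def numeral_2_eq_2)
  qed
  ultimately show ?thesis
    unfolding H11_B_def H_Dol_def quot_simps E11_def[symmetric] by auto
qed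

end

section \<open>De Rham functionals on the torus and the inversion of the frame matrix\<close>

lemma tmean_extd_1:
  assumes "\<eta> \<in> forms lattice_B 1"
  shows "tmean (\<lambda>p. extd \<eta> p [u, v]) = 0"
proof -
  have s: "smooth_on UNIV (\<lambda>p. \<eta> p vs)" "periodic (\<lambda>p. \<eta> p vs)" for vs
    using assms by (auto simp: forms_B_iff intro: is_kform_smooth)
  have z: "tmean (\<lambda>p. frechet_derivative (\<lambda>q. \<eta> q vs) (at p) w) = 0" for vs w
    by (rule tmean_directional_derivative[OF smooth_on_continuous[OF s(1)] s(2) continuous_on_frechet_derivative[OF s(1)] smooth_line_derivative[OF s(1)]])
  have e: "(\<lambda>p. extd \<eta> p [u, v]) = (\<lambda>p. frechet_derivative (\<lambda>q. \<eta> q [v]) (at p) u - frechet_derivative (\<lambda>q. \<eta> q [u]) (at p) v)"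
    by (simp add: extd_def lessThan_Suc)
  show ?thesis
    unfolding e by (subst tmean_diff) (auto intro!: continuous_on_frechet_derivative s simp: z)
qed

text \<open>Row \<open>i\<close> lists the coordinates of the \<open>i\<close>-th of the forms \<open>\<alpha>\<^sub>t\<beta>\<^sub>t, \<alpha>\<^sub>t\<alpha>\<^sub>t\<^sup>*, \<alpha>\<^sub>t\<beta>\<^sub>t\<^sup>*, \<beta>\<^sub>t\<alpha>\<^sub>t\<^sup>*,
  \<beta>\<^sub>t\<beta>\<^sub>t\<^sup>*, \<alpha>\<^sub>t\<^sup>*\<beta>\<^sub>t\<^sup>*\<close> in the same forms for \<open>t = 0\<close>, where \<open>*\<close> denotes conjugation.\<close>

definition tab :: "param \<Rightarrow> complex list list" where
  "tab t = (let a = t$1$1; b = t$1$2; c = t$2$1; d = t$2$2 in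
    [[1, c, d, - a, - b, D t],
     [cnj b, 1 - a * cnj a, - b * cnj a, - a * cnj b, - b * cnj b, - b],
     [cnj d, - a * cnj c, 1 - b * cnj c, - a * cnj d, - b * cnj d, a],
     [- cnj a, - c * cnj a, - d * cnj a, 1 - c * cnj b, - d * cnj b, - d],
     [- cnj c, - c * cnj c, - d * cnj c, - c * cnj d, 1 - d * cnj d, c],
     [cnj (D t), - cnj c, cnj a, - cnj d, cnj b, 1]])"

text \<open>Coordinates of the two-forms dual to the first five rows under the wedge pairing: rows
  5, -4, 3, 2, -1. The multiple of row 0 makes their coordinate of \<alpha>\<beta> vanish, which is
  the entry that would multiply the missing sixth coordinate; it does not disturb the pairing with
  the first five rows.\<close>

definition kap :: "param \<Rightarrow> nat \<Rightarrow> nat \<Rightarrow> complex" where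
  "kap t i k = [tab t ! 5 ! k - cnj (D t) * tab t ! 0 ! k,
     - (tab t ! 4 ! k + cnj (t$2$1) * tab t ! 0 ! k),
     tab t ! 3 ! k + cnj (t$1$1) * tab t ! 0 ! k,
     tab t ! 2 ! k - cnj (t$2$2) * tab t ! 0 ! k,
     - (tab t ! 1 ! k - cnj (t$1$2) * tab t ! 0 ! k)] ! i"

text \<open>The coefficients are read off from the wedge product with a dual \<open>2\<close>-form, corrected by a multiple
  of \<open>\<alpha>\<^sub>t\<beta>\<^sub>t\<close> so that the coordinate of \<open>\<alpha>\<^sup>*\<beta>\<^sup>*\<close> is not needed.\<close>

definition rB :: "nat \<Rightarrow> nat \<Rightarrow> param \<Rightarrow> complex" where
  "rB i k t = [kap t i 5, - kap t i 4, kap t i 3, kap t i 2, - kap t i 1] ! k / NN t"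

lemma less5: "(i::nat) < 5 \<longleftrightarrow> i = 0 \<or> i = 1 \<or> i = 2 \<or> i = 3 \<or> i = 4"
  and less6: "(i::nat) < 6 \<longleftrightarrow> i = 0 \<or> i = 1 \<or> i = 2 \<or> i = 3 \<or> i = 4 \<or> i = 5"
  by auto

lemma sum_5: "(\<Sum>k<5. f k) = f 0 + f 1 + f 2 + f 3 + (f (4::nat) :: complex)"
  and sum_6: "(\<Sum>k<6. f k) = f 0 + f 1 + f 2 + f 3 + f 4 + (f (5::nat) :: complex)"
  by (simp_all add: eval_nat_numeral)

text \<open>\<open>orth\<close> says that the wedge pairing of the frame with its dual is diagonal;
  \<open>NN t\<close> is the factor by which the volume form changes from parameter 0 to t.\<close>

lemma rB_tab:
  assumes "norm t < 1/4" "i < 5" "length cs = 5"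
  shows "cs ! i = (\<Sum>k<5. rB i k t * (\<Sum>j<5. cs ! j * tab t ! j ! k))"
proof -
  let ?K = "\<lambda>i k. [kap t i 5, - kap t i 4, kap t i 3, kap t i 2, - kap t i 1] ! k"
  have orth: "(\<Sum>k<5. ?K i k * tab t ! j ! k) = (if i = j then NN t else 0)" if "j < 5" for j
  proof -
    define a b c d e where v: "a = t$1$1" "b = t$1$2" "c = t$2$1" "d = t$2$2" "e = D t"
    \<comment> \<open>With the conjugates named, the claim becomes a polynomial identity in the
      entries and their conjugates, the determinants being expanded by \<open>e\<close>.\<close>
    define a' b' c' d' e' where v': "a' = cnj a" "b' = cnj b" "c' = cnj c" "d' = cnj d" "e' = cnj e"
    have e: "e = a * d - b * c" "e' = a' * d' - b' * c'"
      by (simp_all add: v v' D_def)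
    have N: "NN t = 1 - (a * a' + b * c' + c * b' + d * d') + e * e'"
      by (simp add: v v' NN_def)
    have tab: "tab t = [[1, c, d, - a, - b, e], [b', 1 - a * a', - b * a', - a * b', - b * b', - b],
        [d', - a * c', 1 - b * c', - a * d', - b * d', a], [- a', - c * a', - d * a', 1 - c * b', - d * b', - d],
        [- c', - c * c', - d * c', - c * d', 1 - d * d', c], [e', - c', a', - d', b', 1]]"
      by (simp add: tab_def Let_def v v')
    have K: "kap t i k = [tab t ! 5 ! k - e' * tab t ! 0 ! k, - (tab t ! 4 ! k + c' * tab t ! 0 ! k),
        tab t ! 3 ! k + a' * tab t ! 0 ! k, tab t ! 2 ! k - d' * tab t ! 0 ! k,
        - (tab t ! 1 ! k - b' * tab t ! 0 ! k)] ! i" for i k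
      by (simp add: kap_def v v')
    show ?thesis
      using assms(2) that unfolding less5
      by (elim disjE; simp add: sum_5 K tab N e del: One_nat_def; (simp add: algebra_simps)?)
  qed
  have "(\<Sum>k<5. rB i k t * (\<Sum>j<5. cs ! j * tab t ! j ! k)) = (\<Sum>j<5. cs ! j * (\<Sum>k<5. ?K i k * tab t ! j ! k)) / NN t"
    unfolding sum_distrib_left sum_divide_distrib rB_def by (subst sum.swap) (simp add: mult_ac)
  also have "(\<Sum>j<5. cs ! j * (\<Sum>k<5. ?K i k * tab t ! j ! k)) = (\<Sum>j<5. if i = j then cs ! i * NN t else 0)"
  proof (intro sum.cong refl)
    fix j :: nat assume "j \<in> {..<5}"
    then have "(\<Sum>k<5. ?K i k * tab t ! j ! k) = (if i = j then NN t else 0)" by (intro orth) simp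
    then show "cs ! j * (\<Sum>k<5. ?K i k * tab t ! j ! k) = (if i = j then cs ! i * NN t else 0)" by auto
  qed
  also have "\<dots> = cs ! i * NN t" using assms(2) by (subst sum.delta') auto
  finally show ?thesis using NN_nonzero[OF assms(1)] by simp
qed

lemma smooth_entry: "open W \<Longrightarrow> smooth_on W (\<lambda>t::param. t$i$j)"
proof (rule smooth_on_bounded_linear)
  show "bounded_linear (\<lambda>t::param. t$i$j)"
    by (rule bounded_linear_compose[OF bounded_linear_vec_nth bounded_linear_vec_nth])
qed

lemma smooth_D: "open W \<Longrightarrow> smooth_on W D"
  unfolding D_def[abs_def] by (intro smooth_on_diff smooth_on_mult smooth_entry)

lemma smooth_NN: "open W \<Longrightarrow> smooth_on W NN"
  unfolding NN_def[abs_def]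
  by (intro smooth_on_diff smooth_on_add smooth_on_mult smooth_on_cnj smooth_on_const smooth_entry smooth_D)

lemma smooth_tab: "open W \<Longrightarrow> i < 6 \<Longrightarrow> k < 6 \<Longrightarrow> smooth_on W (\<lambda>t. tab t ! i ! k)"
  unfolding less6
  by (elim disjE; simp add: tab_def Let_def; intro smooth_on_diff smooth_on_minus smooth_on_mult smooth_on_cnj smooth_on_const smooth_entry smooth_D)

lemma smooth_kap: "open W \<Longrightarrow> i < 5 \<Longrightarrow> k < 6 \<Longrightarrow> smooth_on W (\<lambda>t. kap t i k)"
  unfolding less5
  by (elim disjE; simp add: kap_def; intro smooth_on_diff smooth_on_add smooth_on_minus smooth_on_mult smooth_on_cnj smooth_entry smooth_D smooth_tab; simp)

lemma smooth_rB: "i < 5 \<Longrightarrow> k < 5 \<Longrightarrow> smooth_on (ball 0 (1/4)) (\<lambda>t. rB i k t)"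
proof -
  assume i: "i < 5" and k: "k < 5"
  have "smooth_on (ball 0 (1/4)) (\<lambda>t. [kap t i 5, - kap t i 4, kap t i 3, kap t i 2, - kap t i 1] ! k)"
    using k unfolding less5
    by (elim disjE; simp; intro smooth_on_minus smooth_kap i; simp)
  then show ?thesis
    unfolding rB_def by (intro smooth_on_divide smooth_NN) (auto simp: NN_nonzero)
qed

text \<open>The first five coordinates, in the forms of the above table for \<open>t = 0\<close>, of the complex bilinear
  extension.\<close>

definition coord2 :: "nat \<Rightarrow> (complex^2 \<Rightarrow> complex^2 \<Rightarrow> complex) \<Rightarrow> complex" where
  "coord2 k u = (let e = vec2 1 0; e' = vec2 \<i> 0; f = vec2 0 1; f' = vec2 0 \<i> in
    [u e f - \<i> * u e' f - \<i> * u e f' - u e' f',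
     u e e - \<i> * u e' e + \<i> * u e e' + u e' e',
     u e f - \<i> * u e' f + \<i> * u e f' + u e' f',
     u f e - \<i> * u f' e + \<i> * u f e' + u f' e',
     u f f - \<i> * u f' f + \<i> * u f f' + u f' f'] ! k / 4)"

lemma coord2_add: "k < 5 \<Longrightarrow> coord2 k (\<lambda>x y. u x y + v x y) = coord2 k u + coord2 k v"
  and coord2_cmult: "k < 5 \<Longrightarrow> coord2 k (\<lambda>x y. c * u x y) = c * coord2 k u"
  unfolding less5
  by (elim disjE; simp add: coord2_def Let_def add_divide_distrib diff_divide_distrib algebra_simps)+

lemma coord2_sum: "finite I \<Longrightarrow> k < 5 \<Longrightarrow> coord2 k (\<lambda>x y. \<Sum>i\<in>I. c i * u i x y) = (\<Sum>i\<in>I. c i * coord2 k (u i))"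
proof (induction I rule: finite_induct)
  case empty
  then show ?case unfolding less5 by (elim disjE; simp add: coord2_def Let_def)
qed (simp add: coord2_add coord2_cmult)

text \<open>The constant two-forms as plain functions of two vectors. The forms on the torus and
  their pullbacks to X both evaluate to these, so one coordinate computation serves both
  manifolds.\<close>

definition two_forms :: "param \<Rightarrow> (complex^2 \<Rightarrow> complex^2 \<Rightarrow> complex) list" where
  "two_forms t = (let w = (\<lambda>f g (x::complex^2) (y::complex^2). f x * g y - f y * (g x :: complex));
     a = (\<lambda>v. Sm t v $ 1); b = (\<lambda>v. Sm t v $ 2); a' = (\<lambda>v. cnj (Sm t v $ 1)); b' = (\<lambda>v. cnj (Sm t v $ 2)) in
    [w a b, w a a', w a b', w b a', w b b', w a' b'])"

lemma two_forms_tab: "i < 6 \<Longrightarrow> (two_forms t ! i) x y = (\<Sum>k<6. tab t ! i ! k * (two_forms 0 ! k) x y)"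
  unfolding less6
  by (elim disjE; simp add: sum_6 two_forms_def tab_def Let_def Sm_def D_def algebra_simps)

lemma coord2_two_forms_0: "k < 5 \<Longrightarrow> i < 6 \<Longrightarrow> coord2 k (two_forms 0 ! i) = (if i = k then 1 else 0)"
  unfolding less5 less6
  by (elim disjE; simp add: coord2_def two_forms_def Let_def Sm_def; simp add: algebra_simps)

lemma coord2_two_forms: "k < 5 \<Longrightarrow> i < 6 \<Longrightarrow> coord2 k (two_forms t ! i) = tab t ! i ! k"
proof -
  assume k: "k < 5" and i: "i < 6"
  have "two_forms t ! i = (\<lambda>x y. \<Sum>k<6. tab t ! i ! k * (two_forms 0 ! k) x y)"
    using two_forms_tab[OF i] by (simp add: fun_eq_iff)
  then have "coord2 k (two_forms t ! i) = (\<Sum>j<6. tab t ! i ! j * coord2 k (two_forms 0 ! j))"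
    using k by (simp add: coord2_sum)
  also have "\<dots> = (\<Sum>j<6. if j = k then tab t ! i ! k else 0)"
    using k by (intro sum.cong) (auto simp: coord2_two_forms_0)
  finally show ?thesis using k by simp
qed

text \<open>The first entry and the first five entries are the frames of the two Hodge bundles. The
  sixth completes a basis, so that every form at t is a combination of the forms at 0.\<close>

definition twoB :: "param \<Rightarrow> (complex^2) cform list" where
  "twoB t = basis20_B t @ basis11_B t @ [cnjf (\<alpha>Bt t) \<and>\<^sub>w cnjf (\<beta>Bt t)]"

lemma length_twoB: "length (twoB t) = 6"
  by (simp add: twoB_def basis20_B_def basis11_B_def)

lemma cnjf_single: "cnjf a p vs = cnj (a p vs)"
  by (simp add: cnjf_def)

lemma twoB_eval: "i < 6 \<Longrightarrow> (twoB t ! i) p [x, y] = (two_forms t ! i) x y"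
  unfolding less6
  by (elim disjE; simp add: twoB_def basis20_B_def basis11_B_def two_forms_def Let_def wedge2 coframe_B_eval cnjf_single nth_append)

lemma twoB_deg2: "i < 6 \<Longrightarrow> length vs \<noteq> 2 \<Longrightarrow> (twoB t ! i) p vs = 0"
  unfolding less6
  by (elim disjE; simp add: twoB_def basis20_B_def basis11_B_def nth_append; cases vs rule: remdups_adj.cases; simp add: wedge2 split: list.split)

lemma twoB_tab: "i < 6 \<Longrightarrow> twoB t ! i = fcomb (map (\<lambda>k. tab t ! i ! k) [0..<6]) (twoB 0)"
proof (rule ext, rule ext)
  fix p vs assume i: "i < 6"
  show "(twoB t ! i) p vs = fcomb (map (\<lambda>k. tab t ! i ! k) [0..<6]) (twoB 0) p vs"
  proof (cases "length vs = 2")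
    case True
    then obtain x y where vs: "vs = [x, y]" by (auto simp: length_Suc_conv numeral_eq_Suc)
    show ?thesis unfolding vs
      by (simp add: fcomb_apply length_twoB twoB_eval i two_forms_tab[OF i])
  next
    case False
    then show ?thesis by (simp add: fcomb_apply length_twoB twoB_deg2 i)
  qed
qed

lemma twoB_closed: "i < 6 \<Longrightarrow> twoB t ! i \<in> dR_closed lattice_B 2"
proof -
  assume i: "i < 6"
  note o = is1_coframe_B[of t] is1_cnjf[OF is1_coframe_B(1)[of t]] is1_cnjf[OF is1_coframe_B(2)[of t]]
  note c = fconst_coframe_B[of t] fconst_cnjf[OF fconst_coframe_B(1)[of t]] fconst_cnjf[OF fconst_coframe_B(2)[of t]]
  have "is_kform 2 (twoB t ! i)" "fconst (twoB t ! i)"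
    using i unfolding less6
    by (elim disjE; simp add: twoB_def basis20_B_def basis11_B_def nth_append; intro is_kform_2 fconst_wedge o c)+
  then show ?thesis by (simp add: dR_closed_def fconst_forms_B extd_fconst)
qed

definition ellB :: "nat \<Rightarrow> (complex^2) cform \<Rightarrow> complex" where
  "ellB k \<omega> = coord2 k (\<lambda>x y. tmean (\<lambda>p. \<omega> p [x, y]))"

lemma forms_continuous: "\<omega> \<in> forms L k \<Longrightarrow> continuous_on UNIV (\<lambda>p. \<omega> p vs)"
  by (auto simp: forms_def intro: smooth_on_continuous is_kform_smooth)

lemma ellB_add: "k < 5 \<Longrightarrow> a \<in> dR_closed lattice_B 2 \<Longrightarrow> b \<in> dR_closed lattice_B 2 \<Longrightarrow> ellB k (a + b) = ellB k a + ellB k b"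
  by (auto simp: ellB_def dR_closed_def coord2_add[symmetric] tmean_add forms_continuous)

lemma ellB_scale: "k < 5 \<Longrightarrow> ellB k (c \<cdot>\<^sub>f a) = c * ellB k a"
  by (simp add: ellB_def fscale_def tmean_cmult coord2_cmult)

lemma ellB_exact: "k < 5 \<Longrightarrow> a \<in> dR_exact lattice_B 2 \<Longrightarrow> ellB k a = 0"
proof -
  assume k: "k < 5" and a: "a \<in> dR_exact lattice_B 2"
  then obtain \<eta> where \<eta>: "\<eta> \<in> forms lattice_B 1" "a = extd \<eta>" by (auto simp: dR_exact_def numeral_2_eq_2)
  have "ellB k a = coord2 k (\<lambda>x y. 0 * 0)" by (simp add: ellB_def \<eta>(2) tmean_extd_1[OF \<eta>(1)])
  then show ?thesis using coord2_cmult[OF k, of 0 "\<lambda>_ _. 0"] by simp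
qed

lemma ellB_fcomb:
  assumes "k < 5" "length cs = n" "n \<le> 5"
  shows "ellB k (fcomb cs (take n (twoB t))) = (\<Sum>j<n. cs ! j * tab t ! j ! k)"
proof -
  have "(\<lambda>x y. tmean (\<lambda>p. fcomb cs (take n (twoB t)) p [x, y])) = (\<lambda>x y. \<Sum>j<n. cs ! j * (two_forms t ! j) x y)"
    using assms by (simp add: fcomb_apply length_twoB twoB_eval)
  then show ?thesis
    using assms by (simp add: ellB_def coord2_sum coord2_two_forms)
qed

section \<open>Fibres spanned by explicit classes and the Hodge bundles of the torus\<close>

lemma fcomb_append: "length cs = length \<omega>s \<Longrightarrow> fcomb (cs @ ds) (\<omega>s @ \<eta>s) = fcomb cs \<omega>s + fcomb ds \<eta>s"
  by (induction cs \<omega>s rule: list_induct2) (simp_all add: add.assoc del: fcomb_simps(3) add: fcomb_simps(3)[abs_def])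

text \<open>\<open>UNIV\<close> is a placeholder, as the operations of \<open>quot\<close> depend
  only on the subspace divided out. The predicate covers full cohomology groups as well as
  \<open>H21_gamma\<close>, whose carrier is a subspace.\<close>

definition spanned_by :: "('v cform set) vsp \<Rightarrow> 'v cform set \<Rightarrow> 'v cform list \<Rightarrow> bool" where
  "spanned_by V E \<omega>s \<longleftrightarrow> fsub E \<and> findep E \<omega>s \<and>
     vcarr V = (\<lambda>cs. coset E (fcomb cs \<omega>s)) ` {cs. length cs = length \<omega>s} \<and>
     vzero V = vzero (quot UNIV E) \<and> vadd V = vadd (quot UNIV E) \<and> vsmul V = vsmul (quot UNIV E)"

lemma spanned_by_simps:
  assumes "spanned_by V E \<omega>s"
  shows "vcarr V = (\<lambda>cs. coset E (fcomb cs \<omega>s)) ` {cs. length cs = length \<omega>s}"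
    "length cs = length \<omega>s \<Longrightarrow> length ds = length \<omega>s \<Longrightarrow>
      vadd V (coset E (fcomb cs \<omega>s)) (coset E (fcomb ds \<omega>s)) = coset E (fcomb (map2 (+) cs ds) \<omega>s)"
    "length cs = length \<omega>s \<Longrightarrow> vsmul V c (coset E (fcomb cs \<omega>s)) = coset E (fcomb (map ((*) c) cs) \<omega>s)"
    "vzero V = coset E (fcomb (replicate (length \<omega>s) 0) \<omega>s)"
proof -
  have "fcomb (replicate (length \<omega>s) 0) \<omega>s = 0"
    by (auto simp: fun_eq_iff fcomb_apply)
  then show "vzero V = coset E (fcomb (replicate (length \<omega>s) 0) \<omega>s)"
    using assms by (simp only: spanned_by_def quot_simps)
qed (use assms in \<open>simp_all only: spanned_by_def quot_simps fcomb_add fcomb_scale\<close>)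

lemma lin_ext_spanned:
  assumes V: "spanned_by V E \<omega>s" and "length cs = length \<omega>s"
  shows "lin_ext E \<omega>s E' \<eta>s (coset E (fcomb cs \<omega>s)) = coset E' (fcomb cs \<eta>s)"
  using assms by (intro lin_ext_eq) (auto simp: spanned_by_def)

lemma lin_iso_spanned:
  assumes V: "spanned_by V E \<omega>s" and W: "spanned_by W E' \<eta>s" and l: "length \<omega>s = length \<eta>s"
  shows "lin_iso V W (lin_ext E \<omega>s E' \<eta>s)"
proof -
  note L = lin_ext_spanned[OF V, of _ E' \<eta>s]
  have "bij_betw (lin_ext E \<omega>s E' \<eta>s) (vcarr V) (vcarr W)"
    unfolding bij_betw_def spanned_by_simps(1)[OF V] spanned_by_simps(1)[OF W]
  proof
    show "inj_on (lin_ext E \<omega>s E' \<eta>s) ((\<lambda>cs. coset E (fcomb cs \<omega>s)) ` {cs. length cs = length \<omega>s})"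
      using findep_eq[of E' \<eta>s] W l by (auto simp: inj_on_def L spanned_by_def)
    show "lin_ext E \<omega>s E' \<eta>s ` (\<lambda>cs. coset E (fcomb cs \<omega>s)) ` {cs. length cs = length \<omega>s}
        = (\<lambda>cs. coset E' (fcomb cs \<eta>s)) ` {cs. length cs = length \<eta>s}"
      unfolding image_image using l by (intro image_cong) (auto simp: L)
  qed
  moreover have "lin_map V W (lin_ext E \<omega>s E' \<eta>s)"
    unfolding lin_map_def spanned_by_simps(1)[OF V] spanned_by_simps(1)[OF W]
    using l by (auto simp: L spanned_by_simps(2,3)[OF V] spanned_by_simps(2,3)[OF W])
  ultimately show ?thesis by (simp add: lin_iso_def)
qed

context frame_data
begin

lemma single_bundle:
  assumes "ambient F = quot Z X"
    and V: "\<And>t. t \<in> \<Delta> \<Longrightarrow> spanned_by (fibre F t) (E t) (\<nu> t)"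
    and I: "\<And>t cs. t \<in> \<Delta> \<Longrightarrow> length cs = n \<Longrightarrow> incl F t (coset (E t) (fcomb cs (\<nu> t))) = coset X (fcomb cs (\<nu> t))"
  shows "framed_bundle \<Delta> W F n (\<lambda>t cs. coset (E t) (fcomb cs (\<nu> t))) \<nu> Z X \<kappa> M m ell r"
  by unfold_locales
    (use assms W subspaces \<nu> ell coeff spanned_by_simps[OF V] in \<open>auto simp: \<nu>(1)\<close>)

text \<open>The head of a coefficient list belongs to the one-dimensional first summand and the tail
  to the second; the inclusion adds the two de Rham classes.\<close>

lemma pair_bundle:
  assumes amb: "ambient F = quot Z X"
    and fib: "\<And>t. t \<in> \<Delta> \<Longrightarrow> fibre F t = vprod (V1 t) (V2 t)"
    and V1: "\<And>t. t \<in> \<Delta> \<Longrightarrow> spanned_by (V1 t) (E1 t) [\<omega> t]"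
    and V2: "\<And>t. t \<in> \<Delta> \<Longrightarrow> spanned_by (V2 t) (E2 t) (\<eta>s t)"
    and \<nu>_eq: "\<And>t. t \<in> \<Delta> \<Longrightarrow> \<nu> t = \<omega> t # \<eta>s t"
    and incl: "\<And>t u v. t \<in> \<Delta> \<Longrightarrow> incl F t (u, v) = vadd (quot Z X) (i1 t u) (i2 t v)"
    and i1: "\<And>t c. t \<in> \<Delta> \<Longrightarrow> i1 t (coset (E1 t) (fcomb [c] [\<omega> t])) = coset X (fcomb [c] [\<omega> t])"
    and i2: "\<And>t cs. t \<in> \<Delta> \<Longrightarrow> Suc (length cs) = n \<Longrightarrow> i2 t (coset (E2 t) (fcomb cs (\<eta>s t))) = coset X (fcomb cs (\<eta>s t))"
  shows "framed_bundle \<Delta> W F n (\<lambda>t cs. (coset (E1 t) (fcomb [hd cs] [\<omega> t]), coset (E2 t) (fcomb (tl cs) (\<eta>s t)))) \<nu> Z X \<kappa> M m ell r"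
proof
  fix t assume t: "t \<in> \<Delta>"
  have n: "n = Suc (length (\<eta>s t))" using \<nu>(1)[OF t] \<nu>_eq[OF t] by simp
  note s1 = spanned_by_simps[OF V1[OF t]] and s2 = spanned_by_simps[OF V2[OF t]]
  let ?e = "\<lambda>cs. (coset (E1 t) (fcomb [hd cs] [\<omega> t]), coset (E2 t) (fcomb (tl cs) (\<eta>s t)))"
  show "vcarr (fibre F t) = ?e ` {cs. length cs = n}"
  proof (intro equalityI subsetI)
    fix x assume "x \<in> vcarr (fibre F t)"
    then obtain cs ds where x: "x = (coset (E1 t) (fcomb cs [\<omega> t]), coset (E2 t) (fcomb ds (\<eta>s t)))"
      "length cs = 1" "length ds = length (\<eta>s t)"
      unfolding fib[OF t] vprod_def by (auto simp: s1(1) s2(1))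
    then have "x = ?e (hd cs # ds)" by (cases cs) auto
    then show "x \<in> ?e ` {cs. length cs = n}" using x n by (intro image_eqI[of _ _ "hd cs # ds"]) auto
  next
    fix x assume "x \<in> ?e ` {cs. length cs = n}"
    then obtain cs where "x = ?e cs" "length cs = n" by blast
    then show "x \<in> vcarr (fibre F t)"
      unfolding fib[OF t] vprod_def using n by (auto simp: s1(1) s2(1) image_iff intro: exI[of _ "[hd cs]"] exI[of _ "tl cs"])
  qed
  show "vzero (fibre F t) = ?e (replicate n 0)"
    unfolding fib[OF t] vprod_def using n by (simp add: s1(4) s2(4) del: fcomb_simps)
  fix cs :: "complex list" assume cs: "length cs = n"
  then obtain c cs' where c: "cs = c # cs'" "length cs' = length (\<eta>s t)" using n by (cases cs) auto
  show "vsmul (fibre F t) z (?e cs) = ?e (map ((*) z) cs)" for z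
    unfolding fib[OF t] vprod_def using c s1(3)[of "[c]" z] s2(3)[of cs' z] by (simp del: fcomb_simps)
  show "vadd (fibre F t) (?e cs) (?e ds) = ?e (map2 (+) cs ds)" if l: "length ds = n" for ds
  proof -
    obtain d ds' where d: "ds = d # ds'" "length ds' = length (\<eta>s t)" using l n by (cases ds) auto
    show ?thesis
      unfolding fib[OF t] vprod_def using c d s1(2)[of "[c]" "[d]"] s2(2)[of cs' ds'] by (simp del: fcomb_simps)
  qed
  have "incl F t (?e cs) = vadd (quot Z X) (coset X (fcomb [c] [\<omega> t])) (coset X (fcomb cs' (\<eta>s t)))"
    using c n by (simp add: incl[OF t] i1[OF t] i2[OF t] del: fcomb_simps)
  also have "\<dots> = coset X (fcomb [c] [\<omega> t] + fcomb cs' (\<eta>s t))" by (rule quot_simps(3)[OF subspaces(1)])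
  also have "fcomb [c] [\<omega> t] + fcomb cs' (\<eta>s t) = fcomb cs (\<nu> t)"
    unfolding c(1) \<nu>_eq[OF t] using fcomb_append[of "[c]" "[\<omega> t]" cs' "\<eta>s t"] by (simp only: append.simps list.size)
  finally show "incl F t (?e cs) = coset X (fcomb cs (\<nu> t))" .
qed (use amb W subspaces \<nu> ell coeff in auto)

end

lemma ball_small: "t \<in> Delta_gamma \<epsilon> \<Longrightarrow> \<epsilon> \<le> 1/4 \<Longrightarrow> norm t < 1/4"
  by (simp add: Delta_gamma_def)

lemma frame_data_B:
  assumes "\<epsilon> \<le> 1/4" "n \<le> 5"
  shows "frame_data (Delta_gamma \<epsilon>) (ball 0 (1/4)) n (\<lambda>t. take n (twoB t)) (dR_closed lattice_B 2) (dR_exact lattice_B 2)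
    (twoB 0) (\<lambda>i k t. tab t ! i ! k) 5 ellB rB"
proof
  show "Delta_gamma \<epsilon> \<subseteq> ball 0 (1/4)" using ball_small assms by auto
  show "take n (twoB t) ! i = fcomb (map (\<lambda>k. tab t ! i ! k) [0..<length (twoB 0)]) (twoB 0)" if "i < n" for t i
    using that assms twoB_tab[of i t] by (simp add: length_twoB)
  show "set (twoB 0) \<subseteq> dR_closed lattice_B 2"
    unfolding set_conv_nth using twoB_closed by (auto simp: length_twoB)
  show "smooth_on (ball 0 (1/4)) (\<lambda>t. tab t ! i ! k)" if "i < n" "k < length (twoB 0)" for i k
    using that assms by (intro smooth_tab) (auto simp: length_twoB)
  fix cs :: "complex list" and i t assume t: "t \<in> Delta_gamma \<epsilon>" and cs: "length cs = n" and i: "i < n"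
  \<comment> \<open>Padding with zeros lets the inverse of the full frame matrix serve for the line
    bundle and for the bundle of rank five.\<close>
  define ds where "ds = cs @ replicate (5 - n) (0::complex)"
  have ds: "length ds = 5" using cs assms by (simp add: ds_def)
  have "(\<Sum>j<5. ds ! j * tab t ! j ! k) = (\<Sum>j<n. cs ! j * tab t ! j ! k)" for k
    using assms cs by (intro sum.mono_neutral_cong_right) (auto simp: ds_def nth_append)
  then have "ellB k (fcomb cs (take n (twoB t))) = (\<Sum>j<5. ds ! j * tab t ! j ! k)" if "k < 5" for k
    using ellB_fcomb[OF that cs assms(2)] by simp
  moreover have "ds ! i = (\<Sum>k<5. rB i k t * (\<Sum>j<5. ds ! j * tab t ! j ! k))"
    using i assms ball_small[OF t assms(1)] by (intro rB_tab ds) auto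
  moreover have "ds ! i = cs ! i" using i cs by (simp add: ds_def nth_append)
  ultimately show "cs ! i = (\<Sum>k<5. rB i k t * ellB k (fcomb cs (take n (twoB t))))" by simp
qed (use assms ellB_add ellB_scale ellB_exact smooth_rB in \<open>auto simp: length_twoB fsub_dR_exact fsub_dR_closed\<close>)

lemma spanned_H20_B: "norm t < 1/4 \<Longrightarrow> spanned_by (H20_B t) (Dol_exact lattice_B (coframe_B t) 2 0) (basis20_B t)"
proof -
  assume "norm t < 1/4"
  then interpret small_param t by unfold_locales
  show ?thesis
    unfolding spanned_by_def E20_def[symmetric]
    using findep_20 H20_B_carrier by (simp add: E20 fsub_zero H20_B_def H_Dol_def quot_def Dol_exact_def basis20_B_def)
qed

lemma spanned_H11_B: "norm t < 1/4 \<Longrightarrow> spanned_by (H11_B t) (Dol_exact lattice_B (coframe_B t) 1 1) (basis11_B t)"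
proof -
  assume "norm t < 1/4"
  then interpret small_param t by unfold_locales
  have "length (basis11_B t) = 4" by (simp add: basis11_B_def)
  then show ?thesis
    unfolding spanned_by_def E11_def[symmetric]
    using findep_11 H11_B_carrier fsub_E11 by (simp add: H11_B_def H_Dol_def quot_def E11_def[symmetric] del: One_nat_def)
qed

lemma take_twoB: "take 1 (twoB t) = basis20_B t" "take 5 (twoB t) = (\<alpha>Bt t \<and>\<^sub>w \<beta>Bt t) # basis11_B t"
  by (simp_all add: twoB_def basis20_B_def basis11_B_def)

lemma framed_F2H2_B:
  assumes "\<epsilon> \<le> 1/4"
  shows "framed_bundle (Delta_gamma \<epsilon>) (ball 0 (1/4)) F2H2_B 1
    (\<lambda>t cs. coset (Dol_exact lattice_B (coframe_B t) 2 0) (fcomb cs (basis20_B t))) basis20_B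
    (dR_closed lattice_B 2) (dR_exact lattice_B 2) (twoB 0) (\<lambda>i k t. tab t ! i ! k) 5 ellB rB"
proof (rule frame_data.single_bundle)
  show "frame_data (Delta_gamma \<epsilon>) (ball 0 (1/4)) 1 basis20_B (dR_closed lattice_B 2) (dR_exact lattice_B 2)
    (twoB 0) (\<lambda>i k t. tab t ! i ! k) 5 ellB rB"
    using frame_data_B[OF assms, of 1] by (simp add: take_twoB[unfolded One_nat_def])
  fix t assume t: "t \<in> Delta_gamma \<epsilon>"
  note s = spanned_H20_B[OF ball_small[OF t assms]]
  show "spanned_by (fibre F2H2_B t) (Dol_exact lattice_B (coframe_B t) 2 0) (basis20_B t)"
    using s by (simp add: F2H2_B_def)
  fix cs :: "complex list" assume "length cs = 1"
  then show "incl F2H2_B t (coset (Dol_exact lattice_B (coframe_B t) 2 0) (fcomb cs (basis20_B t)))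
      = coset (dR_exact lattice_B 2) (fcomb cs (basis20_B t))"
    unfolding F2H2_B_def to_dR_20_B_def embbundle.simps by (intro lin_ext_spanned[OF s]) (simp add: basis20_B_def)
qed (simp add: F2H2_B_def H_dR_def)

lemma framed_F1H2_B:
  assumes "\<epsilon> \<le> 1/4"
  shows "framed_bundle (Delta_gamma \<epsilon>) (ball 0 (1/4)) F1H2_B 5
    (\<lambda>t cs. (coset (Dol_exact lattice_B (coframe_B t) 2 0) (fcomb [hd cs] [\<alpha>Bt t \<and>\<^sub>w \<beta>Bt t]),
       coset (Dol_exact lattice_B (coframe_B t) 1 1) (fcomb (tl cs) (basis11_B t)))) (\<lambda>t. take 5 (twoB t))
    (dR_closed lattice_B 2) (dR_exact lattice_B 2) (twoB 0) (\<lambda>i k t. tab t ! i ! k) 5 ellB rB"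
proof (rule frame_data.pair_bundle[where ?V1.0 = H20_B and ?V2.0 = H11_B and ?i1.0 = to_dR_20_B and ?i2.0 = to_dR_11_B])
  show "frame_data (Delta_gamma \<epsilon>) (ball 0 (1/4)) 5 (\<lambda>t. take 5 (twoB t)) (dR_closed lattice_B 2) (dR_exact lattice_B 2)
    (twoB 0) (\<lambda>i k t. tab t ! i ! k) 5 ellB rB"
    by (rule frame_data_B[OF assms]) simp
  fix t assume t: "t \<in> Delta_gamma \<epsilon>"
  note s1 = spanned_H20_B[OF ball_small[OF t assms], unfolded basis20_B_def]
  note s2 = spanned_H11_B[OF ball_small[OF t assms]]
  show "spanned_by (H20_B t) (Dol_exact lattice_B (coframe_B t) 2 0) [\<alpha>Bt t \<and>\<^sub>w \<beta>Bt t]" by (rule s1)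
  show "spanned_by (H11_B t) (Dol_exact lattice_B (coframe_B t) 1 1) (basis11_B t)" by (rule s2)
  show "to_dR_20_B t (coset (Dol_exact lattice_B (coframe_B t) 2 0) (fcomb [c] [\<alpha>Bt t \<and>\<^sub>w \<beta>Bt t]))
     = coset (dR_exact lattice_B 2) (fcomb [c] [\<alpha>Bt t \<and>\<^sub>w \<beta>Bt t])" for c
    unfolding to_dR_20_B_def basis20_B_def by (intro lin_ext_spanned[OF s1]) simp
  show "to_dR_11_B t (coset (Dol_exact lattice_B (coframe_B t) 1 1) (fcomb cs (basis11_B t)))
     = coset (dR_exact lattice_B 2) (fcomb cs (basis11_B t))" if "Suc (length cs) = 5" for cs
    unfolding to_dR_11_B_def by (intro lin_ext_spanned[OF s2]) (use that in \<open>simp add: basis11_B_def\<close>)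
qed (simp_all add: F1H2_B_def H_dR_def take_twoB)

section \<open>The Iwasawa manifold\<close>

definition vec3 :: "complex^2 \<Rightarrow> complex \<Rightarrow> complex^3" where "vec3 u w = vector [u$1, u$2, w]"

lemma vec3_nth [simp]: "vec3 u w $ 1 = u $ 1" "vec3 u w $ 2 = u $ 2" "vec3 u w $ 3 = w"
  by (simp_all add: vec3_def)

lemma vec3_eq_iff: "(u :: complex^3) = v \<longleftrightarrow> u $ 1 = v $ 1 \<and> u $ 2 = v $ 2 \<and> u $ 3 = v $ 3"
  by (simp add: vec_eq_iff forall_3)

lemma proj_nth [simp]: "proj p $ 1 = p $ 1" "proj p $ 2 = p $ 2"
  by (simp_all add: proj_def)

lemma proj_vec3 [simp]: "proj (vec3 u w) = u"
  by (simp add: vec2_eq_iff)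

lemma vec3_add: "vec3 u w + vec3 u' w' = vec3 (u + u') (w + w')"
  and vec3_scaleR: "s *\<^sub>R vec3 u w = vec3 (s *\<^sub>R u) (s *\<^sub>R w)"
  by (simp_all add: vec3_eq_iff)

text \<open>The left-invariant vector field with value \<open>(u, w)\<close> at the origin.\<close>

definition lf :: "complex^2 \<Rightarrow> complex \<Rightarrow> complex^3 \<Rightarrow> complex^3" where
  "lf u w p = vec3 u (p$1 * u$2 + w)"

lemma bounded_linear_lf: "bounded_linear (\<lambda>q. vec3 0 (q$1 * c))"
proof (subst linear_conv_bounded_linear[symmetric], rule linearI)
qed (simp_all add: vec3_eq_iff algebra_simps)

lemma lf_has_derivative: "(lf u w has_derivative (\<lambda>h. vec3 0 (h$1 * u$2))) (at p)"
proof -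
  have "lf u w = (\<lambda>q. vec3 0 (q$1 * u$2) + vec3 u w)"
    by (simp add: fun_eq_iff lf_def vec3_eq_iff)
  then show ?thesis
    using has_derivative_add[OF bounded_linear_imp_has_derivative[OF bounded_linear_lf[of "u$2"]] has_derivative_const[of "vec3 u w"]] by simp
qed

lemma smooth_lf: "smooth_on UNIV (lf u w)"
proof -
  have "lf u w = (\<lambda>q. vec3 0 (q$1 * u$2) + vec3 u w)"
    by (simp add: fun_eq_iff lf_def vec3_eq_iff)
  then show ?thesis
    by (simp add: smooth_on_add smooth_on_const smooth_on_bounded_linear[OF open_UNIV bounded_linear_lf])
qed

section \<open>Forms evaluated on left-invariant fields\<close>

lemma linear_Basis_expand:
  fixes F :: "'a::euclidean_space \<Rightarrow> complex"
  assumes "linear F"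
  shows "F v = (\<Sum>b\<in>Basis. of_real (v \<bullet> b) * F b)"
proof -
  have "F (\<Sum>b\<in>Basis. (v \<bullet> b) *\<^sub>R b) = (\<Sum>b\<in>Basis. (v \<bullet> b) *\<^sub>R F b)"
    by (simp add: linear_sum[OF assms] linear_cmul[OF assms])
  then show ?thesis by (simp add: euclidean_representation scaleR_conv_of_real)
qed

text \<open>The smoothness built into \<open>is_kform\<close> concerns fixed arguments. Expanding a
  moving argument in the standard basis reduces to these.\<close>

lemma smooth_linear_apply:
  fixes F :: "'b::real_normed_vector \<Rightarrow> 'a::euclidean_space \<Rightarrow> complex"
  assumes "\<And>p. linear (F p)" "\<And>v. smooth_on UNIV (\<lambda>p. F p v)" "smooth_on UNIV V"
  shows "smooth_on UNIV (\<lambda>p. F p (V p))"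
proof -
  have "smooth_on UNIV (\<lambda>p. complex_of_real (V p \<bullet> b))" for b
    using smooth_on_compose_bounded_linear[OF open_UNIV bounded_linear_compose[OF bounded_linear_of_real bounded_linear_inner_left[of b]] assms(3)] by simp
  then have "smooth_on UNIV (\<lambda>p. \<Sum>b\<in>Basis. of_real (V p \<bullet> b) * F p b)"
    by (intro smooth_on_sum smooth_on_mult open_UNIV assms)
  moreover have "(\<lambda>p. F p (V p)) = (\<lambda>p. \<Sum>b\<in>Basis. of_real (V p \<bullet> b) * F p b)"
    by (intro ext linear_Basis_expand assms(1))
  ultimately show ?thesis by (simp only:)
qed

lemma linear_apply_has_derivative:
  fixes F :: "'b::real_normed_vector \<Rightarrow> 'a::euclidean_space \<Rightarrow> complex"
  assumes lin: "\<And>p. linear (F p)" and F: "\<And>v. (\<lambda>p. F p v) differentiable (at p)"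
    and V: "(V has_derivative V') (at p)"
  shows "((\<lambda>q. F q (V q)) has_derivative (\<lambda>h. frechet_derivative (\<lambda>q. F q (V p)) (at p) h + F p (V' h))) (at p)"
proof -
  note dF = F[unfolded frechet_derivative_works]
  have dV: "((\<lambda>q. complex_of_real (V q \<bullet> b)) has_derivative (\<lambda>h. of_real (V' h \<bullet> b))) (at p)" for b
    by (intro bounded_linear.has_derivative[OF bounded_linear_of_real] has_derivative_inner_left V)
  have "((\<lambda>q. \<Sum>b\<in>Basis. of_real (V q \<bullet> b) * F q b) has_derivative
     (\<lambda>h. \<Sum>b\<in>Basis. of_real (V p \<bullet> b) * frechet_derivative (\<lambda>q. F q b) (at p) h + of_real (V' h \<bullet> b) * F p b)) (at p)"
    by (intro has_derivative_sum has_derivative_mult dV dF)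
  moreover have "((\<lambda>q. F q (V p)) has_derivative (\<lambda>h. \<Sum>b\<in>Basis. of_real (V p \<bullet> b) * frechet_derivative (\<lambda>q. F q b) (at p) h)) (at p)"
    unfolding linear_Basis_expand[OF lin, of _ "V p"] by (intro has_derivative_sum has_derivative_mult_right dF)
  then have "frechet_derivative (\<lambda>q. F q (V p)) (at p) = (\<lambda>h. \<Sum>b\<in>Basis. of_real (V p \<bullet> b) * frechet_derivative (\<lambda>q. F q b) (at p) h)"
    by (rule frechet_derivative_at[symmetric])
  ultimately show ?thesis
    unfolding linear_Basis_expand[OF lin, of _ "V _"] linear_Basis_expand[OF lin, of p "V' _"] by (simp add: sum.distrib)
qed

lemma is_kform_linear:
  assumes "is_kform k \<omega>" "Suc (length us + length vs) = k"
  shows "linear (\<lambda>v. \<omega> p (us @ v # vs))"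
proof -
  have "\<forall>p vs i. length vs = k \<and> i < k \<longrightarrow> linear (\<lambda>v. \<omega> p (vs[i := v]))"
    using assms(1) unfolding is_kform_def by blast
  from this[rule_format, of "us @ 0 # vs" "length us" p] show ?thesis using assms(2) by simp
qed

text \<open>Constant vectors are replaced by fields one slot at a time from the left; the induction
  appends the new field at the end of the list and keeps the remaining constant arguments
  general.\<close>

lemma kform_fields_smooth:
  fixes \<omega> :: "'v::euclidean_space cform"
  assumes \<omega>: "is_kform k \<omega>" and V: "\<And>V. V \<in> set Vs \<Longrightarrow> smooth_on UNIV V"
  shows "length Vs + length vs = k \<Longrightarrow> smooth_on UNIV (\<lambda>p. \<omega> p (map (\<lambda>V. V p) Vs @ vs))"
  using V
proof (induction Vs arbitrary: vs rule: rev_induct)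
  case Nil
  then show ?case using is_kform_smooth[OF \<omega>] by simp
next
  case (snoc V Vs)
  have "smooth_on UNIV (\<lambda>p. (\<lambda>p v. \<omega> p (map (\<lambda>V. V p) Vs @ v # vs)) p (V p))"
  proof (rule smooth_linear_apply[where F = "\<lambda>p v. \<omega> p (map (\<lambda>V. V p) Vs @ v # vs)"])
    show "linear (\<lambda>v. \<omega> p (map (\<lambda>V. V p) Vs @ v # vs))" for p
      using snoc.prems by (intro is_kform_linear[OF \<omega>]) simp
    show "smooth_on UNIV (\<lambda>p. \<omega> p (map (\<lambda>V. V p) Vs @ v # vs))" for v
      using snoc.prems by (intro snoc.IH) auto
  qed (use snoc.prems in simp)
  then show ?case by simp
qed

lemma frechet_linear_slot:
  assumes "\<And>p. linear (\<lambda>v. F p v)" "\<And>v p. (\<lambda>p. F p v) differentiable (at p)"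
  shows "linear (\<lambda>v. frechet_derivative (\<lambda>q. F q v :: complex) (at p) w)"
proof (rule linearI)
  note d = assms(2)[unfolded frechet_derivative_works]
  show "frechet_derivative (\<lambda>q. F q (u + v)) (at p) w = frechet_derivative (\<lambda>q. F q u) (at p) w + frechet_derivative (\<lambda>q. F q v) (at p) w" for u v
    using frechet_derivative_at[OF has_derivative_add[OF d[where v = u] d[where v = v]]] by (simp add: linear_add[OF assms(1)] fun_eq_iff)
  show "frechet_derivative (\<lambda>q. F q (c *\<^sub>R v)) (at p) w = c *\<^sub>R frechet_derivative (\<lambda>q. F q v) (at p) w" for c v
    using frechet_derivative_at[OF has_derivative_scaleR_right[OF d[where v = v]]] by (simp add: linear_cmul[OF assms(1)] fun_eq_iff)
qed

lemma is_kform_directional: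
  assumes "is_kform k \<omega>"
  shows "is_kform k (\<lambda>p vs. frechet_derivative (\<lambda>q. \<omega> q vs) (at p) w)"
  unfolding is_kform_def
proof (intro conjI allI impI)
  have z: "frechet_derivative (\<lambda>q. \<omega> q vs) (at p) w = 0" if "\<And>q. \<omega> q vs = 0" for p vs
    using that frechet_derivative_const[of "0::complex" p] by simp
  fix p and vs :: "'a list"
  show "frechet_derivative (\<lambda>q. \<omega> q vs) (at p) w = 0" if "length vs \<noteq> k"
    using assms that by (intro z) (auto simp: is_kform_def)
  show "frechet_derivative (\<lambda>q. \<omega> q vs) (at p) w = 0" if "length vs = k \<and> i < j \<and> j < k \<and> vs ! i = vs ! j" for i j
    using assms that unfolding is_kform_def by (intro z) blast
  show "linear (\<lambda>v. frechet_derivative (\<lambda>q. \<omega> q (vs[i := v])) (at p) w)" if "length vs = k \<and> i < k" for i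
  proof (rule frechet_linear_slot)
    show "linear (\<lambda>v. \<omega> q (vs[i := v]))" for q using assms that unfolding is_kform_def by blast
  qed (use is_kform_fdiff[OF assms] in \<open>auto simp: fdiff_def\<close>)
  show "smooth_on UNIV (\<lambda>p. frechet_derivative (\<lambda>q. \<omega> q vs) (at p) w)"
    by (intro smooth_on_frechet_derivative is_kform_smooth[OF assms])
qed

lemma heis_mult_derivative: "frechet_derivative (heis_mult g) (at p) = (\<lambda>v. vec3 (proj v) (v$3 + g$1 * v$2))"
proof -
  let ?L = "\<lambda>v::complex^3. vec3 (proj v) (v$3 + g$1 * v$2)"
  have "linear ?L"
    by (rule linearI) (simp_all add: vec3_eq_iff algebra_simps)
  then have "((\<lambda>z. ?L z + g) has_derivative ?L) (at p)"
    using has_derivative_add[OF bounded_linear_imp_has_derivative has_derivative_const[of g]] by (simp add: linear_conv_bounded_linear)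
  moreover have "heis_mult g = (\<lambda>z. ?L z + g)"
    by (simp add: fun_eq_iff heis_mult_def vec3_eq_iff)
  ultimately have "(heis_mult g has_derivative ?L) (at p)" by (simp only:)
  then show ?thesis by (rule frechet_derivative_at[symmetric])
qed

lemma heis_mult_vec3: "heis_mult (vec3 a c) (vec3 u w) = vec3 (a + u) (c + w + a$1 * u$2)"
  by (simp add: heis_mult_def vec3_eq_iff)

lemma lattice_X_I:
  assumes "a \<in> lattice" "c \<in> lattice"
  shows "heis_mult (vec3 a c) \<in> lattice_X"
proof -
  have a: "a $ i \<in> gauss_ints" for i using assms(1) gauss_lattice by blast
  have c: "c \<in> gauss_ints" using assms(2) by (auto simp: lattice_def gauss_ints_def Basis_complex_def complex_inner_1_right complex_inner_i_right)
  have "0 \<in> gauss_ints" "1 \<in> gauss_ints" by (simp_all add: gauss_ints_def)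
  then have "\<forall>i j. heis_matrix (vec3 a c) $ i $ j \<in> gauss_ints"
    using a c by (auto simp: heis_matrix_def forall_3)
  then show ?thesis unfolding lattice_X_def by blast
qed

definition invX :: "(complex^3 \<Rightarrow> complex) \<Rightarrow> bool" where
  "invX f \<longleftrightarrow> (\<forall>\<phi>\<in>lattice_X. \<forall>p. f (\<phi> p) = f p)"

lemma invX_vec3: "invX f \<Longrightarrow> a \<in> lattice \<Longrightarrow> c \<in> lattice \<Longrightarrow> f (vec3 (a + u) (c + w + a$1 * u$2)) = f (vec3 u w)"
  using lattice_X_I[of a c] unfolding invX_def heis_mult_vec3[symmetric] by blast

text \<open>Left translations carry left-invariant fields to themselves, so the components of an
  invariant form along them are functions on X.\<close>

lemma invX_fields:
  assumes "\<omega> \<in> forms lattice_X k"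
  shows "invX (\<lambda>p. \<omega> p (map (\<lambda>(u, w). lf u w p) l))"
  unfolding invX_def
proof (intro ballI allI)
  fix \<phi> p assume \<phi>: "\<phi> \<in> lattice_X"
  then obtain g where g: "\<phi> = heis_mult g" by (auto simp: lattice_X_def)
  have "lf u w (\<phi> p) = frechet_derivative \<phi> (at p) (lf u w p)" for u w
    unfolding g heis_mult_derivative by (simp add: lf_def vec3_eq_iff heis_mult_def algebra_simps)
  then have "map (\<lambda>(u, w). lf u w (\<phi> p)) l = map (frechet_derivative \<phi> (at p)) (map (\<lambda>(u, w). lf u w p) l)" by (simp add: case_prod_beta)
  then have "\<omega> (\<phi> p) (map (\<lambda>(u, w). lf u w (\<phi> p)) l) = pullback \<phi> \<omega> p (map (\<lambda>(u, w). lf u w p) l)"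
    by (simp only: pullback_def)
  then show "\<omega> (\<phi> p) (map (\<lambda>(u, w). lf u w (\<phi> p)) l) = \<omega> p (map (\<lambda>(u, w). lf u w p) l)"
    using assms \<phi> by (simp add: forms_def)
qed

lemma smooth_fields:
  assumes "\<omega> \<in> forms lattice_X k" "length l = k"
  shows "smooth_on UNIV (\<lambda>p. \<omega> p (map (\<lambda>(u, w). lf u w p) l))"
proof -
  have "smooth_on UNIV (\<lambda>p. \<omega> p (map (\<lambda>V. V p) (map (\<lambda>(u, w). lf u w) l) @ []))"
    using assms by (intro kform_fields_smooth[of k]) (auto simp: forms_def smooth_lf)
  then show ?thesis by (simp add: comp_def case_prod_unfold)
qed

text \<open>Invariant integration over \<open>X\<close>, first over the fibres of the projection to the base torus.\<close>

definition mX :: "(complex^3 \<Rightarrow> complex) \<Rightarrow> complex" where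
  "mX F = tmean (\<lambda>y. tmean (\<lambda>w. F (vec3 y w)))"

lemma bounded_linear_vec3: "bounded_linear (\<lambda>(u, w). vec3 u w)"
proof (subst linear_conv_bounded_linear[symmetric], rule linearI)
qed (auto simp: vec3_eq_iff)

lemma continuous_vec3 [continuous_intros]:
  "continuous_on S f \<Longrightarrow> continuous_on S g \<Longrightarrow> continuous_on S (\<lambda>x. vec3 (f x) (g x))"
  using bounded_linear.continuous_on[OF bounded_linear_vec3, of S "\<lambda>x. (f x, g x)"]
  by (simp add: continuous_on_Pair)

lemma continuous_fibre: "continuous_on UNIV F \<Longrightarrow> continuous_on UNIV (\<lambda>w. F (vec3 y w))"
  by (rule continuous_on_compose2[of UNIV F]) (auto intro!: continuous_intros)

lemma continuous_fibre_mean: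
  "continuous_on UNIV F \<Longrightarrow> continuous_on UNIV (\<lambda>y. tmean (\<lambda>w. F (vec3 y w)))"
  unfolding tmean_def
  by (rule integral_continuous_on_param, unfold split_beta,
      rule continuous_on_compose2[of UNIV F]) (auto intro!: continuous_intros)

lemma mX_add: "continuous_on UNIV F \<Longrightarrow> continuous_on UNIV G \<Longrightarrow> mX (\<lambda>p. F p + G p) = mX F + mX G"
  and mX_diff: "continuous_on UNIV F \<Longrightarrow> continuous_on UNIV G \<Longrightarrow> mX (\<lambda>p. F p - G p) = mX F - mX G"
  unfolding mX_def by (simp_all add: tmean_add tmean_diff continuous_fibre continuous_fibre_mean)

lemma mX_cmult: "mX (\<lambda>p. c * F p) = c * mX F"
  unfolding mX_def tmean_cmult ..

lemma mX_const [simp]: "mX (\<lambda>_. c) = c"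
  by (simp add: mX_def)

lemma fibre_derivative:
  assumes "(F has_derivative F') (at (vec3 y w))"
  shows "((\<lambda>s. F (vec3 y (w + s *\<^sub>R c))) has_vector_derivative F' (vec3 0 c)) (at 0)"
  using line_has_vector_derivative[OF assms, of "vec3 0 c"] by (simp add: vec3_add vec3_scaleR)

lemma tmean_fibre_derivative:
  assumes F: "smooth_on UNIV F" and per: "periodic (\<lambda>w. F (vec3 y w))"
  shows "tmean (\<lambda>w. frechet_derivative F (at (vec3 y w)) (vec3 0 c)) = 0"
  by (rule tmean_directional_derivative[OF continuous_fibre[OF smooth_on_continuous[OF F]] per
        continuous_fibre[OF continuous_on_frechet_derivative[OF F]] fibre_derivative[OF smooth_on_has_derivative[OF F UNIV_I]]])

lemma invX_periodic_fibre: "invX f \<Longrightarrow> periodic (\<lambda>w. f (vec3 y w))"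
  unfolding periodic_def
proof (intro allI ballI)
  fix w b :: complex assume f: "invX f" and b: "b \<in> Basis"
  have "f (vec3 (0 + y) (b + w + (0::complex^2) $ 1 * y $ 2)) = f (vec3 y w)"
    by (rule invX_vec3[OF f lattice_0 lattice_Basis[OF b]])
  then show "f (vec3 y (w + b)) = f (vec3 y w)" by (simp add: add.commute)
qed

text \<open>The lattice element over \<open>b\<close> translates the base by \<open>b\<close> and
  also shifts the fibre by an amount depending on y; the fibre mean does not see that shift.\<close>

lemma fibre_mean_periodic:
  assumes f: "invX f" "continuous_on UNIV f"
  shows "periodic (\<lambda>y. tmean (\<lambda>w. f (vec3 y w)))"
  unfolding periodic_def
proof (intro allI ballI)
  fix y b :: "complex^2" assume b: "b \<in> Basis"
  have "f (vec3 (y + b) (w + b$1 * y$2)) = f (vec3 y w)" for w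
    using invX_vec3[OF f(1) lattice_Basis[OF b] lattice_0, of y w] by (simp add: add.commute)
  then have "tmean (\<lambda>w. f (vec3 y w)) = tmean (\<lambda>w. f (vec3 (y + b) (w + b$1 * y$2)))" by simp
  also have "\<dots> = tmean (\<lambda>w. f (vec3 (y + b) w))"
    by (rule tmean_shift[OF continuous_fibre[OF f(2)] invX_periodic_fibre[OF f(1)]])
  finally show "tmean (\<lambda>w. f (vec3 (y + b) w)) = tmean (\<lambda>w. f (vec3 y w))" ..
qed

text \<open>The field is the coordinate direction \<open>vec3 u 0\<close> plus a vertical vector
  that is constant along each fibre. The vertical derivative has fibre mean zero, and the other one
  is the derivative of the fibre mean along the base torus.\<close>

lemma mX_lf_derivative:
  assumes F: "smooth_on UNIV F" "invX F"
  shows "mX (\<lambda>p. frechet_derivative F (at p) (lf u c p)) = 0"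
proof -
  let ?D = "\<lambda>p. frechet_derivative F (at p)"
  note cF = smooth_on_continuous[OF F(1)] and cD = continuous_on_frechet_derivative[OF F(1)]
  have "tmean (\<lambda>w. ?D (vec3 y w) (lf u c (vec3 y w))) = tmean (\<lambda>w. ?D (vec3 y w) (vec3 u 0))" for y
  proof -
    have "?D (vec3 y w) (lf u c (vec3 y w)) = ?D (vec3 y w) (vec3 u 0) + ?D (vec3 y w) (vec3 0 (y$1 * u$2 + c))" for w
    proof -
      have "lf u c (vec3 y w) = vec3 u 0 + vec3 0 (y$1 * u$2 + c)" by (simp add: lf_def vec3_eq_iff)
      then show ?thesis
        using linear_add[OF has_derivative_linear[OF smooth_on_has_derivative[OF F(1) UNIV_I]]] by simp
    qed
    then have "tmean (\<lambda>w. ?D (vec3 y w) (lf u c (vec3 y w))) = tmean (\<lambda>w. ?D (vec3 y w) (vec3 u 0))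
        + tmean (\<lambda>w. ?D (vec3 y w) (vec3 0 (y$1 * u$2 + c)))"
      by (simp only: tmean_add[OF continuous_fibre[OF cD] continuous_fibre[OF cD]])
    then show ?thesis
      using tmean_fibre_derivative[OF F(1) invX_periodic_fibre[OF F(2)]] by simp
  qed
  then have "mX (\<lambda>p. ?D p (lf u c p)) = tmean (\<lambda>y. tmean (\<lambda>w. ?D (vec3 y w) (vec3 u 0)))"
    by (simp add: mX_def)
  also have "\<dots> = 0"
  proof (rule tmean_directional_derivative)
    show "continuous_on UNIV (\<lambda>y. tmean (\<lambda>w. F (vec3 y w)))" by (rule continuous_fibre_mean[OF cF])
    show "periodic (\<lambda>y. tmean (\<lambda>w. F (vec3 y w)))" by (rule fibre_mean_periodic[OF F(2) cF])
    show "continuous_on UNIV (\<lambda>y. tmean (\<lambda>w. ?D (vec3 y w) (vec3 u 0)))" by (rule continuous_fibre_mean[OF cD])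
    fix y
    have d: "((\<lambda>s. F (vec3 (y + s *\<^sub>R u) w)) has_vector_derivative ?D (vec3 (y + s *\<^sub>R u) w) (vec3 u 0)) (at s within UNIV)" for s w
    proof -
      have "((\<lambda>r. F (vec3 (y + s *\<^sub>R u) w + r *\<^sub>R vec3 u 0)) has_vector_derivative ?D (vec3 (y + s *\<^sub>R u) w) (vec3 u 0)) (at (s - s))"
        using smooth_line_derivative[OF F(1)] by simp
      then have "((\<lambda>r. F (vec3 (y + s *\<^sub>R u) w + r *\<^sub>R vec3 u 0)) \<circ> (\<lambda>r. r - s) has_vector_derivative 1 *\<^sub>R ?D (vec3 (y + s *\<^sub>R u) w) (vec3 u 0)) (at s)"
        by (intro vector_diff_chain_at) (auto intro!: derivative_eq_intros simp: has_vector_derivative_def)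
      then show ?thesis by (simp add: o_def vec3_add vec3_scaleR algebra_simps)
    qed
    have "((\<lambda>s. integral (cbox 0 One) (\<lambda>w. F (vec3 (y + s *\<^sub>R u) w))) has_vector_derivative
       integral (cbox 0 One) (\<lambda>w. ?D (vec3 (y + 0 *\<^sub>R u) w) (vec3 u 0))) (at 0 within UNIV)"
    proof (rule leibniz_rule_vector_derivative[OF d])
      show "(\<lambda>w. F (vec3 (y + s *\<^sub>R u) w)) integrable_on cbox 0 One" for s
        by (intro integrable_continuous_UNIV continuous_fibre cF)
      show "continuous_on (UNIV \<times> cbox 0 One) (\<lambda>(s, w). ?D (vec3 (y + s *\<^sub>R u) w) (vec3 u 0))"
        unfolding split_beta by (rule continuous_on_compose2[OF cD]) (auto intro!: continuous_intros)
    qed auto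
    then show "((\<lambda>s. tmean (\<lambda>w. F (vec3 (y + s *\<^sub>R u) w))) has_vector_derivative tmean (\<lambda>w. ?D (vec3 y w) (vec3 u 0))) (at 0)"
      by (simp add: tmean_def)
  qed
  finally show ?thesis .
qed

text \<open>Central lattice elements act as translations with identity derivative, so even values on
  constant vectors are periodic along the fibres.\<close>

lemma forms_X_fibre_periodic: "\<omega> \<in> forms lattice_X k \<Longrightarrow> periodic (\<lambda>w. \<omega> (vec3 y w) vs)"
  unfolding periodic_def
proof (intro allI ballI)
  fix w b :: complex assume \<omega>: "\<omega> \<in> forms lattice_X k" and b: "b \<in> Basis"
  let ?\<phi> = "heis_mult (vec3 0 b)"
  have "frechet_derivative ?\<phi> (at p) = (\<lambda>v. v)" for p
    by (simp add: heis_mult_derivative vec3_eq_iff fun_eq_iff)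
  then have "pullback ?\<phi> \<omega> (vec3 y w) vs = \<omega> (?\<phi> (vec3 y w)) vs"
    by (simp add: pullback_def)
  moreover have "pullback ?\<phi> \<omega> = \<omega>"
    using \<omega> lattice_X_I[OF lattice_0 lattice_Basis[OF b]] by (simp add: forms_def)
  ultimately show "\<omega> (vec3 y (w + b)) vs = \<omega> (vec3 y w) vs"
    by (simp add: heis_mult_vec3 add.commute)
qed

lemma is_kform_swap:
  assumes "is_kform 2 \<eta>"
  shows "\<eta> p [u, v] = - \<eta> p [v, u]"
proof -
  have l: "linear (\<lambda>v. \<eta> p [v, w])" "linear (\<lambda>v. \<eta> p [w, v])" for w
    using is_kform_linear[OF assms, of "[]" "[w]" p] is_kform_linear[OF assms, of "[w]" "[]" p] by simp_all
  have alt: "\<forall>p vs i j. length vs = 2 \<and> i < j \<and> j < 2 \<and> vs ! i = vs ! j \<longrightarrow> \<eta> p vs = 0"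
    using assms unfolding is_kform_def by blast
  have z: "\<eta> p [w, w] = 0" for w
    by (rule alt[rule_format, of _ 0 1]) simp
  have "\<eta> p [u + v, u + v] = \<eta> p [u, u] + \<eta> p [u, v] + (\<eta> p [v, u] + \<eta> p [v, v])"
    by (simp add: linear_add[OF l(1)] linear_add[OF l(2)])
  then show ?thesis by (simp add: z eq_neg_iff_add_eq_0)
qed

text \<open>\<open>extd\<close> differentiates with the arguments frozen at p. Letting the field
  move with the point changes the derivative by the derivative of the field, and these corrections
  add up to a Lie bracket in \<open>mX_extd\<close>.\<close>

lemma field_derivative:
  assumes "is_kform 2 \<eta>"
  shows "frechet_derivative (\<lambda>q. \<eta> q [lf u 0 p, w]) (at p) h =
    frechet_derivative (\<lambda>q. \<eta> q [lf u 0 q, w]) (at p) h - \<eta> p [vec3 0 (h$1 * u$2), w]"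
proof -
  have "((\<lambda>q. \<eta> q [lf u 0 q, w]) has_derivative
      (\<lambda>h. frechet_derivative (\<lambda>q. \<eta> q [lf u 0 p, w]) (at p) h + \<eta> p [vec3 0 (h$1 * u$2), w])) (at p)"
  proof (rule linear_apply_has_derivative[where F = "\<lambda>q v. \<eta> q [v, w]"])
    show "linear (\<lambda>v. \<eta> q [v, w])" for q using is_kform_linear[OF assms, of "[]" "[w]" q] by simp
    show "(\<lambda>q. \<eta> q [v, w]) differentiable (at p)" for v using is_kform_fdiff[OF assms] by (simp add: fdiff_def)
  qed (rule lf_has_derivative)
  from fun_cong[OF frechet_derivative_at[OF this], of h] show ?thesis by (simp add: algebra_simps)
qed

text \<open>Only the structure equation \<open>d\<gamma> = - \<alpha> \<and> \<beta>\<close> survives in the mean of an exact form.\<close>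

lemma mX_extd:
  assumes \<eta>: "\<eta> \<in> forms lattice_X 2"
  shows "mX (\<lambda>p. extd \<eta> p [lf x 0 p, lf y 0 p, lf 0 w p])
    = - mX (\<lambda>p. \<eta> p [vec3 0 (x$1 * y$2 - y$1 * x$2), vec3 0 w])"
    and "continuous_on UNIV (\<lambda>p. extd \<eta> p [lf x 0 p, lf y 0 p, lf 0 w p])"
proof -
  have k: "is_kform 2 \<eta>" using \<eta> by (simp add: forms_def)
  let ?F = "\<lambda>u q. \<eta> q [lf u 0 q, vec3 0 w]"
  let ?D = "\<lambda>u v p. frechet_derivative (?F u) (at p) (lf v 0 p)"
  let ?H = "\<lambda>p. \<eta> p [vec3 0 (x$1 * y$2 - y$1 * x$2), vec3 0 w]"
  let ?W = "\<lambda>p. frechet_derivative (\<lambda>q. \<eta> q [lf x 0 p, lf y 0 p]) (at p) (vec3 0 w)"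
  have w: "lf 0 w p = vec3 0 w" for p by (simp add: lf_def)
  have lin: "linear (\<lambda>v. \<eta> p [vec3 0 v, vec3 0 w])" for p
  proof -
    have "linear (\<lambda>v. vec3 0 v)" by (rule linearI) (simp_all add: vec3_add vec3_scaleR)
    from linear_compose[OF this] show ?thesis
      using is_kform_linear[OF k, of "[]" "[vec3 0 w]" p] by (simp add: o_def)
  qed
  \<comment> \<open>The term \<open>?H\<close> is \<eta> applied to the bracket of the two
    horizontal fields, which points along the fibre; the terms \<open>?D\<close> are derivatives of
    invariant functions along left-invariant fields.\<close>
  have e: "(\<lambda>p. extd \<eta> p [lf x 0 p, lf y 0 p, lf 0 w p]) = (\<lambda>p. (?D y x p - ?D x y p - ?H p) + ?W p)"
  proof
    fix p
    have "extd \<eta> p [lf x 0 p, lf y 0 p, vec3 0 w]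
        = frechet_derivative (\<lambda>q. \<eta> q [lf y 0 p, vec3 0 w]) (at p) (lf x 0 p)
        - frechet_derivative (\<lambda>q. \<eta> q [lf x 0 p, vec3 0 w]) (at p) (lf y 0 p) + ?W p"
      by (simp add: extd_def lessThan_Suc numeral_eq_Suc)
    also have "\<dots> = ?D y x p - ?D x y p - (\<eta> p [vec3 0 (x$1 * y$2), vec3 0 w] - \<eta> p [vec3 0 (y$1 * x$2), vec3 0 w]) + ?W p"
      unfolding field_derivative[OF k] by (simp add: lf_def)
    also have "\<eta> p [vec3 0 (x$1 * y$2), vec3 0 w] - \<eta> p [vec3 0 (y$1 * x$2), vec3 0 w] = ?H p"
      by (rule linear_diff[OF lin, symmetric])
    finally show "extd \<eta> p [lf x 0 p, lf y 0 p, lf 0 w p] = (?D y x p - ?D x y p - ?H p) + ?W p" by (simp only: w)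
  qed
  have F: "smooth_on UNIV (?F u)" "invX (?F u)" for u
    using smooth_fields[OF \<eta>, of "[(u, 0), (0, w)]"] invX_fields[OF \<eta>, of "[(u, 0), (0, w)]"] by (simp_all add: w)
  have cD: "continuous_on UNIV (?D u v)" for u v
  proof (rule smooth_on_continuous, rule smooth_linear_apply[where F = "\<lambda>p. frechet_derivative (?F u) (at p)" and V = "lf v 0"])
    show "linear (frechet_derivative (?F u) (at p))" for p
      by (rule has_derivative_linear[OF smooth_on_has_derivative[OF F(1) UNIV_I]])
    show "smooth_on UNIV (\<lambda>p. frechet_derivative (?F u) (at p) v)" for v
      by (rule smooth_on_frechet_derivative[OF F(1)])
  qed (rule smooth_lf)
  have cH: "continuous_on UNIV ?H" by (rule forms_continuous[OF \<eta>])
  have cW: "continuous_on UNIV ?W"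
  proof (rule smooth_on_continuous)
    have "smooth_on UNIV (\<lambda>p. (\<lambda>p vs. frechet_derivative (\<lambda>q. \<eta> q vs) (at p) (vec3 0 w)) p (map (\<lambda>V. V p) [lf x 0, lf y 0] @ []))"
      by (rule kform_fields_smooth[OF is_kform_directional[OF k]]) (auto simp: smooth_lf)
    then show "smooth_on UNIV ?W" by simp
  qed
  \<comment> \<open>The fields \<open>lf x 0\<close> and \<open>lf y 0\<close> depend on the base
    point only, so along a fibre the arguments are constant and \<open>?W\<close> is a derivative of
    a periodic function.\<close>
  have fib: "tmean (\<lambda>v. ?W (vec3 y' v)) = 0" for y'
  proof -
    have "(\<lambda>v. ?W (vec3 y' v)) =
      (\<lambda>v. frechet_derivative (\<lambda>q. \<eta> q [lf x 0 (vec3 y' 0), lf y 0 (vec3 y' 0)]) (at (vec3 y' v)) (vec3 0 w))"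
      by (simp add: lf_def)
    then show ?thesis
      using tmean_fibre_derivative[OF is_kform_smooth[OF k] forms_X_fibre_periodic[OF \<eta>]] by simp
  qed
  then have "mX ?W = 0" by (simp add: mX_def)
  then show "mX (\<lambda>p. extd \<eta> p [lf x 0 p, lf y 0 p, lf 0 w p]) = - mX ?H"
    unfolding e by (simp add: mX_add[OF continuous_on_diff[OF continuous_on_diff[OF cD cD] cH] cW]
        mX_diff[OF continuous_on_diff[OF cD cD] cH] mX_diff[OF cD cD] mX_lf_derivative[OF F])
  show "continuous_on UNIV (\<lambda>p. extd \<eta> p [lf x 0 p, lf y 0 p, lf 0 w p])"
    unfolding e by (intro continuous_on_add continuous_on_diff cD cH cW)
qed

text \<open>The complex linear part in the last slot, that is, the coefficient of \<gamma> (and not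
  of its conjugate) in the mean of \<omega>, as a function of two base vectors.\<close>

definition uX :: "(complex^3) cform \<Rightarrow> complex^2 \<Rightarrow> complex^2 \<Rightarrow> complex" where
  "uX \<omega> x y = (mX (\<lambda>p. \<omega> p [lf x 0 p, lf y 0 p, lf 0 1 p]) - \<i> * mX (\<lambda>p. \<omega> p [lf x 0 p, lf y 0 p, lf 0 \<i> p])) / 2"

definition ellX :: "nat \<Rightarrow> (complex^3) cform \<Rightarrow> complex" where
  "ellX k \<omega> = coord2 k (uX \<omega>)"

lemma forms_X_continuous:
  "\<omega> \<in> forms lattice_X 3 \<Longrightarrow> continuous_on UNIV (\<lambda>p. \<omega> p [lf x 0 p, lf y 0 p, lf 0 w p])"
  using smooth_on_continuous[OF smooth_fields[of \<omega> 3 "[(x, 0), (y, 0), (0, w)]"]] by simp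

lemma uX_add: "a \<in> forms lattice_X 3 \<Longrightarrow> b \<in> forms lattice_X 3 \<Longrightarrow> uX (a + b) = (\<lambda>x y. uX a x y + uX b x y)"
  by (simp add: fun_eq_iff uX_def mX_add forms_X_continuous algebra_simps add_divide_distrib diff_divide_distrib)

lemma uX_scale: "uX (c \<cdot>\<^sub>f a) = (\<lambda>x y. c * uX a x y)"
  by (simp add: fun_eq_iff uX_def fscale_def mX_cmult algebra_simps diff_divide_distrib)

lemma ellX_add: "k < 5 \<Longrightarrow> a \<in> forms lattice_X 3 \<Longrightarrow> b \<in> forms lattice_X 3 \<Longrightarrow> ellX k (a + b) = ellX k a + ellX k b"
  by (simp add: ellX_def uX_add coord2_add)

lemma ellX_scale: "k < 5 \<Longrightarrow> ellX k (c \<cdot>\<^sub>f a) = c * ellX k a"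
  by (simp add: ellX_def uX_scale coord2_cmult)

text \<open>On the one-dimensional complex fibre an alternating form is a multiple \<open>h\<close>
  of the area form. Inserting the vertical bracket and taking the complex linear part in the other
  slot leaves the conjugate of the bracket.\<close>

lemma uX_extd:
  assumes \<eta>: "\<eta> \<in> forms lattice_X 2"
  obtains c where "uX (extd \<eta>) = (\<lambda>x y. c * cnj (x$1 * y$2 - y$1 * x$2))"
proof -
  have k: "is_kform 2 \<eta>" using \<eta> by (simp add: forms_def)
  define h where "h = mX (\<lambda>p. \<eta> p [vec3 0 1, vec3 0 \<i>])"
  have l: "\<eta> p [vec3 0 a, v] = Re a * \<eta> p [vec3 0 1, v] + Im a * \<eta> p [vec3 0 \<i>, v]" for p a v
  proof -
    have l: "linear (\<lambda>u. \<eta> p [u, v])" using is_kform_linear[OF k, of "[]" "[v]" p] by simp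
    have "vec3 0 a = Re a *\<^sub>R vec3 0 1 + Im a *\<^sub>R vec3 0 \<i>" by (simp add: vec3_eq_iff complex_eq_iff)
    then show ?thesis by (simp only: linear_add[OF l] linear_cmul[OF l]) (simp add: scaleR_conv_of_real)
  qed
  have z: "\<eta> p [v, v] = 0" for p v using is_kform_swap[OF k, of p v v] by simp
  have m: "mX (\<lambda>p. \<eta> p [vec3 0 a, vec3 0 1]) = - of_real (Im a) * h" "mX (\<lambda>p. \<eta> p [vec3 0 a, vec3 0 \<i>]) = of_real (Re a) * h" for a
    unfolding h_def mX_cmult[symmetric] l[of _ a] is_kform_swap[OF k, of _ "vec3 0 \<i>" "vec3 0 1"] by (simp_all add: z)
  have "uX (extd \<eta>) = (\<lambda>x y. \<i> * h / 2 * cnj (x$1 * y$2 - y$1 * x$2))"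
    unfolding uX_def mX_extd(1)[OF \<eta>] m by (simp add: fun_eq_iff complex_eq_iff field_simps)
  then show ?thesis by (rule that)
qed

text \<open>The conjugate bracket is the sixth two-form at parameter 0, and its first five
  coordinates vanish.\<close>

lemma ellX_extd: "k < 5 \<Longrightarrow> \<eta> \<in> forms lattice_X 2 \<Longrightarrow> ellX k (extd \<eta>) = 0"
proof -
  assume k: "k < 5" and \<eta>: "\<eta> \<in> forms lattice_X 2"
  obtain c where c: "uX (extd \<eta>) = (\<lambda>x y. c * cnj (x$1 * y$2 - y$1 * x$2))" by (rule uX_extd[OF \<eta>])
  have "(\<lambda>x y. cnj (x$1 * y$2 - y$1 * x$2)) = two_forms 0 ! 5"
    by (simp add: two_forms_def Let_def Sm_def fun_eq_iff mult.commute)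
  then have "ellX k (extd \<eta>) = c * coord2 k (two_forms 0 ! 5)"
    using coord2_cmult[OF k, of c "\<lambda>x y. cnj (x$1 * y$2 - y$1 * x$2)"] by (simp only: ellX_def c)
  then show ?thesis using k coord2_two_forms_0[OF k, of 5] by simp
qed

text \<open>The form \<open>\<gamma>\<^sub>t\<close> in the direction of the fibre, and its inverse.\<close>

definition S3 :: "param \<Rightarrow> complex \<Rightarrow> complex" where "S3 t w = w - D t * cnj w"
definition R3 :: "param \<Rightarrow> complex \<Rightarrow> complex" where
  "R3 t w = (w + D t * cnj w) / (1 - D t * cnj (D t))"

lemma D_nonunit: "norm t < 1/4 \<Longrightarrow> 1 - D t * cnj (D t) \<noteq> 0"
proof
  assume t: "norm t < 1/4" and 0: "1 - D t * cnj (D t) = 0"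
  have "cmod (D t * cnj (D t)) < (1/8) * (1/8)"
    unfolding norm_mult complex_mod_cnj using small_D[OF t] by (intro mult_strict_mono') auto
  moreover have "D t * cnj (D t) = 1" using 0 by simp
  ultimately show False by simp
qed

lemma S3_R3: "norm t < 1/4 \<Longrightarrow> S3 t (R3 t w) = w" and R3_S3: "norm t < 1/4 \<Longrightarrow> R3 t (S3 t w) = w"
proof -
  assume t: "norm t < 1/4"
  note n = D_nonunit[OF t]
  have c: "cnj (1 - D t * cnj (D t)) = 1 - D t * cnj (D t)" by (simp add: mult.commute)
  have "S3 t (R3 t w) = (w + D t * cnj w - D t * (cnj w + cnj (D t) * w)) / (1 - D t * cnj (D t))"
    unfolding S3_def R3_def complex_cnj_divide c by (simp add: diff_divide_distrib)
  also have "w + D t * cnj w - D t * (cnj w + cnj (D t) * w) = w * (1 - D t * cnj (D t))"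
    by (simp add: algebra_simps)
  finally show "S3 t (R3 t w) = w" using n by simp
  have "R3 t (S3 t w) = (w - D t * cnj w + D t * (cnj w - cnj (D t) * w)) / (1 - D t * cnj (D t))"
    by (simp add: S3_def R3_def)
  also have "w - D t * cnj w + D t * (cnj w - cnj (D t) * w) = w * (1 - D t * cnj (D t))"
    by (simp add: algebra_simps)
  finally show "R3 t (S3 t w) = w" using n by simp
qed

definition xX :: "param \<Rightarrow> nat \<Rightarrow> complex^3 \<Rightarrow> complex^3" where
  "xX t j = (if j < 2 then lf (xB t j 0) 0 else lf 0 (R3 t 1))"
definition yX :: "param \<Rightarrow> nat \<Rightarrow> complex^3 \<Rightarrow> complex^3" where
  "yX t j = (if j < 2 then lf (yB t j 0) 0 else lf 0 (R3 t \<i>))"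

lemma linear_S3: "linear (S3 t)" and linear_R3: "linear (R3 t)"
  by (rule linearI; simp add: S3_def R3_def algebra_simps scaleR_conv_of_real add_divide_distrib)+

text \<open>When these two parameters vanish, \<open>\<gamma>t t\<close> involves only \<gamma> and
  its conjugate. The dual frame then splits into left-invariant lifts of the frame of B_t and
  multiples of the fibre direction.\<close>

locale deform = small_param +
  assumes t3: "t$3$1 = 0" "t$3$2 = 0"
begin

lemma \<gamma>t_eq: "\<gamma>t t = \<gamma> - D t \<cdot>\<^sub>f cnjf \<gamma>"
  by (simp add: \<gamma>t_def t3 fscale_def fun_eq_iff)

lemma coframe_X_eval:
  "\<alpha>t t p [v] = Sm t (proj v) $ 1" "\<beta>t t p [v] = Sm t (proj v) $ 2" "\<gamma>t t p [v] = S3 t (v$3 - p$1 * v$2)"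
  by (simp_all add: \<alpha>t_def \<beta>t_def \<gamma>t_eq \<alpha>_def \<beta>_def \<gamma>_def fscale_def cnjf_def Sm_def S3_def)

lemma less3: "(i::nat) < 3 \<longleftrightarrow> i = 0 \<or> i = 1 \<or> i = 2"
  by auto

sublocale X: coframe "coframe_X t" 3 "xX t" "yX t"
proof
  show "length (coframe_X t) = 3" by (simp add: coframe_X_def)
  show "deg1 (coframe_X t ! i)" if "i < 3" for i
    using that unfolding less3 by (elim disjE) (simp_all add: coframe_X_def)
  have 0: "Sm t 0 = 0" "S3 t 0 = 0" using linear_0[OF linear_Sm] linear_0[OF linear_S3] by blast+
  have p: "proj (lf u w p) = u" "lf u w p $ 3 = p$1 * u$2 + w" "lf u w p $ 2 = u $ 2" for u w and p :: "complex^3" by (simp_all add: lf_def)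
  show "(coframe_X t ! i) p [xX t j p] = (if i = j then 1 else 0)"
    "(coframe_X t ! i) p [yX t j p] = (if i = j then \<i> else 0)" if "i < 3" "j < 3" for i j p
    using that unfolding less3
    by (elim disjE; simp add: coframe_X_def coframe_X_eval xX_def yX_def p 0 xB_def yB_def Sm_Rm[OF small] S3_R3[OF small])+
  fix v p :: "complex^3"
  define a b where "a = Sm t (proj v)" "b = S3 t (v$3 - p$1 * v$2)"
  have lin_lf: "lf (u + u') (w + w') p = lf u w p + lf u' w' p" "r *\<^sub>R lf u w p = lf (r *\<^sub>R u) (r *\<^sub>R w) p" for u u' w w' r
    by (simp_all add: lf_def vec3_eq_iff algebra_simps)
  have "proj v = Rm t a" using small by (simp add: Rm_Sm a_b_def)
  also have "\<dots> = Re (a $ 1) *\<^sub>R Rm t (vec2 1 0) + Im (a $ 1) *\<^sub>R Rm t (vec2 \<i> 0)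
      + Re (a $ 2) *\<^sub>R Rm t (vec2 0 1) + Im (a $ 2) *\<^sub>R Rm t (vec2 0 \<i>)"
    by (subst vec2_expand[of a]) (simp add: linear_add[OF linear_Rm[OF small]] linear_cmul[OF linear_Rm[OF small]])
  finally have 1: "proj v = Re (a $ 1) *\<^sub>R Rm t (vec2 1 0) + Im (a $ 1) *\<^sub>R Rm t (vec2 \<i> 0)
      + Re (a $ 2) *\<^sub>R Rm t (vec2 0 1) + Im (a $ 2) *\<^sub>R Rm t (vec2 0 \<i>)" .
  have "v$3 - p$1 * v$2 = R3 t (Re b *\<^sub>R 1 + Im b *\<^sub>R \<i>)"
    using R3_S3[OF small] by (simp add: a_b_def scaleR_conv_of_real complex_eq[symmetric] mult.commute[of _ \<i>])
  then have 2: "v$3 - p$1 * v$2 = Re b *\<^sub>R R3 t 1 + Im b *\<^sub>R R3 t \<i>"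
    by (simp only: linear_add[OF linear_R3] linear_cmul[OF linear_R3])
  have "v = lf (proj v) (v$3 - p$1 * v$2) p" by (simp add: lf_def vec3_eq_iff)
  also have "\<dots> = Re (a $ 1) *\<^sub>R lf (Rm t (vec2 1 0)) 0 p + Im (a $ 1) *\<^sub>R lf (Rm t (vec2 \<i> 0)) 0 p
      + Re (a $ 2) *\<^sub>R lf (Rm t (vec2 0 1)) 0 p + Im (a $ 2) *\<^sub>R lf (Rm t (vec2 0 \<i>)) 0 p
      + (Re b *\<^sub>R lf 0 (R3 t 1) p + Im b *\<^sub>R lf 0 (R3 t \<i>) p)"
    by (simp only: lin_lf(2) lin_lf(1)[symmetric] 1[symmetric] 2[symmetric] scaleR_zero_right add_0_left add_0_right)
  finally show "v = (\<Sum>j<3. Re ((coframe_X t ! j) p [v]) *\<^sub>R xX t j p + Im ((coframe_X t ! j) p [v]) *\<^sub>R yX t j p)"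
    by (simp add: coframe_X_def coframe_X_eval xX_def yX_def xB_def yB_def lessThan_Suc numeral_eq_Suc add_ac a_b_def)
qed

end

section \<open>Closed left-invariant three-forms on X_t\<close>

definition twoX :: "param \<Rightarrow> (complex^3) cform list" where
  "twoX t = [\<alpha>t t \<and>\<^sub>w \<beta>t t, \<alpha>t t \<and>\<^sub>w cnjf (\<alpha>t t), \<alpha>t t \<and>\<^sub>w cnjf (\<beta>t t), \<beta>t t \<and>\<^sub>w cnjf (\<alpha>t t),
    \<beta>t t \<and>\<^sub>w cnjf (\<beta>t t), cnjf (\<alpha>t t) \<and>\<^sub>w cnjf (\<beta>t t)]"

lemma length_twoX: "length (twoX t) = 6"
  by (simp add: twoX_def)

lemma \<alpha>\<beta>t_eval: "\<alpha>t t p [v] = Sm t (proj v) $ 1" "\<beta>t t p [v] = Sm t (proj v) $ 2"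
  by (simp_all add: \<alpha>t_def \<beta>t_def \<alpha>_def \<beta>_def fscale_def cnjf_def Sm_def)

lemma twoX_eval: "i < 6 \<Longrightarrow> (twoX t ! i) p [x, y] = (two_forms t ! i) (proj x) (proj y)"
  unfolding less6
  by (elim disjE; simp add: twoX_def two_forms_def Let_def wedge2 \<alpha>\<beta>t_eval cnjf_single)

lemma twoX_deg2: "i < 6 \<Longrightarrow> length vs \<noteq> 2 \<Longrightarrow> (twoX t ! i) p vs = 0"
  unfolding less6
  by (elim disjE; simp add: twoX_def; cases vs rule: remdups_adj.cases; simp add: wedge2 split: list.split)

lemma twoX_tab: "i < 6 \<Longrightarrow> twoX t ! i = fcomb (map (\<lambda>k. tab t ! i ! k) [0..<6]) (twoX 0)"
proof (rule ext, rule ext)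
  fix p vs assume i: "i < 6"
  show "(twoX t ! i) p vs = fcomb (map (\<lambda>k. tab t ! i ! k) [0..<6]) (twoX 0) p vs"
  proof (cases "length vs = 2")
    case True
    then obtain x y where vs: "vs = [x, y]" by (auto simp: length_Suc_conv numeral_eq_Suc)
    show ?thesis unfolding vs
      by (simp add: fcomb_apply length_twoX twoX_eval i two_forms_tab[OF i])
  next
    case False
    then show ?thesis by (simp add: fcomb_apply length_twoX twoX_deg2 i)
  qed
qed

text \<open>The coefficients of \<open>d\<gamma>\<^sub>t\<close> in the forms of type \<open>(2,0)\<close> and \<open>(1,1)\<close>.\<close>

definition sg :: "param \<Rightarrow> nat \<Rightarrow> complex" where
  "sg t j = [D t * cnj (D t) - 1, t$2$1 + D t * cnj (t$2$1), t$2$2 - D t * cnj (t$1$1),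
     D t * cnj (t$2$2) - t$1$1, - (t$1$2 + D t * cnj (t$1$2))] ! j / NN t"

text \<open>The right-hand list holds the coordinates of d \<gamma>_t = - \<alpha>\<beta> + D
  cnj(\<alpha>\<beta>) at parameter 0. Five rows suffice to represent it, which expresses the
  absence of a (0,2)-part.\<close>

lemma sg_tab:
  assumes "norm t < 1/4" "k < 6"
  shows "(\<Sum>j<5. sg t j * tab t ! j ! k) = [-1, 0, 0, 0, 0, D t] ! k"
proof -
  define a b c d e where v: "a = t$1$1" "b = t$1$2" "c = t$2$1" "d = t$2$2" "e = D t"
  define a' b' c' d' e' where v': "a' = cnj a" "b' = cnj b" "c' = cnj c" "d' = cnj d" "e' = cnj e"
  have e: "e = a * d - b * c" "e' = a' * d' - b' * c'"
    by (simp_all add: v v' D_def)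
  have N: "NN t = 1 - (a * a' + b * c' + c * b' + d * d') + e * e'"
    by (simp add: v v' NN_def)
  have tab: "tab t = [[1, c, d, - a, - b, e], [b', 1 - a * a', - b * a', - a * b', - b * b', - b],
      [d', - a * c', 1 - b * c', - a * d', - b * d', a], [- a', - c * a', - d * a', 1 - c * b', - d * b', - d],
      [- c', - c * c', - d * c', - c * d', 1 - d * d', c], [e', - c', a', - d', b', 1]]"
    by (simp add: tab_def Let_def v v')
  let ?s = "[e * e' - 1, c + e * c', d - e * a', e * d' - a, - (b + e * b')]"
  have "(\<Sum>j<5. ?s ! j * tab t ! j ! k) = [-1, 0, 0, 0, 0, e] ! k * NN t"
    using assms(2) unfolding less6
    by (elim disjE; simp add: sum_5 tab N e del: One_nat_def; (simp add: algebra_simps)?)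
  moreover have "(\<Sum>j<5. sg t j * tab t ! j ! k) = (\<Sum>j<5. ?s ! j * tab t ! j ! k) / NN t"
    by (simp add: sg_def v v' sum_divide_distrib)
  ultimately show ?thesis using NN_nonzero[OF assms(1)] by (simp add: v)
qed

text \<open>The multiple of \<open>cnj \<gamma>\<^sub>t \<and> \<alpha>\<^sub>t \<and> \<beta>\<^sub>t\<close> which makes \<open>\<gamma>\<^sub>t \<and> twoX t ! j\<close> closed.\<close>

definition ss :: "param \<Rightarrow> nat \<Rightarrow> complex" where
  "ss t j = (D t * tab t ! j ! 0 - tab t ! j ! 5) / (1 - D t * cnj (D t))"

lemma ss_0: "ss t 0 = 0"
  by (simp add: ss_def tab_def Let_def)

lemma NN_real: "cnj (NN t) = NN t"
  by (simp add: NN_def algebra_simps)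

text \<open>Closedness dictates the correction \<open>ss\<close>; here it is identified with the
  quotients of structure constants that occur in the forms \<Gamma>_j.\<close>

lemma ss_sg:
  assumes "norm t < 1/4"
  shows "ss t 1 = sg t 4 / cnj (sg t 0)" "ss t 2 = - sg t 3 / cnj (sg t 0)"
    "ss t 3 = - sg t 2 / cnj (sg t 0)" "ss t 4 = sg t 1 / cnj (sg t 0)"
proof -
  have c: "cnj (sg t 0) = - (1 - D t * cnj (D t)) / NN t"
    by (simp add: sg_def NN_real mult.commute)
  have r: "ss t j = x / cnj (sg t 0)" if "x = - (D t * tab t ! j ! 0 - tab t ! j ! 5) / NN t" for x j
    unfolding that c ss_def using D_nonunit[OF assms] NN_nonzero[OF assms] by (simp add: field_simps)
  show "ss t 1 = sg t 4 / cnj (sg t 0)" "ss t 2 = - sg t 3 / cnj (sg t 0)"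
    "ss t 3 = - sg t 2 / cnj (sg t 0)" "ss t 4 = sg t 1 / cnj (sg t 0)"
    by (rule r; simp add: sg_def tab_def Let_def diff_divide_distrib)+
qed

text \<open>A uniform description of the frame: index 0 gives \<open>\<Omega>t t\<close>, and
  indices 1 to 4 give the lifts - \<Gamma>_j.\<close>

definition nuX :: "param \<Rightarrow> nat \<Rightarrow> (complex^3) cform" where
  "nuX t j = \<gamma>t t \<and>\<^sub>w twoX t ! j + ss t j \<cdot>\<^sub>f (cnjf (\<gamma>t t) \<and>\<^sub>w twoX t ! 0)"

text \<open>The forms \<open>\<gamma> \<and> cnj \<alpha> \<and> cnj \<beta>\<close> and \<open>cnj \<gamma> \<and> \<alpha> \<and> \<beta>\<close> have the same nonzero differential, so only
  their difference is closed.\<close>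

definition kapX :: "(complex^3) cform list" where
  "kapX = map (\<lambda>k. \<gamma> \<and>\<^sub>w twoX 0 ! k) [0..<5] @ map (\<lambda>k. cnjf \<gamma> \<and>\<^sub>w twoX 0 ! k) [1..<6]
     @ [\<gamma> \<and>\<^sub>w twoX 0 ! 5 - cnjf \<gamma> \<and>\<^sub>w twoX 0 ! 0]"

lemma length_kapX: "length kapX = 11"
  by (simp add: kapX_def)

text \<open>Indices 0 to 4 of \<open>kapX\<close> carry \<gamma>, indices 5 to 9 its conjugate with
  the two-forms 1 to 5, hence the offset 4; index 10 is the closed difference and takes the
  coefficient of \<gamma> with two-form 5.\<close>

definition MX :: "nat \<Rightarrow> nat \<Rightarrow> param \<Rightarrow> complex" where
  "MX j k t = (if 5 \<le> k \<and> k < 10 then ss t j * tab t ! 0 ! (k - 4) - D t * tab t ! j ! (k - 4)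
     else tab t ! j ! (if k = 10 then 5 else k) - ss t j * cnj (D t) * tab t ! 0 ! (if k = 10 then 5 else k))"

lemma forms_X_wedge_2: "is1 a \<Longrightarrow> is1 b \<Longrightarrow> is1 c \<Longrightarrow>
    (\<And>\<phi>. \<phi> \<in> lattice_X \<Longrightarrow> pullback \<phi> a = a) \<Longrightarrow> (\<And>\<phi>. \<phi> \<in> lattice_X \<Longrightarrow> pullback \<phi> b = b) \<Longrightarrow>
    (\<And>\<phi>. \<phi> \<in> lattice_X \<Longrightarrow> pullback \<phi> c = c) \<Longrightarrow> a \<and>\<^sub>w b \<and>\<^sub>w c \<in> forms lattice_X 3"
  by (simp add: forms_def is_kform_3 pullback_wedge)

lemma is1_coframe: "is1 \<alpha>" "is1 \<beta>" "is1 \<gamma>"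
proof -
  show "is1 \<alpha>" "is1 \<beta>"
    by (auto simp: is1_def \<alpha>_def \<beta>_def smooth_on_const intro!: linearI)
  have "smooth_on UNIV (\<lambda>p::complex^3. v $ 3 - p $ 1 * v $ 2)" for v :: "complex^3"
    by (intro smooth_on_diff smooth_on_mult smooth_on_const smooth_on_bounded_linear[OF open_UNIV bounded_linear_vec_nth] open_UNIV)
  then show "is1 \<gamma>"
    by (auto simp: is1_def \<gamma>_def algebra_simps intro!: linearI)
qed

lemma fconst_coframe: "fconst \<alpha>" "fconst \<beta>"
  by (rule fconst_deg1I, simp, simp add: \<alpha>_def \<beta>_def)+

lemma twoX_0: "twoX 0 = [\<alpha> \<and>\<^sub>w \<beta>, \<alpha> \<and>\<^sub>w cnjf \<alpha>, \<alpha> \<and>\<^sub>w cnjf \<beta>, \<beta> \<and>\<^sub>w cnjf \<alpha>, \<beta> \<and>\<^sub>w cnjf \<beta>, cnjf \<alpha> \<and>\<^sub>w cnjf \<beta>]"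
proof -
  have "\<alpha>t 0 = \<alpha>" "\<beta>t 0 = \<beta>" by (simp_all add: \<alpha>t_def \<beta>t_def fscale_def fun_eq_iff)
  then show ?thesis by (simp add: twoX_def)
qed

lemma pullback_coframe: "\<phi> \<in> lattice_X \<Longrightarrow> pullback \<phi> (cnjf \<alpha>) = cnjf \<alpha>" "\<phi> \<in> lattice_X \<Longrightarrow> pullback \<phi> (cnjf \<beta>) = cnjf \<beta>"
  "\<phi> \<in> lattice_X \<Longrightarrow> pullback \<phi> (cnjf \<gamma>) = cnjf \<gamma>"
  by (simp_all add: pullback_cnjf coframe_invariant)

lemma cnjf_wedge_2: "deg1 a \<Longrightarrow> deg1 b \<Longrightarrow> cnjf (a \<and>\<^sub>w b) = cnjf a \<and>\<^sub>w cnjf b"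
  by (auto simp: fun_eq_iff wedge2 cnjf_single split: list.split)

lemma wedge_rotate: "deg1 a \<Longrightarrow> deg1 b \<Longrightarrow> deg1 c \<Longrightarrow> a \<and>\<^sub>w b \<and>\<^sub>w c = b \<and>\<^sub>w c \<and>\<^sub>w a"
  by (auto simp: fun_eq_iff wedge3 algebra_simps split: list.split)

text \<open>Rotating \<open>g\<close> to the end is an even permutation; then d has to pass only two
  constant factors, and the two signs cancel.\<close>

lemma extd_wedge_3:
  assumes "deg1 b" "deg1 c" "deg1 g" "fconst b" "fconst c" "fdiff g"
  shows "extd (g \<and>\<^sub>w b \<and>\<^sub>w c) = b \<and>\<^sub>w c \<and>\<^sub>w extd g"
proof -
  have "extd (g \<and>\<^sub>w b \<and>\<^sub>w c) = extd (b \<and>\<^sub>w c \<and>\<^sub>w g)" using assms by (simp add: wedge_rotate)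
  also have "\<dots> = b \<and>\<^sub>w c \<and>\<^sub>w extd g"
    using assms by (simp add: extd_wedge_fconst fdiff_wedge_fconst wedge_minus)
  finally show ?thesis .
qed

lemma extd_cnjf_gamma: "extd (cnjf \<gamma>) = - (cnjf \<alpha> \<and>\<^sub>w cnjf \<beta>)"
proof -
  have "cnjf (- (\<alpha> \<and>\<^sub>w \<beta>)) = - cnjf (\<alpha> \<and>\<^sub>w \<beta>)" by (simp add: cnjf_def fun_eq_iff)
  then show ?thesis using is1_fdiff[OF is1_coframe(3)] by (simp add: extd_cnjf extd_gamma cnjf_wedge_2)
qed

text \<open>After differentiation most products repeat \<alpha>, \<beta> or a conjugate and
  vanish.\<close>

lemma kapX_closed: "set kapX \<subseteq> dR_closed lattice_X 3"
proof
  fix \<omega> assume \<omega>: "\<omega> \<in> set kapX"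
  have up: "[0..<5] = [0, 1, 2, 3, 4::nat]" "[1..<6] = [1, 2, 3, 4, 5::nat]" by (simp_all add: upt_rec numeral_eq_Suc)
  note i = is1_coframe is1_coframe[THEN is1_cnjf] and f = fconst_coframe fconst_coframe[THEN fconst_cnjf]
  have f3: "fdiff (g \<and>\<^sub>w b \<and>\<^sub>w c)" if "is1 g" "is1 b" "is1 c" for g b c :: "(complex^3) cform"
    using is_kform_fdiff[OF is_kform_3[OF that]] .
  have "\<omega> \<in> forms lattice_X 3"
    using \<omega> unfolding kapX_def up twoX_0
    by (simp del: One_nat_def, elim disjE)
       (simp_all del: One_nat_def add: coframe_invariant pullback_coframe i forms_X_wedge_2 fsub_diff[OF fsub_forms])
  moreover have "extd \<omega> = 0"
  proof -
    have s0: "a \<and>\<^sub>w b \<and>\<^sub>w b \<and>\<^sub>w c = 0" "a \<and>\<^sub>w b \<and>\<^sub>w a \<and>\<^sub>w c = 0" "a \<and>\<^sub>w b \<and>\<^sub>w c \<and>\<^sub>w b = 0" "a \<and>\<^sub>w b \<and>\<^sub>w c \<and>\<^sub>w a = 0"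
      if "deg1 a" "deg1 b" "deg1 c" for a b c :: "(complex^3) cform"
    proof -
      have w0: "x \<and>\<^sub>w 0 = 0" if "deg1 x" for x :: "(complex^3) cform" using wedge_0[OF that] .
      show 1: "a \<and>\<^sub>w b \<and>\<^sub>w b \<and>\<^sub>w c = 0" using that by (simp add: wedge_same w0)
      show "a \<and>\<^sub>w b \<and>\<^sub>w a \<and>\<^sub>w c = 0" using that wedge_swap[of b a c] by (simp add: wedge_minus wedge_same)
      have bb: "x \<and>\<^sub>w x = 0" if "deg1 x" for x :: "(complex^3) cform"
        using wedge_same[OF that, of unitf] by (simp add: wedge_unitf that)
      have sw: "x \<and>\<^sub>w y = - (y \<and>\<^sub>w x)" if "deg1 x" "deg1 y" for x y :: "(complex^3) cform"
        using wedge_swap[OF that, of unitf] that by (simp add: wedge_unitf)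
      show "a \<and>\<^sub>w b \<and>\<^sub>w c \<and>\<^sub>w b = 0" using that sw[of c b] by (simp add: wedge_minus wedge_same w0)
      show "a \<and>\<^sub>w b \<and>\<^sub>w c \<and>\<^sub>w a = 0" using that sw[of c a] wedge_swap[of b a c] by (simp add: wedge_minus wedge_same)
    qed
    \<comment> \<open>Two-forms commute; this cancels the two differentials in the last
      element.\<close>
    have s4: "a \<and>\<^sub>w b \<and>\<^sub>w c \<and>\<^sub>w d = c \<and>\<^sub>w d \<and>\<^sub>w a \<and>\<^sub>w b" if "deg1 a" "deg1 b" "deg1 c" "deg1 d" for a b c d :: "(complex^3) cform"
    proof -
      have r: "a' \<and>\<^sub>w c \<and>\<^sub>w d = c \<and>\<^sub>w d \<and>\<^sub>w a'" if "deg1 a'" for a' using that \<open>deg1 c\<close> \<open>deg1 d\<close> by (rule wedge_rotate)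
      have "a \<and>\<^sub>w b \<and>\<^sub>w c \<and>\<^sub>w d = a \<and>\<^sub>w c \<and>\<^sub>w d \<and>\<^sub>w b" using r[OF \<open>deg1 b\<close>] by simp
      also have "\<dots> = c \<and>\<^sub>w d \<and>\<^sub>w a \<and>\<^sub>w b"
        using that wedge_swap[of a c "d \<and>\<^sub>w b"] wedge_swap[of a d b] by (simp add: wedge_minus)
      finally show ?thesis .
    qed
    have d: "extd (\<gamma> \<and>\<^sub>w b \<and>\<^sub>w c) = - (b \<and>\<^sub>w c \<and>\<^sub>w \<alpha> \<and>\<^sub>w \<beta>)"
      "extd (cnjf \<gamma> \<and>\<^sub>w b \<and>\<^sub>w c) = - (b \<and>\<^sub>w c \<and>\<^sub>w cnjf \<alpha> \<and>\<^sub>w cnjf \<beta>)"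
      if "deg1 b" "deg1 c" "fconst b" "fconst c" for b c
      using that is1_fdiff[OF is1_coframe(3)]
      by (simp_all add: extd_wedge_3 fdiff_cnjf extd_gamma extd_cnjf_gamma wedge_minus)
    show ?thesis
      using \<omega> unfolding kapX_def up twoX_0
      by (simp del: One_nat_def, elim disjE)
         (simp_all del: One_nat_def add: d f s0 extd_diff f3 i s4[of "cnjf \<alpha>" "cnjf \<beta>" \<alpha> \<beta>])
  qed
  ultimately show "\<omega> \<in> dR_closed lattice_X 3" by (simp add: dR_closed_def)
qed

context deform
begin

lemma wedge_gamma_t:
  "\<gamma>t t \<and>\<^sub>w \<omega> = \<gamma> \<and>\<^sub>w \<omega> - D t \<cdot>\<^sub>f (cnjf \<gamma> \<and>\<^sub>w \<omega>)"
  "cnjf (\<gamma>t t) \<and>\<^sub>w \<omega> = cnjf \<gamma> \<and>\<^sub>w \<omega> - cnj (D t) \<cdot>\<^sub>f (\<gamma> \<and>\<^sub>w \<omega>)"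
proof -
  have l: "(a - c \<cdot>\<^sub>f b) \<and>\<^sub>w \<omega> = a \<and>\<^sub>w \<omega> - c \<cdot>\<^sub>f (b \<and>\<^sub>w \<omega>)" if "deg1 a" "deg1 b" for a b c
  proof -
    have "deg1 (a - c \<cdot>\<^sub>f b)" using that by simp
    then show ?thesis using that
      by (simp add: fun_eq_iff wedge_deg1) (simp add: wedge_deg1 fscale_def sum_subtractf sum_distrib_left algebra_simps)
  qed
  have "cnjf (\<gamma>t t) = cnjf \<gamma> - cnj (D t) \<cdot>\<^sub>f \<gamma>" by (simp add: \<gamma>t_eq cnjf_def fscale_def fun_eq_iff)
  then show "cnjf (\<gamma>t t) \<and>\<^sub>w \<omega> = cnjf \<gamma> \<and>\<^sub>w \<omega> - cnj (D t) \<cdot>\<^sub>f (\<gamma> \<and>\<^sub>w \<omega>)"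
    by (simp add: l)
  show "\<gamma>t t \<and>\<^sub>w \<omega> = \<gamma> \<and>\<^sub>w \<omega> - D t \<cdot>\<^sub>f (cnjf \<gamma> \<and>\<^sub>w \<omega>)"
    unfolding \<gamma>t_eq by (simp add: l)
qed

lemma wedge_twoX:
  assumes "deg1 g" "j < 6"
  shows "(g \<and>\<^sub>w twoX t ! j) p vs = (\<Sum>k<6. tab t ! j ! k * (g \<and>\<^sub>w twoX 0 ! k) p vs)"
proof -
  have "twoX t ! j = (\<lambda>p vs. \<Sum>k<6. tab t ! j ! k * (twoX 0 ! k) p vs)"
    by (simp add: twoX_tab[OF assms(2)] fun_eq_iff fcomb_apply length_twoX)
  then show ?thesis using wedge_sum[OF assms(1), where c = "\<lambda>k _. tab t ! j ! k"] by simp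
qed

text \<open>Twelve products of \<gamma> or its conjugate with a two-form occur, but only eleven
  closed combinations are available; the choice of \<open>ss\<close> balances the two products that
  are not closed separately.\<close>

lemma nuX_fcomb:
  assumes "j < 6"
  shows "nuX t j = fcomb (map (\<lambda>k. MX j k t) [0..<length kapX]) kapX"
proof (rule ext, rule ext)
  fix p vs
  define G where "G k = (\<gamma> \<and>\<^sub>w twoX 0 ! k) p vs" for k
  define H where "H k = (cnjf \<gamma> \<and>\<^sub>w twoX 0 ! k) p vs" for k
  define s where "s = ss t j"
  have s: "s * (1 - D t * cnj (D t)) = D t * tab t ! j ! 0 - tab t ! j ! 5"
    unfolding s_def ss_def using D_nonunit[OF small] by simp
  have t0: "tab t ! 0 ! 0 = 1" "tab t ! 0 ! 5 = D t" by (simp_all add: tab_def Let_def)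
  have "nuX t j p vs = (\<Sum>k<6. tab t ! j ! k * G k) - D t * (\<Sum>k<6. tab t ! j ! k * H k)
      + s * ((\<Sum>k<6. tab t ! 0 ! k * H k) - cnj (D t) * (\<Sum>k<6. tab t ! 0 ! k * G k))"
    using assms by (simp add: nuX_def wedge_gamma_t wedge_twoX fscale_def G_def H_def s_def)
  also have "\<dots> = (\<Sum>k<6. (tab t ! j ! k - s * cnj (D t) * tab t ! 0 ! k) * G k)
      + (\<Sum>k<6. (s * tab t ! 0 ! k - D t * tab t ! j ! k) * H k)"
    by (simp add: sum_distrib_left sum.distrib sum_subtractf algebra_simps)
  also have "\<dots> = (\<Sum>k<5. MX j k t * G k) + (\<Sum>k<5. MX j (k + 5) t * H (k + 1)) + MX j 10 t * (G 5 - H 0)"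
  proof -
    have split: "(\<Sum>k<6. u k * G k) + (\<Sum>k<6. v k * H k) = (\<Sum>k<5. u k * G k) + (\<Sum>k<5. v (k + 1) * H (k + 1)) + u 5 * (G 5 - H 0)"
      if "v 0 = - u 5" for u v
      by (simp add: sum_5 sum_6 that algebra_simps del: One_nat_def)
    \<comment> \<open>This is the defining equation of \<open>ss\<close>: the coefficients of the
      two nonclosed products are opposite, so the products merge into the last element of
      \<open>kapX\<close>.\<close>
    have "s * tab t ! 0 ! 0 - D t * tab t ! j ! 0 = - (tab t ! j ! 5 - s * cnj (D t) * tab t ! 0 ! 5)"
      using s unfolding t0 by (simp add: algebra_simps)
    from split[of "\<lambda>k. s * tab t ! 0 ! k - D t * tab t ! j ! k" "\<lambda>k. tab t ! j ! k - s * cnj (D t) * tab t ! 0 ! k", OF this]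
    show ?thesis by (simp add: MX_def s_def)
  qed
  also have "\<dots> = (\<Sum>k<11. MX j k t * (kapX ! k) p vs)"
  proof -
    have s11: "(\<Sum>k<11. f k) = (\<Sum>k<5. f k) + (\<Sum>k<5. f (k + 5)) + f (10::nat)" for f :: "nat \<Rightarrow> complex"
      by (simp add: eval_nat_numeral)
    have "kapX ! k = \<gamma> \<and>\<^sub>w twoX 0 ! k" "kapX ! (k + 5) = cnjf \<gamma> \<and>\<^sub>w twoX 0 ! (k + 1)" if "k < 5" for k
      using that by (simp_all add: kapX_def nth_append)
    moreover have "kapX ! 10 = \<gamma> \<and>\<^sub>w twoX 0 ! 5 - cnjf \<gamma> \<and>\<^sub>w twoX 0 ! 0" by (simp add: kapX_def nth_append)
    ultimately show ?thesis by (simp add: s11 G_def H_def)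
  qed
  finally show "nuX t j p vs = fcomb (map (\<lambda>k. MX j k t) [0..<length kapX]) kapX p vs"
    by (simp add: fcomb_apply length_kapX)
qed

lemma nuX_closed: "j < 6 \<Longrightarrow> nuX t j \<in> dR_closed lattice_X 3"
  by (simp add: nuX_fcomb fcomb_in[OF fsub_dR_closed _ kapX_closed])

end

context deform
begin

lemma nuX_eval: "j < 6 \<Longrightarrow> nuX t j p [lf x 0 p, lf y 0 p, lf 0 w p] =
    S3 t w * (two_forms t ! j) x y + ss t j * cnj (S3 t w) * (two_forms t ! 0) x y"
proof -
  assume j: "j < 6"
  have 0: "S3 t 0 = 0" by (simp add: S3_def)
  have p: "proj (lf u w p) = u" "lf u w p $ 3 - p$1 * lf u w p $ 2 = w" for u w and p :: "complex^3" by (simp_all add: lf_def)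
  have *: "(g \<and>\<^sub>w twoX t ! i) p [lf x 0 p, lf y 0 p, lf 0 w p] = g p [lf 0 w p] * (two_forms t ! i) x y"
    if "deg1 g" "i < 6" "g p [lf x 0 p] = 0" "g p [lf y 0 p] = 0" for g i
    using that by (simp add: wedge_deg1 lessThan_Suc numeral_eq_Suc twoX_eval[unfolded numeral_eq_Suc] p)
  show ?thesis
    by (simp add: nuX_def fscale_def * j coframe_X_eval cnjf_single p 0)
qed

lemma uX_nuX: "j < 6 \<Longrightarrow> uX (nuX t j) = (\<lambda>x y. (two_forms t ! j) x y - ss t j * cnj (D t) * (two_forms t ! 0) x y)"
  by (simp add: fun_eq_iff uX_def nuX_eval S3_def field_simps)

lemma ellX_nuX: "k < 5 \<Longrightarrow> j < 6 \<Longrightarrow> ellX k (nuX t j) = tab t ! j ! k - ss t j * cnj (D t) * tab t ! 0 ! k"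
  using coord2_add[of k "two_forms t ! j" "\<lambda>x y. - (ss t j * cnj (D t)) * (two_forms t ! 0) x y"]
    coord2_cmult[of k "- (ss t j * cnj (D t))" "two_forms t ! 0"]
  by (simp add: ellX_def uX_nuX coord2_two_forms)

end

lemma ellX_fcomb: "k < 5 \<Longrightarrow> length cs = length \<omega>s \<Longrightarrow> set \<omega>s \<subseteq> forms lattice_X 3 \<Longrightarrow>
    ellX k (fcomb cs \<omega>s) = (\<Sum>j<length \<omega>s. cs ! j * ellX k (\<omega>s ! j))"
  by (rule additive_fcomb[OF fsub_forms]) (simp_all only: ellX_add ellX_scale)

text \<open>The matrix of the functionals is \<open>tab t\<close> minus a rank-one matrix
  proportional to row 0, so its inverse is \<open>rB\<close> with one correction in coefficient
  0.\<close>

definition rX :: "nat \<Rightarrow> nat \<Rightarrow> param \<Rightarrow> complex" where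
  "rX i k t = rB i k t + (if i = 0 then cnj (D t) * (\<Sum>j<5. ss t j * rB j k t) else 0)"

text \<open>Only the coefficient of \<open>\<alpha>\<^sub>t \<and> \<beta>\<^sub>t \<and> \<gamma>\<^sub>t\<close> differs from the one on the base torus.\<close>

lemma (in deform) rX_extract:
  assumes cs: "length cs = 5" "i < 5"
  shows "cs ! i = (\<Sum>k<5. rX i k t * (\<Sum>j<5. cs ! j * (tab t ! j ! k - ss t j * cnj (D t) * tab t ! 0 ! k)))"
proof -
  \<comment> \<open>Absorbing the rank-one term into coefficient 0 turns the system for
    \<open>cs\<close> into the torus system for \<open>ds\<close>.\<close>
  define S where "S = (\<Sum>j<5. cs ! j * ss t j)"
  define ds where "ds = cs[0 := cs ! 0 - cnj (D t) * S]"
  have ds: "length ds = 5" "ds ! 0 = cs ! 0 - cnj (D t) * S" "\<And>j. j \<noteq> 0 \<Longrightarrow> ds ! j = cs ! j"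
    using cs by (simp_all add: ds_def)
  have e: "(\<Sum>j<5. cs ! j * (tab t ! j ! k - ss t j * cnj (D t) * tab t ! 0 ! k)) = (\<Sum>j<5. ds ! j * tab t ! j ! k)" for k
    unfolding S_def sum_5 ds(2) by (simp add: ds(3) sum_5 S_def algebra_simps)
  have x: "ds ! j = (\<Sum>k<5. rB j k t * (\<Sum>j<5. ds ! j * tab t ! j ! k))" if "j < 5" for j
    by (rule rB_tab[OF small that ds(1)])
  show ?thesis
  proof (cases "i = 0")
    case True
    \<comment> \<open>Because \<open>ss t 0\<close> vanishes, S does not involve the modified entry
      and can be read off from \<open>ds\<close>.\<close>
    have "S = (\<Sum>j<5. ss t j * ds ! j)" unfolding S_def sum_5 by (simp add: ds ss_0 mult.commute)
    also have "\<dots> = (\<Sum>j<5. \<Sum>k<5. ss t j * (rB j k t * (\<Sum>j<5. ds ! j * tab t ! j ! k)))"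
      by (intro sum.cong refl) (subst x, simp_all add: sum_distrib_left)
    also have "\<dots> = (\<Sum>k<5. \<Sum>j<5. ss t j * rB j k t * (\<Sum>j<5. ds ! j * tab t ! j ! k))"
      by (subst sum.swap) (simp only: mult.assoc)
    finally have S: "S = (\<Sum>k<5. (\<Sum>j<5. ss t j * rB j k t) * (\<Sum>j<5. ds ! j * tab t ! j ! k))"
      by (simp only: sum_distrib_right)
    have "cs ! 0 = ds ! 0 + cnj (D t) * S" by (simp add: ds)
    also have "\<dots> = (\<Sum>k<5. rX 0 k t * (\<Sum>j<5. ds ! j * tab t ! j ! k))"
    proof -
      have "a = (\<Sum>k<5. f k * E k) \<Longrightarrow> b = (\<Sum>k<5. T k * E k) \<Longrightarrow> a + c * b = (\<Sum>k<5. (f k + c * T k) * E k)"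
        for a b c :: complex and f T E :: "nat \<Rightarrow> complex"
        by (simp add: sum_distrib_left sum.distrib[symmetric] distrib_right mult.assoc)
      from this[OF x[of 0] S] show ?thesis by (simp add: rX_def)
    qed
    finally show ?thesis unfolding e True .
  next
    case False
    then show ?thesis unfolding e using x[of i] cs ds by (simp add: rX_def)
  qed
qed

section \<open>Smooth dependence on t and the frame data of X\<close>

lemma smooth_ss: "j < 6 \<Longrightarrow> smooth_on (ball 0 (1/4)) (\<lambda>t. ss t j)"
proof -
  have "1 - D t * cnj (D t) \<noteq> 0" if "t \<in> ball 0 (1/4)" for t using D_nonunit[of t] that by simp
  moreover assume "j < 6"
  ultimately show ?thesis
    unfolding ss_def
    by (intro smooth_on_divide smooth_on_diff smooth_on_mult smooth_on_const smooth_D smooth_tab smooth_on_cnj) auto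
qed

lemma smooth_rX: "i < 5 \<Longrightarrow> k < 5 \<Longrightarrow> smooth_on (ball 0 (1/4)) (rX i k)"
proof -
  assume i: "i < 5" and k: "k < 5"
  have "smooth_on (ball 0 (1/4)) (\<lambda>t. rB i k t + (if i = 0 then 1 else 0) * (cnj (D t) * (\<Sum>j<5. ss t j * rB j k t)))"
    using i k by (intro smooth_on_add smooth_on_mult smooth_on_const smooth_on_cnj smooth_D smooth_on_sum smooth_rB smooth_ss) auto
  moreover have "rX i k = (\<lambda>t. rB i k t + (if i = 0 then 1 else 0) * (cnj (D t) * (\<Sum>j<5. ss t j * rB j k t)))"
    by (auto simp: rX_def fun_eq_iff)
  ultimately show ?thesis by (simp only:)
qed

lemma smooth_MX: "j < 5 \<Longrightarrow> k < 11 \<Longrightarrow> smooth_on (ball 0 (1/4)) (MX j k)"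
proof -
  assume j: "j < 5" and k: "k < 11"
  show ?thesis
  proof (cases "5 \<le> k \<and> k < 10")
    case True
    define l where "l = k - 4"
    have "l < 6" using True by (auto simp: l_def)
    moreover have "MX j k = (\<lambda>t. ss t j * tab t ! 0 ! l - D t * tab t ! j ! l)"
      using True by (simp add: MX_def fun_eq_iff l_def)
    ultimately show ?thesis using j
      by (simp only:) (intro smooth_on_diff smooth_on_mult smooth_ss smooth_D smooth_tab; simp)
  next
    case False
    define l where "l = (if k = 10 then 5 else k)"
    have l: "l < 6" using False k by (auto simp: l_def)
    have "MX j k = (\<lambda>t. tab t ! j ! l - ss t j * cnj (D t) * tab t ! 0 ! l)"
      using False by (auto simp: MX_def fun_eq_iff l_def)
    then show ?thesis using l j
      by (simp only:) (intro smooth_on_diff smooth_on_mult smooth_on_cnj smooth_ss smooth_D smooth_tab; simp)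
  qed
qed

lemma deform_ball: "t \<in> Delta_gamma \<epsilon> \<Longrightarrow> \<epsilon> \<le> 1/4 \<Longrightarrow> deform t"
  by unfold_locales (auto simp: Delta_gamma_def)

lemma frame_data_X:
  assumes "\<epsilon> \<le> 1/4" "n \<le> 5"
  shows "frame_data (Delta_gamma \<epsilon>) (ball 0 (1/4)) n (\<lambda>t. map (nuX t) [0..<n]) (dR_closed lattice_X 3) (dR_exact lattice_X 3)
    kapX MX 5 ellX rX"
proof
  show "Delta_gamma \<epsilon> \<subseteq> ball 0 (1/4)" using ball_small assms by auto
  show "map (nuX t) [0..<n] ! i = fcomb (map (\<lambda>k. MX i k t) [0..<length kapX]) kapX" if "t \<in> Delta_gamma \<epsilon>" "i < n" for t i
    using that assms deform.nuX_fcomb[OF deform_ball, of t \<epsilon> i] by simp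
  show "smooth_on (ball 0 (1/4)) (MX i k)" if "i < n" "k < length kapX" for i k
    using that assms by (intro smooth_MX) (auto simp: length_kapX)
  show "ellX k (a + b) = ellX k a + ellX k b" if "k < 5" "a \<in> dR_closed lattice_X 3" "b \<in> dR_closed lattice_X 3" for k a b
    using that by (simp add: ellX_add dR_closed_def)
  show "ellX k a = 0" if "k < 5" "a \<in> dR_exact lattice_X 3" for k a
    using that ellX_extd by (auto simp: dR_exact_def numeral_3_eq_3 numeral_2_eq_2)
  fix cs :: "complex list" and i t assume t: "t \<in> Delta_gamma \<epsilon>" and cs: "length cs = n" and i: "i < n"
  interpret deform t using deform_ball[OF t assms(1)] .
  define ds where "ds = cs @ replicate (5 - n) (0::complex)"
  have ds: "length ds = 5" using cs assms by (simp add: ds_def)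
  have "ellX k (fcomb cs (map (nuX t) [0..<n])) = (\<Sum>j<5. ds ! j * (tab t ! j ! k - ss t j * cnj (D t) * tab t ! 0 ! k))" if "k < 5" for k
  proof -
    have "set (map (nuX t) [0..<n]) \<subseteq> forms lattice_X 3"
      using nuX_closed assms by (auto simp: dR_closed_def)
    then have "ellX k (fcomb cs (map (nuX t) [0..<n])) = (\<Sum>j<n. cs ! j * (tab t ! j ! k - ss t j * cnj (D t) * tab t ! 0 ! k))"
      using that cs assms by (simp add: ellX_fcomb ellX_nuX)
    also have "\<dots> = (\<Sum>j<5. ds ! j * (tab t ! j ! k - ss t j * cnj (D t) * tab t ! 0 ! k))"
      using assms cs by (intro sum.mono_neutral_cong_left) (auto simp: ds_def nth_append)
    finally show ?thesis .
  qed
  moreover have "ds ! i = (\<Sum>k<5. rX i k t * (\<Sum>j<5. ds ! j * (tab t ! j ! k - ss t j * cnj (D t) * tab t ! 0 ! k)))"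
    using i assms by (intro rX_extract ds) auto
  moreover have "ds ! i = cs ! i" using i cs by (simp add: ds_def nth_append)
  ultimately show "cs ! i = (\<Sum>k<5. rX i k t * ellX k (fcomb cs (map (nuX t) [0..<n])))" by simp
qed (use assms ellX_scale smooth_rX kapX_closed in \<open>auto simp: fsub_dR_exact fsub_dR_closed\<close>)

section \<open>Types on X_t and the structure constants\<close>

lemma monomials_3:
  assumes "deg1 a" "deg1 b" "deg1 c"
  shows "monomial [a, b, c] {0, 1} {} = a \<and>\<^sub>w b" "monomial [a, b, c] {0, 2} {} = a \<and>\<^sub>w c" "monomial [a, b, c] {1, 2} {} = b \<and>\<^sub>w c"
    "monomial [a, b, c] {0} {} = a" "monomial [a, b, c] {1} {} = b" "monomial [a, b, c] {2} {} = c"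
    "monomial [a, b, c] {0} {0} = a \<and>\<^sub>w cnjf a" "monomial [a, b, c] {0} {1} = a \<and>\<^sub>w cnjf b"
    "monomial [a, b, c] {1} {0} = b \<and>\<^sub>w cnjf a" "monomial [a, b, c] {1} {1} = b \<and>\<^sub>w cnjf b"
    "monomial [a, b, c] {0, 1, 2} {} = a \<and>\<^sub>w b \<and>\<^sub>w c"
    "monomial [a, b, c] {0, 1, 2} {0} = a \<and>\<^sub>w b \<and>\<^sub>w c \<and>\<^sub>w cnjf a" "monomial [a, b, c] {0, 1, 2} {1} = a \<and>\<^sub>w b \<and>\<^sub>w c \<and>\<^sub>w cnjf b"
    "monomial [a, b, c] {0, 1, 2} {2} = a \<and>\<^sub>w b \<and>\<^sub>w c \<and>\<^sub>w cnjf c"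
  using assms by (simp_all add: monomial_def wedges_eq nths_Cons wedge_unitf)

context deform
begin

lemmas monomials_X = monomials_3[OF deg1_frames(1)[of t] deg1_frames(2)[of t] deg1_frames(3)[of t], folded coframe_X_def]

lemma oftype_X: "X.oftype 2 0 (\<alpha>t t \<and>\<^sub>w \<beta>t t)" "X.oftype 2 0 (\<alpha>t t \<and>\<^sub>w \<gamma>t t)" "X.oftype 2 0 (\<beta>t t \<and>\<^sub>w \<gamma>t t)"
  "X.oftype 1 1 (\<alpha>t t \<and>\<^sub>w cnjf (\<alpha>t t))" "X.oftype 1 1 (\<alpha>t t \<and>\<^sub>w cnjf (\<beta>t t))"
   "X.oftype 1 1 (\<beta>t t \<and>\<^sub>w cnjf (\<alpha>t t))" "X.oftype 1 1 (\<beta>t t \<and>\<^sub>w cnjf (\<beta>t t))" "X.oftype 3 0 (\<alpha>t t \<and>\<^sub>w \<beta>t t \<and>\<^sub>w \<gamma>t t)"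
  using X.oftype_monomial[of "{0,1}" "{}"] X.oftype_monomial[of "{0,2}" "{}"] X.oftype_monomial[of "{1,2}" "{}"]
    X.oftype_monomial[of "{0}" "{0}"] X.oftype_monomial[of "{0}" "{1}"]
    X.oftype_monomial[of "{1}" "{0}"] X.oftype_monomial[of "{1}" "{1}"] X.oftype_monomial[of "{0,1,2}" "{}"]
  by (simp_all add: monomials_X numeral_2_eq_2[symmetric] numeral_3_eq_3[symmetric] One_nat_def[symmetric] del: One_nat_def)

definition dgamma11 :: "(complex^3) cform" where
  "dgamma11 = sg t 1 \<cdot>\<^sub>f (\<alpha>t t \<and>\<^sub>w cnjf (\<alpha>t t)) + sg t 2 \<cdot>\<^sub>f (\<alpha>t t \<and>\<^sub>w cnjf (\<beta>t t))
     + sg t 3 \<cdot>\<^sub>f (\<beta>t t \<and>\<^sub>w cnjf (\<alpha>t t)) + sg t 4 \<cdot>\<^sub>f (\<beta>t t \<and>\<^sub>w cnjf (\<beta>t t))"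

lemma oftype_dgamma11: "X.oftype 1 1 dgamma11"
  unfolding dgamma11_def by (intro X.oftype_add X.oftype_scale oftype_X)

text \<open>The structure equation at 0 is rewritten in the forms at t through
  \<open>sg_tab\<close>. No (0,2)-term appears, which is the integrability of the complex structure
  of X_t.\<close>

lemma extd_gamma_t: "extd (\<gamma>t t) = sg t 0 \<cdot>\<^sub>f (\<alpha>t t \<and>\<^sub>w \<beta>t t) + dgamma11"
proof (rule ext, rule ext)
  fix p vs
  have "extd (\<gamma>t t) = - (\<alpha> \<and>\<^sub>w \<beta>) + D t \<cdot>\<^sub>f (cnjf \<alpha> \<and>\<^sub>w cnjf \<beta>)"
    using is1_fdiff[OF is1_coframe(3)]
    by (simp add: \<gamma>t_eq extd_diff extd_scale fdiff_scale fdiff_cnjf extd_gamma extd_cnjf_gamma) (simp add: fun_eq_iff fscale_def)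
  then have "extd (\<gamma>t t) p vs = (\<Sum>k<6. [-1, 0, 0, 0, 0, D t] ! k * (twoX 0 ! k) p vs)"
    by (simp add: sum_6 twoX_0 fscale_def)
  also have "\<dots> = (\<Sum>k<6. (\<Sum>j<5. sg t j * tab t ! j ! k) * (twoX 0 ! k) p vs)"
    using sg_tab[OF small] by (intro sum.cong) auto
  also have "\<dots> = (\<Sum>j<5. sg t j * (\<Sum>k<6. tab t ! j ! k * (twoX 0 ! k) p vs))"
    unfolding sum_distrib_right sum_distrib_left by (subst sum.swap) (simp add: mult.assoc)
  also have "\<dots> = (\<Sum>j<5. sg t j * (twoX t ! j) p vs)"
    using twoX_tab[of _ t] by (intro sum.cong refl arg_cong2[where f = times]) (simp add: fcomb_apply length_twoX)
  also have "\<dots> = (sg t 0 \<cdot>\<^sub>f (\<alpha>t t \<and>\<^sub>w \<beta>t t) + dgamma11) p vs"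
    by (simp add: sum_5 twoX_def dgamma11_def fscale_def)
  finally show "extd (\<gamma>t t) p vs = (sg t 0 \<cdot>\<^sub>f (\<alpha>t t \<and>\<^sub>w \<beta>t t) + dgamma11) p vs" .
qed

lemma sigma12_eq: "sigma12 t = sg t 0"
proof -
  have d: "del (coframe_X t) 1 0 (\<gamma>t t) = sg t 0 \<cdot>\<^sub>f (\<alpha>t t \<and>\<^sub>w \<beta>t t)"
    unfolding del_def extd_gamma_t add.commute[of _ dgamma11]
    using X.pq_part_sum2[OF oftype_dgamma11 X.oftype_scale[OF oftype_X(1)]] by (simp add: numeral_2_eq_2)
  have 1: "(\<alpha>t t \<and>\<^sub>w \<beta>t t) 0 [xX t 0 0, xX t 1 0] = 1"
    using X.dual(1)[of 0 0 0] X.dual(1)[of 0 1 0] X.dual(1)[of 1 0 0] X.dual(1)[of 1 1 0]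
    by (simp add: wedge2 coframe_X_def)
  show ?thesis
    unfolding sigma12_def d
  proof (rule the_equality)
    fix s assume "sg t 0 \<cdot>\<^sub>f (\<alpha>t t \<and>\<^sub>w \<beta>t t) = s \<cdot>\<^sub>f (\<alpha>t t \<and>\<^sub>w \<beta>t t)"
    from fun_cong[OF fun_cong[OF this, of 0], of "[xX t 0 0, xX t 1 0]"] show "s = sg t 0"
      by (simp add: fscale_def 1[unfolded One_nat_def])
  qed simp
qed

lemma sigma_bar_eq: "sigma_bar t $ 1 $ 1 = sg t 1" "sigma_bar t $ 1 $ 2 = sg t 2"
  "sigma_bar t $ 2 $ 1 = sg t 3" "sigma_bar t $ 2 $ 2 = sg t 4"
proof -
  have d: "delbar (coframe_X t) 1 0 (\<gamma>t t) = dgamma11"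
    unfolding delbar_def extd_gamma_t
    using X.pq_part_sum2[OF X.oftype_scale[OF oftype_X(1)] oftype_dgamma11] by simp
  let ?F = "\<lambda>c00 c01 c10 c11. c00 \<cdot>\<^sub>f (\<alpha>t t \<and>\<^sub>w cnjf (\<alpha>t t)) + c01 \<cdot>\<^sub>f (\<alpha>t t \<and>\<^sub>w cnjf (\<beta>t t))
     + c10 \<cdot>\<^sub>f (\<beta>t t \<and>\<^sub>w cnjf (\<alpha>t t)) + c11 \<cdot>\<^sub>f (\<beta>t t \<and>\<^sub>w cnjf (\<beta>t t))"
  have u: "a = a' \<and> b = b' \<and> c = c' \<and> d = d'" if "?F a b c d = ?F a' b' c' d'" for a b c d a' b' c' d'
  proof -
    let ?S = "{({0}, {0}), ({0}, {1}), ({1}, {0}), ({1}, {1})} :: (nat set \<times> nat set) set"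
    let ?c = "\<lambda>f00 f01 f10 f11 (s :: nat set \<times> nat set) (p :: complex^3). if fst s = {0} then (if snd s = {0} then f00 else f01) else (if snd s = {0} then f10 else f11)"
    have x: "expansion (coframe_X t) ?S (?c a b c d) = ?F a b c d" for a b c d
      by (simp add: expansion_def monomials_X[unfolded One_nat_def] fun_eq_iff add.assoc fscale_def)
    have S: "?S \<subseteq> all_idx (coframe_X t)" by (auto simp: all_idx_def coframe_X_def)
    have e: "expansion (coframe_X t) ?S (?c a b c d) = expansion (coframe_X t) ?S (?c a' b' c' d')"
      unfolding x by (rule that)
    show ?thesis
      using X.expansion_unique[OF S e, of "({0},{0})"] X.expansion_unique[OF S e, of "({0},{1})"]
        X.expansion_unique[OF S e, of "({1},{0})"] X.expansion_unique[OF S e, of "({1},{1})"] by simp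
  qed
  have "sigma_bar t = vector [vec2 (sg t 1) (sg t 2), vec2 (sg t 3) (sg t 4)]"
    unfolding sigma_bar_def d
  proof (rule the_equality)
    fix s :: "complex^2^2" assume "dgamma11 = ?F (s$1$1) (s$1$2) (s$2$1) (s$2$2)"
    from u[OF this[symmetric, unfolded dgamma11_def]] show "s = vector [vec2 (sg t 1) (sg t 2), vec2 (sg t 3) (sg t 4)]"
      by (simp add: vec_eq_iff forall_2)
  qed (simp add: dgamma11_def)
  then show "sigma_bar t $ 1 $ 1 = sg t 1" "sigma_bar t $ 1 $ 2 = sg t 2"
    "sigma_bar t $ 2 $ 1 = sg t 3" "sigma_bar t $ 2 $ 2 = sg t 4" by simp_all
qed

lemma nuX_0: "nuX t 0 = \<Omega>t t"
  by (auto simp: nuX_def ss_0 twoX_def \<Omega>t_def wedge3 fscale_def fun_eq_iff algebra_simps split: list.splits)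

text \<open>With the structure constants evaluated, \<open>ss_sg\<close> matches the prescribed
  corrections to those forced by closedness, so the lifts are closed.\<close>

lemma lifts11_nuX: "lifts11 t = map (nuX t) [1..<5]"
proof -
  have up: "[1..<5] = [1, 2, 3, 4::nat]" by (simp add: upt_rec numeral_eq_Suc)
  have r: "\<alpha>t t \<and>\<^sub>w \<beta>t t \<and>\<^sub>w cnjf (\<gamma>t t) = cnjf (\<gamma>t t) \<and>\<^sub>w \<alpha>t t \<and>\<^sub>w \<beta>t t"
    by (rule wedge_rotate[symmetric]) simp_all
  show ?thesis
    unfolding up lifts11_def basis11_B_def pullback_wedge_proj
    by (simp add: nuX_def twoX_def ss_sg[OF small] ss_sg(1)[OF small, unfolded One_nat_def] sigma12_eq sigma_bar_eq pullback_wedge_proj pullback_proj_coframe r)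
qed

end

section \<open>Invariant coefficient functions and Dolbeault classes on X_t\<close>

definition lfields :: "((complex^2) \<times> complex) list \<Rightarrow> complex^3 \<Rightarrow> (complex^3) list" where
  "lfields l p = map (\<lambda>(u, w). lf u w p) l"

definition invfields :: "(complex^3) cform \<Rightarrow> bool" where
  "invfields \<omega> \<longleftrightarrow> (\<forall>l. smooth_on UNIV (\<lambda>p. \<omega> p (lfields l p)) \<and> invX (\<lambda>p. \<omega> p (lfields l p)))"

lemma forms_invfields: "\<omega> \<in> forms lattice_X k \<Longrightarrow> invfields \<omega>"
  unfolding invfields_def
proof (intro allI conjI)
  fix l assume \<omega>: "\<omega> \<in> forms lattice_X k"
  show "invX (\<lambda>p. \<omega> p (lfields l p))" unfolding lfields_def by (rule invX_fields[OF \<omega>])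
  show "smooth_on UNIV (\<lambda>p. \<omega> p (lfields l p))"
  proof (cases "length l = k")
    case True
    then show ?thesis unfolding lfields_def by (rule smooth_fields[OF \<omega>])
  next
    case False
    then have "(\<lambda>p. \<omega> p (lfields l p)) = (\<lambda>_. 0)" using \<omega> by (auto simp: forms_def is_kform_def lfields_def)
    then show ?thesis by (simp add: smooth_on_const)
  qed
qed

lemma invX_lincomb: "invX f \<Longrightarrow> invX g \<Longrightarrow> invX (\<lambda>p. a * f p + b * g p)"
  by (simp add: invX_def)

lemma pq_idx_3:
  "length \<theta> = 3 \<Longrightarrow> pq_idx \<theta> 3 0 = {({0,1,2}, {})}"
  "length \<theta> = 3 \<Longrightarrow> pq_idx \<theta> 2 0 = {({0,1}, {}), ({0,2}, {}), ({1,2}, {})}"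
proof -
  have "{..<3::nat} = insert 2 (insert 1 {0})" by auto
  then have P: "Pow {..<3::nat} = {{}, {0}, {1}, {2}, {0,1}, {0,2}, {1,2}, {0,1,2}}"
    by (simp add: Pow_insert insert_commute Un_commute del: One_nat_def)
  have c: "{I \<in> Pow {..<3::nat}. card I = 0} = {{}}" "{I \<in> Pow {..<3::nat}. card I = 3} = {{0,1,2}}"
    "{I \<in> Pow {..<3::nat}. card I = 2} = {{0,1}, {0,2}, {1,2}}"
    unfolding P by auto
  have *: "pq_idx \<theta> p q = {I \<in> Pow {..<3}. card I = p} \<times> {I \<in> Pow {..<3}. card I = q}" if "length \<theta> = 3" for p q
    using that by (auto simp: pq_idx_def all_idx_def)
  show "length \<theta> = 3 \<Longrightarrow> pq_idx \<theta> 3 0 = {({0,1,2}, {})}"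
    "length \<theta> = 3 \<Longrightarrow> pq_idx \<theta> 2 0 = {({0,1}, {}), ({0,2}, {}), ({1,2}, {})}"
    by (simp_all only: * c) auto
qed

context deform
begin

lemma cf_smooth_invX: "invfields \<omega> \<Longrightarrow> smooth_on UNIV (X.cf ks \<omega>) \<and> invX (X.cf ks \<omega>)"
proof (induction ks arbitrary: \<omega>)
  case Nil
  have "X.cf [] \<omega> = (\<lambda>p. \<omega> p (lfields [] p))" by (simp add: fun_eq_iff lfields_def)
  then show ?case using Nil unfolding invfields_def by metis
next
  case (Cons k ks)
  define j where "j = (if k < 3 then k else k - 3)"
  define e where "e = (if j < 2 then (xB t j 0, 0) else (0, R3 t 1))"
  define e' where "e' = (if j < 2 then (yB t j 0, 0) else (0, R3 t \<i>))"
  define c where "c = (if k < 3 then - \<i> / 2 else \<i> / 2)"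
  have ee: "lfields (e # l) p = xX t j p # lfields l p" "lfields (e' # l) p = yX t j p # lfields l p" for l p
    by (simp_all add: lfields_def e_def e'_def xX_def yX_def)
  have eq: "(\<lambda>p. X.cn k \<omega> p (lfields l p)) = (\<lambda>p. (1/2) * \<omega> p (lfields (e # l) p) + c * \<omega> p (lfields (e' # l) p))" for l
    unfolding ee by (auto simp: X.cn_def contract_def fun_eq_iff diff_divide_distrib add_divide_distrib c_def j_def)
  have pr: "smooth_on UNIV (\<lambda>p. \<omega> p (lfields l p))" "invX (\<lambda>p. \<omega> p (lfields l p))" for l
    using Cons.prems by (simp_all add: invfields_def)
  have "invfields (X.cn k \<omega>)"
    unfolding invfields_def eq
    by (intro allI conjI invX_lincomb smooth_on_add smooth_on_mult smooth_on_const open_UNIV pr)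
  then have "smooth_on UNIV (X.cf ks (X.cn k \<omega>)) \<and> invX (X.cf ks (X.cn k \<omega>))" by (rule Cons.IH)
  moreover have "X.cf (k # ks) \<omega> = X.cf ks (X.cn k \<omega>)" by (simp add: fun_eq_iff)
  ultimately show ?case by simp
qed

lemma pq_form_coefficients_X:
  assumes "\<omega> \<in> pq_forms lattice_X (coframe_X t) p q"
  obtains c where "\<omega> = expansion (coframe_X t) (pq_idx (coframe_X t) p q) c"
    "\<And>s. s \<in> pq_idx (coframe_X t) p q \<Longrightarrow> smooth_on UNIV (c s) \<and> invX (c s)"
proof -
  obtain c where c: "\<omega> = expansion (coframe_X t) (pq_idx (coframe_X t) p q) c" and \<omega>: "\<omega> \<in> forms lattice_X (p + q)"
    using assms by (auto simp: pq_forms_def)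
  have "smooth_on UNIV (c s) \<and> invX (c s)" if s: "s \<in> pq_idx (coframe_X t) p q" for s
  proof -
    have m: "(fst s, snd s) \<in> all_idx (coframe_X t)" using s X.pq_idx_subset by auto
    have "c s = X.cf (X.idx (fst s) (snd s)) \<omega>"
      using X.cf_expansion[OF X.pq_idx_subset m, of p q c] s unfolding c by (simp add: fun_eq_iff)
    then show ?thesis using cf_smooth_invX[OF forms_invfields[OF \<omega>]] by simp
  qed
  then show ?thesis using that c by blast
qed

lemma dZ_fibre: "X.dZ 5 f p = (frechet_derivative f (at p) (vec3 0 (R3 t 1)) + \<i> * frechet_derivative f (at p) (vec3 0 (R3 t \<i>))) / 2"
  by (simp add: X.dZ_def xX_def yX_def lf_def)

text \<open>Restricted to a fibre the function is periodic and killed by the vertical d-bar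
  operator, hence constant. It then descends to a periodic function on the base, where the torus
  argument applies.\<close>

lemma X_holomorphic_const:
  assumes f: "smooth_on UNIV f" "invX f" and 0: "\<And>p k. k < 3 \<Longrightarrow> X.dZ (3 + k) f p = 0"
  shows "f p = f q"
proof -
  let ?D = "\<lambda>p. frechet_derivative f (at p)"
  note c = smooth_on_continuous[OF f(1)] and cD = continuous_on_frechet_derivative[OF f(1)]
  have fib: "f (vec3 y w) = f (vec3 y 0)" for y w
  proof (rule periodic_kernel_constant[where f = "\<lambda>w. f (vec3 y w)" and f' = "\<lambda>w v. ?D (vec3 y w) (vec3 0 v)" and J = "{(R3 t 1, R3 t \<i>)}"])
    show "((\<lambda>s. f (vec3 y (w + s *\<^sub>R v))) has_vector_derivative ?D (vec3 y w) (vec3 0 v)) (at 0)" for w v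
      by (rule fibre_derivative[OF smooth_on_has_derivative[OF f(1) UNIV_I]])
    show "?D (vec3 y w) (vec3 0 u) + \<i> * ?D (vec3 y w) (vec3 0 v) = 0" if "(u, v) \<in> {(R3 t 1, R3 t \<i>)}" for u v w
      using that 0[of 2 "vec3 y w"] by (simp add: dZ_fibre)
    show "\<exists>(u, v)\<in>{(R3 t 1, R3 t \<i>)}. k \<bullet> u \<noteq> 0 \<or> k \<bullet> v \<noteq> 0" if k: "k \<noteq> 0" for k
    proof (rule ccontr)
      assume "\<not> ?thesis"
      then have z: "k \<bullet> R3 t 1 = 0" "k \<bullet> R3 t \<i> = 0" by auto
      define z where "z = S3 t k"
      have "k = R3 t (Re z *\<^sub>R 1 + Im z *\<^sub>R \<i>)"
        using R3_S3[OF small, of k] by (simp add: z_def scaleR_conv_of_real complex_eq[symmetric] mult.commute[of _ \<i>])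
      then have "k \<bullet> k = k \<bullet> (Re z *\<^sub>R R3 t 1 + Im z *\<^sub>R R3 t \<i>)"
        by (simp only: linear_add[OF linear_R3] linear_cmul[OF linear_R3])
      then show False using k z by (simp add: inner_add_right)
    qed
  qed (use f c cD continuous_fibre invX_periodic_fibre in auto)
  \<comment> \<open>Vertical derivatives vanish, so a left-invariant lift may be replaced by the
    coordinate direction \<open>vec3 u 0\<close>.\<close>
  have D0: "?D (vec3 y w) (vec3 0 v) = 0" for y w v
  proof -
    have "((\<lambda>s. f (vec3 y (w + s *\<^sub>R v))) has_vector_derivative ?D (vec3 y w) (vec3 0 v)) (at 0)"
      by (rule fibre_derivative[OF smooth_on_has_derivative[OF f(1) UNIV_I]])
    moreover have "(\<lambda>s. f (vec3 y (w + s *\<^sub>R v))) = (\<lambda>s. f (vec3 y 0))" by (intro ext fib)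
    ultimately show ?thesis
      using vector_derivative_unique_at[OF _ has_vector_derivative_const] by metis
  qed
  have "f (vec3 y 0) = f (vec3 y' 0)" for y y'
  proof (rule periodic_kernel_constant[where f = "\<lambda>y. f (vec3 y 0)" and f' = "\<lambda>y v. ?D (vec3 y 0) (vec3 v 0)" and J = "{wB 0, wB 1}"])
    show "continuous_on UNIV (\<lambda>y. f (vec3 y 0))" "continuous_on UNIV (\<lambda>y. ?D (vec3 y 0) (vec3 v 0))" for v
      by (rule continuous_on_compose2[OF c] continuous_on_compose2[OF cD]; auto intro!: continuous_intros)+
    show "periodic (\<lambda>y. f (vec3 y 0))"
      unfolding periodic_def
    proof (intro allI ballI)
      fix y b :: "complex^2" assume b: "b \<in> Basis"
      have "f (vec3 (y + b) (0 + b$1 * y$2)) = f (vec3 y 0)"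
        using invX_vec3[OF f(2) lattice_Basis[OF b] lattice_0, of y 0] by (simp add: add.commute)
      then show "f (vec3 (y + b) 0) = f (vec3 y 0)" using fib by metis
    qed
    show "((\<lambda>s. f (vec3 (y + s *\<^sub>R v) 0)) has_vector_derivative ?D (vec3 y 0) (vec3 v 0)) (at 0)" for y v
      using line_has_vector_derivative[OF smooth_on_has_derivative[OF f(1) UNIV_I], of "vec3 y 0" "vec3 v 0"]
      by (simp add: vec3_add vec3_scaleR)
    show "?D (vec3 y 0) (vec3 u 0) + \<i> * ?D (vec3 y 0) (vec3 v 0) = 0" if uv: "(u, v) \<in> {wB 0, wB 1}" for u v y
    proof -
      have lfD: "?D (vec3 y 0) (lf u 0 (vec3 y 0)) = ?D (vec3 y 0) (vec3 u 0)" for u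
      proof -
        have "lf u 0 (vec3 y 0) = vec3 u 0 + vec3 0 (y$1 * u$2)" by (simp add: lf_def vec3_eq_iff)
        then show ?thesis
          using linear_add[OF has_derivative_linear[OF smooth_on_has_derivative[OF f(1) UNIV_I]]] D0 by simp
      qed
      have "(u, v) = wB 0 \<or> (u, v) = wB 1" using uv by (simp only: insert_iff empty_iff simp_thms)
      then have "\<exists>j<2. (u, v) = wB j" by (elim disjE) (rule exI[of _ 0], simp, rule exI[of _ 1], simp)
      then obtain j where j: "j < 2" "(u, v) = wB j" by blast
      then have "X.dZ (3 + j) f (vec3 y 0) = (?D (vec3 y 0) (vec3 u 0) + \<i> * ?D (vec3 y 0) (vec3 v 0)) / 2"
        by (simp add: X.dZ_def xX_def yX_def wB_def lfD)
      then show ?thesis using 0[of j] j by simp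
    qed
    show "\<exists>(u, v)\<in>{wB 0, wB 1}. k \<bullet> u \<noteq> 0 \<or> k \<bullet> v \<noteq> 0" if "k \<in> lattice" "k \<noteq> 0" for k
      using lattice_lower_bound[OF that] by (auto simp: split_beta)
  qed
  moreover have "p = vec3 (proj p) (p$3)" "q = vec3 (proj q) (q$3)" by (simp_all add: vec3_eq_iff)
  ultimately show ?thesis using fib by metis
qed

lemma \<Omega>_closed: "\<Omega>t t \<in> dR_closed lattice_X 3"
  using nuX_closed[of 0] by (simp add: nuX_0)

lemma \<Omega>_oftype: "X.oftype 3 0 (\<Omega>t t)"
  using oftype_X(8) by (simp add: \<Omega>t_def)

lemma \<Omega>_fdiff: "fdiff (\<Omega>t t)"
  using \<Omega>_closed forms_fdiff by (auto simp: dR_closed_def)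

lemma wedge_rotate_4:
  assumes "deg1 a" "deg1 b" "deg1 c" "deg1 d"
  shows "d \<and>\<^sub>w a \<and>\<^sub>w b \<and>\<^sub>w c = - (a \<and>\<^sub>w b \<and>\<^sub>w c \<and>\<^sub>w d)"
  using wedge_swap[OF assms(4,1), of "b \<and>\<^sub>w c"] wedge_rotate[OF assms(4,2,3)] by simp

lemma oftype_30:
  assumes "X.oftype 3 0 \<omega>"
  obtains f where "\<omega> = (\<lambda>p vs. f p * \<Omega>t t p vs)"
proof -
  obtain c where "\<omega> = expansion (coframe_X t) (pq_idx (coframe_X t) 3 0) c" using assms by (auto simp: X.oftype_def)
  then have "\<omega> = (\<lambda>p vs. c ({0,1,2}, {}) p * \<Omega>t t p vs)"
    unfolding pq_idx_3(1)[OF X.len] by (simp add: expansion_def monomials_X \<Omega>t_def del: One_nat_def)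
  then show ?thesis by (rule that)
qed

lemma Dol_closed_30: "Dol_closed lattice_X (coframe_X t) 3 0 = {c \<cdot>\<^sub>f \<Omega>t t | c. True}"
proof (intro equalityI subsetI)
  fix \<omega> assume \<omega>: "\<omega> \<in> Dol_closed lattice_X (coframe_X t) 3 0"
  then obtain c where c: "\<omega> = expansion (coframe_X t) (pq_idx (coframe_X t) 3 0) c"
    "\<And>s. s \<in> pq_idx (coframe_X t) 3 0 \<Longrightarrow> smooth_on UNIV (c s) \<and> invX (c s)"
    using pq_form_coefficients_X unfolding Dol_closed_def by blast
  define f where "f = c ({0,1,2}, {})"
  have f: "\<omega> = (\<lambda>p vs. f p * \<Omega>t t p vs)" "smooth_on UNIV f" "invX f"
    using c unfolding pq_idx_3(1)[OF X.len] by (simp_all add: expansion_def monomials_X \<Omega>t_def f_def del: One_nat_def)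
  have fd: "\<And>p. f differentiable (at p)" using smooth_on_differentiable[OF f(2)] by simp
  have "0 = delbar (coframe_X t) 3 0 \<omega>" using \<omega> by (simp add: Dol_closed_def)
  also have "\<dots> = X.dform (\<lambda>k. X.dZ k f) {3..<6} (\<Omega>t t)"
    unfolding delbar_def f(1) using X.pq_part_extd_fun_scale(2)[OF fd \<Omega>_fdiff \<Omega>_oftype] \<Omega>_closed by (simp add: dR_closed_def)
  finally have z: "X.dform (\<lambda>k. X.dZ k f) {3..<6} (\<Omega>t t) = 0" ..
  let ?S = "{({0,1,2},{0}), ({0,1,2},{1}), ({0,1,2},{2})} :: (nat set \<times> nat set) set"
  let ?c = "\<lambda>s::nat set \<times> nat set. if snd s = {0} then X.dZ 3 f else if snd s = {1} then X.dZ 4 f else X.dZ 5 f"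
  have e: "expansion (coframe_X t) ?S ?c = expansion (coframe_X t) ?S (\<lambda>_ _. 0)"
  proof -
    have I: "{3..<6} = {3, 4, 5::nat}" by auto
    have co: "X.co 3 = cnjf (\<alpha>t t)" "X.co 4 = cnjf (\<beta>t t)" "X.co 5 = cnjf (\<gamma>t t)"
      unfolding X.co_def by (simp_all add: coframe_X_def)
    note r = wedge_rotate_4[OF deg1_frames(1)[of t] deg1_frames(2)[of t] deg1_frames(3)[of t]]
    note r = r[OF deg1_simps(2)[OF deg1_frames(1)[of t]]] r[OF deg1_simps(2)[OF deg1_frames(2)[of t]]] r[OF deg1_simps(2)[OF deg1_frames(3)[of t]]]
    \<comment> \<open>The sign comes from moving a conjugate coframe element past the three factors
      of \<open>\<Omega>t t\<close>.\<close>
    have "expansion (coframe_X t) ?S ?c = - X.dform (\<lambda>k. X.dZ k f) {3..<6} (\<Omega>t t)"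
      unfolding X.dform_def I \<Omega>t_def
      by (simp add: co r expansion_def monomials_X fun_eq_iff del: One_nat_def)
    then show ?thesis unfolding z by (simp add: expansion_def fun_eq_iff)
  qed
  have S: "?S \<subseteq> all_idx (coframe_X t)" by (auto simp: all_idx_def coframe_X_def)
  have "X.dZ 3 f p = 0" "X.dZ 4 f p = 0" "X.dZ 5 f p = 0" for p
    using X.expansion_unique[OF S e, of "({0,1,2},{0})" p] X.expansion_unique[OF S e, of "({0,1,2},{1})" p]
      X.expansion_unique[OF S e, of "({0,1,2},{2})" p] by simp_all
  then have "X.dZ (3 + k) f p = 0" if "k < 3" for k p
    using that unfolding less3 by (elim disjE) simp_all
  then have "f p = f 0" for p
    by (intro X_holomorphic_const f)
  then have "\<omega> = f 0 \<cdot>\<^sub>f \<Omega>t t" unfolding f(1) fscale_def by metis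
  then show "\<omega> \<in> {c \<cdot>\<^sub>f \<Omega>t t | c. True}" by blast
next
  fix \<omega> assume "\<omega> \<in> {c \<cdot>\<^sub>f \<Omega>t t | c. True}"
  then obtain c where c: "\<omega> = c \<cdot>\<^sub>f \<Omega>t t" by blast
  have "\<omega> \<in> dR_closed lattice_X 3" unfolding c by (intro fsub_scale[OF fsub_dR_closed] \<Omega>_closed)
  then have cl: "\<omega> \<in> forms lattice_X 3" "extd \<omega> = 0" by (auto simp: dR_closed_def)
  then have "delbar (coframe_X t) 3 0 \<omega> = 0"
    using X.pq_part_oftype[OF X.oftype_0, of 3 1] by (simp add: delbar_def)
  moreover have "X.oftype 3 0 \<omega>" unfolding c by (intro X.oftype_scale \<Omega>_oftype)
  ultimately show "\<omega> \<in> Dol_closed lattice_X (coframe_X t) 3 0"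
    using cl by (simp add: Dol_closed_def pq_forms_def X.oftype_def)
qed

lemma nuX_independent:
  assumes "length cs = 5" "\<And>k. k < 5 \<Longrightarrow> ellX k (fcomb cs (map (nuX t) [0..<5])) = 0"
  shows "set cs \<subseteq> {0}"
proof -
  have "set (map (nuX t) [0..<5]) \<subseteq> forms lattice_X 3"
    using nuX_closed by (auto simp: dR_closed_def)
  then have "ellX k (fcomb cs (map (nuX t) [0..<5])) = (\<Sum>j<5. cs ! j * (tab t ! j ! k - ss t j * cnj (D t) * tab t ! 0 ! k))" if "k < 5" for k
    using that assms(1) by (simp add: ellX_fcomb ellX_nuX)
  then have "cs ! i = 0" if "i < 5" for i
    using rX_extract[OF assms(1) that] assms(2) by simp
  then show ?thesis using assms(1) by (auto simp: in_set_conv_nth)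
qed

lemma ellX_zero: "k < 5 \<Longrightarrow> ellX k 0 = 0"
  using ellX_scale[of k 0 0] by (simp only: fscale_simps mult_zero_left)

text \<open>Padding with zero coefficients makes this a case of the independence of the five
  forms.\<close>

lemma findep_30: "findep {0} [\<Omega>t t]"
  unfolding findep_def
proof (intro allI impI)
  fix cs assume "length cs = length [\<Omega>t t]" and 0: "fcomb cs [\<Omega>t t] \<in> {0}"
  then obtain c where c: "cs = [c]" by (auto simp: length_Suc_conv)
  have up: "[0..<5] = [0, 1, 2, 3, 4::nat]" by (simp add: upt_rec numeral_eq_Suc)
  have "fcomb [c, 0, 0, 0, 0] (map (nuX t) [0..<5]) = fcomb cs [\<Omega>t t]"
    unfolding up by (simp add: c nuX_0 fun_eq_iff fscale_def)
  then have "set [c, 0, 0, 0, 0] \<subseteq> {0}"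
    using 0 by (intro nuX_independent) (simp_all add: ellX_zero)
  then show "set cs \<subseteq> {0}" by (simp add: c)
qed

lemma spanned_H30: "spanned_by (H30 t) (Dol_exact lattice_X (coframe_X t) 3 0) [\<Omega>t t]"
proof -
  have E: "Dol_exact lattice_X (coframe_X t) 3 0 = {0}" by (simp add: Dol_exact_def)
  have "{cs::complex list. length cs = 1} = range (\<lambda>c. [c])" by (auto simp: length_Suc_conv)
  then have "vcarr (H30 t) = (\<lambda>cs. coset {0} (fcomb cs [\<Omega>t t])) ` {cs. length cs = 1}"
    unfolding H30_def H_Dol_def quot_simps Dol_closed_30 E by (auto simp: image_iff)
  then show ?thesis
    unfolding spanned_by_def E using findep_30 by (simp add: fsub_zero H30_def H_Dol_def quot_def E)
qed

text \<open>The only danger to the type is the differential of \<open>\<gamma>t t\<close>. Its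
  (2,0)-part is a multiple of the product of \<open>\<alpha>t t\<close> and
  \<open>\<beta>t t\<close> and dies against either factor, so only the (1,1)-part
  contributes.\<close>

lemma pq_forms_20_decomposition:
  assumes "\<eta> \<in> pq_forms lattice_X (coframe_X t) 2 0"
  obtains P Q where "extd \<eta> = P + Q" "X.oftype 3 0 P" "X.oftype 2 1 Q"
proof -
  obtain c where c: "\<eta> = expansion (coframe_X t) (pq_idx (coframe_X t) 2 0) c"
    "\<And>s. s \<in> pq_idx (coframe_X t) 2 0 \<Longrightarrow> smooth_on UNIV (c s) \<and> invX (c s)"
    using pq_form_coefficients_X[OF assms] by blast
  let ?dec = "\<lambda>\<omega>. \<exists>P Q. \<omega> = P + Q \<and> X.oftype 3 0 P \<and> X.oftype 2 1 Q"
  have dec_add: "?dec (\<omega> + \<omega>')" if d: "?dec \<omega>" "?dec \<omega>'" for \<omega> \<omega>'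
  proof -
    obtain P Q P' Q' where "\<omega> = P + Q" "X.oftype 3 0 P" "X.oftype 2 1 Q" "\<omega>' = P' + Q'" "X.oftype 3 0 P'" "X.oftype 2 1 Q'"
      using d by blast
    then show ?thesis by (intro exI[of _ "P + P'"] exI[of _ "Q + Q'"]) (simp add: X.oftype_add add_ac)
  qed
  have dec: "fdiff (\<lambda>p vs. f p * m p vs) \<and> ?dec (extd (\<lambda>p vs. f p * m p vs))"
    if f: "smooth_on UNIV f" and m: "fdiff m" "X.oftype 2 0 m" "X.oftype 2 1 (extd m)" for f m
  proof
    have fd: "f differentiable (at p)" for p using smooth_on_differentiable[OF f] by simp
    show "fdiff (\<lambda>p vs. f p * m p vs)" by (rule fdiff_fun_scale[OF fd m(1)])
    note o = X.oftype_dform[OF m(2), of "\<lambda>k. X.dZ k f"]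
    have "extd (\<lambda>p vs. f p * m p vs) = X.dform (\<lambda>k. X.dZ k f) {..<3} m
        + (X.dform (\<lambda>k. X.dZ k f) {3..<2*3} m + (\<lambda>p vs. f p * extd m p vs))"
      unfolding X.extd_fun_scale_dform[OF fd m(1)] by (simp only: add.assoc)
    moreover have "X.oftype 2 1 (X.dform (\<lambda>k. X.dZ k f) {3..<2*3} m + (\<lambda>p vs. f p * extd m p vs))"
      using o(2) m(3) by (intro X.oftype_add X.oftype_mult) simp_all
    moreover have "X.oftype 3 0 (X.dform (\<lambda>k. X.dZ k f) {..<3} m)" using o(1) by (simp add: numeral_3_eq_3 numeral_2_eq_2)
    ultimately show "?dec (extd (\<lambda>p vs. f p * m p vs))" by blast
  qed
  note i1 = is1_add is1_scale is1_cnjf is1_diff is1_coframe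
  have is1: "is1 (\<alpha>t t)" "is1 (\<beta>t t)" "is1 (\<gamma>t t)"
    unfolding \<alpha>t_def \<beta>t_def \<gamma>t_eq by (intro i1)+
  have fc: "fconst (\<alpha>t t)" "fconst (\<beta>t t)"
    unfolding \<alpha>t_def \<beta>t_def by (intro fconst_add fconst_scale fconst_cnjf fconst_coframe)+
  have dw: "X.oftype 2 1 (extd (a \<and>\<^sub>w \<gamma>t t))" if a: "a = X.co k" "k < 2" "deg1 a" "fconst a" and z: "a \<and>\<^sub>w \<alpha>t t \<and>\<^sub>w \<beta>t t = 0" for a k
  proof -
    have "extd (a \<and>\<^sub>w \<gamma>t t) = - (a \<and>\<^sub>w dgamma11)"
      using a z is1_fdiff[OF is1(3)] by (simp add: extd_wedge_fconst extd_gamma_t wedge_add wedge_scale)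
    moreover have "X.oftype 2 1 (a \<and>\<^sub>w dgamma11)"
      using X.oftype_wedge[OF oftype_dgamma11, of k] a by (simp add: numeral_2_eq_2)
    ultimately show ?thesis by (simp add: X.oftype_minus)
  qed
  have co: "\<alpha>t t = X.co 0" "\<beta>t t = X.co 1" unfolding X.co_def by (simp_all add: coframe_X_def)
  have w0: "\<alpha>t t \<and>\<^sub>w \<alpha>t t \<and>\<^sub>w \<beta>t t = 0" "\<beta>t t \<and>\<^sub>w \<alpha>t t \<and>\<^sub>w \<beta>t t = 0"
    using wedge_same[of "\<beta>t t" unitf] by (simp_all add: wedge_same wedge_unitf wedge_swap[of "\<beta>t t" "\<alpha>t t"] wedge_0)
  have m: "X.oftype 2 1 (extd (\<alpha>t t \<and>\<^sub>w \<gamma>t t))" "X.oftype 2 1 (extd (\<beta>t t \<and>\<^sub>w \<gamma>t t))" "X.oftype 2 1 (extd (\<alpha>t t \<and>\<^sub>w \<beta>t t))"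
    using dw[OF co(1)] dw[OF co(2)] w0 fc extd_fconst[OF fconst_wedge[OF fc]] by (simp_all add: X.oftype_0)
  have fd: "fdiff (\<alpha>t t \<and>\<^sub>w \<beta>t t)" "fdiff (\<alpha>t t \<and>\<^sub>w \<gamma>t t)" "fdiff (\<beta>t t \<and>\<^sub>w \<gamma>t t)"
    by (intro is_kform_fdiff[OF is_kform_2] is1)+
  have \<eta>: "\<eta> = (\<lambda>p vs. c ({0,1},{}) p * (\<alpha>t t \<and>\<^sub>w \<beta>t t) p vs) + ((\<lambda>p vs. c ({0,2},{}) p * (\<alpha>t t \<and>\<^sub>w \<gamma>t t) p vs)
      + (\<lambda>p vs. c ({1,2},{}) p * (\<beta>t t \<and>\<^sub>w \<gamma>t t) p vs))"
  proof -
    have "{0, 2::nat} \<noteq> {0, 1}" "{1, 2::nat} \<noteq> {0, 1}" "{1, 2::nat} \<noteq> {0, 2}" by (auto simp: doubleton_eq_iff)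
    then show ?thesis
      unfolding c(1) pq_idx_3(2)[OF X.len] by (simp add: expansion_def monomials_X fun_eq_iff del: One_nat_def)
  qed
  have cs: "smooth_on UNIV (c ({0,1},{}))" "smooth_on UNIV (c ({0,2},{}))" "smooth_on UNIV (c ({1,2},{}))"
    using c(2) unfolding pq_idx_3(2)[OF X.len] by simp_all
  have "?dec (extd \<eta>)"
    unfolding \<eta> using dec[OF cs(1) fd(1) oftype_X(1) m(3)] dec[OF cs(2) fd(2) oftype_X(2) m(1)] dec[OF cs(3) fd(3) oftype_X(3) m(2)]
    by (simp only: extd_add fdiff_add dec_add)
  then show ?thesis using that by blast
qed

end

lemma fcomb_uminus: "length cs = length \<omega>s \<Longrightarrow> fcomb cs (map uminus \<omega>s) = fcomb (map uminus cs) \<omega>s"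
  by (auto simp: fun_eq_iff fcomb_apply)

context deform
begin

lemma fsub_Dol_exact_21: "fsub (Dol_exact lattice_X (coframe_X t) 2 1)"
  unfolding One_nat_def
proof (rule X.fsub_Dol_exact)
  show "X.expandable (extd \<omega>)" if "\<omega> \<in> pq_forms lattice_X (coframe_X t) 2 0" for \<omega>
    using that by (rule pq_forms_20_decomposition) (simp add: X.expandable_add X.oftype_expandable)
qed

text \<open>A d-bar-exact combination equals d \<eta> minus its (3,0)-part g
  \<open>\<Omega>t t\<close>. The functionals kill d \<eta> and see g only through its mean, so the
  combination plus that multiple of \<open>\<Omega>t t\<close> is annihilated, and independence of
  the five forms applies.\<close>

lemma findep_lifts11: "findep (Dol_exact lattice_X (coframe_X t) 2 1) (lifts11 t)"
  unfolding findep_def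
proof (intro allI impI)
  fix cs assume l: "length cs = length (lifts11 t)" and e: "fcomb cs (lifts11 t) \<in> Dol_exact lattice_X (coframe_X t) 2 1"
  define \<omega> where "\<omega> = fcomb cs (lifts11 t)"
  obtain \<eta> where \<eta>: "\<eta> \<in> pq_forms lattice_X (coframe_X t) 2 0" "\<omega> = delbar (coframe_X t) 2 0 \<eta>"
    using e by (auto simp: Dol_exact_def \<omega>_def)
  obtain P Q where PQ: "extd \<eta> = P + Q" "X.oftype 3 0 P" "X.oftype 2 1 Q"
    by (rule pq_forms_20_decomposition[OF \<eta>(1)])
  have "\<omega> = Q" unfolding \<eta>(2) delbar_def PQ(1) using X.pq_part_sum2[OF PQ(2,3)] by simp
  moreover obtain g where "P = (\<lambda>p vs. g p * \<Omega>t t p vs)" by (rule oftype_30[OF PQ(2)])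
  ultimately have ext_eta: "\<omega> p vs = extd \<eta> p vs - g p * \<Omega>t t p vs" for p vs using PQ(1) by simp
  have \<eta>2: "\<eta> \<in> forms lattice_X 2" using \<eta>(1) by (simp add: pq_forms_def)
  have cl: "set (lifts11 t) \<subseteq> dR_closed lattice_X 3"
    unfolding lifts11_nuX using nuX_closed by auto
  have "\<omega> \<in> dR_closed lattice_X 3"
    unfolding \<omega>_def by (rule fcomb_in[OF fsub_dR_closed l cl])
  then have \<omega>3: "\<omega> \<in> forms lattice_X 3" by (simp add: dR_closed_def)
  have \<Omega>3: "\<Omega>t t \<in> forms lattice_X 3" using \<Omega>_closed by (simp add: dR_closed_def)
  define K where "K w x y = S3 t w * (two_forms t ! 0) x y" for w x y
  have K: "\<Omega>t t p [lf x 0 p, lf y 0 p, lf 0 w p] = K w x y" for x y w p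
    using nuX_eval[of 0 p x y w] by (simp add: nuX_0 ss_0 K_def)
  have m: "mX (\<lambda>p. \<omega> p [lf x 0 p, lf y 0 p, lf 0 w p])
      = mX (\<lambda>p. extd \<eta> p [lf x 0 p, lf y 0 p, lf 0 w p]) - mX g * K w x y" for x y w
  proof -
    have e: "(\<lambda>p. \<omega> p [lf x 0 p, lf y 0 p, lf 0 w p]) = (\<lambda>p. extd \<eta> p [lf x 0 p, lf y 0 p, lf 0 w p] - K w x y * g p)"
      by (simp add: ext_eta K mult.commute)
    \<comment> \<open>The type condition gives no regularity of g. Continuity of its multiple by
      \<open>K w x y\<close> is inferred from the two terms of which it is the difference.\<close>
    have "continuous_on UNIV (\<lambda>p. extd \<eta> p [lf x 0 p, lf y 0 p, lf 0 w p] - \<omega> p [lf x 0 p, lf y 0 p, lf 0 w p])"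
      by (intro continuous_on_diff mX_extd(2)[OF \<eta>2] forms_X_continuous[OF \<omega>3])
    then have c: "continuous_on UNIV (\<lambda>p. K w x y * g p)" by (simp add: ext_eta K mult.commute)
    show ?thesis
      unfolding e mX_diff[OF mX_extd(2)[OF \<eta>2] c] mX_cmult by (simp only: mult.commute)
  qed
  have u: "uX \<omega> = (\<lambda>x y. uX (extd \<eta>) x y + - mX g * uX (\<Omega>t t) x y)"
    unfolding fun_eq_iff uX_def m K mX_const by (simp add: field_simps)
  have w: "ellX k \<omega> = - mX g * ellX k (\<Omega>t t)" if "k < 5" for k
    using ellX_extd[OF that \<eta>2] unfolding ellX_def u coord2_add[OF that] coord2_cmult[OF that] by simp
  have up: "[0..<5] = 0 # [1..<5::nat]" by (simp add: upt_conv_Cons)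
  \<comment> \<open>The mean of g enters as the coefficient of \<open>\<Omega>t t\<close>, so it is
    shown to vanish together with \<open>cs\<close>.\<close>
  have "set (mX g # cs) \<subseteq> {0}"
  proof (rule nuX_independent)
    show "length (mX g # cs) = 5" using l by (simp add: lifts11_nuX)
    have f: "fcomb (mX g # cs) (map (nuX t) [0..<5]) = mX g \<cdot>\<^sub>f \<Omega>t t + \<omega>"
      unfolding up by (simp only: list.map fcomb_simps nuX_0 lifts11_nuX[symmetric] \<omega>_def)
    show "ellX k (fcomb (mX g # cs) (map (nuX t) [0..<5])) = 0" if "k < 5" for k
      unfolding f ellX_add[OF that fsub_scale[OF fsub_forms \<Omega>3] \<omega>3] ellX_scale[OF that] w[OF that] by simp
  qed
  then show "set cs \<subseteq> {0}" by simp
qed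

lemma Gammas_eq: "Gammas t = map uminus (lifts11 t)"
  by (simp add: Gammas_def lifts11_eq)

lemma length_lifts11: "length (lifts11 t) = 4"
  by (simp add: lifts11_nuX)

lemma spanned_Gammas: "spanned_by (H21_gamma t) (Dol_exact lattice_X (coframe_X t) 2 1) (Gammas t)"
proof -
  have "findep (Dol_exact lattice_X (coframe_X t) 2 1) (Gammas t)"
    unfolding findep_def
  proof (intro allI impI)
    fix cs assume "length cs = length (Gammas t)" "fcomb cs (Gammas t) \<in> Dol_exact lattice_X (coframe_X t) 2 1"
    then have "set (map uminus cs) \<subseteq> {0}"
      using findep_lifts11 unfolding findep_def Gammas_eq by (metis fcomb_uminus length_map)
    then show "set cs \<subseteq> {0}" by auto
  qed
  moreover have "length (Gammas t) = 4" by (simp add: Gammas_def)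
  ultimately show ?thesis
    unfolding spanned_by_def using fsub_Dol_exact_21 by (auto simp: H21_gamma_def H_Dol_def quot_def)
qed

text \<open>The lifts are the frame on which the map from the torus is the identity on coefficients;
  the signs against the \<Gamma>_j are absorbed into the coefficient lists.\<close>

lemma spanned_H21: "spanned_by (H21_gamma t) (Dol_exact lattice_X (coframe_X t) 2 1) (lifts11 t)"
proof -
  have "(\<lambda>cs. fcomb cs (Gammas t)) ` {cs. length cs = 4} = (\<lambda>cs. fcomb cs (lifts11 t)) ` {cs. length cs = 4}"
  proof (intro equalityI subsetI)
    fix x assume "x \<in> (\<lambda>cs. fcomb cs (Gammas t)) ` {cs. length cs = 4}"
    then obtain cs where "x = fcomb cs (Gammas t)" "length cs = 4" by blast
    then show "x \<in> (\<lambda>cs. fcomb cs (lifts11 t)) ` {cs. length cs = 4}"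
      by (intro image_eqI[of _ _ "map uminus cs"]) (simp_all add: Gammas_eq fcomb_uminus length_lifts11)
  next
    fix x assume "x \<in> (\<lambda>cs. fcomb cs (lifts11 t)) ` {cs. length cs = 4}"
    then obtain cs where "x = fcomb cs (lifts11 t)" "length cs = 4" by blast
    then show "x \<in> (\<lambda>cs. fcomb cs (Gammas t)) ` {cs. length cs = 4}"
      by (intro image_eqI[of _ _ "map uminus cs"]) (simp_all add: Gammas_eq fcomb_uminus length_lifts11 o_def)
  qed
  from arg_cong[OF this, of "\<lambda>S. coset (Dol_exact lattice_X (coframe_X t) 2 1) ` S"]
  have "vcarr (H21_gamma t) = (\<lambda>cs. coset (Dol_exact lattice_X (coframe_X t) 2 1) (fcomb cs (lifts11 t))) ` {cs. length cs = length (lifts11 t)}"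
    using spanned_by_simps(1)[OF spanned_Gammas] by (simp add: image_image length_lifts11 Gammas_eq)
  then show ?thesis
    using spanned_Gammas findep_lifts11 unfolding spanned_by_def by simp
qed

lemma to_dR_21_lifts:
  assumes "length cs = 4"
  shows "to_dR_21 t (coset (Dol_exact lattice_X (coframe_X t) 2 1) (fcomb cs (lifts11 t)))
    = coset (dR_exact lattice_X 3) (fcomb cs (lifts11 t))"
proof -
  have "fcomb cs (lifts11 t) = fcomb (map uminus cs) (Gammas t)"
    using assms by (simp add: Gammas_eq fcomb_uminus length_lifts11 o_def)
  then show ?thesis
    unfolding to_dR_21_def using lin_ext_spanned[OF spanned_Gammas, of "map uminus cs"] assms
    by (simp add: Gammas_eq length_lifts11)
qed

end

section \<open>The Hodge bundles of X and the isomorphisms\<close>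

lemma framed_F3H3:
  assumes "\<epsilon> \<le> 1/4"
  shows "framed_bundle (Delta_gamma \<epsilon>) (ball 0 (1/4)) F3H3 1
    (\<lambda>t cs. coset (Dol_exact lattice_X (coframe_X t) 3 0) (fcomb cs (map (nuX t) [0..<1]))) (\<lambda>t. map (nuX t) [0..<1])
    (dR_closed lattice_X 3) (dR_exact lattice_X 3) kapX MX 5 ellX rX"
proof (rule frame_data.single_bundle)
  show "frame_data (Delta_gamma \<epsilon>) (ball 0 (1/4)) 1 (\<lambda>t. map (nuX t) [0..<1]) (dR_closed lattice_X 3) (dR_exact lattice_X 3)
    kapX MX 5 ellX rX"
    by (rule frame_data_X[OF assms]) simp
  fix t assume t: "t \<in> Delta_gamma \<epsilon>"
  interpret deform t using deform_ball[OF t assms] .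
  have \<nu>: "map (nuX t) [0..<1] = [\<Omega>t t]" by (simp add: nuX_0)
  show "spanned_by (fibre F3H3 t) (Dol_exact lattice_X (coframe_X t) 3 0) (map (nuX t) [0..<1])"
    unfolding \<nu> using spanned_H30 by (simp add: F3H3_def)
  fix cs :: "complex list" assume "length cs = 1"
  then show "incl F3H3 t (coset (Dol_exact lattice_X (coframe_X t) 3 0) (fcomb cs (map (nuX t) [0..<1])))
      = coset (dR_exact lattice_X 3) (fcomb cs (map (nuX t) [0..<1]))"
    unfolding \<nu> F3H3_def to_dR_30_def embbundle.simps by (intro lin_ext_spanned[OF spanned_H30]) simp
qed (simp add: F3H3_def H_dR_def)

lemma framed_F2H3_gamma:
  assumes "\<epsilon> \<le> 1/4"
  shows "framed_bundle (Delta_gamma \<epsilon>) (ball 0 (1/4)) F2H3_gamma 5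
    (\<lambda>t cs. (coset (Dol_exact lattice_X (coframe_X t) 3 0) (fcomb [hd cs] [\<Omega>t t]),
       coset (Dol_exact lattice_X (coframe_X t) 2 1) (fcomb (tl cs) (lifts11 t)))) (\<lambda>t. map (nuX t) [0..<5])
    (dR_closed lattice_X 3) (dR_exact lattice_X 3) kapX MX 5 ellX rX"
proof (rule frame_data.pair_bundle[where ?V1.0 = H30 and ?V2.0 = H21_gamma and ?i1.0 = to_dR_30 and ?i2.0 = to_dR_21])
  show "frame_data (Delta_gamma \<epsilon>) (ball 0 (1/4)) 5 (\<lambda>t. map (nuX t) [0..<5]) (dR_closed lattice_X 3) (dR_exact lattice_X 3)
    kapX MX 5 ellX rX"
    by (rule frame_data_X[OF assms]) simp
  fix t assume t: "t \<in> Delta_gamma \<epsilon>"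
  interpret deform t using deform_ball[OF t assms] .
  show "spanned_by (H30 t) (Dol_exact lattice_X (coframe_X t) 3 0) [\<Omega>t t]" by (rule spanned_H30)
  show "spanned_by (H21_gamma t) (Dol_exact lattice_X (coframe_X t) 2 1) (lifts11 t)" by (rule spanned_H21)
  show "map (nuX t) [0..<5] = \<Omega>t t # lifts11 t"
    by (simp add: upt_conv_Cons[of 0] nuX_0 lifts11_nuX)
  show "to_dR_30 t (coset (Dol_exact lattice_X (coframe_X t) 3 0) (fcomb [c] [\<Omega>t t])) = coset (dR_exact lattice_X 3) (fcomb [c] [\<Omega>t t])" for c
    unfolding to_dR_30_def by (intro lin_ext_spanned[OF spanned_H30]) simp
  show "to_dR_21 t (coset (Dol_exact lattice_X (coframe_X t) 2 1) (fcomb cs (lifts11 t))) = coset (dR_exact lattice_X 3) (fcomb cs (lifts11 t))"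
    if "Suc (length cs) = 5" for cs
    using that by (intro to_dR_21_lifts) simp
qed (simp_all add: F2H3_gamma_def H_dR_def)

lemma length_bases: "length (basis20_B t) = 1" "length (basis11_B t) = 4" "length (lifts20 t) = 1" "length (lifts11 t) = 4"
  by (simp_all add: basis20_B_def basis11_B_def lifts20_eq lifts11_eq)

theorem corollary4p11:
  shows "\<exists>\<epsilon>\<^sub>0>0. \<forall>\<epsilon>. 0 < \<epsilon> \<and> \<epsilon> \<le> \<epsilon>\<^sub>0 \<longrightarrow>
    (\<forall>t\<in>Delta_gamma \<epsilon>.
       lin_iso (H20_B t) (H30 t) (gamma_wedge20 t) \<and>
       lin_iso (H11_B t) (H21_gamma t) (gamma_wedge11 t)) \<and>
    smooth_vbundle_iso (Delta_gamma \<epsilon>) F2H2_B F3H3 gamma_wedge20 \<and>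
    smooth_vbundle_iso (Delta_gamma \<epsilon>) F1H2_B F2H3_gamma
      (\<lambda>t. map_prod (gamma_wedge20 t) (gamma_wedge11 t))"
\<comment> \<open>One radius serves all conditions on t: injectivity of \<open>Sm t\<close>, and
  nonvanishing of \<open>NN t\<close> and \<open>1 - D t * cnj (D t)\<close>.\<close>
proof (intro exI[of _ "1/4"] conjI allI impI ballI)
  fix \<epsilon> :: real assume "0 < \<epsilon> \<and> \<epsilon> \<le> 1/4"
  then have \<epsilon>: "\<epsilon> \<le> 1/4" by simp
  have g20: "gamma_wedge20 t (coset (Dol_exact lattice_B (coframe_B t) 2 0) (fcomb cs (basis20_B t)))
      = coset (Dol_exact lattice_X (coframe_X t) 3 0) (fcomb cs [\<Omega>t t])"
    if "t \<in> Delta_gamma \<epsilon>" "length cs = 1" for t cs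
    unfolding gamma_wedge20_def using lin_ext_spanned[OF spanned_H20_B[OF ball_small[OF that(1) \<epsilon>]]] that(2)
    by (simp add: length_bases lifts20_eq)
  have g11: "gamma_wedge11 t (coset (Dol_exact lattice_B (coframe_B t) 1 1) (fcomb cs (basis11_B t)))
      = coset (Dol_exact lattice_X (coframe_X t) 2 1) (fcomb cs (lifts11 t))"
    if "t \<in> Delta_gamma \<epsilon>" "length cs = 4" for t cs
    unfolding gamma_wedge11_def by (rule lin_ext_spanned[OF spanned_H11_B[OF ball_small[OF that(1) \<epsilon>]]]) (simp add: length_bases that)
  show "smooth_vbundle_iso (Delta_gamma \<epsilon>) F2H2_B F3H3 gamma_wedge20"
  proof (rule framed_bundle_iso[OF framed_F2H2_B[OF \<epsilon>] framed_F3H3[OF \<epsilon>]])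
    fix t :: param and cs :: "complex list" assume t: "t \<in> Delta_gamma \<epsilon>" and "length cs = 1"
    interpret deform t using deform_ball[OF t \<epsilon>] .
    show "gamma_wedge20 t (coset (Dol_exact lattice_B (coframe_B t) 2 0) (fcomb cs (basis20_B t)))
      = coset (Dol_exact lattice_X (coframe_X t) 3 0) (fcomb cs (map (nuX t) [0..<1]))"
      using g20[OF t \<open>length cs = 1\<close>] by (simp add: nuX_0)
  qed
  show "smooth_vbundle_iso (Delta_gamma \<epsilon>) F1H2_B F2H3_gamma (\<lambda>t. map_prod (gamma_wedge20 t) (gamma_wedge11 t))"
    by (rule framed_bundle_iso[OF framed_F1H2_B[OF \<epsilon>] framed_F2H3_gamma[OF \<epsilon>]])
      (simp add: g20[unfolded basis20_B_def] g11[unfolded One_nat_def] del: fcomb_simps)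
  fix t assume t: "t \<in> Delta_gamma \<epsilon>"
  interpret deform t using deform_ball[OF t \<epsilon>] .
  show "lin_iso (H20_B t) (H30 t) (gamma_wedge20 t)"
    unfolding gamma_wedge20_def
    by (rule lin_iso_spanned[OF spanned_H20_B[OF small]]) (simp_all add: lifts20_eq spanned_H30 length_bases)
  show "lin_iso (H11_B t) (H21_gamma t) (gamma_wedge11 t)"
    unfolding gamma_wedge11_def
    by (rule lin_iso_spanned[OF spanned_H11_B[OF small] spanned_H21]) (simp add: length_bases)
qed simp

end
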